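(* Let $d\ge 5$ and let $\eta=\{\eta(x)\}_{x\in\mathbb{Z}^d}$ be a family of i.i.d. symmetric real random variables (with law $\mathbb{P}$) satisfying either condition $(A_\alpha)$ for some $\alpha\in(0,2]$ or condition $(\widetilde A)$. Define $$M^*=\begin{cases}\left(\frac{d}{c_\alpha}\right)^{1/\alpha}G^* & \text{if } (A_\alpha) \text{ holds with } \alpha\in(0,1],\\[2pt] \left(\frac{d}{c_\alpha}\right)^{1/\alpha}\left(G^*_{(\alpha)}\right)^{\frac{\alpha-1}{\alpha}} & \text{if } (A_\alpha)\text{ holds with } \alpha\in(1,2),\\[2pt] \left(2dG^*+\frac{d}{c_2}G^*_{(2)}\right)^{1/2} & \text{if } (A_\alpha)\text{ holds with } \alpha=2,\\[2pt] (2dG^* )^{1/2} & \text{if } (\widetilde A)\text{ holds}.\end{cases}$$ Then for every $\varepsilon,\varepsilon'>0$, $$\lim_{N\to\infty}\mu_N^\eta\Bigl(\frac{1}{(\log N)^{1/(\alpha\wedge 2)}}\max_{x\in\Lambda_N}\phi(x)\ge M^*-\varepsilon\Bigr)=1\qquad \mathbb{P}\text{-a.s.},$$ and $$\lim_{N\to\infty}\mathbb{P}\Bigl(\mu_N^\eta\Bigl(\frac{1}{(\log N)^{1/(\alpha\wedge 2)}}\max_{x\in\Lambda_N}\phi(x)\le M^*+\varepsilon\Bigr)\ge 1-\varepsilon'\Bigr)=1.$$ Moreover, if either $(A_\alpha)$ holds with $\alpha=2$ and $2dG^*>\frac{G^*_{(2)}}{c_2}$, or $(\widetilde A)$ holds,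 then for every $\varepsilon>0$, $$\lim_{N\to\infty}\mu_N^\eta\Bigl(\frac{1}{(\log N)^{1/(\alpha\wedge 2)}}\max_{x\in\Lambda_N}\phi(x)\le M^*+\varepsilon\Bigr)=1\qquad \mathbb{P}\text{-a.s.}$$
   Context: $\Lambda_N=[-N,N]^d\cap\mathbb{Z}^d$. Given a realization $\eta$, $\mu_N^\eta$ is the probability measure on $\mathbb{R}^{\Lambda_N}$ (configurations $\phi=\{\phi(x)\}_{x\in\Lambda_N}$) $$\mu_N^\eta(d\phi)=\frac{1}{Z_N^\eta}\exp\Bigl\{-\frac{1}{4d}\sum_{\{x,y\}\cap\Lambda_N\neq\emptyset,\ |x-y|=1}(\phi(x)-\phi(y))^2+\sum_{x\in\Lambda_N}\eta(x)\phi(x)\Bigr\}\prod_{x\in\Lambda_N}d\phi(x),$$ where $Z_N^\eta$ is the normalization constant, the first sum runs over unordered nearest-neighbor pairs of $\mathbb{Z}^d$ intersecting $\Lambda_N$ (each counted once), and $\phi(x)=0$ for every $x\notin\Lambda_N$ adjacent to $\Lambda_N$ ($0$-boundary conditions). $\mathbb{P}$ denotes the probability measure of the field $\eta$. Condition $(A_\alpha)$: there exist $\alpha\in(0,2]$ and $c_\alpha\in(0,\infty)$ such that $\lim_{r\to\infty}\frac{1}{r^\alpha}\log\mathbb{P}(\eta(0)\ge r)=-c_\alpha$. Condition $(\widetilde A)$: $\lim_{r\to\infty}\frac{1}{r^2}\log\mathbb{P}(\eta(0)\ge r)=-\infty$ (bounded variables are included). Under $(\widetilde A)$, the exponent $\alpha\wedge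 2$ is interpreted as $2$. $\Delta$ is the discrete Laplacian on $\mathbb{Z}^d$ with entries $\Delta(x,y)=\frac{1}{2d}$ if $|x-y|=1$, $-1$ if $x=y$, and $0$ otherwise; $(-\Delta)^{-1}(x,y)=E_x\bigl[\sum_{n\ge0}I(S_n=y)\bigr]$ is the Green function of the simple random walk $\{S_n\}$ on $\mathbb{Z}^d$. $G^*=(-\Delta)^{-1}(0,0)$, and for $\alpha\in(1,2]$, $G^*_{(\alpha)}=\sum_{x\in\mathbb{Z}^d}\bigl((-\Delta)^{-1}(0,x)\bigr)^{\frac{\alpha}{\alpha-1}}$. *)

theory Defs
  imports "HOL-Probability.Probability"
begin

type_synonym 'd site = "int ^ 'd"

definition adjacent :: "'d::finite site \<Rightarrow> 'd site \<Rightarrow> bool" where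
  "adjacent x y \<longleftrightarrow> norm ((\<chi> i. real_of_int (x $ i - y $ i)) :: real ^ 'd) = 1"

definition lattice_box :: "nat \<Rightarrow> 'd::finite site set" where
  "lattice_box N = {x. \<forall>i. \<bar>x $ i\<bar> \<le> int N}"

text \<open>
  Configurations on the box are elements of the extensional function space underlying
  \<^const>\<open>PiM\<close>; the zero boundary condition is imposed by \<open>extend0\<close>.
\<close>

definition extend0 :: "nat \<Rightarrow> ('d::finite site \<Rightarrow> real) \<Rightarrow> 'd site \<Rightarrow> real" where
  "extend0 N \<phi> x = (if x \<in> lattice_box N then \<phi> x else 0)"

text \<open>
  The sum over unordered nearest-neighbour pairs meeting the box, each counted once, is
  half the sum over ordered pairs.
\<close>

definition gradient_energy :: "nat \<Rightarrow> ('d::finite site \<Rightarrow> real) \<Rightarrow> real" where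
  "gradient_energy N \<phi> =
     (1 / 2) * (\<Sum>(x, y) \<in> {(x, y). adjacent x y \<and> {x, y} \<inter> lattice_box N \<noteq> {}}.
       (extend0 N \<phi> x - extend0 N \<phi> y)\<^sup>2)"

definition gibbs_weight ::
    "nat \<Rightarrow> ('d::finite site \<Rightarrow> real) \<Rightarrow> ('d site \<Rightarrow> real) \<Rightarrow> real" where
  "gibbs_weight N h \<phi> =
     exp (- (1 / (4 * real CARD('d))) * gradient_energy N \<phi> + (\<Sum>x\<in>lattice_box N. h x * \<phi> x))"

definition gibbs_Z :: "nat \<Rightarrow> ('d::finite site \<Rightarrow> real) \<Rightarrow> real" where
  "gibbs_Z N h = (\<integral>\<phi>. gibbs_weight N h \<phi> \<partial>(\<Pi>\<^sub>M x\<in>lattice_box N. lborel))"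

definition gibbs :: "nat \<Rightarrow> ('d::finite site \<Rightarrow> real) \<Rightarrow> ('d site \<Rightarrow> real) measure" where
  "gibbs N h =
     density (\<Pi>\<^sub>M x\<in>lattice_box N. lborel) (\<lambda>\<phi>. ennreal (1 / gibbs_Z N h * gibbs_weight N h \<phi>))"

definition srw_steps :: "(nat \<Rightarrow> 'd::finite site) measure" where
  "srw_steps = (\<Pi>\<^sub>M k\<in>UNIV. measure_pmf (pmf_of_set {e. adjacent 0 e}))"

definition srw :: "'d::finite site \<Rightarrow> (nat \<Rightarrow> 'd site) \<Rightarrow> nat \<Rightarrow> 'd site" where
  "srw x \<xi> n = x + (\<Sum>k<n. \<xi> k)"

text \<open>
  The kernel of the inverse of the negative discrete Laplacian, as the expected number of
  visits to \<open>y\<close> of the walk started at \<open>x\<close>.  The expectation is finite in dimension at least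
  three; \<^const>\<open>enn2real\<close> sends an infinite value to zero.
\<close>

definition green :: "'d::finite site \<Rightarrow> 'd site \<Rightarrow> real" where
  "green x y = enn2real (\<integral>\<^sup>+\<xi>. (\<Sum>n. indicator {y} (srw x \<xi> n)) \<partial>srw_steps)"

definition Gstar :: "'d::finite itself \<Rightarrow> real" where
  "Gstar _ = green (0 :: 'd site) 0"

text \<open>Used for \<open>1 < \<alpha> \<le> 2\<close>, where the series converges in dimension at least five.\<close>

definition Gstar_pow :: "'d::finite itself \<Rightarrow> real \<Rightarrow> real" where
  "Gstar_pow _ \<alpha> = (\<Sum>\<^sub>\<infinity>x\<in>(UNIV :: 'd site set). green 0 x powr (\<alpha> / (\<alpha> - 1)))"

text \<open>
  Logarithm of a probability with the convention that the logarithm of zero is minus infinity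
  (the real function \<^const>\<open>ln\<close> has value zero there), so that bounded variables satisfy the
  light-tail condition.
\<close>

definition elog :: "real \<Rightarrow> ereal" where
  "elog p = (if p = 0 then - \<infinity> else ereal (ln p))"

text \<open>
  \<open>TailA \<alpha> c\<close> stands for condition \<open>A\<^sub>\<alpha>\<close> with constant \<open>c = c\<^sub>\<alpha>\<close>, and \<open>TailLight\<close> for the
  condition written A with a tilde.
\<close>

datatype tail_type = TailA real real | TailLight

fun has_tail :: "'w measure \<Rightarrow> ('w \<Rightarrow> real) \<Rightarrow> tail_type \<Rightarrow> bool" where
  "has_tail M X (TailA \<alpha> c) \<longleftrightarrow>
     0 < \<alpha> \<and> \<alpha> \<le> 2 \<and> 0 < c \<and>
     ((\<lambda>r. ereal (1 / r powr \<alpha>) * elog (measure M {\<omega> \<in> space M. X \<omega> \<ge> r}))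
        \<longlongrightarrow> - ereal c) at_top"
| "has_tail M X TailLight \<longleftrightarrow>
     ((\<lambda>r. ereal (1 / r\<^sup>2) * elog (measure M {\<omega> \<in> space M. X \<omega> \<ge> r}))
        \<longlongrightarrow> - \<infinity>) at_top"

text \<open>The exponent \<open>\<alpha> \<and> 2\<close>, interpreted as 2 for light tails.\<close>

fun tail_exponent :: "tail_type \<Rightarrow> real" where
  "tail_exponent (TailA \<alpha> c) = min \<alpha> 2"
| "tail_exponent TailLight = 2"

fun Mstar :: "'d::finite itself \<Rightarrow> tail_type \<Rightarrow> real" where
  "Mstar D (TailA \<alpha> c) =
     (if \<alpha> \<le> 1 then (real CARD('d) / c) powr (1 / \<alpha>) * Gstar D
      else if \<alpha> < 2 then
        (real CARD('d) / c) powr (1 / \<alpha>) * Gstar_pow D \<alpha> powr ((\<alpha> - 1) / \<alpha>)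
      else sqrt (2 * real CARD('d) * Gstar D + real CARD('d) / c * Gstar_pow D 2))"
| "Mstar D TailLight = sqrt (2 * real CARD('d) * Gstar D)"

definition scaled_max :: "tail_type \<Rightarrow> nat \<Rightarrow> ('d::finite site \<Rightarrow> real) \<Rightarrow> real" where
  "scaled_max T N \<phi> =
     1 / (ln (real N) powr (1 / tail_exponent T)) * (MAX x\<in>lattice_box N. \<phi> x)"

end

theory Submission
  imports Defs "HOL-Real_Asymp.Real_Asymp"
begin

text \<open>
  Under the Gibbs measure the field is Gaussian.  Its covariance is the Green function
  \<open>box_green N\<close> of the walk killed on leaving the box, and the disorder only moves its
  centre, to \<open>mean_field N \<eta> x\<close>, the sum of \<open>box_green N x y * \<eta> y\<close> over \<open>y\<close>.  A site reaches
  a height of order \<open>(log N)\<^bsup>1/\<alpha>\<^esup>\<close> by a large value of the centre, by a large Gaussian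
  fluctuation (this matters when \<open>\<alpha> = 2\<close>), or by both; each possibility has a cost \<open>\<beta>\<close>,
  meaning a probability \<open>N\<^bsup>-\<beta>\<^esup>\<close>.  There are about \<open>N\<^bsup>d\<^esup>\<close> sites, so the heights that occur
  are those whose cheapest cost is below \<open>d\<close>, and \<open>Mstar\<close> is the height of cost \<open>d\<close>.

  Upper bound.  Chebyshev's exponential inequality is used with parameter
  \<open>\<lambda> = \<kappa> (log N)\<^bsup>(\<alpha>-1)/\<alpha>\<^esup>\<close>.  At this scale the logarithmic moment generating function of the
  centre is \<open>log N\<close> times the sum over \<open>z\<close> of \<open>\<psi> (\<kappa> * green 0 z)\<close>, where \<open>\<psi>\<close> is the Legendre
  transform of \<open>c * r\<^bsup>\<alpha>\<^esup>\<close>; distant sites enter through the sum of the squared Green function,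
  which converges because \<open>d \<ge> 5\<close> (\<open>field_mgf\<close>).  The optimal \<open>\<kappa>\<close> gives exactly \<open>Mstar\<close>
  (\<open>rate_choice\<close>), and a union bound over the box finishes the bound in probability.  For
  \<open>\<alpha> \<le> 1\<close> the disorder is first truncated just above its maximum over the box; then
  \<open>\<psi> = 0\<close> for all admissible \<open>\<kappa>\<close>, which expresses that a single large value carries the sum.

  Almost sure upper bound.  Here probabilities summable in \<open>N\<close> are needed.  The dangerous
  event is that the centre alone exceeds \<open>Mstar\<close>; its cost is \<open>d + 2 d G\<^sup>* c / G\<^sup>*\<^sub>(\<^sub>2\<^sub>)\<close>, so
  the hypothesis says that its probability is \<open>N\<^bsup>-1-\<delta>\<^esup>\<close> (\<open>mean_field_max_small\<close>).  Off this
  event every term of the union bound is at most \<open>N\<^bsup>-\<delta>\<^esup>\<close>, and since the centre is, up to a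
  small error, a function of finitely many disorder variables, the sum of these terms
  concentrates (\<open>near_cost_sum_small\<close>).

  Lower bound.  Call a site good if \<open>\<eta> (x + z) \<ge> a z * (log N)\<^bsup>1/\<alpha>\<^esup>\<close> for \<open>z\<close> in a large
  finite set.  This costs \<open>\<beta> = c \<Sum> a z\<^bsup>\<alpha>\<^esup>\<close> and lifts the centre to \<open>\<Sum> green 0 z * a z\<close>.  Along a
  grid of spacing \<open>(log N)\<^sup>2\<close> the trials are independent, so almost surely there are at least
  \<open>N\<^bsup>d-\<beta>-o(1)\<^esup>\<close> good grid sites (\<open>many_good_sites\<close>).  On the grid the Gaussian fluctuations are
  almost uncorrelated, and a truncated second moment argument shows that one of the good
  sites gains a further \<open>(2 G\<^sup>* (d - \<beta>) log N)\<^bsup>1/2\<^esup>\<close> (\<open>weakly_correlated_max\<close>).  Optimising over \<open>a\<close>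
  gives \<open>Mstar\<close> again, by the equality case of Young's inequality (\<open>profile_choice\<close>).

  The Gaussian estimates all rest on the joint exponential moments \<open>gibbs_0_mgf\<close>, which
  follow from the translation invariance of Lebesgue measure.  The estimates on the Green
  function all rest on the heat kernel bound \<open>heat_le\<close>.
\<close>

section \<open>The simple random walk and its heat kernel\<close>

definition steps :: "'d::finite site set" where
  "steps = {e. adjacent 0 e}"

lemma adjacent_iff_sum_squares: "adjacent x y \<longleftrightarrow> (\<Sum>i\<in>UNIV. (x $ i - y $ i)\<^sup>2) = 1"
proof -
  have "adjacent x y \<longleftrightarrow> (norm ((\<chi> i. real_of_int (x $ i - y $ i)) :: real ^ 'a))\<^sup>2 = 1"
    unfolding adjacent_def power2_eq_1_iff
    using norm_ge_zero[of "(\<chi> i. real_of_int (x $ i - y $ i)) :: real ^ 'a"] by linarith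
  also have "\<dots> \<longleftrightarrow> (\<Sum>i\<in>UNIV. (real_of_int (x $ i - y $ i))\<^sup>2) = 1"
    by (simp add: norm_vec_def L2_set_def sum_nonneg)
  also have "(\<Sum>i\<in>UNIV. (real_of_int (x $ i - y $ i))\<^sup>2) = real_of_int (\<Sum>i\<in>UNIV. (x $ i - y $ i)\<^sup>2)"
    by simp
  finally show ?thesis
    by (metis of_int_1 of_int_eq_iff)
qed

text \<open>
  Integer squares summing to one: one of them is one and the others vanish.
\<close>

lemma steps_eq: "(steps :: 'd::finite site set) = (\<Union>i. {axis i 1, axis i (-1)})"
proof (intro set_eqI iffI)
  fix e :: "'d site"
  assume "e \<in> steps"
  then have s: "(\<Sum>i\<in>UNIV. (e $ i)\<^sup>2) = 1"
    by (simp add: steps_def adjacent_iff_sum_squares)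
  then obtain i where i: "e $ i \<noteq> 0" by force
  have "(\<Sum>j\<in>UNIV. (e $ j)\<^sup>2) = (e $ i)\<^sup>2 + (\<Sum>j\<in>UNIV - {i}. (e $ j)\<^sup>2)"
    by (simp add: sum.remove)
  moreover have "(e $ i)\<^sup>2 \<ge> 1" using i
    by (metis int_one_le_iff_zero_less zero_less_power2)
  moreover have "(\<Sum>j\<in>UNIV - {i}. (e $ j)\<^sup>2) \<ge> 0" by (simp add: sum_nonneg)
  ultimately have 1: "(e $ i)\<^sup>2 = 1" and 2: "(\<Sum>j\<in>UNIV - {i}. (e $ j)\<^sup>2) = 0"
    using s by linarith+
  from 2 have "\<forall>j\<in>UNIV - {i}. e $ j = 0" by (subst (asm) sum_nonneg_eq_0_iff) auto
  then have "e = axis i (e $ i)" by (auto simp: vec_eq_iff axis_def)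
  moreover have "e $ i = 1 \<or> e $ i = -1" using 1 by (simp add: power2_eq_1_iff)
  ultimately show "e \<in> (\<Union>i. {axis i 1, axis i (-1)})" by auto
next
  fix e :: "'d site"
  assume "e \<in> (\<Union>i. {axis i 1, axis i (-1)})"
  then obtain i c where c: "c = 1 \<or> c = -1" "e = axis i c" by auto
  have "(\<Sum>j\<in>UNIV. (e $ j)\<^sup>2) = (\<Sum>j\<in>UNIV. if j = i then 1 else 0)"
    using c by (intro sum.cong) (auto simp: axis_def)
  then show "e \<in> steps" by (simp add: steps_def adjacent_iff_sum_squares)
qed

lemma sum_steps:
  fixes f :: "'d::finite site \<Rightarrow> 'b::comm_monoid_add"
  shows "(\<Sum>e\<in>steps. f e) = (\<Sum>i\<in>UNIV. f (axis i 1) + f (axis i (-1)))"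
proof -
  have disj: "{axis i 1, axis i (-1)} \<inter> {axis j 1, axis j (-1)} = ({} :: 'd site set)"
    if "i \<noteq> j" for i j :: 'd
    using that by (auto simp: axis_eq_axis)
  have "(\<Sum>e\<in>steps. f e) = (\<Sum>i\<in>UNIV. \<Sum>e\<in>{axis i 1, axis i (-1)}. f e)"
    unfolding steps_eq by (rule sum.UNION_disjoint) (auto simp: disj[simplified])
  also have "\<dots> = (\<Sum>i\<in>UNIV. f (axis i 1) + f (axis i (-1)))"
    by (intro sum.cong) (auto simp: axis_eq_axis)
  finally show ?thesis .
qed

lemma finite_steps [simp]: "finite (steps :: 'd::finite site set)"
  by (simp add: steps_eq)

lemma card_steps: "card (steps :: 'd::finite site set) = 2 * CARD('d)"
  using sum_steps[of "\<lambda>_::'d site. 1::nat"] by simp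

lemma steps_nonempty [simp]: "(steps :: 'd::finite site set) \<noteq> {}"
  by (auto simp: steps_eq)

lemma adjacent_steps: "adjacent x y \<longleftrightarrow> y - x \<in> steps"
  by (simp add: steps_def adjacent_iff_sum_squares power2_commute)

lemma uminus_steps: "e \<in> steps \<Longrightarrow> - e \<in> steps"
  by (simp add: steps_def adjacent_iff_sum_squares)

lemma sum_steps_uminus: "(\<Sum>e\<in>steps. f (- e)) = (\<Sum>e\<in>steps. f e)"
  by (rule sum.reindex_bij_witness[of _ uminus uminus]) (auto intro: uminus_steps)

lemma step_coord_le: "e \<in> steps \<Longrightarrow> \<bar>e $ i\<bar> \<le> 1"
  by (auto simp: steps_eq axis_def)

lemma step_coord_sum_odd: "e \<in> steps \<Longrightarrow> odd (\<Sum>i\<in>UNIV. e $ i)"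
  by (auto simp: steps_eq axis_def)

lemma lattice_box_eq_image:
  "(lattice_box N :: 'd::finite site set) = (\<lambda>f. \<chi> i. f i) ` (UNIV \<rightarrow>\<^sub>E {- int N..int N})"
proof (intro set_eqI iffI)
  fix x :: "'d site" assume "x \<in> lattice_box N"
  then show "x \<in> (\<lambda>f. \<chi> i. f i) ` (UNIV \<rightarrow>\<^sub>E {- int N..int N})"
    by (intro image_eqI[of _ _ "\<lambda>i. x $ i"]) (auto simp: lattice_box_def abs_le_iff minus_le_iff)
qed (auto simp: lattice_box_def PiE_def Pi_def abs_le_iff minus_le_iff)

lemma finite_lattice_box [simp]: "finite (lattice_box N :: 'd::finite site set)"
  unfolding lattice_box_eq_image by (intro finite_imageI finite_PiE) auto

lemma card_lattice_box: "card (lattice_box N :: 'd::finite site set) = (2 * N + 1) ^ CARD('d)"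
proof -
  have "card (lattice_box N :: 'd site set) = card ((UNIV :: 'd set) \<rightarrow>\<^sub>E {- int N..int N})"
    unfolding lattice_box_eq_image
    by (intro card_image) (auto simp: inj_on_def vec_eq_iff fun_eq_iff)
  also have "\<dots> = (2 * N + 1) ^ CARD('d)"
    by (simp add: card_PiE) (metis mult_2 nat_int of_nat_Suc of_nat_add add.commute plus_1_eq_Suc)
  finally show ?thesis .
qed

lemma zero_in_lattice_box [simp]: "0 \<in> lattice_box N"
  by (simp add: lattice_box_def)

lemma lattice_box_nonempty [simp]: "lattice_box N \<noteq> {}"
  using zero_in_lattice_box by blast

text \<open>
  The \<open>n\<close>-step transition probability from the origin to \<open>z\<close>; \<open>walk_law\<close> identifies it with
  the law of the walk.
\<close>

primrec heat :: "nat \<Rightarrow> 'd::finite site \<Rightarrow> real" where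
  "heat 0 z = (if z = 0 then 1 else 0)"
| "heat (Suc n) z = (\<Sum>e\<in>steps. heat n (z - e)) / (2 * real CARD('d))"

text \<open>
  The number of \<open>n\<close>-step paths moving only in the coordinates in \<open>J\<close>, from the origin to the
  projection of \<open>z\<close> to these coordinates.  Counting paths for all \<open>J\<close> allows an induction over
  the coordinates, although the lattice is a fixed type.
\<close>

primrec walk_count :: "'d::finite set \<Rightarrow> nat \<Rightarrow> 'd site \<Rightarrow> real" where
  "walk_count J 0 z = (if \<forall>i\<in>J. z $ i = 0 then 1 else 0)"
| "walk_count J (Suc n) z =
     (\<Sum>i\<in>J. walk_count J n (z - axis i 1) + walk_count J n (z + axis i 1))"

lemma axis_minus: "axis i (- c) = - (axis i c :: 'd::finite site)"
  by (auto simp: axis_def vec_eq_iff)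

lemma heat_eq_walk_count:
  "heat n z = walk_count UNIV n z / (2 * real CARD('d)) ^ n" for z :: "'d::finite site"
proof (induction n arbitrary: z)
  case 0
  show ?case by (simp add: vec_eq_iff)
next
  case (Suc n)
  show ?case
    by (simp add: Suc.IH sum_steps axis_minus sum_divide_distrib add_divide_distrib mult.commute)
qed

lemma walk_count_nonneg: "walk_count J n z \<ge> 0"
  by (induction n arbitrary: z) (auto intro!: sum_nonneg add_nonneg_nonneg)

lemma walk_count_shift_other:
  "i \<notin> J \<Longrightarrow> walk_count J n (z + axis i c) = walk_count J n z"
proof (induction n arbitrary: z)
  case 0
  then show ?case by (auto simp: axis_def)
next
  case (Suc n)
  have 1: "z + axis i c - axis j 1 = (z - axis j 1) + axis i c" for j by simp
  have 2: "z + axis i c + axis j 1 = (z + axis j 1) + axis i c" for j by (simp add: ac_simps)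
  show ?case unfolding walk_count.simps 1 2 Suc.IH[OF Suc.prems] ..
qed

text \<open>
  Pascal's rule, summed over the entries of a row.
\<close>

lemma binomial_convolution_Suc:
  fixes f g :: "nat \<Rightarrow> real"
  shows "(\<Sum>k\<le>Suc n. real (Suc n choose k) * f k * g (Suc n - k)) =
         (\<Sum>k\<le>n. real (n choose k) * f (Suc k) * g (n - k)) +
         (\<Sum>k\<le>n. real (n choose k) * f k * g (Suc (n - k)))"
proof -
  have "(\<Sum>k\<le>Suc n. real (Suc n choose k) * f k * g (Suc n - k)) =
      f 0 * g (Suc n) + (\<Sum>k\<le>n. real (Suc n choose Suc k) * f (Suc k) * g (n - k))"
    by (subst sum.atMost_Suc_shift) simp
  also have "(\<Sum>k\<le>n. real (Suc n choose Suc k) * f (Suc k) * g (n - k)) =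
      (\<Sum>k\<le>n. real (n choose k) * f (Suc k) * g (n - k)) +
      (\<Sum>k\<le>n. real (n choose Suc k) * f (Suc k) * g (n - k))"
    by (simp add: algebra_simps sum.distrib)
  also have "(\<Sum>k\<le>n. real (n choose Suc k) * f (Suc k) * g (n - k)) =
      (\<Sum>k\<le>Suc n. real (n choose k) * f k * g (Suc n - k)) - f 0 * g (Suc n)"
    by (subst sum.atMost_Suc_shift) simp
  also have "(\<Sum>k\<le>Suc n. real (n choose k) * f k * g (Suc n - k)) =
      (\<Sum>k\<le>n. real (n choose k) * f k * g (Suc (n - k)))"
    by (simp add: Suc_diff_le)
  finally show ?thesis by simp
qed

text \<open>
  A path in the coordinates \<open>insert i J\<close> interleaves a path of some length \<open>k\<close> in coordinate \<open>i\<close>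
  with a path of length \<open>n - k\<close> in \<open>J\<close>, in \<open>n choose k\<close> ways.
\<close>

lemma walk_count_insert:
  assumes "i \<notin> J"
  shows "walk_count (insert i J) n z =
    (\<Sum>k\<le>n. real (n choose k) * walk_count {i} k z * walk_count J (n - k) z)"
proof (induction n arbitrary: z)
  case 0
  show ?case by simp
next
  case (Suc n)
  have ne: "j \<noteq> i" if "j \<in> J" for j using assms that by auto
  have sh: "walk_count J m (z - axis i 1) = walk_count J m z"
           "walk_count J m (z + axis i 1) = walk_count J m z" for m
    using walk_count_shift_other[OF assms, of m z "-1"] walk_count_shift_other[OF assms, of m z 1]
    by (simp_all add: axis_minus)
  have sh': "walk_count {i} m (z - axis j 1) = walk_count {i} m z"
            "walk_count {i} m (z + axis j 1) = walk_count {i} m z" if "j \<in> J" for m j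
    using walk_count_shift_other[of j "{i}" m z "-1"] walk_count_shift_other[of j "{i}" m z 1] ne[OF that]
    by (simp_all add: axis_minus)
  let ?W = "\<lambda>z. \<Sum>k\<le>n. real (n choose k) * walk_count {i} k z * walk_count J (n - k) z"
  have "walk_count (insert i J) (Suc n) z =
      (?W (z - axis i 1) + ?W (z + axis i 1)) + (\<Sum>j\<in>J. ?W (z - axis j 1) + ?W (z + axis j 1))"
    using assms by (simp add: Suc.IH)
  also have "?W (z - axis i 1) + ?W (z + axis i 1) =
      (\<Sum>k\<le>n. real (n choose k) * walk_count {i} (Suc k) z * walk_count J (n - k) z)"
    by (simp add: sh algebra_simps flip: sum.distrib)
  also have "(\<Sum>j\<in>J. ?W (z - axis j 1) + ?W (z + axis j 1)) =
      (\<Sum>j\<in>J. \<Sum>k\<le>n. real (n choose k) * walk_count {i} k z *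
          (walk_count J (n - k) (z - axis j 1) + walk_count J (n - k) (z + axis j 1)))"
    by (intro sum.cong refl) (simp add: sh' algebra_simps flip: sum.distrib)
  also have "\<dots> = (\<Sum>k\<le>n. real (n choose k) * walk_count {i} k z * walk_count J (Suc (n - k)) z)"
    by (subst sum.swap) (simp add: sum_distrib_left)
  finally show ?case
    by (subst binomial_convolution_Suc) simp
qed

text \<open>
  In one coordinate the endpoint determines the number \<open>m\<close> of steps to the right.
\<close>

lemma walk_count_single:
  "(\<forall>m. z $ i = 2 * int m - int k \<longrightarrow> walk_count {i} k z = real (k choose m)) \<and>
   ((\<forall>m. z $ i \<noteq> 2 * int m - int k) \<longrightarrow> walk_count {i} k z = 0)"
proof (induction k arbitrary: z)
  case 0
  show ?case by (auto simp: binomial_eq_0)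
next
  case (Suc k)
  have rec: "walk_count {i} (Suc k) z = walk_count {i} k (z - axis i 1) + walk_count {i} k (z + axis i 1)"
    by simp
  have cm: "(z - axis i 1) $ i = z $ i - 1" "(z + axis i 1) $ i = z $ i + 1"
    by (simp_all add: axis_def)
  show ?case
  proof (intro conjI allI impI)
    fix m assume m: "z $ i = 2 * int m - int (Suc k)"
    have p: "walk_count {i} k (z + axis i 1) = real (k choose m)"
      using Suc.IH[of "z + axis i 1"] m cm by auto
    show "walk_count {i} (Suc k) z = real (Suc k choose m)"
    proof (cases m)
      case 0
      have "walk_count {i} k (z - axis i 1) = 0"
        using Suc.IH[of "z - axis i 1"] m cm 0 by auto
      then show ?thesis using p rec 0 by simp
    next
      case (Suc m')
      have "(z - axis i 1) $ i = 2 * int m' - int k" using m cm Suc by simp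
      then have "walk_count {i} k (z - axis i 1) = real (k choose m')"
        using Suc.IH[of "z - axis i 1"] by blast
      then show ?thesis using p rec Suc by simp
    qed
  next
    assume nm: "\<forall>m. z $ i \<noteq> 2 * int m - int (Suc k)"
    have "(z - axis i 1) $ i \<noteq> 2 * int m - int k" for m
      using nm[rule_format, of "Suc m"] cm by simp
    moreover have "(z + axis i 1) $ i \<noteq> 2 * int m - int k" for m
      using nm[rule_format, of m] cm by simp
    ultimately show "walk_count {i} (Suc k) z = 0"
      using rec Suc.IH[of "z - axis i 1"] Suc.IH[of "z + axis i 1"] by simp
  qed
qed

text \<open>
  The left side divided by \<open>16\<^sup>m\<close> decreases in \<open>m\<close>: consecutive values have the ratio
  \<open>(2 m + 1) (2 m + 3) / (2 m + 2)\<^sup>2\<close>.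
\<close>

lemma central_binomial_upper: "(2 * m + 1) * ((2 * m) choose m)\<^sup>2 \<le> 16 ^ m"
proof (induction m)
  case 0
  show ?case by simp
next
  case (Suc m)
  define a where "a = (2 * m) choose m"
  define b where "b = (2 * Suc m) choose (Suc m)"
  have "Suc m * b = 2 * (2 * m + 1) * a"
  proof -
    have "Suc (Suc (2*m)) choose Suc m = (Suc (2*m) choose m) + (Suc (2 * m) choose Suc m)" by simp
    also have "Suc (2*m) choose m = Suc (2 * m) choose Suc m"
      by (subst binomial_symmetric) auto
    finally have "b = 2 * (Suc (2*m) choose Suc m)" by (simp add: b_def)
    moreover have "Suc m * (Suc (2*m) choose Suc m) = Suc (2*m) * a"
      unfolding a_def by (rule Suc_times_binomial)
    ultimately show ?thesis by (simp del: binomial_Suc_Suc)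
  qed
  then have "(Suc m * b)\<^sup>2 = (2 * (2 * m + 1) * a)\<^sup>2" by (rule arg_cong)
  then have "(Suc m)\<^sup>2 * b\<^sup>2 = 4 * (2 * m + 1)\<^sup>2 * a\<^sup>2"
    unfolding power_mult_distrib by simp
  then have "(Suc m)\<^sup>2 * ((2 * m + 3) * b\<^sup>2) = 4 * (2 * m + 1) * (2 * m + 3) * ((2 * m + 1) * a\<^sup>2)"
    by (simp add: power2_eq_square) algebra
  also have "\<dots> \<le> 4 * (2 * m + 1) * (2 * m + 3) * 16 ^ m"
    using Suc.IH by (intro mult_left_mono) (auto simp: a_def)
  also have "\<dots> \<le> (16 * (Suc m)\<^sup>2) * 16 ^ m"
    by (intro mult_right_mono) (auto simp: power2_eq_square algebra_simps)
  also have "\<dots> = (Suc m)\<^sup>2 * 16 ^ Suc m" by simp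
  finally have "(2 * m + 3) * b\<^sup>2 \<le> 16 ^ Suc m" 
    by (subst (asm) mult_le_cancel1) auto
  then show ?case unfolding b_def
    by (simp del: binomial_Suc_Suc add: algebra_simps)
qed

lemma binomial_upper: "real (k choose m) \<le> 2 ^ k / sqrt (real (Suc k))"
proof -
  have "Suc k * (k choose (k div 2))\<^sup>2 \<le> 4 ^ k"
  proof (cases "even k")
    case True
    then obtain m where "k = 2 * m" by blast
    then show ?thesis using central_binomial_upper[of m] by (simp add: power_mult)
  next
    case False
    then obtain m where k: "k = 2 * m + 1" using oddE by blast
    have "Suc (Suc (2*m)) choose Suc m = (Suc (2*m) choose m) + (Suc (2 * m) choose Suc m)" by simp
    also have "Suc (2*m) choose Suc m = Suc (2 * m) choose m"
      by (subst binomial_symmetric) auto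
    finally have e: "(2 * Suc m) choose (Suc m) = 2 * (k choose (k div 2))" using k by simp
    have "(2 * Suc m + 1) * (2 * (k choose (k div 2)))\<^sup>2 \<le> 16 ^ Suc m"
      using central_binomial_upper[of "Suc m"] unfolding e .
    moreover have "(16::nat) ^ Suc m = 4 * 4 ^ k" using k by (simp add: power_mult)
    moreover have "(2 * Suc m + 1) * (2 * (k choose (k div 2)))\<^sup>2 = 4 * ((2 * m + 3) * (k choose (k div 2))\<^sup>2)"
      unfolding power_mult_distrib by (simp add: algebra_simps)
    ultimately have "4 * ((2 * m + 3) * (k choose (k div 2))\<^sup>2) \<le> 4 * 4 ^ k" by simp
    then have "(2 * m + 3) * (k choose (k div 2))\<^sup>2 \<le> 4 ^ k" by simp
    moreover have "Suc k * (k choose (k div 2))\<^sup>2 \<le> (2 * m + 3) * (k choose (k div 2))\<^sup>2"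
      using k by (intro mult_right_mono) auto
    ultimately show ?thesis by linarith
  qed
  then have "real (Suc k * (k choose (k div 2))\<^sup>2) \<le> real (4 ^ k)" by (simp only: of_nat_le_iff)
  then have "(real (k choose (k div 2)))\<^sup>2 \<le> 4 ^ k / real (Suc k)"
    by (simp add: field_simps)
  then have "real (k choose (k div 2)) \<le> sqrt (4 ^ k / real (Suc k))"
    by (rule real_le_rsqrt)
  also have "\<dots> = 2 ^ k / sqrt (real (Suc k))"
    using real_sqrt_power[of 4 k] by (simp add: real_sqrt_divide)
  finally have "real (k choose (k div 2)) \<le> 2 ^ k / sqrt (real (Suc k))" .
  moreover have "k choose m \<le> k choose (k div 2)" by (rule binomial_maximum)
  ultimately show ?thesis by (meson of_nat_le_iff order_trans)
qed

lemma walk_count_single_le: "walk_count {i} k z \<le> 2 ^ k / sqrt (real (Suc k))"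
proof (cases "\<exists>m. z $ i = 2 * int m - int k")
  case True
  then show ?thesis using walk_count_single[of z i k] binomial_upper[of k] by metis
next
  case False
  then show ?thesis using walk_count_single[of z i k] by simp
qed

text \<open>
  The bound has the order \<open>n\<^bsup>-j/2\<^esup>\<close> for \<open>j\<close> coordinates, up to the total number of paths.  It is
  written with a square root of factorials because in this form the induction over \<open>J\<close> closes
  exactly: the Cauchy--Schwarz inequality for the binomial weights turns the product of the
  two bounds into a partial binomial sum.
\<close>

lemma walk_count_le:
  assumes "finite J"
  shows "walk_count J n z \<le> (2 * real (card J)) ^ n *
    sqrt (real (card J) ^ card J * fact n / fact (n + card J))"
  using assms
proof (induction J arbitrary: n z)
  case empty
  show ?case by (cases n) auto
next
  case (insert i J)
  define j where "j = card J"
  \<comment> \<open>The weights count all interleavings; \<open>u\<close> collects the two bounds with the path counts taken out.\<close>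
  define w where "w k = real (n choose k) * 2 ^ k * (2 * real j) ^ (n - k)" for k
  define u where "u k = 1 / sqrt (real (Suc k)) * sqrt (real j ^ j * fact (n-k) / fact (n - k + j))" for k
  have wnn: "w k \<ge> 0" for k by (simp add: w_def)
  have "walk_count (insert i J) n z \<le> (\<Sum>k\<le>n. w k * u k)"
    unfolding walk_count_insert[OF insert.hyps(2)]
  proof (rule sum_mono)
    fix k assume "k \<in> {..n}"
    have "walk_count {i} k z * walk_count J (n - k) z \<le>
      (2 ^ k / sqrt (real (Suc k))) * ((2 * real j) ^ (n - k) * sqrt (real j ^ j * fact (n-k) / fact (n - k + j)))"
      using walk_count_single_le insert.IH[of "n - k" z] unfolding j_def
      by (intro mult_mono walk_count_nonneg) auto
    then have "real (n choose k) * (walk_count {i} k z * walk_count J (n - k) z) \<le> real (n choose k) * 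
     ((2 ^ k / sqrt (real (Suc k))) * ((2 * real j) ^ (n - k) * sqrt (real j ^ j * fact (n-k) / fact (n - k + j))))"
      by (rule mult_left_mono) simp
    then show "real (n choose k) * walk_count {i} k z * walk_count J (n - k) z \<le> w k * u k"
      unfolding w_def u_def by (simp add: mult_ac)
  qed
  also have "(\<Sum>k\<le>n. w k * u k) = (\<Sum>k\<le>n. sqrt (w k) * (sqrt (w k) * u k))"
    by (intro sum.cong) (auto simp: wnn mult.assoc[symmetric])
  also have "\<dots> \<le> sqrt (\<Sum>k\<le>n. (sqrt (w k))\<^sup>2) * sqrt (\<Sum>k\<le>n. (sqrt (w k) * u k)\<^sup>2)"
    using Cauchy_Schwarz_ineq_sum[of "\<lambda>k. sqrt (w k)" "\<lambda>k. sqrt (w k) * u k" "{..n}"]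
    unfolding real_sqrt_mult[symmetric] by (rule real_le_rsqrt)
  also have "(\<Sum>k\<le>n. (sqrt (w k))\<^sup>2) = (2 * real (j + 1)) ^ n"
    using binomial_ring[of "2::real" "2 * real j" n] by (simp add: wnn w_def algebra_simps)
  also have "(\<Sum>k\<le>n. (sqrt (w k) * u k)\<^sup>2) =
      (\<Sum>k\<le>n. 2 ^ n * (fact n / fact (n + (j + 1))) * (real (n + j + 1 choose Suc k) * real j ^ (n + j + 1 - Suc k)))"
  proof (rule sum.cong[OF refl])
    fix k assume "k \<in> {..n}"
    then have k: "k \<le> n" by simp
    have sq: "(u k)\<^sup>2 = real j ^ j * fact (n-k) / (real (Suc k) * fact (n - k + j))"
      by (simp add: u_def power_mult_distrib power_divide)
    have b1: "real (n choose k) = fact n / (fact k * fact (n - k))"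
      by (rule binomial_fact[OF k])
    have b2: "real (n + j + 1 choose Suc k) = fact (n + j + 1) / (fact (Suc k) * fact (n - k + j))"
      using binomial_fact[of "Suc k" "n + j + 1", where 'a = real] k by simp
    have p: "(2 * real j) ^ (n - k) * 2 ^ k * real j ^ j = 2 ^ n * real j ^ (n + j + 1 - Suc k)"
    proof -
      have "n + j + 1 - Suc k = (n - k) + j" using k by simp
      moreover have "(2::real) ^ n = 2 ^ (n - k) * 2 ^ k" using k by (simp flip: power_add)
      ultimately show ?thesis by (simp add: power_mult_distrib power_add)
    qed
    have "(sqrt (w k) * u k)\<^sup>2 = w k * (u k)\<^sup>2" by (simp add: power_mult_distrib wnn)
    also have "\<dots> = real (n choose k) * ((2 * real j) ^ (n - k) * 2 ^ k * real j ^ j) * fact (n-k) / (real (Suc k) * fact (n - k + j))"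
      by (simp add: sq w_def)
    also have "\<dots> = (2 ^ n * real j ^ (n + j + 1 - Suc k)) * (fact n / (fact k * fact (n - k)) * fact (n-k) / (real (Suc k) * fact (n - k + j)))"
      by (simp only: p b1) simp
    also have "fact n / (fact k * fact (n - k)) * fact (n-k) / (real (Suc k) * fact (n - k + j)) =
        fact n / fact (n + (j + 1)) * (fact (n + j + 1) / (fact (Suc k) * fact (n - k + j)))" (is "?l = ?r")
    proof -
      have "?l = fact n / (fact (Suc k) * fact (n - k + j))" by simp
      also have "\<dots> = ?r" by (simp add: add.assoc)
      finally show ?thesis .
    qed
    finally show "(sqrt (w k) * u k)\<^sup>2 =
      2 ^ n * (fact n / fact (n + (j + 1))) * (real (n + j + 1 choose Suc k) * real j ^ (n + j + 1 - Suc k))"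
      by (simp only: b2) (simp add: mult_ac)
  qed
  also have "\<dots> = 2 ^ n * (fact n / fact (n + (j + 1))) *
      (\<Sum>k\<le>n. real (n + j + 1 choose Suc k) * real j ^ (n + j + 1 - Suc k))"
    by (simp add: sum_distrib_left)
  also have "\<dots> \<le> 2 ^ n * (fact n / fact (n + (j + 1))) * real (j + 1) ^ (n + j + 1)"
  proof (rule mult_left_mono)
    have "(\<Sum>k\<le>n. real (n + j + 1 choose Suc k) * real j ^ (n + j + 1 - Suc k)) =
        (\<Sum>k\<in>Suc ` {..n}. real (n + j + 1 choose k) * real j ^ (n + j + 1 - k))"
      by (subst sum.reindex) auto
    also have "\<dots> \<le> (\<Sum>k\<le>n + j + 1. real (n + j + 1 choose k) * real j ^ (n + j + 1 - k))"
      by (intro sum_mono2) auto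
    also have "\<dots> = real (j + 1) ^ (n + j + 1)"
      using binomial_ring[of "1::real" "real j" "n + j + 1"] by (simp add: add.commute)
    finally show "(\<Sum>k\<le>n. real (n + j + 1 choose Suc k) * real j ^ (n + j + 1 - Suc k)) \<le> real (j + 1) ^ (n + j + 1)" .
  qed simp
  also have "2 ^ n * (fact n / fact (n + (j + 1))) * real (j + 1) ^ (n + j + 1) =
     (2 * real (j + 1)) ^ n * (real (j + 1) ^ (j + 1) * fact n / fact (n + (j + 1)))"
    unfolding power_mult_distrib by (simp add: power_add mult_ac)
  finally have "walk_count (insert i J) n z \<le> sqrt ((2 * real (j + 1)) ^ n) *
     sqrt ((2 * real (j + 1)) ^ n * (real (j + 1) ^ (j + 1) * fact n / fact (n + (j + 1))))"
    by (simp add: mult_left_mono)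
  also have "\<dots> = (2 * real (j + 1)) ^ n * sqrt (real (j + 1) ^ (j + 1) * fact n / fact (n + (j + 1)))"
    by (simp only: real_sqrt_mult) (simp only: mult.assoc[symmetric], simp)
  finally show ?case using insert.hyps by (simp add: j_def)
qed

lemma fact_add_ge: "fact (n + j) \<ge> fact n * real (Suc n) ^ j"
proof (induction j)
  case (Suc j)
  have "fact n * real (Suc n) ^ Suc j \<le> fact (n + j) * real (Suc (n + j))"
    using Suc by (simp only: power_Suc2 mult.assoc[symmetric]) (intro mult_mono, auto)
  also have "\<dots> = fact (n + Suc j)" by (simp add: mult.commute)
  finally show ?case .
qed auto

text \<open>
  The decay \<open>n\<^bsup>-d/2\<^esup>\<close>, with \<open>d\<close> replaced by 5.  That the power exceeds 2 is what makes the squared Green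
  function summable.
\<close>

lemma heat_le:
  assumes d: "CARD('d::finite) \<ge> 5"
  shows "heat n (z :: 'd site) \<le> sqrt (real CARD('d) ^ CARD('d)) * real (Suc n) powr (-5/2)"
proof -
  let ?d = "CARD('d)"
  have "heat n z \<le> sqrt (real ?d ^ ?d * fact n / fact (n + ?d))"
    using walk_count_le[of "UNIV::'d set" n z]
    by (simp add: heat_eq_walk_count field_simps)
  also have "\<dots> \<le> sqrt (real ?d ^ ?d * (real (Suc n) powr (-5)))"
  proof -
    have "fact n * real (Suc n) ^ 5 \<le> fact n * real (Suc n) ^ ?d"
      using d by (intro mult_left_mono power_increasing) auto
    also have "\<dots> \<le> fact (n + ?d)" by (rule fact_add_ge)
    finally have "fact n / fact (n + ?d) \<le> 1 / real (Suc n) ^ 5"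
      by (simp add: field_simps del: of_nat_Suc)
    also have "\<dots> = real (Suc n) powr (-5)"
      by (simp add: powr_minus powr_numeral inverse_eq_divide)
    finally have "real ?d ^ ?d * (fact n / fact (n + ?d)) \<le> real ?d ^ ?d * real (Suc n) powr (-5)"
      by (intro mult_left_mono) auto
    then show ?thesis by simp
  qed
  also have "\<dots> = sqrt (real ?d ^ ?d) * real (Suc n) powr (-5/2)"
    by (simp add: real_sqrt_mult powr_half_sqrt[symmetric] powr_powr)
  finally show ?thesis .
qed

section \<open>The Green function of the lattice\<close>

lemma nn_integral_steps:
  "(\<integral>\<^sup>+e. ennreal (f e) \<partial>measure_pmf (pmf_of_set (steps :: 'd::finite site set))) =
     ennreal ((\<Sum>e\<in>steps. f e) / (2 * real CARD('d)))" if "\<And>e. f e \<ge> 0"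
proof -
  have "(\<integral>\<^sup>+e. ennreal (f e) \<partial>measure_pmf (pmf_of_set (steps :: 'd::finite site set))) =
      (\<Sum>e\<in>steps. ennreal (f e)) / ennreal (real (card (steps :: 'd site set)))"
    by (subst nn_integral_pmf_of_set) (auto simp: ennreal_of_nat_eq_real_of_nat)
  also have "(\<Sum>e\<in>steps. ennreal (f e)) = ennreal (\<Sum>e\<in>steps. f e)"
    using that by (simp add: sum_ennreal)
  also have "\<dots> / ennreal (real (card (steps :: 'd site set))) = ennreal ((\<Sum>e\<in>steps. f e) / real (card (steps :: 'd site set)))"
    using that by (intro divide_ennreal) (auto simp: card_steps intro!: sum_nonneg)
  finally show ?thesis by (simp add: card_steps)
qed

lemma heat_nonneg: "heat n z \<ge> 0"
  by (simp add: heat_eq_walk_count walk_count_nonneg)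

lemma partial_sum_measurable:
  "(\<lambda>\<xi>. \<Sum>k<n. \<xi> k) \<in> measurable (\<Pi>\<^sub>M k\<in>(UNIV::nat set). measure_pmf (p :: 'd::finite site pmf)) (count_space UNIV)"
proof (induction n)
  case (Suc n)
  have c: "(\<lambda>\<xi>. \<xi> n) \<in> measurable (\<Pi>\<^sub>M k\<in>(UNIV::nat set). measure_pmf p) (count_space UNIV)"
    using measurable_component_singleton[of n "UNIV::nat set" "\<lambda>_. measure_pmf p"] by simp
  have "(\<lambda>\<xi>. (\<lambda>s \<xi>. (\<Sum>k<n. \<xi> k) + s) (\<xi> n) \<xi>) \<in>
      measurable (\<Pi>\<^sub>M k\<in>(UNIV::nat set). measure_pmf p) (count_space UNIV)"
    by (rule measurable_compose_countable[OF _ c])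
       (rule measurable_compose[OF Suc.IH], simp)
  then show ?case by simp
qed simp

text \<open>
  The first step is independent of the remaining ones, which again form a walk; this is the
  recursion that defines \<open>heat\<close>.
\<close>

lemma walk_law:
  "(\<integral>\<^sup>+\<xi>. indicator {z} (\<Sum>k<n. \<xi> k) \<partial>(srw_steps :: (nat \<Rightarrow> 'd::finite site) measure)) =
     ennreal (heat n z)"
proof (induction n arbitrary: z)
  case 0
  interpret prob_space "srw_steps :: (nat \<Rightarrow> 'd::finite site) measure"
    unfolding srw_steps_def by (intro prob_space_PiM) (simp add: measure_pmf.prob_space_axioms)
  show ?case
    by (simp add: indicator_def emeasure_space_1)
next
  case (Suc n)
  define p where "p = measure_pmf (pmf_of_set (steps :: 'd site set))"
  interpret sequence_space p
    unfolding sequence_space_def product_prob_space_def product_prob_space_axioms_def product_sigma_finite_def p_def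
    by (auto intro: measure_pmf.prob_space_axioms measure_pmf.sigma_finite_measure_axioms)
  have S: "srw_steps = (\<Pi>\<^sub>M i\<in>UNIV. p)"
    by (simp add: srw_steps_def p_def steps_def)
  have m1: "(\<lambda>\<xi>. \<Sum>k<m. \<xi> k) \<in> measurable (\<Pi>\<^sub>M i\<in>(UNIV::nat set). p) (count_space UNIV)" for m
    unfolding p_def by (rule partial_sum_measurable)
  have meas: "(\<lambda>\<xi>. indicator {z} (\<Sum>k<m. \<xi> k) :: ennreal) \<in> borel_measurable (\<Pi>\<^sub>M i\<in>(UNIV::nat set). p)" for m z
    by (rule measurable_compose[OF m1]) simp
  have iter: "(\<lambda>(s, \<omega>). case_nat s \<omega>) \<in> measurable (p \<Otimes>\<^sub>M (\<Pi>\<^sub>M i\<in>UNIV. p)) (\<Pi>\<^sub>M i\<in>UNIV. p)"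
    by measurable
  have "(\<integral>\<^sup>+\<xi>. indicator {z} (\<Sum>k<Suc n. \<xi> k) \<partial>srw_steps) =
      (\<integral>\<^sup>+\<xi>. indicator {z} (\<Sum>k<Suc n. \<xi> k) \<partial>distr (p \<Otimes>\<^sub>M S) S (\<lambda>(s, \<omega>). case_nat s \<omega>))"
    by (simp only: S PiM_iter)
  also have "\<dots> = (\<integral>\<^sup>+q. indicator {z} (\<Sum>k<Suc n. (case q of (s, \<omega>) \<Rightarrow> case_nat s \<omega>) k) \<partial>(p \<Otimes>\<^sub>M S))"
    by (intro nn_integral_distr iter) (simp only: measurable_distr_eq1 meas)
  also have "\<dots> = (\<integral>\<^sup>+s. \<integral>\<^sup>+\<omega>. indicator {z} (\<Sum>k<Suc n. (case_nat s \<omega>) k) \<partial>S \<partial>p)"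
    by (subst P.nn_integral_fst[symmetric], rule measurable_compose[OF iter meas])
       (simp del: sum.lessThan_Suc)
  also have "\<dots> = (\<integral>\<^sup>+s. ennreal (heat n (z - s)) \<partial>p)"
  proof (rule nn_integral_cong)
    fix s
    have "indicator {z} (\<Sum>k<Suc n. (case_nat s \<omega>) k) = (indicator {z - s} (\<Sum>k<n. \<omega> k) :: ennreal)" for \<omega>
      by (auto simp: sum.lessThan_Suc_shift indicator_def simp del: sum.lessThan_Suc)
    then show "(\<integral>\<^sup>+\<omega>. indicator {z} (\<Sum>k<Suc n. (case_nat s \<omega>) k) \<partial>S) = ennreal (heat n (z - s))"
      using Suc.IH[of "z - s"] by (simp only: S)
  qed
  also have "\<dots> = ennreal (heat (Suc n) z)"
    unfolding p_def by (subst nn_integral_steps) (auto simp: heat_nonneg)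
  finally show ?case .
qed

lemma summable_powr_shift: "a > 1 \<Longrightarrow> summable (\<lambda>n. real (Suc n) powr (- a))"
  using summable_Suc_iff[of "\<lambda>n. real n powr (- a)"] summable_real_powr_iff[of "- a"] by simp

context
  assumes dim: "CARD('d::finite) \<ge> 5"
begin

lemma heat_summable: "summable (\<lambda>n. heat n (z :: 'd site))"
proof (rule summable_comparison_test)
  show "\<exists>N. \<forall>n\<ge>N. norm (heat n z) \<le> sqrt (real CARD('d) ^ CARD('d)) * real (Suc n) powr - (5/2)"
    using heat_le[OF dim, of _ z] by (auto simp: heat_nonneg simp del: of_nat_Suc)
  show "summable (\<lambda>n. sqrt (real CARD('d) ^ CARD('d)) * real (Suc n) powr - (5/2))"
    by (intro summable_mult summable_powr_shift) simp
qed

lemma green_eq_suminf: "green x (y :: 'd site) = (\<Sum>n. heat n (y - x))"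
proof -
  have S: "(srw_steps :: (nat \<Rightarrow> 'd site) measure) = (\<Pi>\<^sub>M k\<in>UNIV. measure_pmf (pmf_of_set {e. adjacent 0 e}))"
    by (simp add: srw_steps_def)
  have [measurable]: "(\<lambda>\<xi>. \<Sum>k<n. \<xi> k) \<in> measurable (srw_steps :: (nat \<Rightarrow> 'd site) measure) (count_space UNIV)" for n
    unfolding S by (rule partial_sum_measurable)
  have eq: "indicator {y} (srw x \<xi> n) = (indicator {y - x} (\<Sum>k<n. \<xi> k) :: ennreal)" for \<xi> n
    by (auto simp: srw_def indicator_def)
  have "(\<integral>\<^sup>+\<xi>. (\<Sum>n. indicator {y} (srw x \<xi> n)) \<partial>srw_steps) =
      (\<Sum>n. \<integral>\<^sup>+\<xi>. indicator {y - x} (\<Sum>k<n. \<xi> k) \<partial>srw_steps)"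
    unfolding eq by (intro nn_integral_suminf) measurable
  also have "\<dots> = (\<Sum>n. ennreal (heat n (y - x)))"
    by (simp only: walk_law)
  also have "\<dots> = ennreal (\<Sum>n. heat n (y - x))"
    by (intro suminf_ennreal2 heat_nonneg heat_summable)
  finally show ?thesis
    by (simp add: green_def suminf_nonneg heat_summable heat_nonneg)
qed

lemma green_nonneg: "green x (y :: 'd site) \<ge> 0"
  by (simp add: green_def)

end

lemma heat_uminus: "heat n (- z) = heat n z"
proof (induction n arbitrary: z)
  case (Suc n)
  have "(\<Sum>e\<in>steps. heat n (- z - e)) = (\<Sum>e\<in>steps. heat n (- (z - (- e))))" by simp
  also have "\<dots> = (\<Sum>e\<in>steps. heat n (z - (- e)))" by (simp only: Suc.IH)
  also have "\<dots> = (\<Sum>e\<in>steps. heat n (z - e))" by (rule sum_steps_uminus)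
  finally show ?case by simp
qed simp

lemma heat_zero_outside: "z \<notin> lattice_box n \<Longrightarrow> heat n z = 0"
proof (induction n arbitrary: z)
  case 0
  then show ?case by auto
next
  case (Suc n)
  have "z - e \<notin> lattice_box n" if e: "e \<in> steps" for e
  proof
    assume "z - e \<in> lattice_box n"
    then have h: "\<bar>z $ i - e $ i\<bar> \<le> int n" for i by (simp add: lattice_box_def)
    have "\<bar>z $ i\<bar> \<le> int (Suc n)" for i
      using step_coord_le[OF e, of i] h[of i] by linarith
    then show False using Suc.prems by (simp add: lattice_box_def)
  qed
  then show ?case using Suc.IH by (auto intro!: sum.neutral)
qed

text \<open>
  Every step changes the parity of the sum of the coordinates.
\<close>

lemma heat_parity: "odd (int n + (\<Sum>i\<in>UNIV. z $ i)) \<Longrightarrow> heat n z = 0"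
proof (induction n arbitrary: z)
  case 0
  then show ?case by auto
next
  case (Suc n)
  have "heat n (z - e) = 0" if e: "e \<in> steps" for e
    using Suc.prems step_coord_sum_odd[OF e]
    by (intro Suc.IH) (simp add: sum_subtractf)
  then show ?case by simp
qed

lemma sum_heat_superset:
  assumes "finite A" "lattice_box n \<subseteq> A"
  shows "(\<Sum>w\<in>A. heat n w * f w) = (\<Sum>w\<in>lattice_box n. heat n w * f w)"
  using assms by (intro sum.mono_neutral_right) (auto simp: heat_zero_outside)

lemma lattice_box_mono: "m \<le> n \<Longrightarrow> lattice_box m \<subseteq> lattice_box n"
  unfolding lattice_box_def by (intro Collect_mono) (meson of_nat_le_iff order_trans)

text \<open>
  The Chapman--Kolmogorov equation; the box of radius \<open>n\<close> contains the support of \<open>heat n\<close>.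
\<close>

lemma heat_convolution:
  "(\<Sum>w\<in>lattice_box n. heat n w * heat m (z - w)) = heat (n + m) (z :: 'd::finite site)"
proof (induction n arbitrary: z)
  case 0
  have "(\<Sum>w\<in>lattice_box 0. heat 0 w * heat m (z - w)) = (\<Sum>w\<in>{0}. heat 0 w * heat m (z - w))"
    by (intro sum.mono_neutral_right) auto
  then show ?case by simp
next
  case (Suc n)
  have "(\<Sum>w\<in>lattice_box (Suc n). heat (Suc n) w * heat m (z - w)) =
      (\<Sum>e\<in>steps. \<Sum>w\<in>lattice_box (Suc n). heat n (w - e) * heat m (z - w)) / (2 * real CARD('d))"
    by (subst sum.swap) (simp add: sum_divide_distrib sum_distrib_right)
  also have "(\<Sum>e\<in>steps. \<Sum>w\<in>lattice_box (Suc n). heat n (w - e) * heat m (z - w)) =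
      (\<Sum>e\<in>steps. heat (n + m) (z - e))"
  proof (rule sum.cong[OF refl])
    fix e :: "'d site" assume e: "e \<in> steps"
    have "(\<Sum>w\<in>lattice_box (Suc n). heat n (w - e) * heat m (z - w)) =
        (\<Sum>w\<in>(\<lambda>w. w - e) ` lattice_box (Suc n). heat n w * heat m (z - e - w))"
      by (subst sum.reindex) (auto simp: inj_on_def algebra_simps)
    also have "\<dots> = (\<Sum>w\<in>lattice_box n. heat n w * heat m (z - e - w))"
    proof (rule sum_heat_superset)
      show "lattice_box n \<subseteq> (\<lambda>w. w - e) ` lattice_box (Suc n)"
      proof
        fix w :: "'d site" assume w: "w \<in> lattice_box n"
        have h: "\<bar>w $ i\<bar> \<le> int n" for i using w by (simp add: lattice_box_def)
        have "\<bar>w $ i + e $ i\<bar> \<le> int (Suc n)" for i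
          using step_coord_le[OF e, of i] h[of i] by linarith
        then show "w \<in> (\<lambda>w. w - e) ` lattice_box (Suc n)"
          by (intro image_eqI[of _ _ "w + e"]) (auto simp: lattice_box_def)
      qed
    qed simp
    also have "\<dots> = heat (n + m) (z - e)" by (rule Suc.IH)
    finally show "(\<Sum>w\<in>lattice_box (Suc n). heat n (w - e) * heat m (z - w)) = heat (n + m) (z - e)" .
  qed
  finally show ?case by simp
qed

text \<open>
  By Chapman--Kolmogorov and the symmetry of the walk, \<open>heat (2 * n)\<close> is positive definite, so
  it is largest at the origin.
\<close>

lemma heat_even_le: "heat (2 * n) (z :: 'd site) \<le> heat (2 * n) (0 :: 'd::finite site)"
proof -
  define A where "A = lattice_box n \<union> (\<lambda>w. z - w) ` lattice_box n"
  have A: "finite A" "lattice_box n \<subseteq> A" by (auto simp: A_def)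
  have A': "lattice_box n \<subseteq> (\<lambda>w. z - w) ` A"
    by (auto simp: A_def image_Un image_image)
  have d: "(\<Sum>w\<in>A. heat n w * heat n w) = heat (2 * n) (0::'d site)"
    using heat_convolution[of n n "0::'d site"] sum_heat_superset[OF A, of "heat n"]
    by (simp add: heat_uminus mult_2)
  have d': "(\<Sum>w\<in>A. heat n (z - w) * heat n (z - w)) = heat (2 * n) (0::'d site)"
  proof -
    have "(\<Sum>w\<in>A. heat n (z - w) * heat n (z - w)) = (\<Sum>w\<in>(\<lambda>w. z - w) ` A. heat n w * heat n w)"
      by (subst sum.reindex) (auto simp: inj_on_def)
    also have "\<dots> = (\<Sum>w\<in>(lattice_box n :: 'd site set). heat n w * heat n w)"
      by (intro sum_heat_superset A') (simp add: A)
    finally show ?thesis using heat_convolution[of n n "0::'d site"] by (simp add: heat_uminus mult_2)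
  qed
  have "heat (2 * n) z = (\<Sum>w\<in>A. heat n w * heat n (z - w))"
    using heat_convolution[of n n z] sum_heat_superset[OF A, of "\<lambda>w. heat n (z - w)"] by (simp add: mult_2)
  also have "\<dots> \<le> (\<Sum>w\<in>A. (heat n w * heat n w + heat n (z - w) * heat n (z - w)) / 2)"
  proof (rule sum_mono)
    fix w
    have "0 \<le> (heat n w - heat n (z - w)) * (heat n w - heat n (z - w))" by simp
    then show "heat n w * heat n (z - w) \<le> (heat n w * heat n w + heat n (z - w) * heat n (z - w)) / 2"
      by (simp add: algebra_simps)
  qed
  also have "\<dots> = heat (2 * n) (0 :: 'd site)"
    by (simp add: sum_divide_distrib[symmetric] sum.distrib d d')
  finally show ?thesis .
qed

lemma sums_pairs:
  "summable (f :: nat \<Rightarrow> real) \<Longrightarrow> (\<lambda>n. f (2 * n) + f (2 * n + 1)) sums suminf f"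
proof -
  assume "summable f"
  then have "f sums suminf f" by (rule summable_sums)
  then have "(\<lambda>n. sum f {n * 2..<n * 2 + 2}) sums suminf f"
    by (rule sums_group) simp
  moreover have "sum f {n * 2..<n * 2 + 2} = f (2 * n) + f (2 * n + 1)" for n
    by (simp add: mult.commute numeral_2_eq_2)
  ultimately show ?thesis by simp
qed

context
  assumes dim: "CARD('d::finite) \<ge> 5"
begin

text \<open>
  Pairing the times \<open>2 * n\<close> and \<open>2 * n + 1\<close>, by parity only one of them contributes at a given
  site, and either contribution is at most \<open>heat (2 * n) 0\<close>.
\<close>

lemma green_le_Gstar: "green 0 (z :: 'd site) \<le> Gstar TYPE('d)"
proof -
  have 1: "(\<lambda>n. heat (2 * n) z + heat (2 * n + 1) z) sums green 0 z"
    using sums_pairs[OF heat_summable[OF dim, of z]] by (simp add: green_eq_suminf[OF dim])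
  have 2: "(\<lambda>n. heat (2 * n) (0::'d site) + heat (2 * n + 1) (0::'d site)) sums Gstar TYPE('d)"
    using sums_pairs[OF heat_summable[OF dim, of 0]] by (simp add: Gstar_def green_eq_suminf[OF dim])
  have odd_le: "heat (2 * n + 1) z \<le> heat (2 * n) (0::'d site)" for n
  proof -
    have "heat (2 * n + 1) z = (\<Sum>e\<in>steps. heat (2 * n) (z - e)) / (2 * real CARD('d))" by simp
    also have "\<dots> \<le> (\<Sum>e\<in>(steps::'d site set). heat (2 * n) (0::'d site)) / (2 * real CARD('d))"
      by (intro divide_right_mono sum_mono heat_even_le) auto
    also have "\<dots> = heat (2 * n) (0::'d site)" by (simp add: card_steps)
    finally show ?thesis .
  qed
  show ?thesis
  proof (rule sums_le[OF _ 1 2])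
    fix n
    have "heat (2 * n) z = 0 \<or> heat (2 * n + 1) z = 0"
      using heat_parity[of "2 * n" z] heat_parity[of "2 * n + 1" z] by auto
    then show "heat (2 * n) z + heat (2 * n + 1) z \<le> heat (2 * n) (0::'d site) + heat (2 * n + 1) (0::'d site)"
      using heat_even_le[of n z] odd_le[of n] heat_nonneg[of "2 * n + 1" "0::'d site"] heat_nonneg[of "2 * n" "0::'d site"]
      by (elim disjE) linarith+
  qed
qed

lemma Gstar_ge_1: "Gstar TYPE('d) \<ge> 1"
proof -
  have "(\<Sum>n<1. heat n (0::'d site)) \<le> (\<Sum>n. heat n (0::'d site))"
    by (intro sum_le_suminf heat_summable[OF dim]) (auto simp: heat_nonneg)
  then show ?thesis by (simp add: Gstar_def green_eq_suminf[OF dim])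
qed

text \<open>
  The remainder of the series decays like \<open>1 / K\<close>: of the power 5/2 of the heat kernel, 3/2 is
  spent on convergence.  The same bound serves for the decay of \<open>green\<close> and for its
  approximation in a finite box.
\<close>

lemma green_tail_le:
  obtains C where "C > 0" "\<And>K (z :: 'd site). green 0 z \<le> (\<Sum>n<K. heat n z) + C / real (Suc K)"
proof -
  define B where "B = sqrt (real CARD('d) ^ CARD('d))"
  have B: "B > 0" by (simp add: B_def)
  define S where "S = (\<Sum>n. real (Suc n) powr (- (3/2)))"
  have sS: "summable (\<lambda>n. real (Suc n) powr (- (3/2)))" by (rule summable_powr_shift) simp
  have S: "S \<ge> 0" unfolding S_def by (intro suminf_nonneg sS) auto
  show thesis
  proof (rule that[of "B * S + 1"])
    show "B * S + 1 > 0" using B S by (smt (verit) mult_nonneg_nonneg)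
    fix K and z :: "'d site"
    have bd: "heat (n + K) z \<le> B * real (Suc n) powr (- (3/2)) / real (Suc K)" for n
    proof -
      have "heat (n + K) z \<le> B * real (Suc (n + K)) powr (-5/2)"
        using heat_le[OF dim, of "n + K" z] by (simp add: B_def)
      also have "real (Suc (n + K)) powr (-5/2) = real (Suc (n + K)) powr (-(3/2)) * real (Suc (n + K)) powr (-1)"
        by (subst powr_add[symmetric]) simp
      also have "\<dots> \<le> real (Suc n) powr (-(3/2)) * real (Suc K) powr (-1)"
        by (intro mult_mono powr_mono2') auto
      also have "\<dots> = real (Suc n) powr (- (3/2)) / real (Suc K)"
        by (simp add: powr_minus_divide)
      finally show ?thesis using B by (simp add: mult_left_mono)
    qed
    have "(\<Sum>n. heat (n + K) z) \<le> (\<Sum>n. B * real (Suc n) powr (- (3/2)) / real (Suc K))"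
      by (intro suminf_le bd summable_ignore_initial_segment heat_summable[OF dim]
            summable_divide summable_mult sS)
    also have "\<dots> = B * S / real (Suc K)"
      by (simp only: S_def suminf_divide[OF summable_mult[OF sS]] suminf_mult[OF sS])
    also have "\<dots> \<le> (B * S + 1) / real (Suc K)"
      by (intro divide_right_mono) auto
    finally show "green 0 z \<le> (\<Sum>n<K. heat n z) + (B * S + 1) / real (Suc K)"
      using suminf_split_initial_segment[OF heat_summable[OF dim, of z], of K]
      by (simp add: green_eq_suminf[OF dim])
  qed
qed

text \<open>
  Expanding the square and summing over \<open>z\<close> by Chapman--Kolmogorov leaves the double series of
  \<open>heat (n + m) 0\<close>, which is at most a constant times \<open>((n + 1) (m + 1))\<^bsup>-5/4\<^esup>\<close>.
\<close>

lemma green_square_sum_bounded: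
  obtains V where "\<And>A. finite A \<Longrightarrow> (\<Sum>z\<in>A. (green 0 (z :: 'd site))\<^sup>2) \<le> V"
proof -
  define B where "B = sqrt (real CARD('d) ^ CARD('d))"
  have B: "B > 0" by (simp add: B_def)
  define S where "S = (\<Sum>n. real (Suc n) powr (- (5/4)))"
  have sS: "summable (\<lambda>n. real (Suc n) powr (- (5/4)))" by (rule summable_powr_shift) simp
  have bd: "heat (n + m) (0::'d site) \<le> B * (real (Suc n) powr (- (5/4)) * real (Suc m) powr (- (5/4)))" for n m
  proof -
    have "heat (n + m) (0::'d site) \<le> B * real (Suc (n + m)) powr (-5/2)"
      using heat_le[OF dim, of "n + m"] by (simp add: B_def)
    also have "real (Suc (n + m)) powr (-5/2) = real (Suc (n + m)) powr (-(5/4)) * real (Suc (n + m)) powr (-(5/4))"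
      by (simp add: powr_add[symmetric])
    also have "\<dots> \<le> real (Suc n) powr (-(5/4)) * real (Suc m) powr (-(5/4))"
      by (intro mult_mono powr_mono2') auto
    finally show ?thesis using B by (simp add: mult_left_mono)
  qed
  have fin: "(\<Sum>z\<in>A. (\<Sum>n<K. heat n z)\<^sup>2) \<le> B * S\<^sup>2" if A: "finite A" for A :: "'d site set" and K
  proof -
    define A' where "A' = A \<union> lattice_box K"
    have "(\<Sum>z\<in>A. (\<Sum>n<K. heat n z)\<^sup>2) \<le> (\<Sum>z\<in>A'. (\<Sum>n<K. heat n z)\<^sup>2)"
      using A by (intro sum_mono2) (auto simp: A'_def)
    also have "\<dots> = (\<Sum>n<K. \<Sum>m<K. \<Sum>z\<in>A'. heat n z * heat m z)"
      unfolding power2_eq_square sum_product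
      by (subst sum.swap, intro sum.cong refl, subst sum.swap) simp
    also have "\<dots> = (\<Sum>n<K. \<Sum>m<K. heat (n + m) (0::'d site))"
    proof (intro sum.cong refl)
      fix n m assume "n \<in> {..<K}"
      then have "lattice_box n \<subseteq> A'"
        using lattice_box_mono[of n K] by (auto simp: A'_def)
      then have "(\<Sum>z\<in>A'. heat n z * heat m z) = (\<Sum>z\<in>(lattice_box n :: 'd site set). heat n z * heat m z)"
        using A by (intro sum_heat_superset[of A' n "heat m"]) (auto simp: A'_def)
      then show "(\<Sum>z\<in>A'. heat n z * heat m z) = heat (n + m) (0::'d site)"
        using heat_convolution[of n m "0::'d site"] by (simp add: heat_uminus)
    qed
    also have "\<dots> \<le> (\<Sum>n<K. \<Sum>m<K. B * (real (Suc n) powr (- (5/4)) * real (Suc m) powr (- (5/4))))"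
      by (intro sum_mono bd)
    also have "\<dots> = B * (\<Sum>n<K. real (Suc n) powr (- (5/4)))\<^sup>2"
      unfolding power2_eq_square sum_product by (simp add: sum_distrib_left)
    also have "\<dots> \<le> B * S\<^sup>2"
      using B unfolding S_def
      by (intro mult_left_mono power_mono sum_le_suminf sS sum_nonneg) auto
    finally show ?thesis .
  qed
  show thesis
  proof (rule that[of "B * S\<^sup>2"])
    fix A :: "'d site set" assume A: "finite A"
    have "(\<lambda>K. \<Sum>z\<in>A. (\<Sum>n<K. heat n z)\<^sup>2) \<longlonglongrightarrow> (\<Sum>z\<in>A. (green 0 z)\<^sup>2)"
      unfolding green_eq_suminf[OF dim]
      by (intro tendsto_intros tendsto_sum) (use summable_LIMSEQ[OF heat_summable[OF dim]] in simp)
    then show "(\<Sum>z\<in>A. (green 0 z)\<^sup>2) \<le> B * S\<^sup>2"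
      by (rule LIMSEQ_le_const2) (use fin[OF A] in auto)
  qed
qed

lemma green_square_summable: "(\<lambda>z :: 'd site. (green 0 z)\<^sup>2) summable_on UNIV"
proof -
  obtain V where V: "\<And>A. finite A \<Longrightarrow> (\<Sum>z\<in>A. (green 0 (z :: 'd site))\<^sup>2) \<le> V"
    using green_square_sum_bounded by blast
  show ?thesis
    by (rule nonneg_bdd_above_summable_on) (auto intro!: bdd_aboveI2[of _ _ V] V)
qed

end

section \<open>The Green function of a box\<close>

text \<open>
  The \<open>n\<close>-step transition probability of the walk that is killed when it leaves the box.
\<close>

primrec killed :: "nat \<Rightarrow> nat \<Rightarrow> 'd::finite site \<Rightarrow> 'd site \<Rightarrow> real" where
  "killed N 0 x y = (if x = y \<and> x \<in> lattice_box N then 1 else 0)"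
| "killed N (Suc n) x y =
     (if x \<in> lattice_box N then (\<Sum>e\<in>steps. killed N n (x + e) y) / (2 * real CARD('d)) else 0)"

definition box_green :: "nat \<Rightarrow> 'd::finite site \<Rightarrow> 'd site \<Rightarrow> real" where
  "box_green N x y = (\<Sum>n. killed N n x y)"

lemma killed_nonneg: "killed N n x y \<ge> 0"
  by (induction n arbitrary: x) (auto intro!: divide_nonneg_nonneg sum_nonneg)

lemma killed_outside: "x \<notin> lattice_box N \<Longrightarrow> killed N n x y = 0"
  by (cases n) auto

lemma killed_le_heat: "killed N n x y \<le> heat n (y - x)" for x y :: "'d::finite site"
proof (induction n arbitrary: x)
  case (Suc n)
  have "(\<Sum>e\<in>steps. killed N n (x + e) y) \<le> (\<Sum>e\<in>steps. heat n (y - x - e))"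
    using Suc.IH by (intro sum_mono) (metis diff_diff_eq)
  then show ?case by (auto simp: divide_right_mono intro!: divide_nonneg_nonneg sum_nonneg heat_nonneg)
qed auto

text \<open>
  A walk started at distance at least \<open>n\<close> from the outside cannot leave the box in \<open>n\<close> steps.
\<close>

lemma killed_eq_heat:
  "(\<And>i. \<bar>x $ i\<bar> + int n \<le> int N) \<Longrightarrow> killed N n x y = heat n (y - x)" for x y :: "'d::finite site"
proof (induction n arbitrary: x)
  case 0
  then show ?case by (auto simp: lattice_box_def)
next
  case (Suc n)
  have "\<bar>x $ i\<bar> \<le> int N" for i using Suc.prems[of i] by simp
  then have x: "x \<in> lattice_box N" by (simp add: lattice_box_def)
  have "killed N n (x + e) y = heat n (y - x - e)" if e: "e \<in> steps" for e
  proof -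
    have "\<bar>(x + e) $ i\<bar> + int n \<le> int N" for i
      using Suc.prems[of i] step_coord_le[OF e, of i] by simp
    then show ?thesis using Suc.IH[of "x + e"] by (simp add: diff_diff_eq)
  qed
  then show ?case using x by simp
qed

context
  assumes dim: "CARD('d::finite) \<ge> 5"
begin

lemma killed_summable: "summable (\<lambda>n. killed N n x (y :: 'd site))"
  by (rule summable_comparison_test[OF _ heat_summable[OF dim, of "y - x"]])
     (auto simp: killed_nonneg killed_le_heat)

lemma box_green_nonneg: "box_green N x (y :: 'd site) \<ge> 0"
  unfolding box_green_def by (intro suminf_nonneg killed_summable killed_nonneg)

lemma box_green_le_green: "box_green N x (y :: 'd site) \<le> green 0 (y - x)"
  unfolding box_green_def green_eq_suminf[OF dim]
  using heat_summable[OF dim, of "y - x"] by (intro suminf_le killed_summable) (auto simp: killed_le_heat)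

lemma box_green_le_Gstar: "box_green N x (y :: 'd site) \<le> Gstar TYPE('d)"
  using box_green_le_green green_le_Gstar[OF dim] by (rule order_trans)

lemma box_green_outside: "x \<notin> lattice_box N \<Longrightarrow> box_green N x (y :: 'd site) = 0"
  by (simp add: box_green_def killed_outside)

lemma box_green_rec:
  assumes "x \<in> lattice_box N"
  shows "box_green N x (y :: 'd site) =
    (if x = y then 1 else 0) + (\<Sum>e\<in>steps. box_green N (x + e) y) / (2 * real CARD('d))"
proof -
  have "box_green N x y = killed N 0 x y + (\<Sum>n. killed N (Suc n) x y)"
    unfolding box_green_def using suminf_split_head[OF killed_summable, of N x y] by simp
  also have "(\<Sum>n. killed N (Suc n) x y) = (\<Sum>n. \<Sum>e\<in>steps. killed N n (x + e) y / (2 * real CARD('d)))"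
    using assms by (simp add: sum_divide_distrib)
  also have "\<dots> = (\<Sum>e\<in>steps. \<Sum>n. killed N n (x + e) y / (2 * real CARD('d)))"
    by (intro suminf_sum summable_divide killed_summable)
  also have "\<dots> = (\<Sum>e\<in>steps. box_green N (x + e) y) / (2 * real CARD('d))"
    unfolding sum_divide_distrib box_green_def
    by (intro sum.cong refl suminf_divide killed_summable)
  finally show ?thesis using assms by simp
qed

lemma box_green_ge_1: "x \<in> lattice_box N \<Longrightarrow> box_green N x (x :: 'd site) \<ge> 1"
  using box_green_rec[of x N x] by (simp add: sum_nonneg box_green_nonneg)

lemma box_green_bulk_ge:
  assumes "\<And>i. \<bar>x $ i\<bar> + int K \<le> int N"
  shows "box_green N x (y :: 'd site) \<ge> (\<Sum>n<K. heat n (y - x))"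
proof -
  have "\<bar>x $ i\<bar> + int n \<le> int N" if "n < K" for i n
    using assms[of i] that by simp
  then have "(\<Sum>n<K. heat n (y - x)) = (\<Sum>n<K. killed N n x y)"
    by (intro sum.cong refl killed_eq_heat[symmetric]) auto
  also have "\<dots> \<le> box_green N x y"
    unfolding box_green_def by (intro sum_le_suminf killed_summable) (auto simp: killed_nonneg)
  finally show ?thesis .
qed

end

section \<open>The quadratic form of the Gibbs measure\<close>

definition laplace :: "nat \<Rightarrow> ('d::finite site \<Rightarrow> real) \<Rightarrow> 'd site \<Rightarrow> real" where
  "laplace N f x = f x - (\<Sum>y\<in>lattice_box N. if y - x \<in> steps then f y else 0) / (2 * real CARD('d))"

definition energy_form :: "nat \<Rightarrow> ('d::finite site \<Rightarrow> real) \<Rightarrow> ('d site \<Rightarrow> real) \<Rightarrow> real" where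
  "energy_form N f g = (\<Sum>x\<in>lattice_box N. f x * laplace N g x)"

lemma sum_neighbours_box:
  "(\<Sum>y\<in>lattice_box N. if y - x \<in> steps then f y else 0) = (\<Sum>e\<in>steps. extend0 N f (x + e))"
proof -
  have "(\<Sum>e\<in>steps. extend0 N f (x + e)) = (\<Sum>y\<in>(\<lambda>e. x + e) ` steps. extend0 N f y)"
    by (subst sum.reindex) (auto simp: inj_on_def)
  also have "\<dots> = (\<Sum>y\<in>lattice_box N \<inter> {y. y - x \<in> steps}. f y)"
    by (rule sum.mono_neutral_cong_right)
       (auto simp: extend0_def image_iff, metis add.commute diff_add_cancel)
  also have "\<dots> = (\<Sum>y\<in>lattice_box N. if y - x \<in> steps then f y else 0)"
    by (simp add: sum.inter_restrict)
  finally show ?thesis ..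
qed

lemma mult_laplace:
  "c * laplace N g x = c * g x -
    (\<Sum>y\<in>lattice_box N. if y - x \<in> steps then c * g y else 0) / (2 * real CARD('d))"
  for g :: "'d::finite site \<Rightarrow> real"
proof -
  have "c * (\<Sum>y\<in>lattice_box N. if y - x \<in> steps then g y else 0) =
      (\<Sum>y\<in>lattice_box N. if y - x \<in> steps then c * g y else 0)"
    unfolding sum_distrib_left by (intro sum.cong) auto
  then show ?thesis by (simp add: laplace_def right_diff_distrib)
qed

lemma energy_form_eq:
  "energy_form N f g = (\<Sum>x\<in>lattice_box N. f x * g x) -
      (\<Sum>x\<in>lattice_box N. \<Sum>y\<in>lattice_box N. if y - x \<in> steps then f x * g y else 0) / (2 * real CARD('d))"
  for f g :: "'d::finite site \<Rightarrow> real"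
  unfolding energy_form_def mult_laplace sum_subtractf sum_divide_distrib[symmetric] ..

lemma energy_form_sym: "energy_form N f g = energy_form N g f"
proof -
  have st: "y - x \<in> steps \<longleftrightarrow> x - y \<in> steps" for x y :: "'a site"
    using uminus_steps[of "y - x"] uminus_steps[of "x - y"] by auto
  have "(\<Sum>x\<in>lattice_box N. \<Sum>y\<in>lattice_box N. if y - x \<in> steps then f x * g y else 0) =
      (\<Sum>x\<in>lattice_box N. \<Sum>y\<in>lattice_box N. if y - x \<in> steps then g x * f y else 0)"
    by (subst sum.swap) (auto intro!: sum.cong simp: st mult.commute)
  then show ?thesis unfolding energy_form_eq by (simp add: mult.commute)
qed

text \<open>
  Summation by parts.  Ordered pairs with the first entry outside the box contribute nothing to
  \<open>u x * (u x - u y)\<close>, so the pairs can be enumerated by a site of the box and a step.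
\<close>

lemma gradient_energy_eq:
  "gradient_energy N f = 2 * real CARD('d) * energy_form N f f" for f :: "'d::finite site \<Rightarrow> real"
proof -
  define P where "P = {(x, y :: 'd site). adjacent x y \<and> {x, y} \<inter> lattice_box N \<noteq> {}}"
  define u where "u = extend0 N f"
  have P1: "P = (\<lambda>(x, e). (x, x + e)) ` (lattice_box N \<times> steps) \<union> (\<lambda>(x, e). (x + e, x)) ` (lattice_box N \<times> steps)"
    (is "P = ?A \<union> ?B")
  proof (intro set_eqI iffI)
    fix q assume "q \<in> P"
    then obtain x y where q: "q = (x, y)" "y - x \<in> steps" "x \<in> lattice_box N \<or> y \<in> lattice_box N"
      by (auto simp: P_def adjacent_steps)
    have "x - y \<in> steps" using uminus_steps[OF q(2)] by simp
    with q show "q \<in> ?A \<union> ?B"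
      by (elim disjE) (auto intro: image_eqI[of _ _ "(x, y - x)"] image_eqI[of _ _ "(y, x - y)"])
  next
    fix q assume "q \<in> ?A \<union> ?B"
    then show "q \<in> P" using uminus_steps by (fastforce simp: P_def adjacent_steps)
  qed
  have finP: "finite P" unfolding P1 by auto
  have swap: "(\<Sum>(x, y)\<in>P. u y * (u y - u x)) = (\<Sum>(x, y)\<in>P. u x * (u x - u y))"
    by (rule sum.reindex_bij_witness[of _ prod.swap prod.swap])
       (auto simp: P_def adjacent_steps dest: uminus_steps)
  have "(\<Sum>(x, y)\<in>P. (u x - u y)\<^sup>2) = (\<Sum>(x, y)\<in>P. u x * (u x - u y)) + (\<Sum>(x, y)\<in>P. u y * (u y - u x))"
    by (auto simp: sum.distrib[symmetric] power2_eq_square algebra_simps intro!: sum.cong)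
  also have "\<dots> = 2 * (\<Sum>(x, y)\<in>P. u x * (u x - u y))"
    using swap by simp
  also have "(\<Sum>(x, y)\<in>P. u x * (u x - u y)) = (\<Sum>(x, y)\<in>?A. u x * (u x - u y))"
    using finP by (intro sum.mono_neutral_right)
      (auto simp: P_def adjacent_steps u_def extend0_def intro!: image_eqI[of _ _ "(_, _ - _)"] split: if_splits)
  also have "\<dots> = (\<Sum>(x, e)\<in>lattice_box N \<times> steps. u x * (u x - u (x + e)))"
    by (subst sum.reindex) (auto simp: inj_on_def intro!: sum.cong)
  also have "\<dots> = (\<Sum>x\<in>lattice_box N. \<Sum>e\<in>steps. u x * (u x - u (x + e)))"
    by (simp add: sum.cartesian_product)
  also have "\<dots> = (\<Sum>x\<in>lattice_box N. 2 * real CARD('d) * (f x * laplace N f x))"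
  proof (rule sum.cong[OF refl])
    fix x :: "'d site" assume "x \<in> lattice_box N"
    then have "u x = f x" by (simp add: u_def extend0_def)
    then have "(\<Sum>e\<in>steps. u x * (u x - u (x + e))) = f x * (2 * real CARD('d) * f x - (\<Sum>e\<in>steps. u (x + e)))"
      by (simp add: sum_distrib_left[symmetric] sum_subtractf card_steps)
    then show "(\<Sum>e\<in>steps. u x * (u x - u (x + e))) = 2 * real CARD('d) * (f x * laplace N f x)"
      unfolding laplace_def sum_neighbours_box u_def[symmetric] by (simp only:) (simp add: right_diff_distrib)
  qed
  finally show ?thesis
    unfolding gradient_energy_def P_def u_def energy_form_def by (simp add: sum_distrib_left[symmetric])
qed

lemma gibbs_weight_eq:
  "gibbs_weight N h \<phi> = exp (- (1 / 2) * energy_form N \<phi> \<phi> + (\<Sum>x\<in>lattice_box N. h x * \<phi> x))"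
  by (simp add: gibbs_weight_def gradient_energy_eq)

lemma laplace_cong: "(\<And>x. x \<in> lattice_box N \<Longrightarrow> f x = g x) \<Longrightarrow> x \<in> lattice_box N \<Longrightarrow> laplace N f x = laplace N g x"
  unfolding laplace_def by (intro arg_cong2[where f = "(-)"] arg_cong2[where f = "(/)"] sum.cong) auto

lemma gibbs_weight_cong:
  assumes "\<And>x. x \<in> lattice_box N \<Longrightarrow> \<phi> x = \<psi> x"
  shows "gibbs_weight N h \<phi> = gibbs_weight N h \<psi>"
proof -
  have "energy_form N \<phi> \<phi> = energy_form N \<psi> \<psi>"
    unfolding energy_form_def using laplace_cong[of N \<phi> \<psi>] by (intro sum.cong) (auto simp: assms)
  moreover have "(\<Sum>x\<in>lattice_box N. h x * \<phi> x) = (\<Sum>x\<in>lattice_box N. h x * \<psi> x)"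
    using assms by (intro sum.cong) auto
  ultimately show ?thesis by (simp add: gibbs_weight_eq)
qed

lemma laplace_add: "laplace N (\<lambda>x. f x + g x) x = laplace N f x + laplace N g x"
proof -
  have "(\<Sum>y\<in>lattice_box N. if y - x \<in> steps then f y + g y else 0) =
    (\<Sum>y\<in>lattice_box N. if y - x \<in> steps then f y else 0) + (\<Sum>y\<in>lattice_box N. if y - x \<in> steps then g y else 0)"
    by (subst sum.distrib[symmetric]) (auto intro!: sum.cong)
  then show ?thesis by (simp add: laplace_def add_divide_distrib)
qed

lemma energy_form_add: "energy_form N (\<lambda>x. f x + g x) (\<lambda>x. f x + g x) =
   energy_form N f f + 2 * energy_form N f g + energy_form N g g"
proof -
  have "energy_form N (\<lambda>x. f x + g x) (\<lambda>x. f x + g x) =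
    energy_form N f f + energy_form N f g + energy_form N g f + energy_form N g g"
    by (simp add: energy_form_def laplace_add algebra_simps sum.distrib)
  then show ?thesis using energy_form_sym[of N g f] by simp
qed

text \<open>
  The solution of the discrete Poisson equation with right-hand side \<open>h\<close>, and the centre of the
  Gibbs measure with external field \<open>h\<close>.
\<close>

definition mean_field :: "nat \<Rightarrow> ('d::finite site \<Rightarrow> real) \<Rightarrow> 'd site \<Rightarrow> real" where
  "mean_field N h x = (\<Sum>y\<in>lattice_box N. box_green N x y * h y)"

context
  assumes dim: "CARD('d::finite) \<ge> 5"
begin

lemma laplace_mean_field:
  assumes x: "x \<in> lattice_box N"
  shows "laplace N (mean_field N h) x = h (x :: 'd site)"
proof -
  have ext: "extend0 N (mean_field N h) z = mean_field N h z" for z :: "'d site"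
    by (simp add: extend0_def mean_field_def box_green_outside[OF dim])
  have "(\<Sum>e\<in>steps. mean_field N h (x + e)) / (2 * real CARD('d)) =
     (\<Sum>y\<in>lattice_box N. ((\<Sum>e\<in>steps. box_green N (x + e) y) / (2 * real CARD('d))) * h y)"
    unfolding mean_field_def by (subst sum.swap) (simp add: sum_distrib_right sum_divide_distrib)
  also have "\<dots> = (\<Sum>y\<in>lattice_box N. box_green N x y * h y - (if x = y then 1 else 0) * h y)"
    using box_green_rec[OF dim x] by (intro sum.cong refl) (simp add: algebra_simps)
  also have "\<dots> = mean_field N h x - h x"
    using x by (simp add: sum_subtractf mean_field_def if_distrib[of "\<lambda>q. q * _"] cong: if_cong)
  finally show ?thesis
    unfolding laplace_def sum_neighbours_box ext by simp
qed

text \<open>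
  Completing the square: the linear term is the polar form of the energy at \<open>mean_field N h\<close>.
\<close>

lemma gibbs_weight_shift:
  "gibbs_weight N h (\<lambda>x. \<psi> x + mean_field N h x) =
     exp ((\<Sum>x\<in>lattice_box N. h x * mean_field N h x) / 2) * gibbs_weight N (\<lambda>_. 0) (\<psi> :: 'd site \<Rightarrow> real)"
proof -
  let ?v = "mean_field N h"
  have f: "energy_form N f ?v = (\<Sum>x\<in>lattice_box N. h x * f x)" for f
    unfolding energy_form_def by (intro sum.cong refl) (simp add: laplace_mean_field)
  have "- (1 / 2) * energy_form N (\<lambda>x. \<psi> x + ?v x) (\<lambda>x. \<psi> x + ?v x) + (\<Sum>x\<in>lattice_box N. h x * (\<psi> x + ?v x))
    = (\<Sum>x\<in>lattice_box N. h x * ?v x) / 2 - (1 / 2) * energy_form N \<psi> \<psi>"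
    unfolding energy_form_add f by (simp add: algebra_simps sum.distrib)
  then show ?thesis by (simp add: gibbs_weight_eq flip: exp_add)
qed

text \<open>
  The energy form is positive definite, which makes the partition function finite.  The function
  \<open>w\<close> below is the expected exit time from the box; it satisfies \<open>laplace N w = 1\<close> and lies
  between 1 and the constant \<open>F\<close>.  The ground state transform with respect to \<open>w\<close> gives
  \<open>energy_form N f f \<ge> (\<Sum>x. (f x)\<^sup>2 / w x)\<close>.
\<close>

lemma energy_form_ge:
  "energy_form N f f \<ge> (\<Sum>x\<in>lattice_box N. (f x)\<^sup>2) / (real (card (lattice_box N :: 'd site set)) * Gstar TYPE('d))"
  for f :: "'d site \<Rightarrow> real"
proof -
  let ?B = "lattice_box N :: 'd site set"
  define w where "w = mean_field N (\<lambda>_ :: 'd site. 1)"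
  define F where "F = real (card ?B) * Gstar TYPE('d)"
  have w1: "w x \<ge> 1" if "x \<in> ?B" for x
  proof -
    have "box_green N x x \<le> w x" unfolding w_def mean_field_def
      using that by (simp add: member_le_sum box_green_nonneg[OF dim])
    then show ?thesis using box_green_ge_1[OF dim that] by simp
  qed
  have wF: "w x \<le> F" for x
    unfolding w_def mean_field_def F_def using box_green_le_Gstar[OF dim, of N x]
    by (simp add: sum_bounded_above)
  have st: "y - x \<in> steps \<longleftrightarrow> x - y \<in> steps" for x y :: "'d site"
    using uminus_steps[of "y - x"] uminus_steps[of "x - y"] by auto
  define T where "T = (\<Sum>x\<in>?B. \<Sum>y\<in>?B. if y - x \<in> steps then (f x)\<^sup>2 * w y / w x else 0)"
  have T': "T = (\<Sum>x\<in>?B. \<Sum>y\<in>?B. if y - x \<in> steps then (f y)\<^sup>2 * w x / w y else 0)"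
    unfolding T_def by (subst sum.swap) (auto intro!: sum.cong simp: st)
  have Te: "T = (\<Sum>x\<in>?B. (f x)\<^sup>2 * (2 * real CARD('d)) * (1 - 1 / w x))"
    unfolding T_def
  proof (rule sum.cong[OF refl])
    fix x assume x: "x \<in> ?B"
    have "laplace N w x = 1" unfolding w_def by (rule laplace_mean_field[OF x])
    then have s: "(\<Sum>y\<in>?B. if y - x \<in> steps then w y else 0) = 2 * real CARD('d) * (w x - 1)"
      by (simp add: laplace_def field_simps)
    have "(\<Sum>y\<in>?B. if y - x \<in> steps then (f x)\<^sup>2 * w y / w x else 0) =
        (f x)\<^sup>2 / w x * (\<Sum>y\<in>?B. if y - x \<in> steps then w y else 0)"
      by (simp add: sum_distrib_left if_distrib cong: if_cong)
    then show "(\<Sum>y\<in>?B. if y - x \<in> steps then (f x)\<^sup>2 * w y / w x else 0) =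
       (f x)\<^sup>2 * (2 * real CARD('d)) * (1 - 1 / w x)"
      unfolding s using w1[OF x] by (simp add: field_simps)
  qed
  \<comment> \<open>The cross terms: \<open>2 f x f y \<le> (f x)\<^sup>2 w y / w x + (f y)\<^sup>2 w x / w y\<close>.\<close>
  have "(\<Sum>x\<in>?B. \<Sum>y\<in>?B. if y - x \<in> steps then f x * f y else 0) \<le>
      (\<Sum>x\<in>?B. \<Sum>y\<in>?B. ((if y - x \<in> steps then (f x)\<^sup>2 * w y / w x else 0) + (if y - x \<in> steps then (f y)\<^sup>2 * w x / w y else 0)) / 2)"
  proof (intro sum_mono)
    fix x y assume "x \<in> ?B" "y \<in> ?B"
    then have w: "w x > 0" "w y > 0" using w1 by force+
    have "0 \<le> (f x * w y - f y * w x)\<^sup>2 / (w x * w y)"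
      using w by simp
    also have "\<dots> = (f x)\<^sup>2 * w y / w x + (f y)\<^sup>2 * w x / w y - 2 * (f x * f y)"
      using w by (simp add: field_simps power2_eq_square)
    finally show "(if y - x \<in> steps then f x * f y else 0) \<le>
      ((if y - x \<in> steps then (f x)\<^sup>2 * w y / w x else 0) + (if y - x \<in> steps then (f y)\<^sup>2 * w x / w y else 0)) / 2"
      by simp
  qed
  also have "\<dots> = T"
    unfolding sum_divide_distrib[symmetric] sum.distrib T_def[symmetric] T'[symmetric] by simp
  finally have cross: "(\<Sum>x\<in>?B. \<Sum>y\<in>?B. if y - x \<in> steps then f x * f y else 0) \<le> T" .
  have "(\<Sum>x\<in>?B. (f x)\<^sup>2) / F = (\<Sum>x\<in>?B. (f x)\<^sup>2 / F)" by (rule sum_divide_distrib)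
  also have "\<dots> \<le> (\<Sum>x\<in>?B. (f x)\<^sup>2 / w x)"
  proof (intro sum_mono divide_left_mono wF)
    fix x assume "x \<in> ?B"
    then show "0 < F * w x" using w1[of x] wF[of x] by (intro mult_pos_pos) linarith+
  qed simp
  also have "\<dots> = (\<Sum>x\<in>?B. (f x)\<^sup>2) - T / (2 * real CARD('d))"
    unfolding Te sum_divide_distrib sum_subtractf[symmetric] by (intro sum.cong) (auto simp: field_simps)
  also have "\<dots> \<le> (\<Sum>x\<in>?B. (f x)\<^sup>2) - (\<Sum>x\<in>?B. \<Sum>y\<in>?B. if y - x \<in> steps then f x * f y else 0) / (2 * real CARD('d))"
    using cross by (simp add: divide_right_mono)
  also have "\<dots> = energy_form N f f"
    by (simp add: energy_form_eq power2_eq_square)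
  finally show ?thesis by (simp add: F_def)
qed

end

section \<open>The Gibbs measure as a shifted centred Gaussian measure\<close>

abbreviation field_space :: "nat \<Rightarrow> ('d::finite site \<Rightarrow> real) measure" where
  "field_space N \<equiv> \<Pi>\<^sub>M x\<in>lattice_box N. lborel"

definition shift_field :: "nat \<Rightarrow> ('d::finite site \<Rightarrow> real) \<Rightarrow> ('d site \<Rightarrow> real) \<Rightarrow> 'd site \<Rightarrow> real" where
  "shift_field N v \<phi> = (\<lambda>x\<in>lattice_box N. \<phi> x + v x)"

lemma shift_field_measurable [measurable]: "shift_field N v \<in> measurable (field_space N) (field_space N)"
  unfolding shift_field_def by measurable

interpretation lborel_product: product_sigma_finite "\<lambda>_. lborel :: real measure"
  by (simp add: product_sigma_finite_def lborel.sigma_finite_measure_axioms)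

text \<open>
  Translation invariance of Lebesgue measure, one coordinate at a time.
\<close>

lemma distr_shift_field:
  "distr (field_space N) (field_space N) (shift_field N v) = (field_space N :: ('d::finite site \<Rightarrow> real) measure)"
proof (rule lborel_product.PiM_eqI)
  fix A :: "'d site \<Rightarrow> real set" assume A: "\<And>x. x \<in> lattice_box N \<Longrightarrow> A x \<in> sets lborel"
  have vim: "shift_field N v -` Pi\<^sub>E (lattice_box N) A \<inter> space (field_space N) =
      Pi\<^sub>E (lattice_box N) (\<lambda>x. (\<lambda>s. s + v x) -` A x)"
    by (auto simp: shift_field_def space_PiM PiE_iff extensional_def restrict_def)
  have m: "(\<lambda>s. s + v x) -` A x \<in> sets lborel" if "x \<in> lattice_box N" for x
    using measurable_sets[of "\<lambda>s. s + v x" borel borel "A x"] A[OF that] by simp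
  have t: "emeasure lborel ((\<lambda>s. s + v x) -` A x) = emeasure lborel (A x)" if x: "x \<in> lattice_box N" for x
  proof -
    have "emeasure lborel (A x) = emeasure (distr lborel borel ((+) (v x))) (A x)"
      by (simp only: lborel_distr_plus)
    also have "\<dots> = emeasure lborel ((+) (v x) -` A x)"
      using A[OF x] by (subst emeasure_distr) auto
    also have "(+) (v x) -` A x = (\<lambda>s. s + v x) -` A x" by (auto simp: add.commute)
    finally show ?thesis ..
  qed
  have "emeasure (distr (field_space N) (field_space N) (shift_field N v)) (Pi\<^sub>E (lattice_box N) A) =
      emeasure (field_space N) (Pi\<^sub>E (lattice_box N) (\<lambda>x. (\<lambda>s. s + v x) -` A x))"
    using A by (subst emeasure_distr) (auto simp: vim intro!: sets_PiM_I_finite)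
  also have "\<dots> = (\<Prod>x\<in>lattice_box N. emeasure lborel ((\<lambda>s. s + v x) -` A x))"
    using m by (intro lborel_product.emeasure_PiM) auto
  finally show "emeasure (distr (field_space N) (field_space N) (shift_field N v)) (Pi\<^sub>E (lattice_box N) A) =
      (\<Prod>x\<in>lattice_box N. emeasure lborel (A x))"
    by (simp add: t)
qed simp_all

lemma nn_integral_shift_field:
  assumes "F \<in> borel_measurable (field_space N)"
  shows "(\<integral>\<^sup>+\<phi>. F (shift_field N v \<phi>) \<partial>field_space N) = (\<integral>\<^sup>+\<phi>. F \<phi> \<partial>field_space N)"
proof -
  have "(\<integral>\<^sup>+\<phi>. F \<phi> \<partial>field_space N) = (\<integral>\<^sup>+\<phi>. F \<phi> \<partial>distr (field_space N) (field_space N) (shift_field N v))"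
    by (simp only: distr_shift_field)
  also have "\<dots> = (\<integral>\<^sup>+\<phi>. F (shift_field N v \<phi>) \<partial>field_space N)"
    using assms by (intro nn_integral_distr) auto
  finally show ?thesis ..
qed

lemma energy_form_measurable [measurable]:
  "(\<lambda>\<phi>. energy_form N \<phi> \<phi>) \<in> borel_measurable (field_space N)"
  unfolding energy_form_def laplace_def by measurable

lemma gibbs_weight_measurable [measurable]: "gibbs_weight N h \<in> borel_measurable (field_space N)"
  unfolding gibbs_weight_eq by measurable

lemma gibbs_weight_pos: "gibbs_weight N h \<phi> > 0"
  by (simp add: gibbs_weight_def)

lemma space_gibbs [simp]: "space (gibbs N h) = space (field_space N)"
  by (simp add: gibbs_def)

lemma sets_gibbs [simp, measurable_cong]: "sets (gibbs N h) = sets (field_space N)"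
  by (simp add: gibbs_def)

context
  assumes dim: "CARD('d::finite) \<ge> 5"
begin

lemma nn_integral_weight_0_finite: "(\<integral>\<^sup>+\<phi>. gibbs_weight N (\<lambda>_ :: 'd site. 0) \<phi> \<partial>field_space N) < \<infinity>"
proof -
  let ?B = "lattice_box N :: 'd site set"
  define c where "c = 1 / (2 * (real (card ?B) * Gstar TYPE('d)))"
  have cB: "card ?B > 0" by (simp add: card_gt_0_iff)
  have c: "c > 0" using cB Gstar_ge_1[OF dim] by (simp add: c_def)
  have gauss: "(\<integral>\<^sup>+s. ennreal (exp (- c * s\<^sup>2)) \<partial>lborel) < \<infinity>"
  proof -
    define \<sigma> where "\<sigma> = sqrt (1 / (2 * c))"
    have s: "\<sigma> > 0" "\<sigma>\<^sup>2 = 1 / (2 * c)" using c by (simp_all add: \<sigma>_def)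
    have "exp (- c * s\<^sup>2) = sqrt (2 * pi * \<sigma>\<^sup>2) * normal_density 0 \<sigma> s" for s
      using c s by (simp add: normal_density_def field_simps)
    moreover have "integrable lborel (\<lambda>s. sqrt (2 * pi * \<sigma>\<^sup>2) * normal_density 0 \<sigma> s)"
      using s by (intro integrable_mult_right integrable_normal_density)
    ultimately have "integrable lborel (\<lambda>s. exp (- c * s\<^sup>2))" by simp
    then show ?thesis by (simp add: integrable_iff_bounded)
  qed
  have "(\<integral>\<^sup>+\<phi>. gibbs_weight N (\<lambda>_ :: 'd site. 0) \<phi> \<partial>field_space N) \<le>
      (\<integral>\<^sup>+\<phi>. (\<Prod>x\<in>?B. ennreal (exp (- c * (\<phi> x)\<^sup>2))) \<partial>field_space N)"
  proof (rule nn_integral_mono)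
    fix \<phi> :: "'d site \<Rightarrow> real"
    have "(\<Sum>x\<in>?B. - c * (\<phi> x)\<^sup>2) = - (1 / 2) * ((\<Sum>x\<in>?B. (\<phi> x)\<^sup>2) / (real (card ?B) * Gstar TYPE('d)))"
      by (simp add: c_def sum_negf sum_divide_distrib mult_ac)
    also have "\<dots> \<ge> - (1 / 2) * energy_form N \<phi> \<phi>"
      using energy_form_ge[OF dim, where N = N and f = \<phi>] by simp
    finally have "gibbs_weight N (\<lambda>_ :: 'd site. 0) \<phi> \<le> exp (\<Sum>x\<in>?B. - c * (\<phi> x)\<^sup>2)"
      by (simp add: gibbs_weight_eq)
    also have "\<dots> = (\<Prod>x\<in>?B. exp (- c * (\<phi> x)\<^sup>2))" by (simp add: exp_sum)
    finally show "ennreal (gibbs_weight N (\<lambda>_ :: 'd site. 0) \<phi>) \<le> (\<Prod>x\<in>?B. ennreal (exp (- c * (\<phi> x)\<^sup>2)))"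
      by (subst prod_ennreal) (auto intro: ennreal_leI)
  qed
  also have "\<dots> = (\<Prod>x\<in>?B. \<integral>\<^sup>+s. ennreal (exp (- c * s\<^sup>2)) \<partial>lborel)"
    by (intro lborel_product.product_nn_integral_prod) auto
  also have "\<dots> < \<infinity>" using gauss by (simp add: power_less_top_ennreal)
  finally show ?thesis .
qed

lemma nn_integral_weight:
  assumes [measurable]: "F \<in> borel_measurable (field_space N)"
  shows "(\<integral>\<^sup>+\<phi>. ennreal (gibbs_weight N h \<phi>) * F \<phi> \<partial>field_space N) =
    ennreal (exp ((\<Sum>x\<in>lattice_box N. h x * mean_field N h x) / 2)) *
      (\<integral>\<^sup>+\<phi>. ennreal (gibbs_weight N (\<lambda>_ :: 'd site. 0) \<phi>) * F (shift_field N (mean_field N h) \<phi>) \<partial>field_space N)"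
proof -
  have w: "gibbs_weight N h (shift_field N (mean_field N h) \<phi>) =
      exp ((\<Sum>x\<in>lattice_box N. h x * mean_field N h x) / 2) * gibbs_weight N (\<lambda>_. 0) \<phi>" for \<phi> :: "'d site \<Rightarrow> real"
    unfolding gibbs_weight_shift[OF dim, symmetric]
    by (rule gibbs_weight_cong) (simp add: shift_field_def)
  have "(\<integral>\<^sup>+\<phi>. ennreal (gibbs_weight N h \<phi>) * F \<phi> \<partial>field_space N) =
     (\<integral>\<^sup>+\<phi>. ennreal (gibbs_weight N h (shift_field N (mean_field N h) \<phi>)) * F (shift_field N (mean_field N h) \<phi>) \<partial>field_space N)"
    by (rule nn_integral_shift_field[symmetric]) measurable
  also have "\<dots> = (\<integral>\<^sup>+\<phi>. ennreal (exp ((\<Sum>x\<in>lattice_box N. h x * mean_field N h x) / 2)) *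
      (ennreal (gibbs_weight N (\<lambda>_. 0) \<phi>) * F (shift_field N (mean_field N h) \<phi>)) \<partial>field_space N)"
    unfolding w by (simp only: ennreal_mult'[OF exp_ge_zero] mult.assoc)
  also have "\<dots> = ennreal (exp ((\<Sum>x\<in>lattice_box N. h x * mean_field N h x) / 2)) *
      (\<integral>\<^sup>+\<phi>. ennreal (gibbs_weight N (\<lambda>_ :: 'd site. 0) \<phi>) * F (shift_field N (mean_field N h) \<phi>) \<partial>field_space N)"
    by (rule nn_integral_cmult) measurable
  finally show ?thesis .
qed

lemma gibbs_Z_0_facts:
  shows gibbs_Z_0_pos: "gibbs_Z N (\<lambda>_ :: 'd site. 0) > 0"
    and nn_integral_gibbs_Z_0: "(\<integral>\<^sup>+\<phi>. gibbs_weight N (\<lambda>_ :: 'd site. 0) \<phi> \<partial>field_space N) =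
      ennreal (gibbs_Z N (\<lambda>_ :: 'd site. 0))"
proof -
  let ?I = "\<integral>\<^sup>+\<phi>. gibbs_weight N (\<lambda>_ :: 'd site. 0) \<phi> \<partial>field_space N"
  have int: "integrable (field_space N) (gibbs_weight N (\<lambda>_ :: 'd site. 0))"
    using nn_integral_weight_0_finite[of N] gibbs_weight_pos[of N "\<lambda>_ :: 'd site. 0"]
    by (auto simp: integrable_iff_bounded less_imp_le)
  show eq: "?I = ennreal (gibbs_Z N (\<lambda>_ :: 'd site. 0))"
    unfolding gibbs_Z_def
    using gibbs_weight_pos[of N "\<lambda>_ :: 'd site. 0"] by (intro nn_integral_eq_integral int) (auto simp: less_imp_le)
  have "?I \<noteq> 0"
  proof
    assume "?I = 0"
    then have "AE \<phi> in (field_space N :: ('d site \<Rightarrow> real) measure). False"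
      using gibbs_weight_pos[of N "\<lambda>_ :: 'd site. 0"]
      by (subst (asm) nn_integral_0_iff_AE) (auto simp: ennreal_eq_0_iff not_le)
    then have "emeasure (field_space N :: ('d site \<Rightarrow> real) measure) (space (field_space N)) = 0"
      by (simp add: AE_iff_measurable[OF sets.top])
    moreover have "emeasure (field_space N :: ('d site \<Rightarrow> real) measure) (Pi\<^sub>E (lattice_box N) (\<lambda>_. UNIV)) =
       (\<Prod>x\<in>(lattice_box N :: 'd site set). emeasure lborel (UNIV :: real set))"
      by (intro lborel_product.emeasure_PiM) auto
    ultimately show False by (simp add: space_PiM)
  qed
  then show "gibbs_Z N (\<lambda>_ :: 'd site. 0) > 0"
    unfolding eq by (simp add: ennreal_eq_0_iff not_le)
qed

lemma nn_integral_weight_total: "(\<integral>\<^sup>+\<phi>. gibbs_weight N h \<phi> \<partial>field_space N) =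
  ennreal (exp ((\<Sum>x\<in>lattice_box N. h x * mean_field N h (x :: 'd site)) / 2) * gibbs_Z N (\<lambda>_ :: 'd site. 0))"
  using nn_integral_weight[of "\<lambda>_. 1" N h] nn_integral_gibbs_Z_0[of N] gibbs_Z_0_pos[of N]
  by (simp add: ennreal_mult)

lemma gibbs_Z_eq:
  "gibbs_Z N h = exp ((\<Sum>x\<in>lattice_box N. h x * mean_field N h (x :: 'd site)) / 2) * gibbs_Z N (\<lambda>_ :: 'd site. 0)"
proof -
  have "gibbs_Z N h = enn2real (\<integral>\<^sup>+\<phi>. gibbs_weight N h \<phi> \<partial>field_space N)"
    unfolding gibbs_Z_def
    by (rule integral_eq_nn_integral) (auto simp: less_imp_le gibbs_weight_pos)
  then show ?thesis
    using gibbs_Z_0_pos[of N] by (simp only: nn_integral_weight_total) (simp add: less_imp_le)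
qed

lemma nn_integral_gibbs:
  assumes [measurable]: "F \<in> borel_measurable (field_space N)"
  shows "(\<integral>\<^sup>+\<phi>. F \<phi> \<partial>gibbs N h) = (\<integral>\<^sup>+\<phi>. ennreal (gibbs_weight N h \<phi>) * F \<phi> \<partial>field_space N) / ennreal (gibbs_Z N (h :: 'd site \<Rightarrow> real))"
proof -
  have Z: "gibbs_Z N h > 0" using gibbs_Z_0_pos[of N] by (subst gibbs_Z_eq) simp
  have "(\<integral>\<^sup>+\<phi>. F \<phi> \<partial>gibbs N h) = (\<integral>\<^sup>+\<phi>. ennreal (1 / gibbs_Z N h * gibbs_weight N h \<phi>) * F \<phi> \<partial>field_space N)"
    unfolding gibbs_def by (intro nn_integral_density) auto
  also have "\<dots> = (\<integral>\<^sup>+\<phi>. ennreal (1 / gibbs_Z N h) * (ennreal (gibbs_weight N h \<phi>) * F \<phi>) \<partial>field_space N)"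
  proof -
    have "0 \<le> 1 / gibbs_Z N h" using Z by simp
    then show ?thesis by (simp only: ennreal_mult' mult.assoc)
  qed
  also have "\<dots> = ennreal (1 / gibbs_Z N h) * (\<integral>\<^sup>+\<phi>. ennreal (gibbs_weight N h \<phi>) * F \<phi> \<partial>field_space N)"
    by (intro nn_integral_cmult) measurable
  also have "ennreal (1 / gibbs_Z N h) = inverse (ennreal (gibbs_Z N h))"
    using Z by (simp add: inverse_ennreal inverse_eq_divide)
  finally show ?thesis by (simp add: divide_ennreal_def mult.commute)
qed

text \<open>
  The external field only moves the centre of the Gaussian measure.
\<close>

lemma nn_integral_gibbs_shift:
  assumes [measurable]: "F \<in> borel_measurable (field_space N)"
  shows "(\<integral>\<^sup>+\<phi>. F \<phi> \<partial>gibbs N h) =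
    (\<integral>\<^sup>+\<phi>. F (shift_field N (mean_field N h) \<phi>) \<partial>gibbs N (\<lambda>_ :: 'd site. 0))"
proof -
  define a where "a = exp ((\<Sum>x\<in>lattice_box N. h x * mean_field N h x) / 2)"
  have a: "a > 0" by (simp add: a_def)
  define J where "J = (\<integral>\<^sup>+\<phi>. ennreal (gibbs_weight N (\<lambda>_ :: 'd site. 0) \<phi>) * F (shift_field N (mean_field N h) \<phi>) \<partial>field_space N)"
  have "(\<integral>\<^sup>+\<phi>. F \<phi> \<partial>gibbs N h) = (ennreal a * J) / (ennreal a * ennreal (gibbs_Z N (\<lambda>_ :: 'd site. 0)))"
    using a unfolding nn_integral_gibbs[OF assms] nn_integral_weight[OF assms] gibbs_Z_eq[of N h] J_def
    by (simp add: a_def ennreal_mult')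
  also have "\<dots> = J / ennreal (gibbs_Z N (\<lambda>_ :: 'd site. 0))"
    using a divide_mult_eq[of "ennreal a" J "ennreal (gibbs_Z N (\<lambda>_ :: 'd site. 0))"]
    by (simp add: mult.commute)
  also have "\<dots> = (\<integral>\<^sup>+\<phi>. F (shift_field N (mean_field N h) \<phi>) \<partial>gibbs N (\<lambda>_ :: 'd site. 0))"
    unfolding J_def by (rule nn_integral_gibbs[symmetric]) measurable
  finally show ?thesis .
qed

lemma prob_space_gibbs: "prob_space (gibbs N (h :: 'd site \<Rightarrow> real))"
proof
  have "emeasure (gibbs N h) (space (gibbs N h)) = (\<integral>\<^sup>+\<phi>. 1 \<partial>gibbs N h)" by simp
  also have "\<dots> = (\<integral>\<^sup>+\<phi>. 1 \<partial>gibbs N (\<lambda>_ :: 'd site. 0))"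
    by (rule nn_integral_gibbs_shift) simp
  also have "\<dots> = ennreal (gibbs_Z N (\<lambda>_ :: 'd site. 0)) / ennreal (gibbs_Z N (\<lambda>_ :: 'd site. 0))"
    by (subst nn_integral_gibbs) (simp_all add: nn_integral_gibbs_Z_0)
  also have "\<dots> = 1" using gibbs_Z_0_pos[of N] by (simp add: ennreal_divide_self)
  finally show "emeasure (gibbs N h) (space (gibbs N h)) = 1" .
qed

text \<open>
  The exponential moment at \<open>l\<close> is the ratio of the partition functions with fields \<open>l\<close> and 0.
\<close>

lemma gibbs_0_mgf:
  "(\<integral>\<^sup>+\<phi>. ennreal (exp (\<Sum>x\<in>lattice_box N. l x * \<phi> x)) \<partial>gibbs N (\<lambda>_ :: 'd site. 0)) =
     ennreal (exp ((\<Sum>x\<in>lattice_box N. \<Sum>y\<in>lattice_box N. l x * l y * box_green N x y) / 2))"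
proof -
  have "(\<integral>\<^sup>+\<phi>. ennreal (exp (\<Sum>x\<in>lattice_box N. l x * \<phi> x)) \<partial>gibbs N (\<lambda>_ :: 'd site. 0)) =
     (\<integral>\<^sup>+\<phi>. ennreal (gibbs_weight N (\<lambda>_ :: 'd site. 0) \<phi>) * ennreal (exp (\<Sum>x\<in>lattice_box N. l x * \<phi> x)) \<partial>field_space N) / ennreal (gibbs_Z N (\<lambda>_ :: 'd site. 0))"
    by (rule nn_integral_gibbs) measurable
  also have "(\<integral>\<^sup>+\<phi>. ennreal (gibbs_weight N (\<lambda>_ :: 'd site. 0) \<phi>) * ennreal (exp (\<Sum>x\<in>lattice_box N. l x * \<phi> x)) \<partial>field_space N) =
     (\<integral>\<^sup>+\<phi>. ennreal (gibbs_weight N l \<phi>) \<partial>field_space N)"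
    by (simp add: gibbs_weight_eq flip: ennreal_mult' exp_add)
  also have "\<dots> / ennreal (gibbs_Z N (\<lambda>_ :: 'd site. 0)) = ennreal (exp ((\<Sum>x\<in>lattice_box N. l x * mean_field N l (x :: 'd site)) / 2))"
    unfolding nn_integral_weight_total
    using gibbs_Z_0_pos[of N] by (subst divide_ennreal) auto
  also have "(\<Sum>x\<in>lattice_box N. l x * mean_field N l x) = (\<Sum>x\<in>lattice_box N. \<Sum>y\<in>lattice_box N. l x * l y * box_green N x y)"
    by (simp add: mean_field_def sum_distrib_left mult_ac)
  finally show ?thesis .
qed

end

section \<open>The maximum of the field under the Gibbs measure\<close>

lemma nonneg_integral_le:
  fixes f :: "'a \<Rightarrow> real"
  assumes "f \<in> borel_measurable M" "\<And>x. f x \<ge> 0" "(\<integral>\<^sup>+x. ennreal (f x) \<partial>M) \<le> ennreal c" "c \<ge> 0"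
  shows "integrable M f" "(\<integral>x. f x \<partial>M) \<le> c"
proof -
  show i: "integrable M f"
    using assms by (intro integrableI_nonneg) (auto intro: le_less_trans)
  have "ennreal (\<integral>x. f x \<partial>M) \<le> ennreal c"
    using nn_integral_eq_integral[OF i] assms by simp
  then show "(\<integral>x. f x \<partial>M) \<le> c" using assms by simp
qed

text \<open>
  The exponential weights \<open>T x\<close> have mean one.  Their sum over \<open>A\<close> would concentrate around
  \<open>card A\<close> by a second moment estimate if \<open>l\<^sup>2 * G\<close> were below \<open>ln (card A)\<close>; this loses a factor
  \<open>sqrt 2\<close> in \<open>l\<close>.  Under the measure tilted by \<open>T x\<close> the variable \<open>X x\<close> is close to
  \<open>l * v x\<close>, so restricting \<open>T x\<close> to \<open>X x \<le> l * v x + D\<close> (the variable \<open>U x\<close>) changes the mean little,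
  while it halves the exponent of the second moment.  The part of \<open>T x\<close> with
  \<open>X x < l * v x - D\<close> (the variable \<open>V x\<close>) is negligible as well, so that some \<open>X x\<close> must lie
  above \<open>l * v x - D\<close>.  The constant \<open>b\<close> bounds the covariances.
\<close>

lemma (in prob_space) weakly_correlated_max:
  fixes X :: "'i \<Rightarrow> 'a \<Rightarrow> real"
  assumes A: "finite A" "A \<noteq> {}"
    and X [measurable]: "\<And>x. x \<in> A \<Longrightarrow> X x \<in> borel_measurable M"
    and mgf: "\<And>x a. x \<in> A \<Longrightarrow> (\<integral>\<^sup>+\<omega>. ennreal (exp (a * X x \<omega>)) \<partial>M) = ennreal (exp (a\<^sup>2 * v x / 2))"
    and mgf2: "\<And>x y. x \<in> A \<Longrightarrow> y \<in> A \<Longrightarrow> x \<noteq> y \<Longrightarrow>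
      (\<integral>\<^sup>+\<omega>. ennreal (exp (l * X x \<omega> + l * X y \<omega>)) \<partial>M) \<le> ennreal (exp (l\<^sup>2 * (v x + v y) / 2 + l\<^sup>2 * b))"
    and v: "\<And>x. x \<in> A \<Longrightarrow> 0 < v x" "\<And>x. x \<in> A \<Longrightarrow> v x \<le> G"
    and l: "l \<ge> 0" and D: "D > 0"
  defines "r \<equiv> exp (- D\<^sup>2 / (2 * G))"
  shows "measure M {\<omega> \<in> space M. \<exists>x\<in>A. X x \<omega> \<ge> l * v x - D} \<ge>
    1 - 4 * (exp (l\<^sup>2 * G / 2 + l * D) / card A + exp (l\<^sup>2 * b) - 1 + 2 * r) - 2 * r"
proof -
  define n where "n = real (card A)"
  have n: "n > 0" using A by (simp add: n_def card_gt_0_iff)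
  define T where "T x \<omega> = exp (l * X x \<omega> - l\<^sup>2 * v x / 2)" for x \<omega>
  define U where "U x \<omega> = (if X x \<omega> \<le> l * v x + D then T x \<omega> else 0)" for x \<omega>
  define W where "W x \<omega> = (if X x \<omega> \<le> l * v x + D then 0 else T x \<omega>)" for x \<omega>
  define V where "V x \<omega> = (if X x \<omega> < l * v x - D then T x \<omega> else 0)" for x \<omega>
  have [measurable]: "T x \<in> borel_measurable M" "U x \<in> borel_measurable M" "V x \<in> borel_measurable M" "W x \<in> borel_measurable M" if "x \<in> A" for x
    using that unfolding T_def U_def V_def W_def by measurable
  have nonneg: "T x \<omega> \<ge> 0" "U x \<omega> \<ge> 0" "V x \<omega> \<ge> 0" "W x \<omega> \<ge> 0" for x \<omega>
    by (auto simp: T_def U_def V_def W_def)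
  have expl: "(\<integral>\<^sup>+\<omega>. ennreal (exp (a * X x \<omega> + c)) \<partial>M) = ennreal (exp (a\<^sup>2 * v x / 2 + c))" if x: "x \<in> A" for x a c
  proof -
    have "(\<integral>\<^sup>+\<omega>. ennreal (exp (a * X x \<omega> + c)) \<partial>M) = (\<integral>\<^sup>+\<omega>. ennreal (exp c) * ennreal (exp (a * X x \<omega>)) \<partial>M)"
      by (simp add: exp_add mult.commute flip: ennreal_mult')
    also have "\<dots> = ennreal (exp c) * (\<integral>\<^sup>+\<omega>. ennreal (exp (a * X x \<omega>)) \<partial>M)"
      using x by (intro nn_integral_cmult) measurable
    finally show ?thesis unfolding mgf[OF x] by (simp add: exp_add mult.commute flip: ennreal_mult')
  qed
  have rv: "exp (- D\<^sup>2 / (2 * v x)) \<le> r" if "x \<in> A" for x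
    unfolding r_def using v[OF that] by (simp add: frac_le)
  have rnn: "r \<ge> 0" by (simp add: r_def)
  have T1: "integrable M (T x)" "(\<integral>\<omega>. T x \<omega> \<partial>M) = 1" if x: "x \<in> A" for x
  proof -
    have e: "(\<integral>\<^sup>+\<omega>. ennreal (T x \<omega>) \<partial>M) = ennreal 1"
      using expl[OF x, of l "- (l\<^sup>2 * v x / 2)"] by (simp add: T_def)
    show "integrable M (T x)" using x e by (intro nonneg_integral_le(1)[of _ _ 1] nonneg) auto
    show "(\<integral>\<omega>. T x \<omega> \<partial>M) = 1"
      using x e by (subst integral_eq_nn_integral) (auto simp: nonneg)
  qed
  have V1: "integrable M (V x)" "(\<integral>\<omega>. V x \<omega> \<partial>M) \<le> r" if x: "x \<in> A" for x
  proof -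
    \<comment> \<open>The additional tilt \<open>s\<close> is the optimal one in Chebyshev's inequality.\<close>
    define s where "s = D / v x"
    have vx: "v x > 0" using v x by blast
    have "(\<integral>\<^sup>+\<omega>. ennreal (V x \<omega>) \<partial>M) \<le> (\<integral>\<^sup>+\<omega>. ennreal (exp ((l - s) * X x \<omega> + (s * (l * v x - D) - l\<^sup>2 * v x / 2))) \<partial>M)"
    proof (intro nn_integral_mono ennreal_leI)
      fix \<omega>
      have "s * (l * v x - D - X x \<omega>) \<ge> 0" if "X x \<omega> < l * v x - D"
        using that D vx by (simp add: s_def)
      then show "V x \<omega> \<le> exp ((l - s) * X x \<omega> + (s * (l * v x - D) - l\<^sup>2 * v x / 2))"
        by (auto simp: V_def T_def algebra_simps)
    qed
    also have "\<dots> = ennreal (exp ((l - s)\<^sup>2 * v x / 2 + (s * (l * v x - D) - l\<^sup>2 * v x / 2)))"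
      by (rule expl[OF x])
    also have "(l - s)\<^sup>2 * v x / 2 + (s * (l * v x - D) - l\<^sup>2 * v x / 2) = - D\<^sup>2 / (2 * v x)"
      using vx by (simp add: s_def power2_eq_square field_simps)
    also have "ennreal (exp (- D\<^sup>2 / (2 * v x))) \<le> ennreal r" using rv[OF x] by (rule ennreal_leI)
    finally have "(\<integral>\<^sup>+\<omega>. ennreal (V x \<omega>) \<partial>M) \<le> ennreal r" .
    then show "integrable M (V x)" "(\<integral>\<omega>. V x \<omega> \<partial>M) \<le> r"
      using x by (auto intro!: nonneg_integral_le[of _ _ r] nonneg rnn)
  qed
  have W1: "integrable M (W x)" "(\<integral>\<omega>. W x \<omega> \<partial>M) \<le> r" if x: "x \<in> A" for x
  proof -
    define s where "s = D / v x"
    have vx: "v x > 0" using v x by blast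
    have "(\<integral>\<^sup>+\<omega>. ennreal (W x \<omega>) \<partial>M) \<le> (\<integral>\<^sup>+\<omega>. ennreal (exp ((l + s) * X x \<omega> + (- s * (l * v x + D) - l\<^sup>2 * v x / 2))) \<partial>M)"
    proof (intro nn_integral_mono ennreal_leI)
      fix \<omega>
      have "s * (X x \<omega> - (l * v x + D)) \<ge> 0" if "\<not> X x \<omega> \<le> l * v x + D"
        using that D vx by (simp add: s_def)
      then show "W x \<omega> \<le> exp ((l + s) * X x \<omega> + (- s * (l * v x + D) - l\<^sup>2 * v x / 2))"
        by (auto simp: W_def T_def algebra_simps)
    qed
    also have "\<dots> = ennreal (exp ((l + s)\<^sup>2 * v x / 2 + (- s * (l * v x + D) - l\<^sup>2 * v x / 2)))"
      by (rule expl[OF x])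
    also have "(l + s)\<^sup>2 * v x / 2 + (- s * (l * v x + D) - l\<^sup>2 * v x / 2) = - D\<^sup>2 / (2 * v x)"
      using vx by (simp add: s_def power2_eq_square field_simps)
    also have "ennreal (exp (- D\<^sup>2 / (2 * v x))) \<le> ennreal r" using rv[OF x] by (rule ennreal_leI)
    finally have "(\<integral>\<^sup>+\<omega>. ennreal (W x \<omega>) \<partial>M) \<le> ennreal r" .
    then show "integrable M (W x)" "(\<integral>\<omega>. W x \<omega> \<partial>M) \<le> r"
      using x by (auto intro!: nonneg_integral_le[of _ _ r] nonneg rnn)
  qed
  have UTW: "U x = (\<lambda>\<omega>. T x \<omega> - W x \<omega>)" for x by (auto simp: U_def W_def)
  have U1: "integrable M (U x)" "(\<integral>\<omega>. U x \<omega> \<partial>M) \<ge> 1 - r" if x: "x \<in> A" for x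
    using T1[OF x] W1[OF x] unfolding UTW by auto
  define e1 where "e1 = exp (l\<^sup>2 * G / 2 + l * D)"
  have e1nn: "e1 \<ge> 0" by (simp add: e1_def)
  have U2: "integrable M (\<lambda>\<omega>. U x \<omega> * U x \<omega>)" "(\<integral>\<omega>. U x \<omega> * U x \<omega> \<partial>M) \<le> e1" if x: "x \<in> A" for x
  proof -
    have "(\<integral>\<^sup>+\<omega>. ennreal (U x \<omega> * U x \<omega>) \<partial>M) \<le> (\<integral>\<^sup>+\<omega>. ennreal (exp (l * X x \<omega> + l * D)) \<partial>M)"
    proof (intro nn_integral_mono ennreal_leI)
      fix \<omega>
      \<comment> \<open>On the event \<open>X x \<le> l * v x + D\<close> half of the exponent \<open>2 * l * X x\<close> is bounded by a constant.\<close>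
      have "l * (l * v x + D - X x \<omega>) \<ge> 0" if "X x \<omega> \<le> l * v x + D"
        using that l by simp
      then show "U x \<omega> * U x \<omega> \<le> exp (l * X x \<omega> + l * D)"
        by (auto simp: U_def T_def algebra_simps power2_eq_square simp flip: exp_add)
    qed
    also have "\<dots> = ennreal (exp (l\<^sup>2 * v x / 2 + l * D))" by (rule expl[OF x])
    also have "\<dots> \<le> ennreal e1"
      using v(2)[OF x] by (auto intro!: ennreal_leI mult_left_mono simp: e1_def)
    finally have "(\<integral>\<^sup>+\<omega>. ennreal (U x \<omega> * U x \<omega>) \<partial>M) \<le> ennreal e1" .
    then show "integrable M (\<lambda>\<omega>. U x \<omega> * U x \<omega>)" "(\<integral>\<omega>. U x \<omega> * U x \<omega> \<partial>M) \<le> e1"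
      using x by (auto intro!: nonneg_integral_le[of _ _ e1] nonneg mult_nonneg_nonneg e1nn)
  qed
  define e2 where "e2 = exp (l\<^sup>2 * b)"
  have e2nn: "e2 \<ge> 0" by (simp add: e2_def)
  have UU: "integrable M (\<lambda>\<omega>. U x \<omega> * U y \<omega>)" "(\<integral>\<omega>. U x \<omega> * U y \<omega> \<partial>M) \<le> e2"
    if x: "x \<in> A" and y: "y \<in> A" and xy: "x \<noteq> y" for x y
  proof -
    define c where "c = - (l\<^sup>2 * (v x + v y) / 2)"
    have "(\<integral>\<^sup>+\<omega>. ennreal (U x \<omega> * U y \<omega>) \<partial>M) \<le> (\<integral>\<^sup>+\<omega>. ennreal (exp c) * ennreal (exp (l * X x \<omega> + l * X y \<omega>)) \<partial>M)"
    proof (intro nn_integral_mono)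
      fix \<omega>
      have "U x \<omega> * U y \<omega> \<le> T x \<omega> * T y \<omega>"
        by (intro mult_mono nonneg) (auto simp: U_def nonneg)
      also have "\<dots> = exp c * exp (l * X x \<omega> + l * X y \<omega>)"
        by (simp add: T_def c_def field_simps flip: exp_add)
      finally show "ennreal (U x \<omega> * U y \<omega>) \<le> ennreal (exp c) * ennreal (exp (l * X x \<omega> + l * X y \<omega>))"
        by (simp add: ennreal_leI flip: ennreal_mult')
    qed
    also have "\<dots> = ennreal (exp c) * (\<integral>\<^sup>+\<omega>. ennreal (exp (l * X x \<omega> + l * X y \<omega>)) \<partial>M)"
      using x y by (intro nn_integral_cmult) measurable
    also have "\<dots> \<le> ennreal (exp c) * ennreal (exp (l\<^sup>2 * (v x + v y) / 2 + l\<^sup>2 * b))"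
      by (intro mult_left_mono mgf2 x y xy) auto
    also have "\<dots> = ennreal e2"
      by (simp add: e2_def c_def flip: ennreal_mult' exp_add)
    finally have "(\<integral>\<^sup>+\<omega>. ennreal (U x \<omega> * U y \<omega>) \<partial>M) \<le> ennreal e2" .
    then show "integrable M (\<lambda>\<omega>. U x \<omega> * U y \<omega>)" "(\<integral>\<omega>. U x \<omega> * U y \<omega> \<partial>M) \<le> e2"
      using x y by (auto intro!: nonneg_integral_le[of _ _ e2] nonneg mult_nonneg_nonneg e2nn)
  qed
  have UUi: "integrable M (\<lambda>\<omega>. U x \<omega> * U y \<omega>)" if "x \<in> A" "y \<in> A" for x y
    using UU(1)[OF that] U2(1)[OF that(1)] by (cases "x = y") auto
  define S where "S \<omega> = (\<Sum>x\<in>A. U x \<omega>)" for \<omega>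
  have S[measurable]: "S \<in> borel_measurable M" unfolding S_def by measurable
  have S2: "S \<omega> * S \<omega> = (\<Sum>x\<in>A. \<Sum>y\<in>A. U x \<omega> * U y \<omega>)" for \<omega>
    by (simp add: S_def sum_product)
  have Si: "integrable M S" unfolding S_def by (intro Bochner_Integration.integrable_sum U1)
  have SSi: "integrable M (\<lambda>\<omega>. S \<omega> * S \<omega>)"
    unfolding S2 by (intro Bochner_Integration.integrable_sum UUi)
  have ES: "(\<integral>\<omega>. S \<omega> \<partial>M) \<ge> n * (1 - r)"
  proof -
    have "(\<integral>\<omega>. S \<omega> \<partial>M) = (\<Sum>x\<in>A. \<integral>\<omega>. U x \<omega> \<partial>M)"
      unfolding S_def by (intro Bochner_Integration.integral_sum U1)
    also have "\<dots> \<ge> (\<Sum>x\<in>A. 1 - r)" by (intro sum_mono U1)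
    finally show ?thesis by (simp add: n_def)
  qed
  have ESS: "(\<integral>\<omega>. S \<omega> * S \<omega> \<partial>M) \<le> n * e1 + n * n * e2"
  proof -
    have "(\<integral>\<omega>. S \<omega> * S \<omega> \<partial>M) = (\<Sum>x\<in>A. \<Sum>y\<in>A. \<integral>\<omega>. U x \<omega> * U y \<omega> \<partial>M)"
      unfolding S2 using UUi by (simp add: Bochner_Integration.integral_sum integrable_sum)
    also have "\<dots> \<le> (\<Sum>x\<in>A. \<Sum>y\<in>A. (if x = y then e1 else 0) + e2)"
    proof (intro sum_mono)
      fix x y assume "x \<in> A" "y \<in> A"
      then show "(\<integral>\<omega>. U x \<omega> * U y \<omega> \<partial>M) \<le> (if x = y then e1 else 0) + e2"
        using U2(2)[of x] UU(2)[of x y] e2nn by (cases "x = y") auto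
    qed
    also have "\<dots> = n * e1 + n * n * e2"
      using A by (simp add: n_def sum.distrib algebra_simps)
    finally show ?thesis .
  qed
  have p1: "measure M {\<omega> \<in> space M. S \<omega> \<le> n / 2} \<le> 4 * (e1 / n + e2 - 1 + 2 * r)"
  proof -
    have i: "integrable M (\<lambda>\<omega>. (S \<omega> - n)\<^sup>2)"
      unfolding power2_diff power2_eq_square[of "S _"] using Si SSi by auto
    have "(\<integral>\<omega>. (S \<omega> - n)\<^sup>2 \<partial>M) = (\<integral>\<omega>. S \<omega> * S \<omega> \<partial>M) + n\<^sup>2 - 2 * n * (\<integral>\<omega>. S \<omega> \<partial>M)"
      unfolding power2_diff power2_eq_square[of "S _"] using Si SSi by (simp add: prob_space mult_ac)
    also have "\<dots> \<le> (n * e1 + n * n * e2) + n\<^sup>2 - 2 * n * (n * (1 - r))"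
    proof -
      have "2 * n * (n * (1 - r)) \<le> 2 * n * (\<integral>\<omega>. S \<omega> \<partial>M)"
        using n by (intro mult_left_mono ES) auto
      then show ?thesis using ESS by linarith
    qed
    also have "\<dots> = n\<^sup>2 * (e1 / n + e2 - 1 + 2 * r)"
      using n by (simp add: field_simps power2_eq_square)
    finally have v1: "(\<integral>\<omega>. (S \<omega> - n)\<^sup>2 \<partial>M) \<le> n\<^sup>2 * (e1 / n + e2 - 1 + 2 * r)" .
    have "measure M {\<omega> \<in> space M. S \<omega> \<le> n / 2} \<le> measure M {\<omega> \<in> space M. (S \<omega> - n)\<^sup>2 \<ge> n\<^sup>2 / 4}"
    proof (rule finite_measure_mono)
      show "{\<omega> \<in> space M. S \<omega> \<le> n / 2} \<subseteq> {\<omega> \<in> space M. n\<^sup>2 / 4 \<le> (S \<omega> - n)\<^sup>2}"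
      proof clarsimp
        fix \<omega> assume "S \<omega> * 2 \<le> n"
        then have "(n / 2)\<^sup>2 \<le> (n - S \<omega>)\<^sup>2" using n by (intro power_mono) auto
        then show "n\<^sup>2 \<le> (S \<omega> - n)\<^sup>2 * 4" by (simp add: power_divide power2_commute field_simps)
      qed
    qed measurable
    also have "\<dots> \<le> (\<integral>\<omega>. (S \<omega> - n)\<^sup>2 \<partial>M) / (n\<^sup>2 / 4)"
      using n by (intro integral_Markov_inequality_measure[OF i, of "{}"]) auto
    also have "\<dots> \<le> (n\<^sup>2 * (e1 / n + e2 - 1 + 2 * r)) / (n\<^sup>2 / 4)"
      using v1 by (intro divide_right_mono) auto
    also have "\<dots> = 4 * (e1 / n + e2 - 1 + 2 * r)" using n by simp
    finally show ?thesis .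
  qed
  define R where "R \<omega> = (\<Sum>x\<in>A. V x \<omega>)" for \<omega>
  have R[measurable]: "R \<in> borel_measurable M" unfolding R_def by measurable
  have Ri: "integrable M R" unfolding R_def by (intro Bochner_Integration.integrable_sum V1)
  have p2: "measure M {\<omega> \<in> space M. n / 2 \<le> R \<omega>} \<le> 2 * r"
  proof -
    have "(\<integral>\<omega>. R \<omega> \<partial>M) = (\<Sum>x\<in>A. \<integral>\<omega>. V x \<omega> \<partial>M)"
      unfolding R_def by (intro Bochner_Integration.integral_sum V1)
    also have "\<dots> \<le> (\<Sum>x\<in>A. r)" by (intro sum_mono V1)
    also have "\<dots> = n * r" by (simp add: n_def)
    finally have 1: "(\<integral>\<omega>. R \<omega> \<partial>M) \<le> n * r" .
    have "measure M {\<omega> \<in> space M. n / 2 \<le> R \<omega>} \<le> (\<integral>\<omega>. R \<omega> \<partial>M) / (n / 2)"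
      using n by (intro integral_Markov_inequality_measure[OF Ri, of "{}"]) (auto simp: R_def intro!: sum_nonneg nonneg)
    also have "\<dots> \<le> (n * r) / (n / 2)" using 1 n by (intro divide_right_mono) auto
    also have "\<dots> = 2 * r" using n by simp
    finally show ?thesis .
  qed
  let ?E = "{\<omega> \<in> space M. \<exists>x\<in>A. X x \<omega> \<ge> l * v x - D}"
  have meas: "?E \<in> sets M" using A by measurable
  have "space M - ?E \<subseteq> {\<omega> \<in> space M. S \<omega> \<le> n / 2} \<union> {\<omega> \<in> space M. n / 2 \<le> R \<omega>}"
  proof
    fix \<omega> assume w: "\<omega> \<in> space M - ?E"
    have "U x \<omega> \<le> V x \<omega>" if "x \<in> A" for x
      using w that D by (auto simp: U_def V_def not_le)
    then have "S \<omega> \<le> R \<omega>" unfolding S_def R_def by (rule sum_mono)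
    then show "\<omega> \<in> {\<omega> \<in> space M. S \<omega> \<le> n / 2} \<union> {\<omega> \<in> space M. n / 2 \<le> R \<omega>}"
      using w by auto
  qed
  then have "measure M (space M - ?E) \<le> measure M ({\<omega> \<in> space M. S \<omega> \<le> n / 2} \<union> {\<omega> \<in> space M. n / 2 \<le> R \<omega>})"
    by (rule finite_measure_mono) measurable
  also have "\<dots> \<le> measure M {\<omega> \<in> space M. S \<omega> \<le> n / 2} + measure M {\<omega> \<in> space M. n / 2 \<le> R \<omega>}"
    by (rule measure_Un_le) measurable
  finally have "measure M (space M - ?E) \<le> 4 * (e1 / n + e2 - 1 + 2 * r) + 2 * r"
    using p1 p2 by simp
  moreover have "measure M (space M - ?E) = 1 - measure M ?E" by (rule prob_compl[OF meas])
  ultimately show ?thesis unfolding e1_def e2_def n_def by linarith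
qed

lemma MAX_ge_iff: "(MAX x\<in>lattice_box N. \<phi> x) \<ge> t \<longleftrightarrow> (\<exists>x\<in>lattice_box N. \<phi> x \<ge> (t :: real))"
  by (subst Max_ge_iff) auto

lemma MAX_le_iff: "(MAX x\<in>lattice_box N. \<phi> x) \<le> t \<longleftrightarrow> (\<forall>x\<in>lattice_box N. \<phi> x \<le> (t :: real))"
  by (subst Max_le_iff) auto

context
  assumes dim: "CARD('d::finite) \<ge> 5"
begin

lemma gibbs_measure_shift:
  assumes [measurable]: "Measurable.pred (field_space N) Q"
  shows "measure (gibbs N h) {\<phi> \<in> space (field_space N). Q \<phi>} =
    measure (gibbs N (\<lambda>_ :: 'd site. 0)) {\<phi> \<in> space (field_space N). Q (shift_field N (mean_field N h) \<phi>)}"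
proof -
  have m1: "{\<phi> \<in> space (field_space N). Q \<phi>} \<in> sets (field_space N)" by measurable
  have m2: "{\<phi> \<in> space (field_space N). Q (shift_field N (mean_field N h) \<phi>)} \<in> sets (field_space N)" by measurable
  have "emeasure (gibbs N h) {\<phi> \<in> space (field_space N). Q \<phi>} =
     (\<integral>\<^sup>+\<phi>. indicator {\<phi> \<in> space (field_space N). Q \<phi>} \<phi> \<partial>gibbs N h)" using m1 by simp
  also have "\<dots> = (\<integral>\<^sup>+\<phi>. indicator {\<phi> \<in> space (field_space N). Q \<phi>} (shift_field N (mean_field N h) \<phi>) \<partial>gibbs N (\<lambda>_ :: 'd site. 0))"
    using m1 by (intro nn_integral_gibbs_shift[OF dim]) simp
  also have "\<dots> = (\<integral>\<^sup>+\<phi>. indicator {\<phi> \<in> space (field_space N). Q (shift_field N (mean_field N h) \<phi>)} \<phi> \<partial>gibbs N (\<lambda>_ :: 'd site. 0))"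
    using measurable_space[OF shift_field_measurable, of _ N "mean_field N h"]
    by (intro nn_integral_cong) (auto simp: indicator_def)
  also have "\<dots> = emeasure (gibbs N (\<lambda>_ :: 'd site. 0)) {\<phi> \<in> space (field_space N). Q (shift_field N (mean_field N h) \<phi>)}"
    using m2 by simp
  finally show ?thesis by (simp add: measure_def)
qed

lemma gibbs_0_mgf_site:
  assumes x: "x \<in> lattice_box N"
  shows "(\<integral>\<^sup>+\<phi>. ennreal (exp (a * \<phi> x)) \<partial>gibbs N (\<lambda>_ :: 'd site. 0)) = ennreal (exp (a\<^sup>2 * box_green N x x / 2))"
proof -
  define l where "l z = (if z = x then a else 0)" for z
  have 1: "(\<Sum>z\<in>lattice_box N. l z * \<phi> z) = a * \<phi> x" for \<phi> :: "'d site \<Rightarrow> real"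
    using x by (simp add: l_def if_distrib[of "\<lambda>q. q * _"] cong: if_cong)
  have "(\<Sum>z\<in>lattice_box N. \<Sum>w\<in>lattice_box N. l z * l w * box_green N z w) =
      (\<Sum>z\<in>lattice_box N. l z * (\<Sum>w\<in>lattice_box N. l w * box_green N z w))"
    by (simp add: sum_distrib_left mult.assoc)
  also have "\<dots> = a * (a * box_green N x x)" by (simp only: 1)
  finally show ?thesis
    using gibbs_0_mgf[OF dim, of N l] by (simp add: 1 power2_eq_square mult.assoc)
qed

lemma gibbs_0_mgf_pair:
  assumes x: "x \<in> lattice_box N" "y \<in> lattice_box N" "x \<noteq> y"
  shows "(\<integral>\<^sup>+\<phi>. ennreal (exp (a * \<phi> x + a * \<phi> y)) \<partial>gibbs N (\<lambda>_ :: 'd site. 0)) =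
    ennreal (exp (a\<^sup>2 * (box_green N x x + box_green N y y) / 2 + a\<^sup>2 * (box_green N x y + box_green N y x) / 2))"
proof -
  define l where "l z = (if z = x then a else 0) + (if z = y then a else 0)" for z
  have 1: "(\<Sum>z\<in>lattice_box N. l z * \<phi> z) = a * \<phi> x + a * \<phi> y" for \<phi> :: "'d site \<Rightarrow> real"
    using x by (simp add: l_def distrib_right sum.distrib if_distrib[of "\<lambda>q. q * _"] cong: if_cong)
  have "(\<Sum>z\<in>lattice_box N. \<Sum>w\<in>lattice_box N. l z * l w * box_green N z w) =
      (\<Sum>z\<in>lattice_box N. l z * (\<Sum>w\<in>lattice_box N. l w * box_green N z w))"
    by (simp add: sum_distrib_left mult.assoc)
  also have "\<dots> = a * (a * box_green N x x + a * box_green N x y) + a * (a * box_green N y x + a * box_green N y y)"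
    by (simp only: 1)
  also have "\<dots> = 2 * (a\<^sup>2 * (box_green N x x + box_green N y y) / 2 + a\<^sup>2 * (box_green N x y + box_green N y x) / 2)"
    by (simp add: power2_eq_square field_simps)
  finally have 2: "(\<Sum>z\<in>lattice_box N. \<Sum>w\<in>lattice_box N. l z * l w * box_green N z w) / 2 =
     a\<^sup>2 * (box_green N x x + box_green N y y) / 2 + a\<^sup>2 * (box_green N x y + box_green N y x) / 2"
    by simp
  show ?thesis
    using gibbs_0_mgf[OF dim, of N l] unfolding 1 2 .
qed

text \<open>
  A union bound over the sites, with a parameter \<open>a x\<close> in Chebyshev's inequality that may depend on
  the site: later it is either constant or optimal for the given realisation of the disorder.
\<close>

lemma gibbs_max_le:
  fixes h :: "'d site \<Rightarrow> real"
  assumes a: "\<And>x. x \<in> lattice_box N \<Longrightarrow> a x \<ge> 0"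
  shows "measure (gibbs N h) {\<phi> \<in> space (field_space N). \<forall>x\<in>lattice_box N. \<phi> x \<le> t} \<ge>
    1 - (\<Sum>x\<in>lattice_box N. exp (a x * (mean_field N h x - t) + (a x)\<^sup>2 * Gstar TYPE('d) / 2))"
proof -
  interpret prob_space "gibbs N h" by (rule prob_space_gibbs[OF dim])
  let ?E = "\<lambda>x. {\<phi> \<in> space (field_space N). \<phi> x > t}"
  have one: "measure (gibbs N h) (?E x) \<le> exp (a x * (mean_field N h x - t) + (a x)\<^sup>2 * Gstar TYPE('d) / 2)"
    if x: "x \<in> lattice_box N" for x
  proof -
    let ?m = "mean_field N h x"
    have [measurable]: "(\<lambda>\<phi>. \<phi> x) \<in> borel_measurable (field_space N)"
      using measurable_component_singleton[of x "lattice_box N" "\<lambda>_. lborel"] x by simp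
    have "emeasure (gibbs N h) (?E x) = (\<integral>\<^sup>+\<phi>. indicator (?E x) \<phi> \<partial>gibbs N h)"
      by (subst nn_integral_indicator) auto
    also have "\<dots> \<le> (\<integral>\<^sup>+\<phi>. ennreal (exp (a x * (\<phi> x - t))) \<partial>gibbs N h)"
      using a[OF x] by (intro nn_integral_mono) (auto simp: indicator_def)
    also have "\<dots> = (\<integral>\<^sup>+\<phi>. ennreal (exp (a x * (shift_field N (mean_field N h) \<phi> x - t))) \<partial>gibbs N (\<lambda>_ :: 'd site. 0))"
      by (intro nn_integral_gibbs_shift[OF dim]) measurable
    also have "\<dots> = (\<integral>\<^sup>+\<phi>. ennreal (exp (a x * (?m - t))) * ennreal (exp (a x * \<phi> x)) \<partial>gibbs N (\<lambda>_ :: 'd site. 0))"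
      using x by (intro nn_integral_cong) (simp add: shift_field_def algebra_simps flip: ennreal_mult' exp_add)
    also have "\<dots> = ennreal (exp (a x * (?m - t))) * (\<integral>\<^sup>+\<phi>. ennreal (exp (a x * \<phi> x)) \<partial>gibbs N (\<lambda>_ :: 'd site. 0))"
      by (intro nn_integral_cmult) measurable
    also have "\<dots> = ennreal (exp (a x * (?m - t) + (a x)\<^sup>2 * box_green N x x / 2))"
      by (simp add: gibbs_0_mgf_site[OF x] flip: ennreal_mult' exp_add)
    also have "\<dots> \<le> ennreal (exp (a x * (?m - t) + (a x)\<^sup>2 * Gstar TYPE('d) / 2))"
      using box_green_le_Gstar[OF dim, of N x x] by (intro ennreal_leI) (simp add: mult_left_mono)
    finally show ?thesis by (simp add: emeasure_eq_measure)
  qed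
  have [measurable]: "(\<lambda>\<phi>. \<phi> x) \<in> borel_measurable (field_space N)" if "x \<in> lattice_box N" for x :: "'d site"
      using measurable_component_singleton[of x "lattice_box N" "\<lambda>_. lborel"] that by simp
  let ?F = "{\<phi> \<in> space (field_space N). \<forall>x\<in>lattice_box N. \<phi> x \<le> t}"
  have F: "?F \<in> sets (field_space N)" by measurable
  have eq: "space (gibbs N h) - ?F = (\<Union>x\<in>lattice_box N. ?E x)" by auto
  have "measure (gibbs N h) (space (gibbs N h) - ?F) \<le> (\<Sum>x\<in>lattice_box N. measure (gibbs N h) (?E x))"
    unfolding eq by (intro measure_UNION_le) auto
  also have "\<dots> \<le> (\<Sum>x\<in>lattice_box N. exp (a x * (mean_field N h x - t) + (a x)\<^sup>2 * Gstar TYPE('d) / 2))"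
    by (intro sum_mono one)
  finally show ?thesis
    using prob_compl[of ?F] F by simp
qed

text \<open>
  Here \<open>A\<close> is a set of distant sites at which the centre is high; \<open>l\<close> measures the height of the
  Gaussian fluctuation and \<open>D\<close> the tolerance.
\<close>

lemma gibbs_max_ge:
  fixes h :: "'d site \<Rightarrow> real"
  assumes A: "A \<subseteq> lattice_box N" "A \<noteq> {}" and l: "l \<ge> 0" and D: "D > 0"
    and b: "\<And>x y. x \<in> A \<Longrightarrow> y \<in> A \<Longrightarrow> x \<noteq> y \<Longrightarrow> green 0 (y - x) \<le> b"
    and t: "\<And>x. x \<in> A \<Longrightarrow> t \<le> mean_field N h x + (l * box_green N x x - D)"
  defines "r \<equiv> exp (- D\<^sup>2 / (2 * Gstar TYPE('d)))"
  shows "measure (gibbs N h) {\<phi> \<in> space (field_space N). \<exists>x\<in>lattice_box N. \<phi> x \<ge> t} \<ge>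
    1 - 4 * (exp (l\<^sup>2 * Gstar TYPE('d) / 2 + l * D) / card A + exp (l\<^sup>2 * b) - 1 + 2 * r) - 2 * r"
proof -
  interpret prob_space "gibbs N (\<lambda>_ :: 'd site. 0)" by (rule prob_space_gibbs[OF dim])
  have [measurable]: "(\<lambda>\<phi>. \<phi> x) \<in> borel_measurable (field_space N)" if "x \<in> lattice_box N" for x :: "'d site"
      using measurable_component_singleton[of x "lattice_box N" "\<lambda>_. lborel"] that by simp
  have fA: "finite A" using A by (meson finite_lattice_box finite_subset)
  let ?E = "{\<phi> \<in> space (gibbs N (\<lambda>_ :: 'd site. 0)). \<exists>x\<in>A. \<phi> x \<ge> l * box_green N x x - D}"
  have "1 - 4 * (exp (l\<^sup>2 * Gstar TYPE('d) / 2 + l * D) / card A + exp (l\<^sup>2 * b) - 1 + 2 * r) - 2 * r \<le>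
     measure (gibbs N (\<lambda>_ :: 'd site. 0)) ?E"
    unfolding r_def
  proof (rule weakly_correlated_max)
    fix x assume x: "x \<in> A"
    then have xB: "x \<in> lattice_box N" using A by blast
    show "(\<lambda>\<phi>. \<phi> x) \<in> borel_measurable (gibbs N (\<lambda>_ :: 'd site. 0))" using xB by measurable
    show "(\<integral>\<^sup>+\<phi>. ennreal (exp (a * \<phi> x)) \<partial>gibbs N (\<lambda>_ :: 'd site. 0)) = ennreal (exp (a\<^sup>2 * box_green N x x / 2))" for a
      by (rule gibbs_0_mgf_site[OF xB])
    show "0 < box_green N x x" using box_green_ge_1[OF dim xB] by simp
    show "box_green N x x \<le> Gstar TYPE('d)" by (rule box_green_le_Gstar[OF dim])
  next
    fix x y assume xy: "x \<in> A" "y \<in> A" "x \<noteq> y"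
    then have B: "x \<in> lattice_box N" "y \<in> lattice_box N" using A by auto
    have "box_green N x y \<le> b" using box_green_le_green[OF dim, of N x y] b[of x y] xy by simp
    moreover have "box_green N y x \<le> b" using box_green_le_green[OF dim, of N y x] b[of y x] xy by simp
    ultimately have "l\<^sup>2 * (box_green N x y + box_green N y x) / 2 \<le> l\<^sup>2 * b"
      using mult_left_mono[of "box_green N x y + box_green N y x" "2 * b" "l\<^sup>2"] by simp
    then show "(\<integral>\<^sup>+\<phi>. ennreal (exp (l * \<phi> x + l * \<phi> y)) \<partial>gibbs N (\<lambda>_ :: 'd site. 0)) \<le>
      ennreal (exp (l\<^sup>2 * (box_green N x x + box_green N y y) / 2 + l\<^sup>2 * b))"
      unfolding gibbs_0_mgf_pair[OF B xy(3)] by (intro ennreal_leI) simp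
  qed (use A fA l D in auto)
  also have "\<dots> \<le> measure (gibbs N (\<lambda>_ :: 'd site. 0)) {\<phi> \<in> space (field_space N). \<exists>x\<in>lattice_box N. shift_field N (mean_field N h) \<phi> x \<ge> t}"
  proof (rule finite_measure_mono)
    have "\<exists>x\<in>lattice_box N. shift_field N (mean_field N h) \<phi> x \<ge> t"
      if "x \<in> A" "\<phi> x \<ge> l * box_green N x x - D" for x \<phi>
      using that A t[of x] by (intro bexI[of _ x]) (auto simp: shift_field_def)
    then show "?E \<subseteq> {\<phi> \<in> space (field_space N). \<exists>x\<in>lattice_box N. shift_field N (mean_field N h) \<phi> x \<ge> t}"
      by auto
    show "{\<phi> \<in> space (field_space N). \<exists>x\<in>lattice_box N. shift_field N (mean_field N h) \<phi> x \<ge> t} \<in> events"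
      by simp
  qed
  also have "\<dots> = measure (gibbs N h) {\<phi> \<in> space (field_space N). \<exists>x\<in>lattice_box N. \<phi> x \<ge> t}"
    by (rule gibbs_measure_shift[symmetric]) measurable
  finally show ?thesis .
qed

end

section \<open>Exponential moments of the disorder\<close>

text \<open>
  \<open>tail_rate_above T c\<close> means that the tail of type \<open>T\<close> is lighter than \<open>exp (- c * r\<^bsup>\<alpha>\<^esup>)\<close>.  A light
  tail is lighter than every Gaussian one, so that its upper bounds become the limit
  \<open>c \<longlongrightarrow> \<infinity>\<close> of the case \<open>\<alpha> = 2\<close>.
\<close>

fun tail_rate_above :: "tail_type \<Rightarrow> real \<Rightarrow> bool" where
  "tail_rate_above (TailA \<alpha> c) c' \<longleftrightarrow> c' < c"
| "tail_rate_above TailLight c' \<longleftrightarrow> True"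

lemma tail_exponent_bounds: "has_tail M X T \<Longrightarrow> 0 < tail_exponent T \<and> tail_exponent T \<le> 2"
  by (cases T) auto

lemma tail_upper_bound:
  assumes tail: "has_tail M X T" and c': "tail_rate_above T c'"
  shows "\<forall>\<^sub>F r in at_top. measure M {\<omega> \<in> space M. X \<omega> \<ge> r} \<le> exp (- c' * r powr tail_exponent T)"
proof -
  let ?p = "\<lambda>r. measure M {\<omega> \<in> space M. X \<omega> \<ge> r}"
  have ev: "\<forall>\<^sub>F r in at_top. ereal (1 / r powr tail_exponent T) * elog (?p r) < ereal (- c')"
  proof (cases T)
    case (TailA \<alpha> c)
    then have t: "((\<lambda>r. ereal (1 / r powr \<alpha>) * elog (?p r)) \<longlongrightarrow> - ereal c) at_top"
      and e: "tail_exponent T = \<alpha>" and lt: "- ereal c < ereal (- c')"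
      using tail c' by auto
    show ?thesis unfolding e by (rule order_tendstoD(2)[OF t lt])
  next
    case TailLight
    then have t: "((\<lambda>r. ereal (1 / r\<^sup>2) * elog (?p r)) \<longlongrightarrow> - \<infinity>) at_top"
      using tail by simp
    have "\<forall>\<^sub>F r in at_top. ereal (1 / r\<^sup>2) * elog (?p r) < ereal (- c')"
      using t by (rule order_tendstoD(2)) simp
    then show ?thesis
      using eventually_gt_at_top[of 0] by eventually_elim (simp add: TailLight)
  qed
  show ?thesis
    using ev eventually_gt_at_top[of 0]
  proof eventually_elim
    case (elim r)
    show ?case
    proof (cases "?p r = 0")
      case False
      then have p: "?p r > 0" by (simp add: zero_less_measure_iff)
      have "1 / r powr tail_exponent T * ln (?p r) < - c'"
        using elim False by (simp add: elog_def)
      then have "ln (?p r) < - c' * r powr tail_exponent T"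
        using elim(2) by (simp add: field_simps)
      then show ?thesis using p by (metis exp_less_mono exp_ln less_imp_le)
    qed simp
  qed
qed

lemma tail_lower_bound:
  assumes tail: "has_tail M X (TailA \<alpha> c)" and c': "c < c'"
  shows "\<forall>\<^sub>F r in at_top. measure M {\<omega> \<in> space M. X \<omega> \<ge> r} \<ge> exp (- c' * r powr \<alpha>)"
proof -
  let ?p = "\<lambda>r. measure M {\<omega> \<in> space M. X \<omega> \<ge> r}"
  have t: "((\<lambda>r. ereal (1 / r powr \<alpha>) * elog (?p r)) \<longlongrightarrow> - ereal c) at_top"
    using tail by simp
  have "\<forall>\<^sub>F r in at_top. ereal (- c') < ereal (1 / r powr \<alpha>) * elog (?p r)"
    using t by (rule order_tendstoD(1)) (use c' in simp)
  then show ?thesis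
    using eventually_gt_at_top[of 0]
  proof eventually_elim
    case (elim r)
    have p0: "?p r \<noteq> 0" using elim by (auto simp: elog_def)
    then have p: "?p r > 0" by (simp add: zero_less_measure_iff)
    have "- c' < 1 / r powr \<alpha> * ln (?p r)"
      using elim p0 by (simp add: elog_def)
    then have "- c' * r powr \<alpha> < ln (?p r)"
      using elim(2) by (simp add: field_simps)
    then show ?case using p by (metis exp_less_mono exp_ln less_imp_le)
  qed
qed

text \<open>
  Compare \<open>exp (a * Y)\<close> with \<open>exp (a * (n + 1))\<close> on the event \<open>n \<le> Y\<close> and sum over \<open>n\<close>.
\<close>

lemma (in prob_space) exp_moment_finite:
  assumes Y [measurable]: "Y \<in> borel_measurable M" and nn: "\<And>\<omega>. Y \<omega> \<ge> 0"
    and tail: "\<forall>\<^sub>F s in at_top. prob {\<omega> \<in> space M. Y \<omega> \<ge> s} \<le> K * exp (- b * s)"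
    and a: "0 \<le> a" "a < b"
  shows "(\<integral>\<^sup>+\<omega>. ennreal (exp (a * Y \<omega>)) \<partial>M) < \<infinity>"
proof -
  define f where "f n = exp (a * (real n + 1)) * prob {\<omega> \<in> space M. Y \<omega> \<ge> real n}" for n
  have sm: "summable f"
  proof (rule summable_comparison_test_ev)
    have "\<forall>\<^sub>F n in sequentially. prob {\<omega> \<in> space M. Y \<omega> \<ge> real n} \<le> K * exp (- b * real n)"
      using filterlim_real_sequentially tail by (rule eventually_compose_filterlim[rotated])
    then show "\<forall>\<^sub>F n in sequentially. norm (f n) \<le> (\<bar>K\<bar> * exp a) * exp (a - b) ^ n"
    proof eventually_elim
      case (elim n)
      have "norm (f n) = exp (a * (real n + 1)) * prob {\<omega> \<in> space M. Y \<omega> \<ge> real n}"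
        by (simp add: f_def)
      also have "\<dots> \<le> exp (a * (real n + 1)) * (\<bar>K\<bar> * exp (- b * real n))"
        using elim by (intro mult_left_mono) (auto intro: order_trans mult_right_mono)
      also have "\<dots> = (\<bar>K\<bar> * exp a) * exp (a - b) ^ n"
        by (simp add: exp_of_nat_mult[symmetric] algebra_simps flip: exp_add)
      finally show ?case .
    qed
    show "summable (\<lambda>n. (\<bar>K\<bar> * exp a) * exp (a - b) ^ n)"
      using a by (intro summable_mult summable_geometric) simp
  qed
  have "(\<integral>\<^sup>+\<omega>. ennreal (exp (a * Y \<omega>)) \<partial>M) \<le>
      (\<integral>\<^sup>+\<omega>. (\<Sum>n. ennreal (exp (a * (real n + 1))) * indicator {\<omega> \<in> space M. Y \<omega> \<ge> real n} \<omega>) \<partial>M)"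
  proof (rule nn_integral_mono)
    fix \<omega> assume w: "\<omega> \<in> space M"
    define n where "n = nat \<lfloor>Y \<omega>\<rfloor>"
    have n: "real n \<le> Y \<omega>" "Y \<omega> \<le> real n + 1"
      using nn[of \<omega>] by (auto simp: n_def)
    have "ennreal (exp (a * Y \<omega>)) \<le> ennreal (exp (a * (real n + 1))) * indicator {\<omega> \<in> space M. Y \<omega> \<ge> real n} \<omega>"
      using w n a by (auto intro!: ennreal_leI mult_left_mono)
    also have "\<dots> \<le> (\<Sum>n. ennreal (exp (a * (real n + 1))) * indicator {\<omega> \<in> space M. Y \<omega> \<ge> real n} \<omega>)"
    proof -
      have "F n \<le> suminf F" for F :: "nat \<Rightarrow> ennreal"
        using sum_le_suminf[of F "{n}"] by simp
      then show ?thesis .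
    qed
    finally show "ennreal (exp (a * Y \<omega>)) \<le> \<dots>" .
  qed
  also have "\<dots> = (\<Sum>n. \<integral>\<^sup>+\<omega>. ennreal (exp (a * (real n + 1))) * indicator {\<omega> \<in> space M. Y \<omega> \<ge> real n} \<omega> \<partial>M)"
    by (rule nn_integral_suminf) measurable
  also have "\<dots> = (\<Sum>n. ennreal (f n))"
    by (subst nn_integral_cmult_indicator) (auto simp: f_def emeasure_eq_measure ennreal_mult')
  also have "\<dots> = ennreal (suminf f)"
    by (rule suminf_ennreal2[OF _ sm]) (simp add: f_def)
  also have "\<dots> < \<infinity>" unfolding infinity_ennreal_def by (rule ennreal_less_top)
  finally show ?thesis .
qed

text \<open>
  Symmetry and a uniform bound on one stretched exponential moment.  All upper bounds on the
  disorder use this information alone, and it is inherited by truncations.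
\<close>

definition sub_weibull :: "'w measure \<Rightarrow> real \<Rightarrow> real \<Rightarrow> real \<Rightarrow> ('w \<Rightarrow> real) \<Rightarrow> bool" where
  "sub_weibull M \<alpha> c B X \<longleftrightarrow> X \<in> borel_measurable M \<and>
     distr M borel (\<lambda>\<omega>. - X \<omega>) = distr M borel X \<and>
     (\<integral>\<^sup>+\<omega>. ennreal (exp (c * \<bar>X \<omega>\<bar> powr \<alpha>)) \<partial>M) \<le> ennreal B"

lemma symmetric_prob:
  assumes "X \<in> borel_measurable M" "distr M borel (\<lambda>\<omega>. - X \<omega>) = distr M borel X" "A \<in> sets borel"
  shows "measure M {\<omega> \<in> space M. - X \<omega> \<in> A} = measure M {\<omega> \<in> space M. X \<omega> \<in> (A :: real set)}"
proof -
  have "measure (distr M borel (\<lambda>\<omega>. - X \<omega>)) A = measure (distr M borel X) A" using assms by simp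
  then show ?thesis
    using assms by (subst (asm) (1 2) measure_distr) (auto simp: vimage_def Int_def conj_commute)
qed

lemma (in prob_space) tail_sub_weibull:
  assumes X [measurable]: "X \<in> borel_measurable M" and sym: "distr M borel (\<lambda>\<omega>. - X \<omega>) = distr M borel X"
    and tail: "has_tail M X T" and c: "0 < c" "tail_rate_above T c"
  obtains B where "B \<ge> 1" "sub_weibull M (tail_exponent T) c B X"
proof -
  let ?a = "tail_exponent T"
  have a: "0 < ?a" using tail_exponent_bounds[OF tail] by simp
  obtain c' where c': "c < c'" "tail_rate_above T c'"
    using c by (cases T) (auto dest: dense intro: that[of "c + 1"])
  have "\<forall>\<^sub>F s in at_top. prob {\<omega> \<in> space M. \<bar>X \<omega>\<bar> powr ?a \<ge> s} \<le> 2 * exp (- c' * s)"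
  proof -
    have "filterlim (\<lambda>s::real. s powr (1 / ?a)) at_top at_top"
      using a by real_asymp
    then have "\<forall>\<^sub>F s in at_top. prob {\<omega> \<in> space M. X \<omega> \<ge> s powr (1 / ?a)} \<le> exp (- c' * (s powr (1 / ?a)) powr ?a)"
      using tail_upper_bound[OF tail c'(2)] by (rule eventually_compose_filterlim[rotated])
    then show ?thesis using eventually_gt_at_top[of 0]
    proof eventually_elim
      case (elim s)
      define r where "r = s powr (1 / ?a)"
      have r: "r > 0" "r powr ?a = s" using elim(2) a by (auto simp: r_def powr_powr)
      have "prob {\<omega> \<in> space M. \<bar>X \<omega>\<bar> powr ?a \<ge> s} \<le> prob ({\<omega> \<in> space M. X \<omega> \<ge> r} \<union> {\<omega> \<in> space M. - X \<omega> \<in> {r..}})"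
      proof (rule finite_measure_mono)
        have "X \<omega> \<ge> r \<or> - X \<omega> \<ge> r" if "\<bar>X \<omega>\<bar> powr ?a \<ge> s" for \<omega>
        proof (rule ccontr)
          assume "\<not> ?thesis"
          then have "\<bar>X \<omega>\<bar> < r" by auto
          then have "\<bar>X \<omega>\<bar> powr ?a < r powr ?a" using a by (intro powr_less_mono2) auto
          then show False using that r by simp
        qed
        then show "{\<omega> \<in> space M. \<bar>X \<omega>\<bar> powr ?a \<ge> s} \<subseteq> {\<omega> \<in> space M. X \<omega> \<ge> r} \<union> {\<omega> \<in> space M. - X \<omega> \<in> {r..}}" by auto
      qed measurable
      also have "\<dots> \<le> prob {\<omega> \<in> space M. X \<omega> \<ge> r} + prob {\<omega> \<in> space M. - X \<omega> \<in> {r..}}"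
        by (rule measure_Un_le) measurable
      also have "prob {\<omega> \<in> space M. - X \<omega> \<in> {r..}} = prob {\<omega> \<in> space M. X \<omega> \<in> {r..}}"
        by (intro symmetric_prob X sym) simp
      finally have "prob {\<omega> \<in> space M. \<bar>X \<omega>\<bar> powr ?a \<ge> s} \<le> 2 * prob {\<omega> \<in> space M. X \<omega> \<ge> r}" by simp
      also have "prob {\<omega> \<in> space M. X \<omega> \<ge> r} \<le> exp (- c' * s)" using elim(1) r by (simp add: r_def)
      finally show ?case by simp
    qed
  qed
  then have fin: "(\<integral>\<^sup>+\<omega>. ennreal (exp (c * \<bar>X \<omega>\<bar> powr ?a)) \<partial>M) < \<infinity>"
    using c c' by (intro exp_moment_finite[where b = c' and K = 2]) auto
  define B where "B = max 1 (enn2real (\<integral>\<^sup>+\<omega>. ennreal (exp (c * \<bar>X \<omega>\<bar> powr ?a)) \<partial>M))"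
  have "(\<integral>\<^sup>+\<omega>. ennreal (exp (c * \<bar>X \<omega>\<bar> powr ?a)) \<partial>M) \<le> ennreal B"
  proof -
    have "(\<integral>\<^sup>+\<omega>. ennreal (exp (c * \<bar>X \<omega>\<bar> powr ?a)) \<partial>M) =
        ennreal (enn2real (\<integral>\<^sup>+\<omega>. ennreal (exp (c * \<bar>X \<omega>\<bar> powr ?a)) \<partial>M))"
      using fin by simp
    also have "\<dots> \<le> ennreal B" unfolding B_def by (intro ennreal_leI) simp
    finally show ?thesis .
  qed
  then show thesis
    using X sym by (intro that[of B]) (auto simp: sub_weibull_def B_def)
qed

section \<open>Moment generating functions at the scale of the maximum\<close>

text \<open>
  The constant of the Legendre transform: \<open>sup\<^sub>r (s * r - c * r\<^bsup>\<alpha>\<^esup>)\<close> equals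
  \<open>young_const \<alpha> c\<close> times \<open>s\<close> to the conjugate exponent \<open>\<alpha> / (\<alpha> - 1)\<close>.
\<close>

definition young_const :: "real \<Rightarrow> real \<Rightarrow> real" where
  "young_const \<alpha> c = (\<alpha> - 1) / \<alpha> * (c * \<alpha>) powr (- 1 / (\<alpha> - 1))"

lemma young_const_nonneg: "\<alpha> > 1 \<Longrightarrow> young_const \<alpha> c \<ge> 0"
  by (simp add: young_const_def)

lemma young_const_bound:
  assumes "\<alpha> > 1" "c > 0" "s \<ge> 0" "r \<ge> 0"
  shows "s * r \<le> young_const \<alpha> c * s powr (\<alpha> / (\<alpha> - 1)) + c * r powr \<alpha>"
proof -
  define q where "q = \<alpha> / (\<alpha> - 1)"
  define k where "k = (c * \<alpha>) powr (1 / \<alpha>)"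
  have k: "k > 0" using assms by (simp add: k_def)
  have q: "q > 1" using assms by (simp add: q_def)
  have "(s / k) * (r * k) \<le> (s / k) powr q / q + (r * k) powr \<alpha> / \<alpha>"
    using assms q k by (intro Youngs_inequality) (auto simp: q_def field_simps)
  also have "(r * k) powr \<alpha> / \<alpha> = c * r powr \<alpha>"
    using assms k by (simp add: powr_mult k_def powr_powr)
  also have "(s / k) powr q / q = young_const \<alpha> c * s powr q"
  proof -
    have "k powr q = (c * \<alpha>) powr (1 / (\<alpha> - 1))"
      using assms by (simp add: k_def powr_powr q_def)
    then have "(s / k) powr q = s powr q * (c * \<alpha>) powr (- 1 / (\<alpha> - 1))"
      using assms k by (simp add: powr_divide powr_minus_divide)
    then show ?thesis using assms by (simp add: young_const_def q_def)
  qed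
  finally show ?thesis using k by (simp add: q_def)
qed

lemma exp_add_exp_minus_le: "exp x + exp (- x) \<le> 2 + 2 * (x\<^sup>2 * exp \<bar>x\<bar>)" for x :: real
proof -
  have main: "exp x + exp (- x) \<le> 2 + 2 * (x\<^sup>2 * exp x)" if x: "x \<ge> 0" for x :: real
  proof -
    have "1 - x \<le> exp (- x)" using exp_ge_add_one_self[of "- x"] by simp
    then have "(1 - x) * exp x \<le> exp (- x) * exp x" by (intro mult_right_mono) auto
    then have "exp x - 1 \<le> x * exp x" by (simp add: algebra_simps flip: exp_add)
    moreover have "exp x - 1 \<ge> 0" using x by simp
    ultimately have "(exp x - 1)\<^sup>2 \<le> (x * exp x)\<^sup>2" by (intro power_mono) auto
    then have "exp (- x) * (exp x - 1)\<^sup>2 \<le> exp (- x) * (x * exp x)\<^sup>2" by (intro mult_left_mono) auto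
    moreover have "exp (- x) * (exp x - 1)\<^sup>2 = exp x + exp (- x) - 2"
      by (simp add: power2_eq_square algebra_simps flip: exp_add)
    moreover have "exp (- x) * (x * exp x)\<^sup>2 = x\<^sup>2 * exp x"
      by (simp add: power2_eq_square algebra_simps flip: exp_add)
    moreover have "x\<^sup>2 * exp x \<ge> 0" by simp
    ultimately show ?thesis by linarith
  qed
  show ?thesis using main[of x] main[of "- x"] by (cases "x \<ge> 0") auto
qed

text \<open>
  By symmetry the moment generating function is the mean of a hyperbolic cosine and has no linear
  term, hence the bound is quadratic in \<open>s\<close>.
\<close>

lemma (in prob_space) symmetric_mgf_le:
  assumes X: "sub_weibull M \<alpha> c B X" and B: "B \<ge> 0"
    and D: "\<And>\<omega>. (X \<omega>)\<^sup>2 * exp (s1 * \<bar>X \<omega>\<bar>) \<le> D * exp (c * \<bar>X \<omega>\<bar> powr \<alpha>)" "D \<ge> 0"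
    and s: "0 \<le> s" "s \<le> s1"
  shows "(\<integral>\<^sup>+\<omega>. ennreal (exp (s * X \<omega>)) \<partial>M) \<le> ennreal (exp (D * B * s\<^sup>2))"
proof -
  have [measurable]: "X \<in> borel_measurable M" and sym: "distr M borel (\<lambda>\<omega>. - X \<omega>) = distr M borel X"
    and m: "(\<integral>\<^sup>+\<omega>. ennreal (exp (c * \<bar>X \<omega>\<bar> powr \<alpha>)) \<partial>M) \<le> ennreal B"
    using X by (auto simp: sub_weibull_def)
  let ?I = "\<integral>\<^sup>+\<omega>. ennreal (exp (s * X \<omega>)) \<partial>M"
  have "(\<integral>\<^sup>+\<omega>. ennreal (exp (s * - X \<omega>)) \<partial>M) = (\<integral>\<^sup>+t. ennreal (exp (s * t)) \<partial>distr M borel (\<lambda>\<omega>. - X \<omega>))"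
    by (subst nn_integral_distr) auto
  also have "\<dots> = ?I" unfolding sym by (subst nn_integral_distr) auto
  finally have I': "(\<integral>\<^sup>+\<omega>. ennreal (exp (- (s * X \<omega>))) \<partial>M) = ?I" by simp
  have "2 * ?I = ?I + (\<integral>\<^sup>+\<omega>. ennreal (exp (- (s * X \<omega>))) \<partial>M)" unfolding I' by (simp add: mult_2)
  also have "\<dots> = (\<integral>\<^sup>+\<omega>. ennreal (exp (s * X \<omega>) + exp (- (s * X \<omega>))) \<partial>M)"
    by (subst nn_integral_add[symmetric]) auto
  also have "\<dots> \<le> (\<integral>\<^sup>+\<omega>. 2 + ennreal (2 * s\<^sup>2 * D) * ennreal (exp (c * \<bar>X \<omega>\<bar> powr \<alpha>)) \<partial>M)"
  proof (rule nn_integral_mono)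
    fix \<omega>
    have "exp (s * X \<omega>) + exp (- (s * X \<omega>)) \<le> 2 + 2 * ((s * X \<omega>)\<^sup>2 * exp \<bar>s * X \<omega>\<bar>)"
      by (rule exp_add_exp_minus_le)
    also have "(s * X \<omega>)\<^sup>2 * exp \<bar>s * X \<omega>\<bar> \<le> s\<^sup>2 * ((X \<omega>)\<^sup>2 * exp (s1 * \<bar>X \<omega>\<bar>))"
      using s by (auto simp: power_mult_distrib abs_mult mult.assoc intro!: mult_left_mono mult_right_mono)
    also have "\<dots> \<le> s\<^sup>2 * (D * exp (c * \<bar>X \<omega>\<bar> powr \<alpha>))"
      by (intro mult_left_mono D) auto
    finally have "exp (s * X \<omega>) + exp (- (s * X \<omega>)) \<le> 2 + (2 * s\<^sup>2 * D) * exp (c * \<bar>X \<omega>\<bar> powr \<alpha>)"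
      by simp
    then have "ennreal (exp (s * X \<omega>) + exp (- (s * X \<omega>))) \<le> ennreal (2 + (2 * s\<^sup>2 * D) * exp (c * \<bar>X \<omega>\<bar> powr \<alpha>))"
      by (rule ennreal_leI)
    also have "\<dots> = 2 + ennreal (2 * s\<^sup>2 * D) * ennreal (exp (c * \<bar>X \<omega>\<bar> powr \<alpha>))"
      using D(2) by (simp add: ennreal_plus ennreal_mult')
    finally show "ennreal (exp (s * X \<omega>) + exp (- (s * X \<omega>))) \<le> \<dots>" .
  qed
  also have "\<dots> = 2 + ennreal (2 * s\<^sup>2 * D) * (\<integral>\<^sup>+\<omega>. ennreal (exp (c * \<bar>X \<omega>\<bar> powr \<alpha>)) \<partial>M)"
    by (subst nn_integral_add) (auto simp: nn_integral_cmult emeasure_space_1)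
  also have "\<dots> \<le> 2 + ennreal (2 * s\<^sup>2 * D) * ennreal B"
    by (intro add_left_mono mult_left_mono m) auto
  also have "\<dots> = ennreal (2 * (1 + D * B * s\<^sup>2))"
    using D(2) B by (simp add: ennreal_plus ennreal_mult'[symmetric] algebra_simps flip: ennreal_numeral)
  also have "\<dots> \<le> ennreal (2 * exp (D * B * s\<^sup>2))"
    by (intro ennreal_leI mult_left_mono) auto
  also have "\<dots> = 2 * ennreal (exp (D * B * s\<^sup>2))" by (simp add: ennreal_mult')
  finally have "2 * ?I \<le> 2 * ennreal (exp (D * B * s\<^sup>2))" .
  then show ?thesis by (simp add: ennreal_mult_le_mult_iff)
qed

text \<open>
  For large \<open>s\<close> Young's inequality gives the sharp constant in the exponent.
\<close>

lemma (in prob_space) mgf_le_young: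
  assumes X: "sub_weibull M \<alpha> c B X" and \<alpha>: "\<alpha> > 1" and c: "c > 0" and s: "0 \<le> s" and B: "B \<ge> 0"
  shows "(\<integral>\<^sup>+\<omega>. ennreal (exp (s * X \<omega>)) \<partial>M) \<le> ennreal (exp (young_const \<alpha> c * s powr (\<alpha> / (\<alpha> - 1))) * B)"
proof -
  have [measurable]: "X \<in> borel_measurable M"
    and m: "(\<integral>\<^sup>+\<omega>. ennreal (exp (c * \<bar>X \<omega>\<bar> powr \<alpha>)) \<partial>M) \<le> ennreal B"
    using X by (auto simp: sub_weibull_def)
  let ?K = "exp (young_const \<alpha> c * s powr (\<alpha> / (\<alpha> - 1)))"
  have "(\<integral>\<^sup>+\<omega>. ennreal (exp (s * X \<omega>)) \<partial>M) \<le> (\<integral>\<^sup>+\<omega>. ennreal ?K * ennreal (exp (c * \<bar>X \<omega>\<bar> powr \<alpha>)) \<partial>M)"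
  proof (rule nn_integral_mono)
    fix \<omega>
    have "s * X \<omega> \<le> s * \<bar>X \<omega>\<bar>" using s by (intro mult_left_mono) auto
    also have "\<dots> \<le> young_const \<alpha> c * s powr (\<alpha> / (\<alpha> - 1)) + c * \<bar>X \<omega>\<bar> powr \<alpha>"
      by (intro young_const_bound \<alpha> c s) auto
    finally have "exp (s * X \<omega>) \<le> ?K * exp (c * \<bar>X \<omega>\<bar> powr \<alpha>)" by (simp flip: exp_add)
    then show "ennreal (exp (s * X \<omega>)) \<le> ennreal ?K * ennreal (exp (c * \<bar>X \<omega>\<bar> powr \<alpha>))"
      by (simp add: ennreal_leI flip: ennreal_mult')
  qed
  also have "\<dots> = ennreal ?K * (\<integral>\<^sup>+\<omega>. ennreal (exp (c * \<bar>X \<omega>\<bar> powr \<alpha>)) \<partial>M)"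
    by (rule nn_integral_cmult) measurable
  also have "\<dots> \<le> ennreal ?K * ennreal B" by (intro mult_left_mono m) auto
  finally show ?thesis using B by (simp add: ennreal_mult')
qed

lemma square_le_exp_powr:
  assumes "\<alpha> > 0" "d > 0"
  obtains D where "D \<ge> 0" "\<And>r::real. r \<ge> 0 \<Longrightarrow> r\<^sup>2 \<le> D * exp (d * r powr \<alpha>)"
proof (rule that[of "exp (- (2 / \<alpha>) * ln (d * \<alpha> / 2))"])
  fix r :: real assume r: "r \<ge> 0"
  show "r\<^sup>2 \<le> exp (- (2 / \<alpha>) * ln (d * \<alpha> / 2)) * exp (d * r powr \<alpha>)"
  proof (cases "r = 0")
    case False
    then have r: "r > 0" using r by simp
    have "ln (r powr \<alpha> * (d * \<alpha> / 2)) \<le> r powr \<alpha> * (d * \<alpha> / 2)"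
      using ln_le_minus_one[of "r powr \<alpha> * (d * \<alpha> / 2)"] r assms by simp
    moreover have "ln (r powr \<alpha> * (d * \<alpha> / 2)) = \<alpha> * ln r + ln (d * \<alpha> / 2)"
      using r assms by (subst ln_mult) (simp_all add: ln_powr)
    ultimately have "\<alpha> * ln r + ln (d * \<alpha> / 2) \<le> r powr \<alpha> * (d * \<alpha> / 2)" by simp
    then have "2 / \<alpha> * (\<alpha> * ln r + ln (d * \<alpha> / 2)) \<le> 2 / \<alpha> * (r powr \<alpha> * (d * \<alpha> / 2))"
      using assms by (intro mult_left_mono) auto
    then have "2 * ln r \<le> - (2 / \<alpha>) * ln (d * \<alpha> / 2) + d * r powr \<alpha>"
    proof -
      have "2 / \<alpha> * (\<alpha> * ln r + ln (d * \<alpha> / 2)) = 2 * ln r + 2 / \<alpha> * ln (d * \<alpha> / 2)"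
        using assms by (simp add: distrib_left)
      moreover have "2 / \<alpha> * (r powr \<alpha> * (d * \<alpha> / 2)) = d * r powr \<alpha>"
        using assms by simp
      ultimately show ?thesis
        using \<open>2 / \<alpha> * (\<alpha> * ln r + ln (d * \<alpha> / 2)) \<le> 2 / \<alpha> * (r powr \<alpha> * (d * \<alpha> / 2))\<close> by simp
    qed
    then have "exp (2 * ln r) \<le> exp (- (2 / \<alpha>) * ln (d * \<alpha> / 2) + d * r powr \<alpha>)" by simp
    moreover have "exp (2 * ln r) = r\<^sup>2" using r by (simp add: exp_double)
    ultimately show ?thesis unfolding exp_add by simp
  qed simp
qed simp

text \<open>
  The logarithmic moment generating function of the disorder at the scale of the maximum, divided by
  \<open>l = log N\<close>.  It vanishes for \<open>\<alpha> \<le> 1\<close>, where only truncated variables and small parameters are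
  considered.
\<close>

definition rate_mgf :: "real \<Rightarrow> real \<Rightarrow> real \<Rightarrow> real" where
  "rate_mgf \<alpha> c s = (if \<alpha> \<le> 1 then 0 else young_const \<alpha> c * s powr (\<alpha> / (\<alpha> - 1)))"

lemma rate_mgf_mono: "0 \<le> s \<Longrightarrow> s \<le> t \<Longrightarrow> rate_mgf \<alpha> c s \<le> rate_mgf \<alpha> c t"
  by (auto simp: rate_mgf_def young_const_nonneg intro!: mult_left_mono powr_mono2)

text \<open>
  The first bound, quadratic in the weight \<open>g\<close>, is meant for the many sites with a small Green
  function; the second one has the sharp constant up to an additive \<open>C\<close> and is meant for finitely
  many sites.  For \<open>\<alpha> \<le> 1\<close> the truncation level and the condition \<open>small\<close> ensure that the exponent
  \<open>\<kappa> l\<^bsup>(\<alpha>-1)/\<alpha>\<^esup> g \<bar>X\<bar>\<close> stays below \<open>c1 \<bar>X\<bar>\<^bsup>\<alpha>\<^esup>\<close> with \<open>c1 < c\<close>; the powers of \<open>l\<close> cancel.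
\<close>

lemma (in prob_space) scaled_mgf_bounds:
  assumes \<alpha>: "0 < \<alpha>" "\<alpha> \<le> 2" and c: "c > 0" and B: "B \<ge> 1"
    and \<kappa>: "\<kappa> > 0" and \<gamma>: "\<gamma> > 0" and A: "A > 0"
    and small: "\<alpha> \<le> 1 \<Longrightarrow> \<kappa> * \<gamma> * A powr (1 - \<alpha>) < c"
  obtains C where "C \<ge> 0"
    "\<And>l X g. l \<ge> 1 \<Longrightarrow> sub_weibull M \<alpha> c B X \<Longrightarrow> (\<And>\<omega>. \<alpha> \<le> 1 \<Longrightarrow> \<bar>X \<omega>\<bar> \<le> A * l powr (1 / \<alpha>)) \<Longrightarrow>
       0 \<le> g \<Longrightarrow> g \<le> \<gamma> \<Longrightarrow>
       (\<integral>\<^sup>+\<omega>. ennreal (exp (\<kappa> * l powr ((\<alpha> - 1) / \<alpha>) * g * X \<omega>)) \<partial>M) \<le> ennreal (exp (C * g\<^sup>2 * l))"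
    "\<And>l X g. l \<ge> 1 \<Longrightarrow> sub_weibull M \<alpha> c B X \<Longrightarrow> (\<And>\<omega>. \<alpha> \<le> 1 \<Longrightarrow> \<bar>X \<omega>\<bar> \<le> A * l powr (1 / \<alpha>)) \<Longrightarrow>
       0 \<le> g \<Longrightarrow> g \<le> \<gamma> \<Longrightarrow>
       (\<integral>\<^sup>+\<omega>. ennreal (exp (\<kappa> * l powr ((\<alpha> - 1) / \<alpha>) * g * X \<omega>)) \<partial>M) \<le>
          ennreal (exp (rate_mgf \<alpha> c (\<kappa> * g) * l + C))"
proof (cases "\<alpha> \<le> 1")
  case True
  define c1 where "c1 = \<kappa> * \<gamma> * A powr (1 - \<alpha>)"
  have c1: "c1 < c" "c1 \<ge> 0" using small[OF True] \<kappa> \<gamma> by (simp_all add: c1_def)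
  obtain D where D: "D \<ge> 0" "\<And>r::real. r \<ge> 0 \<Longrightarrow> r\<^sup>2 \<le> D * exp ((c - c1) * r powr \<alpha>)"
    using square_le_exp_powr[of \<alpha> "c - c1"] \<alpha> c1 by auto
  have DB: "D * B \<ge> 0" using D B by simp
  have main: "(\<integral>\<^sup>+\<omega>. ennreal (exp (\<kappa> * l powr ((\<alpha> - 1) / \<alpha>) * g * X \<omega>)) \<partial>M) \<le> ennreal (exp (D * B * \<kappa>\<^sup>2 * g\<^sup>2))"
    if l: "l \<ge> 1" and X: "sub_weibull M \<alpha> c B X" and bd: "\<And>\<omega>. \<alpha> \<le> 1 \<Longrightarrow> \<bar>X \<omega>\<bar> \<le> A * l powr (1 / \<alpha>)"
      and g: "0 \<le> g" "g \<le> \<gamma>" for l X g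
  proof -
    define p where "p = l powr ((\<alpha> - 1) / \<alpha>)"
    have p: "0 < p" "p \<le> 1" 
      using l \<alpha> True powr_mono[of "(\<alpha> - 1) / \<alpha>" 0 l] by (auto simp: p_def divide_nonpos_pos)
    define s1 where "s1 = \<kappa> * p * \<gamma>"
    have "(\<integral>\<^sup>+\<omega>. ennreal (exp ((\<kappa> * p * g) * X \<omega>)) \<partial>M) \<le> ennreal (exp (D * B * (\<kappa> * p * g)\<^sup>2))"
    proof (rule symmetric_mgf_le[OF X])
      fix \<omega>
      have "p * (A * l powr (1 / \<alpha>)) powr (1 - \<alpha>) = A powr (1 - \<alpha>)"
        using l A \<alpha> by (simp add: p_def powr_mult powr_powr flip: powr_add add_divide_distrib)
      then have e: "s1 * (A * l powr (1 / \<alpha>)) powr (1 - \<alpha>) = c1"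
        by (simp add: s1_def c1_def mult_ac)
      have s1: "s1 \<ge> 0" using \<kappa> p \<gamma> by (simp add: s1_def)
      have "s1 * \<bar>X \<omega>\<bar> = s1 * (\<bar>X \<omega>\<bar> powr (1 - \<alpha>) * \<bar>X \<omega>\<bar> powr \<alpha>)"
        by (simp flip: powr_add)
      also have "\<dots> \<le> s1 * ((A * l powr (1 / \<alpha>)) powr (1 - \<alpha>) * \<bar>X \<omega>\<bar> powr \<alpha>)"
        using bd[OF True, of \<omega>] True s1 by (intro mult_left_mono mult_right_mono powr_mono2) auto
      also have "\<dots> = c1 * \<bar>X \<omega>\<bar> powr \<alpha>" using e by (simp only: mult.assoc[symmetric])
      finally have 1: "s1 * \<bar>X \<omega>\<bar> \<le> c1 * \<bar>X \<omega>\<bar> powr \<alpha>" .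
      have "(X \<omega>)\<^sup>2 * exp (s1 * \<bar>X \<omega>\<bar>) \<le> (D * exp ((c - c1) * \<bar>X \<omega>\<bar> powr \<alpha>)) * exp (c1 * \<bar>X \<omega>\<bar> powr \<alpha>)"
        using D(2)[of "\<bar>X \<omega>\<bar>"] D(1) 1 by (intro mult_mono) auto
      also have "\<dots> = D * exp (c * \<bar>X \<omega>\<bar> powr \<alpha>)"
        by (simp add: algebra_simps flip: exp_add)
      finally show "(X \<omega>)\<^sup>2 * exp (s1 * \<bar>X \<omega>\<bar>) \<le> D * exp (c * \<bar>X \<omega>\<bar> powr \<alpha>)" .
    qed (use D B \<kappa> p g in \<open>auto simp: s1_def\<close>)
    also have "\<dots> \<le> ennreal (exp (D * B * \<kappa>\<^sup>2 * g\<^sup>2))"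
    proof -
      have "(\<kappa> * p * g)\<^sup>2 \<le> (\<kappa> * g)\<^sup>2"
        using \<kappa> p g mult_left_mono[of p 1 \<kappa>] by (intro power_mono mult_right_mono) auto
      then have "D * B * (\<kappa> * p * g)\<^sup>2 \<le> D * B * (\<kappa> * g)\<^sup>2" using DB by (rule mult_left_mono)
      then show ?thesis by (intro ennreal_leI) (simp add: power_mult_distrib)
    qed
    finally show ?thesis by (simp add: p_def)
  qed
  show thesis
  proof (rule that[of "D * B * \<kappa>\<^sup>2 * (1 + \<gamma>\<^sup>2)"])
    show "D * B * \<kappa>\<^sup>2 * (1 + \<gamma>\<^sup>2) \<ge> 0" using DB by simp
  next
    fix l X g assume l: "1 \<le> (l::real)" and *: "sub_weibull M \<alpha> c B X" "\<And>\<omega>. \<alpha> \<le> 1 \<Longrightarrow> \<bar>X \<omega>\<bar> \<le> A * l powr (1 / \<alpha>)" "0 \<le> g" "g \<le> \<gamma>"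
    have "D * B * \<kappa>\<^sup>2 * g\<^sup>2 * 1 \<le> D * B * \<kappa>\<^sup>2 * g\<^sup>2 * ((1 + \<gamma>\<^sup>2) * l)"
    proof (rule mult_left_mono)
      have "1 * 1 \<le> (1 + \<gamma>\<^sup>2) * l" using l by (intro mult_mono) auto
      then show "1 \<le> (1 + \<gamma>\<^sup>2) * l" by simp
    qed (use DB in simp)
    then have "ennreal (exp (D * B * \<kappa>\<^sup>2 * g\<^sup>2)) \<le> ennreal (exp (D * B * \<kappa>\<^sup>2 * (1 + \<gamma>\<^sup>2) * g\<^sup>2 * l))"
      by (intro ennreal_leI) (simp add: mult_ac)
    with main[OF l *] show "(\<integral>\<^sup>+\<omega>. ennreal (exp (\<kappa> * l powr ((\<alpha> - 1) / \<alpha>) * g * X \<omega>)) \<partial>M) \<le> ennreal (exp (D * B * \<kappa>\<^sup>2 * (1 + \<gamma>\<^sup>2) * g\<^sup>2 * l))"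
      by (rule order_trans)
    have "g\<^sup>2 \<le> \<gamma>\<^sup>2" using *(3,4) by (intro power_mono) auto
    then have "D * B * \<kappa>\<^sup>2 * g\<^sup>2 \<le> D * B * \<kappa>\<^sup>2 * (1 + \<gamma>\<^sup>2)"
      using DB by (intro mult_left_mono) auto
    then have "ennreal (exp (D * B * \<kappa>\<^sup>2 * g\<^sup>2)) \<le> ennreal (exp (rate_mgf \<alpha> c (\<kappa> * g) * l + D * B * \<kappa>\<^sup>2 * (1 + \<gamma>\<^sup>2)))"
      using True by (intro ennreal_leI) (simp add: rate_mgf_def)
    with main[OF l *] show "(\<integral>\<^sup>+\<omega>. ennreal (exp (\<kappa> * l powr ((\<alpha> - 1) / \<alpha>) * g * X \<omega>)) \<partial>M) \<le> ennreal (exp (rate_mgf \<alpha> c (\<kappa> * g) * l + D * B * \<kappa>\<^sup>2 * (1 + \<gamma>\<^sup>2)))"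
      by (rule order_trans)
  qed
next
  case False
  then have \<alpha>1: "\<alpha> > 1" by simp
  define q where "q = \<alpha> / (\<alpha> - 1)"
  have q2: "q \<ge> 2" using \<alpha> \<alpha>1 by (simp add: q_def field_simps)
  define K where "K = young_const \<alpha> c"
  have K: "K \<ge> 0" using young_const_nonneg[OF \<alpha>1] by (simp add: K_def)
  \<comment> \<open>By \<open>r\<^sup>2 * exp r \<le> exp (3 * r)\<close> and Young's inequality with \<open>s = 3\<close>.\<close>
  define D where "D = exp (K * 3 powr q)"
  have Dpos: "D \<ge> 0" by (simp add: D_def)
  have lnB: "ln B \<ge> 0" using B by simp
  have D: "r\<^sup>2 * exp (1 * r) \<le> D * exp (c * r powr \<alpha>)" if r: "r \<ge> 0" for r :: real
  proof -
    have "r \<le> exp r" using exp_ge_add_one_self[of r] by linarith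
    then have "r\<^sup>2 \<le> (exp r)\<^sup>2" using r by (intro power_mono) auto
    then have "r\<^sup>2 * exp (1 * r) \<le> (exp r)\<^sup>2 * exp (1 * r)" by (intro mult_right_mono) auto
    also have "\<dots> = exp (3 * r)" by (simp add: power2_eq_square flip: exp_add)
    also have "3 * r \<le> K * 3 powr q + c * r powr \<alpha>"
      unfolding K_def q_def by (intro young_const_bound \<alpha>1 c r) simp
    finally show ?thesis by (simp add: D_def exp_add)
  qed
  define C where "C = D * B * \<kappa>\<^sup>2 + (K + ln B) * \<kappa> powr q * \<gamma> powr (q - 2) + ln B"
  have Cparts: "D * B * \<kappa>\<^sup>2 \<ge> 0" "(K + ln B) * \<kappa> powr q * \<gamma> powr (q - 2) \<ge> 0"
    using Dpos B K lnB by auto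
  have C: "C \<ge> 0" "ln B \<le> C" "D * B * \<kappa>\<^sup>2 \<le> C" "(K + ln B) * \<kappa> powr q * \<gamma> powr (q - 2) \<le> C"
    using Cparts lnB by (auto simp: C_def)
  have pq: "(\<kappa> * l powr ((\<alpha> - 1) / \<alpha>) * g) powr q = (\<kappa> * g) powr q * l" if "l \<ge> 1" "g \<ge> 0" for l g
    using that \<kappa> \<alpha>1 by (simp add: powr_mult powr_powr q_def mult_ac)
  have young: "(\<integral>\<^sup>+\<omega>. ennreal (exp (\<kappa> * l powr ((\<alpha> - 1) / \<alpha>) * g * X \<omega>)) \<partial>M) \<le> ennreal (exp (K * ((\<kappa> * g) powr q * l) + ln B))"
    if l: "l \<ge> 1" and X: "sub_weibull M \<alpha> c B X" and g: "0 \<le> g" for l X g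
  proof -
    have "(\<integral>\<^sup>+\<omega>. ennreal (exp (\<kappa> * l powr ((\<alpha> - 1) / \<alpha>) * g * X \<omega>)) \<partial>M) \<le>
      ennreal (exp (K * (\<kappa> * l powr ((\<alpha> - 1) / \<alpha>) * g) powr q) * B)"
      unfolding K_def q_def using \<kappa> g B by (intro mgf_le_young[OF X \<alpha>1 c]) auto
    then show ?thesis using B by (simp add: pq[OF l g] exp_add)
  qed
  show thesis
  proof (rule that[of C])
    show "C \<ge> 0" by (rule C)
  next
    fix l X g assume l: "1 \<le> (l::real)" and X: "sub_weibull M \<alpha> c B X" and g: "0 \<le> g" "g \<le> \<gamma>"
    show "(\<integral>\<^sup>+\<omega>. ennreal (exp (\<kappa> * l powr ((\<alpha> - 1) / \<alpha>) * g * X \<omega>)) \<partial>M) \<le> ennreal (exp (rate_mgf \<alpha> c (\<kappa> * g) * l + C))"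
      using young[OF l X g(1)] C False
      by (elim order_trans) (auto intro!: ennreal_leI simp: rate_mgf_def K_def q_def)
    define s where "s = \<kappa> * l powr ((\<alpha> - 1) / \<alpha>) * g"
    have s: "s \<ge> 0" using \<kappa> g by (simp add: s_def)
    show "(\<integral>\<^sup>+\<omega>. ennreal (exp (\<kappa> * l powr ((\<alpha> - 1) / \<alpha>) * g * X \<omega>)) \<partial>M) \<le> ennreal (exp (C * g\<^sup>2 * l))"
    proof (cases "s \<le> 1")
      case True
      have "(\<integral>\<^sup>+\<omega>. ennreal (exp (s * X \<omega>)) \<partial>M) \<le> ennreal (exp (D * B * s\<^sup>2))"
        using True s B Dpos D[of "\<bar>X _\<bar>"] by (intro symmetric_mgf_le[OF X]) auto
      also have "D * B * s\<^sup>2 \<le> C * g\<^sup>2 * l"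
      proof -
        have "(l powr ((\<alpha> - 1) / \<alpha>))\<^sup>2 = l powr (2 * ((\<alpha> - 1) / \<alpha>))"
          using l by (simp add: powr_powr mult.commute flip: powr_numeral)
        also have "\<dots> \<le> l powr 1"
          using l \<alpha> by (intro powr_mono) (auto simp: field_simps)
        finally have "(l powr ((\<alpha> - 1) / \<alpha>))\<^sup>2 \<le> l" using l by simp
        then have "D * B * \<kappa>\<^sup>2 * g\<^sup>2 * (l powr ((\<alpha> - 1) / \<alpha>))\<^sup>2 \<le> D * B * \<kappa>\<^sup>2 * g\<^sup>2 * l"
          using Cparts by (intro mult_left_mono) auto
        also have "\<dots> \<le> C * g\<^sup>2 * l" using C l by (intro mult_right_mono) auto
        finally show ?thesis by (simp add: s_def power_mult_distrib mult_ac)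
      qed
      finally show ?thesis by (simp add: s_def ennreal_leI)
    next
      case False
      then have gpos: "g > 0" using g by (cases "g = 0") (auto simp: s_def)
      have "1 \<le> s powr q" using False q2 by (intro ge_one_powr_ge_zero) auto
      then have one: "1 \<le> (\<kappa> * g) powr q * l" using pq[OF l g(1)] by (simp add: s_def)
      have "K * ((\<kappa> * g) powr q * l) + ln B \<le> (K + ln B) * ((\<kappa> * g) powr q * l)"
        using mult_left_mono[OF one lnB] by (simp add: algebra_simps)
      also have "(K + ln B) * ((\<kappa> * g) powr q * l) = (K + ln B) * (\<kappa> powr q * (g powr 2 * g powr (q - 2)) * l)"
      proof -
        have "g powr 2 * g powr (q - 2) = g powr q" by (subst powr_add[symmetric]) simp
        then show ?thesis using \<kappa> gpos by (simp only: powr_mult less_imp_le)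
      qed
      also have "(K + ln B) * (\<kappa> powr q * (g powr 2 * g powr (q - 2)) * l) \<le> (K + ln B) * (\<kappa> powr q * (g powr 2 * \<gamma> powr (q - 2)) * l)"
        using K lnB l g q2 by (intro mult_left_mono mult_right_mono powr_mono2) auto
      also have "\<dots> = ((K + ln B) * \<kappa> powr q * \<gamma> powr (q - 2)) * g\<^sup>2 * l"
        using gpos by (simp add: powr_numeral)
      also have "\<dots> \<le> C * g\<^sup>2 * l" using C l by (intro mult_right_mono) auto
      finally show ?thesis
        by (intro order_trans[OF young[OF l X g(1)]] ennreal_leI) simp
    qed
  qed
qed

section \<open>Weighted sums of the disorder\<close>

text \<open>
  The disorder of the model, in a dimension in which the Green function is square summable.
\<close>

locale random_field = prob_space M for M :: "'w measure" +
  fixes \<eta> :: "'d::finite site \<Rightarrow> 'w \<Rightarrow> real" and T :: tail_type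
  assumes dim: "CARD('d) \<ge> 5"
    and indep: "indep_vars (\<lambda>_. borel) \<eta> UNIV"
    and ident: "\<And>x. distr M borel (\<eta> x) = distr M borel (\<eta> 0)"
    and symm: "distr M borel (\<lambda>\<omega>. - \<eta> 0 \<omega>) = distr M borel (\<eta> 0)"
    and tail: "has_tail M (\<eta> 0) T"
begin

abbreviation "\<alpha> \<equiv> tail_exponent T"
abbreviation gr :: "'d site \<Rightarrow> real" where "gr \<equiv> green 0"

lemma \<alpha>: "0 < \<alpha>" "\<alpha> \<le> 2"
  using tail_exponent_bounds[OF tail] by auto

lemma Gstar_ge_one: "Gstar TYPE('d) \<ge> 1" by (rule Gstar_ge_1[OF dim])

lemma gr_nonneg: "gr z \<ge> 0" by (rule green_nonneg[OF dim])

lemma gr_le_Gstar: "gr z \<le> Gstar TYPE('d)" by (rule green_le_Gstar[OF dim])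

lemma \<eta>_measurable [measurable]: "\<eta> x \<in> borel_measurable M"
  using indep by (auto simp: indep_vars_def)

lemma prob_\<eta>_eq:
  assumes "S \<in> sets borel"
  shows "prob {\<omega> \<in> space M. \<eta> x \<omega> \<in> S} = prob {\<omega> \<in> space M. \<eta> 0 \<omega> \<in> S}"
proof -
  have "prob {\<omega> \<in> space M. \<eta> y \<omega> \<in> S} = measure (distr M borel (\<eta> y)) S" for y
    using assms by (subst measure_distr) (auto intro!: arg_cong[where f = prob])
  then show ?thesis by (metis ident)
qed

lemma symmetric_field: "distr M borel (\<lambda>\<omega>. - \<eta> x \<omega>) = distr M borel (\<eta> x)"
proof -
  have "distr M borel (\<lambda>\<omega>. - \<eta> y \<omega>) = distr (distr M borel (\<eta> y)) borel uminus" for y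
    by (subst distr_distr) (auto simp: comp_def)
  then show ?thesis using symm by (metis ident)
qed

lemma sub_weibull_all:
  assumes "sub_weibull M a c B (\<eta> 0)" shows "sub_weibull M a c B (\<eta> x)"
proof -
  have e: "(\<integral>\<^sup>+\<omega>. ennreal (exp (c * \<bar>\<eta> y \<omega>\<bar> powr a)) \<partial>M) = (\<integral>\<^sup>+t. ennreal (exp (c * \<bar>t\<bar> powr a)) \<partial>distr M borel (\<eta> y))" for y
    by (subst nn_integral_distr) auto
  show ?thesis using assms unfolding sub_weibull_def e ident[of x] symmetric_field[of x] symmetric_field[of 0] by simp
qed

definition trunc :: "real \<Rightarrow> real \<Rightarrow> real" where
  "trunc a x = (if \<bar>x\<bar> \<le> a then x else 0)"

lemma trunc_measurable [measurable]: "trunc a \<in> borel_measurable borel"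
  unfolding trunc_def by measurable

text \<open>
  The disorder itself for \<open>\<alpha> > 1\<close> and its truncation at level \<open>A * l\<^bsup>1/\<alpha>\<^esup>\<close> are treated together as
  independent families with common moment bounds.
\<close>

definition good_family :: "real \<Rightarrow> real \<Rightarrow> real \<Rightarrow> real \<Rightarrow> ('d site \<Rightarrow> 'w \<Rightarrow> real) \<Rightarrow> bool" where
  "good_family c B A l X \<longleftrightarrow> indep_vars (\<lambda>_. borel) X UNIV \<and> (\<forall>y. sub_weibull M \<alpha> c B (X y)) \<and>
     (\<alpha> \<le> 1 \<longrightarrow> (\<forall>y \<omega>. \<bar>X y \<omega>\<bar> \<le> A * l powr (1 / \<alpha>)))"

lemma good_family_trunc:
  assumes sw: "sub_weibull M \<alpha> c B (\<eta> 0)" and c: "c \<ge> 0" and A: "A \<ge> 0"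
  shows "good_family c B A l (\<lambda>y \<omega>. trunc (A * l powr (1 / \<alpha>)) (\<eta> y \<omega>))"
  unfolding good_family_def
proof (intro conjI allI impI)
  let ?a = "A * l powr (1 / \<alpha>)"
  show "indep_vars (\<lambda>_. borel) (\<lambda>y \<omega>. trunc ?a (\<eta> y \<omega>)) UNIV"
    by (rule indep_vars_compose2[OF indep]) simp
  show "\<bar>trunc ?a (\<eta> y \<omega>)\<bar> \<le> ?a" for y \<omega>
    using A by (simp add: trunc_def)
  fix y
  have sy: "sub_weibull M \<alpha> c B (\<eta> y)" by (rule sub_weibull_all[OF sw])
  have neg: "- trunc ?a t = trunc ?a (- t)" for t by (simp add: trunc_def)
  have 1: "distr M borel (\<lambda>\<omega>. trunc ?a (- \<eta> y \<omega>)) = distr (distr M borel (\<lambda>\<omega>. - \<eta> y \<omega>)) borel (trunc ?a)"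
    by (subst distr_distr) (auto simp: comp_def)
  have 2: "distr M borel (\<lambda>\<omega>. trunc ?a (\<eta> y \<omega>)) = distr (distr M borel (\<eta> y)) borel (trunc ?a)"
    by (subst distr_distr) (auto simp: comp_def)
  have "(\<integral>\<^sup>+\<omega>. ennreal (exp (c * \<bar>trunc ?a (\<eta> y \<omega>)\<bar> powr \<alpha>)) \<partial>M) \<le> (\<integral>\<^sup>+\<omega>. ennreal (exp (c * \<bar>\<eta> y \<omega>\<bar> powr \<alpha>)) \<partial>M)"
    using c \<alpha> by (intro nn_integral_mono ennreal_leI) (auto simp: trunc_def)
  then show "sub_weibull M \<alpha> c B (\<lambda>\<omega>. trunc ?a (\<eta> y \<omega>))"
    using sy unfolding sub_weibull_def neg 1 2 symmetric_field by auto
qed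

lemma good_family_\<eta>:
  assumes "sub_weibull M \<alpha> c B (\<eta> 0)" "\<alpha> > 1"
  shows "good_family c B A l \<eta>"
  using assms indep sub_weibull_all by (auto simp: good_family_def)

lemma good_family_uminus:
  assumes X: "good_family c B A l X"
  shows "good_family c B A l (\<lambda>y \<omega>. - X y \<omega>)"
proof -
  have i: "indep_vars (\<lambda>_. borel) (\<lambda>y \<omega>. - X y \<omega>) UNIV"
    by (rule indep_vars_compose2[where Y = "\<lambda>_ x. - x"]) (use X in \<open>auto simp: good_family_def\<close>)
  have "sub_weibull M \<alpha> c B (\<lambda>\<omega>. - X y \<omega>)" for y
    using X by (auto simp: good_family_def sub_weibull_def)
  then show ?thesis using i X by (auto simp: good_family_def)
qed

lemma family_measurable: "good_family c B A l X \<Longrightarrow> X y \<in> borel_measurable M"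
  by (auto simp: good_family_def sub_weibull_def)

lemma family_mgf:
  assumes "indep_vars (\<lambda>_. borel) X UNIV" "finite Y"
  shows "(\<integral>\<^sup>+\<omega>. ennreal (exp (\<Sum>y\<in>Y. s y * X y \<omega>)) \<partial>M) =
    (\<Prod>y\<in>Y. \<integral>\<^sup>+\<omega>. ennreal (exp (s y * X y \<omega>)) \<partial>M)"
proof -
  have "indep_vars (\<lambda>_. borel) X Y" using assms(1) by (rule indep_vars_subset) simp
  then have "indep_vars (\<lambda>_. borel) (\<lambda>y \<omega>. ennreal (exp (s y * X y \<omega>))) Y"
    by (rule indep_vars_compose2) simp
  then have "(\<integral>\<^sup>+\<omega>. (\<Prod>y\<in>Y. ennreal (exp (s y * X y \<omega>))) \<partial>M) = (\<Prod>y\<in>Y. \<integral>\<^sup>+\<omega>. ennreal (exp (s y * X y \<omega>)) \<partial>M)"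
    using assms(2) by (intro indep_vars_nn_integral) auto
  moreover have "(\<Prod>y\<in>Y. ennreal (exp (s y * X y \<omega>))) = ennreal (exp (\<Sum>y\<in>Y. s y * X y \<omega>))" for \<omega>
    using assms(2) by (simp add: prod_ennreal exp_sum)
  ultimately show ?thesis by simp
qed

lemma green_square_tail:
  assumes "\<epsilon> > 0"
  obtains F where "finite F" "\<And>S. finite S \<Longrightarrow> S \<inter> F = {} \<Longrightarrow> (\<Sum>z\<in>S. (gr z)\<^sup>2) < \<epsilon>"
proof -
  let ?f = "\<lambda>z. (gr z)\<^sup>2"
  have s: "?f summable_on UNIV" by (rule green_square_summable[OF dim])
  define I where "I = infsum ?f UNIV"
  have "(?f has_sum I) UNIV" using s by (simp add: I_def)
  then have "((\<lambda>F. sum ?f F) \<longlongrightarrow> I) (finite_subsets_at_top UNIV)" by (simp add: has_sum_def)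
  then have "\<forall>\<^sub>F F in finite_subsets_at_top UNIV. I - \<epsilon> < sum ?f F"
    by (rule order_tendstoD(1)) (use assms in simp)
  then obtain F where F: "finite F" "I - \<epsilon> < sum ?f F"
    by (auto simp: eventually_finite_subsets_at_top)
  show thesis
  proof (rule that[OF F(1)])
    fix S assume S: "finite S" "S \<inter> F = {}"
    have "sum ?f (S \<union> F) \<le> I" unfolding I_def using S F s by (intro finite_sum_le_infsum) auto
    moreover have "sum ?f (S \<union> F) = sum ?f S + sum ?f F" using S F by (intro sum.union_disjoint) auto
    ultimately show "sum ?f S < \<epsilon>" using F by linarith
  qed
qed

text \<open>
  The conjugate exponent is at least 2, so the square summability of the bounded function
  \<open>green 0\<close> suffices.
\<close>

lemma green_powr_summable:
  assumes a: "1 < a" "a \<le> 2"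
  shows "(\<lambda>z. gr z powr (a / (a - 1))) summable_on UNIV"
proof -
  define q where "q = a / (a - 1)"
  have q: "q \<ge> 2" using a by (simp add: q_def field_simps)
  have s: "(\<lambda>z. Gstar TYPE('d) powr (q - 2) * (gr z)\<^sup>2) summable_on UNIV"
    by (intro summable_on_cmult_right green_square_summable[OF dim])
  show ?thesis unfolding q_def[symmetric]
  proof (rule summable_on_comparison_test[OF s])
    fix z
    show "gr z powr q \<le> Gstar TYPE('d) powr (q - 2) * (gr z)\<^sup>2"
    proof (cases "gr z = 0")
      case False
      then have g: "gr z > 0" using gr_nonneg[of z] by simp
      have "gr z powr q = gr z powr (q - 2) * gr z powr 2" by (subst powr_add[symmetric]) simp
      also have "\<dots> \<le> Gstar TYPE('d) powr (q - 2) * gr z powr 2"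
        using g q gr_le_Gstar by (intro mult_right_mono powr_mono2) auto
      finally show ?thesis using g by simp
    qed simp
  qed simp
qed

lemma sum_green_powr_le:
  assumes a: "1 < a" "a \<le> 2" and F: "finite F"
  shows "(\<Sum>z\<in>F. gr z powr (a / (a - 1))) \<le> Gstar_pow TYPE('d) a"
  unfolding Gstar_pow_def using green_powr_summable[OF a] F by (intro finite_sum_le_infsum) auto

lemma Gstar_pow_ge_1:
  assumes a: "1 < a" "a \<le> 2" shows "Gstar_pow TYPE('d) a \<ge> 1"
proof -
  have "1 \<le> gr 0 powr (a / (a - 1))"
    using Gstar_ge_one a by (intro ge_one_powr_ge_zero) (auto simp: Gstar_def)
  also have "\<dots> \<le> Gstar_pow TYPE('d) a" using sum_green_powr_le[OF a, of "{0}"] by simp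
  finally show ?thesis .
qed

text \<open>
  The sum of \<open>rate_mgf \<alpha> c (\<kappa> * green 0 z)\<close> over all sites \<open>z\<close>.
\<close>

definition field_rate :: "real \<Rightarrow> real \<Rightarrow> real" where
  "field_rate c \<kappa> = (if \<alpha> \<le> 1 then 0 else young_const \<alpha> c * \<kappa> powr (\<alpha> / (\<alpha> - 1)) * Gstar_pow TYPE('d) \<alpha>)"

lemma sum_rate_mgf_le:
  assumes "finite F" "\<kappa> \<ge> 0"
  shows "(\<Sum>z\<in>F. rate_mgf \<alpha> c (\<kappa> * gr z)) \<le> field_rate c \<kappa>"
proof (cases "\<alpha> \<le> 1")
  case False
  then have "(\<Sum>z\<in>F. rate_mgf \<alpha> c (\<kappa> * gr z)) = young_const \<alpha> c * \<kappa> powr (\<alpha> / (\<alpha> - 1)) * (\<Sum>z\<in>F. gr z powr (\<alpha> / (\<alpha> - 1)))"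
    using assms(2) gr_nonneg by (simp add: rate_mgf_def powr_mult sum_distrib_left mult.assoc)
  also have "\<dots> \<le> young_const \<alpha> c * \<kappa> powr (\<alpha> / (\<alpha> - 1)) * Gstar_pow TYPE('d) \<alpha>"
    using False \<alpha> assms by (intro mult_left_mono sum_green_powr_le mult_nonneg_nonneg young_const_nonneg) auto
  finally show ?thesis using False by (simp add: field_rate_def)
qed (simp add: rate_mgf_def field_rate_def)

text \<open>
  Outside a large finite set \<open>F\<close> the quadratic bound costs a small multiple of \<open>l\<close>; inside, the sharp
  bound costs an additional constant per site, which is small compared with \<open>l\<close>.
\<close>

lemma field_mgf:
  assumes c: "c > 0" and B: "B \<ge> 1" and \<kappa>: "\<kappa> > 0" and A: "A > 0"
    and small: "\<alpha> \<le> 1 \<Longrightarrow> \<kappa> * Gstar TYPE('d) * A powr (1 - \<alpha>) < c" and \<zeta>: "\<zeta> > 0"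
  obtains l0 where "l0 \<ge> 1" "\<And>l X Y x g. l \<ge> l0 \<Longrightarrow> good_family c B A l X \<Longrightarrow> finite Y \<Longrightarrow>
     (\<And>y. y \<in> Y \<Longrightarrow> 0 \<le> g y \<and> g y \<le> gr (y - x)) \<Longrightarrow>
     (\<integral>\<^sup>+\<omega>. ennreal (exp (\<kappa> * l powr ((\<alpha> - 1) / \<alpha>) * (\<Sum>y\<in>Y. g y * X y \<omega>))) \<partial>M) \<le>
       ennreal (exp ((field_rate c \<kappa> + \<zeta>) * l))"
proof -
  have "Gstar TYPE('d) > 0" using Gstar_ge_one by simp
  obtain C where C: "C \<ge> 0"
    and C1: "\<And>l X g. l \<ge> 1 \<Longrightarrow> sub_weibull M \<alpha> c B X \<Longrightarrow> (\<And>\<omega>. \<alpha> \<le> 1 \<Longrightarrow> \<bar>X \<omega>\<bar> \<le> A * l powr (1 / \<alpha>)) \<Longrightarrow>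
       0 \<le> g \<Longrightarrow> g \<le> Gstar TYPE('d) \<Longrightarrow>
       (\<integral>\<^sup>+\<omega>. ennreal (exp (\<kappa> * l powr ((\<alpha> - 1) / \<alpha>) * g * X \<omega>)) \<partial>M) \<le> ennreal (exp (C * g\<^sup>2 * l))"
    and C2: "\<And>l X g. l \<ge> 1 \<Longrightarrow> sub_weibull M \<alpha> c B X \<Longrightarrow> (\<And>\<omega>. \<alpha> \<le> 1 \<Longrightarrow> \<bar>X \<omega>\<bar> \<le> A * l powr (1 / \<alpha>)) \<Longrightarrow>
       0 \<le> g \<Longrightarrow> g \<le> Gstar TYPE('d) \<Longrightarrow>
       (\<integral>\<^sup>+\<omega>. ennreal (exp (\<kappa> * l powr ((\<alpha> - 1) / \<alpha>) * g * X \<omega>)) \<partial>M) \<le>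
          ennreal (exp (rate_mgf \<alpha> c (\<kappa> * g) * l + C))"
    using scaled_mgf_bounds[OF \<alpha> c B \<kappa> \<open>Gstar TYPE('d) > 0\<close> A small] by blast
  define \<epsilon> where "\<epsilon> = \<zeta> / (2 * (C + 1))"
  have \<epsilon>: "\<epsilon> > 0" using \<zeta> C by (simp add: \<epsilon>_def)
  obtain F where F: "finite F" "\<And>S. finite S \<Longrightarrow> S \<inter> F = {} \<Longrightarrow> (\<Sum>z\<in>S. (gr z)\<^sup>2) < \<epsilon>"
    using green_square_tail[OF \<epsilon>] by blast
  define l0 where "l0 = max 1 (2 * C * real (card F) / \<zeta>)"
  show thesis
  proof (rule that[of l0])
    show "l0 \<ge> 1" by (simp add: l0_def)
  next
    fix l X Y x g
    assume l: "l0 \<le> (l::real)" and X: "good_family c B A l X" and Y: "finite Y"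
      and g: "\<And>y. y \<in> Y \<Longrightarrow> 0 \<le> g y \<and> g y \<le> gr (y - x)"
    have l1: "l \<ge> 1" and lF: "C * real (card F) \<le> \<zeta> / 2 * l"
      using l \<zeta> by (auto simp: l0_def field_simps)
    define p where "p = \<kappa> * l powr ((\<alpha> - 1) / \<alpha>)"
    define e where "e z = (if z \<in> F then rate_mgf \<alpha> c (\<kappa> * gr z) * l + C else C * (gr z)\<^sup>2 * l)" for z
    have each: "(\<integral>\<^sup>+\<omega>. ennreal (exp (p * g y * X y \<omega>)) \<partial>M) \<le> ennreal (exp (e (y - x)))" if y: "y \<in> Y" for y
    proof -
      have gy: "0 \<le> g y" "g y \<le> gr (y - x)" "g y \<le> Gstar TYPE('d)" using g[OF y] gr_le_Gstar[of "y - x"] by auto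
      have Xy: "sub_weibull M \<alpha> c B (X y)" "\<And>\<omega>. \<alpha> \<le> 1 \<Longrightarrow> \<bar>X y \<omega>\<bar> \<le> A * l powr (1 / \<alpha>)"
        using X by (auto simp: good_family_def)
      show ?thesis
      proof (cases "y - x \<in> F")
        case True
        have "rate_mgf \<alpha> c (\<kappa> * g y) \<le> rate_mgf \<alpha> c (\<kappa> * gr (y - x))"
          using gy \<kappa> by (intro rate_mgf_mono) auto
        then have "rate_mgf \<alpha> c (\<kappa> * g y) * l + C \<le> e (y - x)"
          using True l1 by (simp add: e_def mult_right_mono)
        then show ?thesis
          unfolding p_def by (intro order_trans[OF C2[OF l1 Xy gy(1,3)]] ennreal_leI) auto
      next
        case False
        have "C * (g y)\<^sup>2 * l \<le> e (y - x)"
          using False l1 C gy by (auto simp: e_def intro!: mult_right_mono mult_left_mono power_mono)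
        then show ?thesis
          unfolding p_def by (intro order_trans[OF C1[OF l1 Xy gy(1,3)]] ennreal_leI) auto
      qed
    qed
    have "(\<integral>\<^sup>+\<omega>. ennreal (exp (p * (\<Sum>y\<in>Y. g y * X y \<omega>))) \<partial>M) = (\<integral>\<^sup>+\<omega>. ennreal (exp (\<Sum>y\<in>Y. (p * g y) * X y \<omega>)) \<partial>M)"
      by (simp add: sum_distrib_left mult.assoc)
    also have "\<dots> = (\<Prod>y\<in>Y. \<integral>\<^sup>+\<omega>. ennreal (exp ((p * g y) * X y \<omega>)) \<partial>M)"
      using X Y by (intro family_mgf) (auto simp: good_family_def)
    also have "\<dots> \<le> (\<Prod>y\<in>Y. ennreal (exp (e (y - x))))"
      by (rule prod_mono_ennreal) (use each in auto)
    also have "\<dots> = ennreal (exp (\<Sum>y\<in>Y. e (y - x)))"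
      using Y by (simp add: prod_ennreal exp_sum)
    also have "(\<Sum>y\<in>Y. e (y - x)) = (\<Sum>z\<in>(\<lambda>y. y - x) ` Y. e z)"
      by (subst sum.reindex) (auto simp: inj_on_def)
    also have "\<dots> \<le> (field_rate c \<kappa> + \<zeta>) * l"
    proof -
      define Z where "Z = (\<lambda>y. y - x) ` Y"
      have Z: "finite Z" using Y by (simp add: Z_def)
      have "(\<Sum>z\<in>Z. e z) = (\<Sum>z\<in>Z \<inter> F. e z) + (\<Sum>z\<in>Z - F. e z)"
        using sum.Int_Diff[OF Z, of e F] .
      also have "(\<Sum>z\<in>Z \<inter> F. e z) = (\<Sum>z\<in>Z \<inter> F. rate_mgf \<alpha> c (\<kappa> * gr z)) * l + C * card (Z \<inter> F)"
        by (simp add: e_def sum.distrib sum_distrib_right)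
      also have "\<dots> \<le> field_rate c \<kappa> * l + C * card F"
      proof -
        have "card (Z \<inter> F) \<le> card F" using F(1) by (intro card_mono) auto
        then show ?thesis
          using sum_rate_mgf_le[of "Z \<inter> F" \<kappa> c] F(1) \<kappa> l1 C by (intro add_mono mult_right_mono mult_left_mono) auto
      qed
      also have "(\<Sum>z\<in>Z - F. e z) = C * l * (\<Sum>z\<in>Z - F. (gr z)\<^sup>2)"
        by (simp add: e_def sum_distrib_left mult_ac)
      also have "\<dots> \<le> C * l * \<epsilon>"
      proof (rule mult_left_mono)
        show "(\<Sum>z\<in>Z - F. (gr z)\<^sup>2) \<le> \<epsilon>" using F(2)[of "Z - F"] Z by force
      qed (use C l1 in simp)
      also have "C * l * \<epsilon> \<le> \<zeta> / 2 * l"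
      proof -
        have "C * \<epsilon> \<le> (C + 1) * \<epsilon>" using \<epsilon> by simp
        also have "\<dots> = \<zeta> / 2" using C by (simp add: \<epsilon>_def field_simps)
        finally have "C * \<epsilon> * l \<le> \<zeta> / 2 * l" using l1 by (intro mult_right_mono) auto
        then show ?thesis by (simp add: mult_ac)
      qed
      finally show ?thesis using lF unfolding Z_def by (simp add: algebra_simps)
    qed
    finally show "(\<integral>\<^sup>+\<omega>. ennreal (exp (\<kappa> * l powr ((\<alpha> - 1) / \<alpha>) * (\<Sum>y\<in>Y. g y * X y \<omega>))) \<partial>M) \<le>
       ennreal (exp ((field_rate c \<kappa> + \<zeta>) * l))"
      by (simp add: p_def ennreal_leI)
  qed
qed

text \<open>
  Away from a large finite set the Green function and the sum of its squares are as small as desired,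
  so any \<open>\<kappa>\<close> is admissible and the exponent is at most \<open>l\<close>.
\<close>

lemma far_mgf:
  assumes c: "c > 0" and B: "B \<ge> 1" and \<kappa>: "\<kappa> > 0" and A: "A > 0"
  obtains F where "finite F" "\<And>l X Y x g. l \<ge> 1 \<Longrightarrow> good_family c B A l X \<Longrightarrow> finite Y \<Longrightarrow>
     (\<And>y. y \<in> Y \<Longrightarrow> 0 \<le> g y \<and> g y \<le> gr (y - x)) \<Longrightarrow> (\<And>y. y \<in> Y \<Longrightarrow> y - x \<in> F \<Longrightarrow> g y = 0) \<Longrightarrow>
     (\<integral>\<^sup>+\<omega>. ennreal (exp (\<kappa> * l powr ((\<alpha> - 1) / \<alpha>) * (\<Sum>y\<in>Y. g y * X y \<omega>))) \<partial>M) \<le> ennreal (exp l)"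
proof -
  define \<gamma> where "\<gamma> = c / (2 * \<kappa> * A powr (1 - \<alpha>))"
  have \<gamma>: "\<gamma> > 0" "\<kappa> * \<gamma> * A powr (1 - \<alpha>) < c" using c \<kappa> A by (simp_all add: \<gamma>_def)
  have small: "\<alpha> \<le> 1 \<Longrightarrow> \<kappa> * \<gamma> * A powr (1 - \<alpha>) < c" using \<gamma>(2) .
  obtain C where C: "C \<ge> 0"
    and C1: "\<And>l X g. l \<ge> 1 \<Longrightarrow> sub_weibull M \<alpha> c B X \<Longrightarrow> (\<And>\<omega>. \<alpha> \<le> 1 \<Longrightarrow> \<bar>X \<omega>\<bar> \<le> A * l powr (1 / \<alpha>)) \<Longrightarrow>
       0 \<le> g \<Longrightarrow> g \<le> \<gamma> \<Longrightarrow>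
       (\<integral>\<^sup>+\<omega>. ennreal (exp (\<kappa> * l powr ((\<alpha> - 1) / \<alpha>) * g * X \<omega>)) \<partial>M) \<le> ennreal (exp (C * g\<^sup>2 * l))"
    and "\<And>l X g. l \<ge> 1 \<Longrightarrow> sub_weibull M \<alpha> c B X \<Longrightarrow> (\<And>\<omega>. \<alpha> \<le> 1 \<Longrightarrow> \<bar>X \<omega>\<bar> \<le> A * l powr (1 / \<alpha>)) \<Longrightarrow>
       0 \<le> g \<Longrightarrow> g \<le> \<gamma> \<Longrightarrow>
       (\<integral>\<^sup>+\<omega>. ennreal (exp (\<kappa> * l powr ((\<alpha> - 1) / \<alpha>) * g * X \<omega>)) \<partial>M) \<le>
          ennreal (exp (rate_mgf \<alpha> c (\<kappa> * g) * l + C))"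
    using scaled_mgf_bounds[OF \<alpha> c B \<kappa> \<gamma>(1) A small] by blast
  obtain F1 where F1: "finite F1" "\<And>S. finite S \<Longrightarrow> S \<inter> F1 = {} \<Longrightarrow> (\<Sum>z\<in>S. (gr z)\<^sup>2) < \<gamma>\<^sup>2"
    using green_square_tail[of "\<gamma>\<^sup>2"] \<gamma> by auto
  obtain F2 where F2: "finite F2" "\<And>S. finite S \<Longrightarrow> S \<inter> F2 = {} \<Longrightarrow> (\<Sum>z\<in>S. (gr z)\<^sup>2) < 1 / (C + 1)"
    using green_square_tail[of "1 / (C + 1)"] C by auto
  have smallg: "gr z \<le> \<gamma>" if "z \<notin> F1" for z
  proof -
    have "(gr z)\<^sup>2 < \<gamma>\<^sup>2" using F1(2)[of "{z}"] that by simp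
    then show ?thesis using power_less_imp_less_base[of "gr z" 2 \<gamma>] \<gamma> by simp
  qed
  show thesis
  proof (rule that[of "F1 \<union> F2"])
    show "finite (F1 \<union> F2)" using F1 F2 by simp
  next
    fix l X Y x g
    assume l1: "1 \<le> (l::real)" and X: "good_family c B A l X" and Y: "finite Y"
      and g: "\<And>y. y \<in> Y \<Longrightarrow> 0 \<le> g y \<and> g y \<le> gr (y - x)"
      and g0: "\<And>y. y \<in> Y \<Longrightarrow> y - x \<in> F1 \<union> F2 \<Longrightarrow> g y = 0"
    define p where "p = \<kappa> * l powr ((\<alpha> - 1) / \<alpha>)"
    have each: "(\<integral>\<^sup>+\<omega>. ennreal (exp (p * g y * X y \<omega>)) \<partial>M) \<le> ennreal (exp (C * (g y)\<^sup>2 * l))" if y: "y \<in> Y" for y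
    proof -
      have "g y \<le> \<gamma>" using g0[OF y] g[OF y] smallg[of "y - x"] \<gamma>(1) by (cases "y - x \<in> F1 \<union> F2") auto
      then show ?thesis unfolding p_def using X g[OF y] by (intro C1[OF l1]) (auto simp: good_family_def)
    qed
    have "(\<integral>\<^sup>+\<omega>. ennreal (exp (p * (\<Sum>y\<in>Y. g y * X y \<omega>))) \<partial>M) = (\<integral>\<^sup>+\<omega>. ennreal (exp (\<Sum>y\<in>Y. (p * g y) * X y \<omega>)) \<partial>M)"
      by (simp add: sum_distrib_left mult.assoc)
    also have "\<dots> = (\<Prod>y\<in>Y. \<integral>\<^sup>+\<omega>. ennreal (exp ((p * g y) * X y \<omega>)) \<partial>M)"
      using X Y by (intro family_mgf) (auto simp: good_family_def)
    also have "\<dots> \<le> (\<Prod>y\<in>Y. ennreal (exp (C * (g y)\<^sup>2 * l)))"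
      by (rule prod_mono_ennreal) (use each in auto)
    also have "\<dots> = ennreal (exp (\<Sum>y\<in>Y. C * (g y)\<^sup>2 * l))"
      using Y by (simp add: prod_ennreal exp_sum)
    also have "(\<Sum>y\<in>Y. C * (g y)\<^sup>2 * l) = C * l * (\<Sum>y\<in>Y. (g y)\<^sup>2)"
      by (simp add: sum_distrib_left mult_ac)
    also have "(\<Sum>y\<in>Y. (g y)\<^sup>2) \<le> (\<Sum>z\<in>(\<lambda>y. y - x) ` Y - F2. (gr z)\<^sup>2)"
    proof -
      have "(\<Sum>y\<in>Y. (g y)\<^sup>2) = (\<Sum>y\<in>{y \<in> Y. y - x \<notin> F2}. (g y)\<^sup>2)"
        using Y g0 by (intro sum.mono_neutral_right) auto
      also have "\<dots> \<le> (\<Sum>y\<in>{y \<in> Y. y - x \<notin> F2}. (gr (y - x))\<^sup>2)"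
        using g by (intro sum_mono power_mono) auto
      also have "\<dots> = (\<Sum>z\<in>(\<lambda>y. y - x) ` {y \<in> Y. y - x \<notin> F2}. (gr z)\<^sup>2)"
        by (subst sum.reindex) (auto simp: inj_on_def)
      also have "(\<lambda>y. y - x) ` {y \<in> Y. y - x \<notin> F2} = (\<lambda>y. y - x) ` Y - F2" by auto
      finally show ?thesis .
    qed
    also have "\<dots> \<le> 1 / (C + 1)" using Y F2(2)[of "(\<lambda>y. y - x) ` Y - F2"] by (intro less_imp_le) auto
    finally have "(\<integral>\<^sup>+\<omega>. ennreal (exp (p * (\<Sum>y\<in>Y. g y * X y \<omega>))) \<partial>M) \<le> ennreal (exp (C * l * (1 / (C + 1))))"
      using C l1 by (simp add: mult_left_mono ennreal_leI)
    also have "C * l * (1 / (C + 1)) \<le> l" using C l1 by (simp add: field_simps)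
    finally show "(\<integral>\<^sup>+\<omega>. ennreal (exp (\<kappa> * l powr ((\<alpha> - 1) / \<alpha>) * (\<Sum>y\<in>Y. g y * X y \<omega>))) \<partial>M) \<le> ennreal (exp l)"
      by (simp add: p_def ennreal_leI)
  qed
qed

end

lemma (in prob_space) chernoff_bound:
  assumes [measurable]: "S \<in> borel_measurable M" and s: "s \<ge> 0"
    and mgf: "(\<integral>\<^sup>+\<omega>. ennreal (exp (s * S \<omega>)) \<partial>M) \<le> ennreal c" "c \<ge> 0"
  shows "prob {\<omega> \<in> space M. S \<omega> > t} \<le> c * exp (- s * t)"
proof -
  have "emeasure M {\<omega> \<in> space M. S \<omega> > t} = (\<integral>\<^sup>+\<omega>. indicator {\<omega> \<in> space M. S \<omega> > t} \<omega> \<partial>M)"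
    by (subst nn_integral_indicator) auto
  also have "\<dots> \<le> (\<integral>\<^sup>+\<omega>. ennreal (exp (- s * t)) * ennreal (exp (s * S \<omega>)) \<partial>M)"
  proof (rule nn_integral_mono)
    fix \<omega>
    have "1 \<le> exp (s * (S \<omega> - t))" if "S \<omega> > t" using that s by simp
    moreover have "exp (s * (S \<omega> - t)) = exp (- s * t) * exp (s * S \<omega>)"
      by (simp add: algebra_simps flip: exp_add)
    ultimately show "indicator {\<omega> \<in> space M. S \<omega> > t} \<omega> \<le> ennreal (exp (- s * t)) * ennreal (exp (s * S \<omega>))"
      by (auto simp: indicator_def simp flip: ennreal_mult')
  qed
  also have "\<dots> = ennreal (exp (- s * t)) * (\<integral>\<^sup>+\<omega>. ennreal (exp (s * S \<omega>)) \<partial>M)"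
    by (rule nn_integral_cmult) measurable
  also have "\<dots> \<le> ennreal (exp (- s * t)) * ennreal c" by (intro mult_left_mono mgf) auto
  also have "\<dots> = ennreal (c * exp (- s * t))" using mgf(2) by (subst ennreal_mult[symmetric]) (auto simp: mult.commute)
  finally show ?thesis using mgf(2) by (simp add: emeasure_eq_measure)
qed

lemma card_lattice_box_le:
  assumes "N \<ge> 1"
  shows "real (card (lattice_box N :: 'd::finite site set)) \<le> 3 ^ CARD('d) * exp (real CARD('d) * ln (real N))"
proof -
  have "real (card (lattice_box N :: 'd site set)) = (2 * real N + 1) ^ CARD('d)"
    by (simp add: card_lattice_box add.commute)
  also have "\<dots> \<le> (3 * real N) ^ CARD('d)"
    using assms by (intro power_mono) auto
  also have "\<dots> = 3 ^ CARD('d) * exp (real CARD('d) * ln (real N))"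
    using assms by (simp add: power_mult_distrib exp_of_nat_mult)
  finally show ?thesis .
qed

context random_field
begin

definition level :: "nat \<Rightarrow> real" where
  "level N = ln (real N) powr (1 / \<alpha>)"

definition far :: "nat \<Rightarrow> 'd site set \<Rightarrow> 'd site \<Rightarrow> 'w \<Rightarrow> real" where
  "far N F x \<omega> = (\<Sum>y\<in>lattice_box N. (if y - x \<in> F then 0 else box_green N x y) * \<eta> y \<omega>)"

definition near :: "nat \<Rightarrow> 'd site set \<Rightarrow> 'd site \<Rightarrow> 'w \<Rightarrow> real" where
  "near N F x \<omega> = (\<Sum>y\<in>lattice_box N. (if y - x \<in> F then box_green N x y else 0) * \<eta> y \<omega>)"

lemma far_measurable [measurable]: "far N F x \<in> borel_measurable M"
  unfolding far_def by measurable

lemma near_measurable [measurable]: "near N F x \<in> borel_measurable M"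
  unfolding near_def by measurable

lemma mean_field_near_far: "mean_field N (\<lambda>y. \<eta> y \<omega>) x = near N F x \<omega> + far N F x \<omega>"
  unfolding mean_field_def near_def far_def by (subst sum.distrib[symmetric]) (auto intro!: sum.cong)

lemma mean_field_measurable [measurable]: "(\<lambda>\<omega>. mean_field N (\<lambda>y. \<eta> y \<omega>) x) \<in> borel_measurable M"
  unfolding mean_field_def by measurable

lemma eventually_ln_ge: "\<forall>\<^sub>F N in sequentially. ln (real N) \<ge> c"
  by real_asymp

lemma tail_prob:
  assumes sw: "sub_weibull M \<alpha> c B (\<eta> 0)" and c: "c > 0" and B: "B \<ge> 1" and r: "r \<ge> 0"
  shows "prob {\<omega> \<in> space M. \<bar>\<eta> y \<omega>\<bar> > r} \<le> B * exp (- c * r powr \<alpha>)"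
proof -
  have "(\<integral>\<^sup>+\<omega>. ennreal (exp (c * \<bar>\<eta> y \<omega>\<bar> powr \<alpha>)) \<partial>M) \<le> ennreal B"
    using sub_weibull_all[OF sw, of y] by (simp add: sub_weibull_def)
  then have "prob {\<omega> \<in> space M. \<bar>\<eta> y \<omega>\<bar> powr \<alpha> > r powr \<alpha>} \<le> B * exp (- c * r powr \<alpha>)"
    using c B by (intro chernoff_bound) auto
  moreover have "prob {\<omega> \<in> space M. \<bar>\<eta> y \<omega>\<bar> > r} \<le> prob {\<omega> \<in> space M. \<bar>\<eta> y \<omega>\<bar> powr \<alpha> > r powr \<alpha>}"
    using r \<alpha> by (intro finite_measure_mono) (auto intro!: powr_less_mono2)
  ultimately show ?thesis by linarith
qed

text \<open>
  The event on which truncation at \<open>A * level N\<close> changes the disorder in the box.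
\<close>

definition overflow :: "real \<Rightarrow> nat \<Rightarrow> 'w set" where
  "overflow A N = {\<omega> \<in> space M. \<exists>y\<in>lattice_box N. \<bar>\<eta> y \<omega>\<bar> > A * level N}"

lemma overflow_measurable [measurable]: "overflow A N \<in> events"
  unfolding overflow_def by measurable

lemma prob_overflow_le:
  assumes sw: "sub_weibull M \<alpha> c B (\<eta> 0)" and c: "c > 0" and B: "B \<ge> 1" and A: "A > 0" and N: "N \<ge> 1"
  shows "prob (overflow A N) \<le> 3 ^ CARD('d) * B * exp ((real CARD('d) - c * A powr \<alpha>) * ln (real N))"
proof -
  have l: "ln (real N) \<ge> 0" using N by simp
  have pw: "(A * level N) powr \<alpha> = A powr \<alpha> * ln (real N)"
    using A \<alpha> l by (simp add: level_def powr_mult powr_powr)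
  have "overflow A N = (\<Union>y\<in>lattice_box N. {\<omega> \<in> space M. \<bar>\<eta> y \<omega>\<bar> > A * level N})"
    by (auto simp: overflow_def)
  then have "prob (overflow A N) \<le> (\<Sum>y\<in>(lattice_box N :: 'd site set). prob {\<omega> \<in> space M. \<bar>\<eta> y \<omega>\<bar> > A * level N})"
    by (simp only:) (intro measure_UNION_le, auto)
  also have "\<dots> \<le> (\<Sum>y\<in>(lattice_box N :: 'd site set). B * exp (- c * (A * level N) powr \<alpha>))"
    using A by (intro sum_mono tail_prob[OF sw c B]) (simp add: level_def)
  also have "\<dots> = real (card (lattice_box N :: 'd site set)) * (B * exp (- (c * A powr \<alpha>) * ln (real N)))"
    by (simp add: pw)
  also have "\<dots> \<le> (3 ^ CARD('d) * exp (real CARD('d) * ln (real N))) * (B * exp (- (c * A powr \<alpha>) * ln (real N)))"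
    using B by (intro mult_right_mono card_lattice_box_le N) auto
  also have "\<dots> = 3 ^ CARD('d) * B * exp ((real CARD('d) - c * A powr \<alpha>) * ln (real N))"
    by (simp add: algebra_simps flip: exp_add)
  finally show ?thesis .
qed

lemma admissible_rate_exists: "\<exists>c>0. tail_rate_above T c"
  using tail by (cases T) (auto intro: exI[of _ "_ / 2"] exI[of _ 1] simp: dense)

lemma level_scale:
  assumes "l \<ge> (1::real)"
  shows "(\<kappa> * l powr ((\<alpha> - 1) / \<alpha>)) * (t * l powr (1 / \<alpha>)) = \<kappa> * t * l"
proof -
  have "l powr ((\<alpha> - 1) / \<alpha>) * l powr (1 / \<alpha>) = l powr 1"
    using \<alpha> by (subst powr_add[symmetric]) (simp add: field_simps)
  then show ?thesis using assms by (simp add: mult_ac)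
qed

text \<open>
  The far part of the centre is a small multiple of \<open>level N\<close>, simultaneously at all sites and with
  probability \<open>1 - N\<^bsup>-K\<^esup>\<close> for any prescribed \<open>K\<close>: in \<open>far_mgf\<close> the parameter \<open>\<kappa>\<close> can be taken
  arbitrarily large.
\<close>

lemma far_field_small:
  assumes \<delta>: "\<delta> > 0"
  obtains F where "finite F" "\<And>F'. F \<subseteq> F' \<Longrightarrow>
    \<forall>\<^sub>F N in sequentially. prob {\<omega> \<in> space M. \<exists>x\<in>lattice_box N. \<bar>far N F' x \<omega>\<bar> > \<delta> * level N} \<le> exp (- K * ln (real N))"
proof -
  obtain c where c: "c > 0" "tail_rate_above T c" using admissible_rate_exists by blast
  obtain B where B: "B \<ge> 1" and sw: "sub_weibull M \<alpha> c B (\<eta> 0)"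
    using tail_sub_weibull[OF \<eta>_measurable symm tail c] by blast
  \<comment> \<open>Each of the events below has a probability of order \<open>N\<^bsup>-p\<^esup>\<close>, and there are of order \<open>N\<^bsup>d\<^esup>\<close> of them.\<close>
  define p where "p = max 1 (real CARD('d) + K + 1)"
  define A where "A = (p / c) powr (1 / \<alpha>)"
  have A: "A > 0" "c * A powr \<alpha> = p" using c \<alpha> by (auto simp: A_def p_def powr_powr)
  define \<kappa> where "\<kappa> = (p + 1) / \<delta>"
  have \<kappa>: "\<kappa> > 0" using \<delta> by (simp add: \<kappa>_def p_def)
  obtain F where F: "finite F" "\<And>l X Y x g. l \<ge> 1 \<Longrightarrow> good_family c B A l X \<Longrightarrow> finite Y \<Longrightarrow>
     (\<And>y. y \<in> Y \<Longrightarrow> 0 \<le> g y \<and> g y \<le> gr (y - x)) \<Longrightarrow> (\<And>y. y \<in> Y \<Longrightarrow> y - x \<in> F \<Longrightarrow> g y = 0) \<Longrightarrow>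
     (\<integral>\<^sup>+\<omega>. ennreal (exp (\<kappa> * l powr ((\<alpha> - 1) / \<alpha>) * (\<Sum>y\<in>Y. g y * X y \<omega>))) \<partial>M) \<le> ennreal (exp l)"
    using far_mgf[OF c(1) B \<kappa> A(1)] by blast
  show thesis
  proof (rule that[OF F(1)])
    fix F' assume FF: "F \<subseteq> F'"
    show "\<forall>\<^sub>F N in sequentially. prob {\<omega> \<in> space M. \<exists>x\<in>lattice_box N. \<bar>far N F' x \<omega>\<bar> > \<delta> * level N} \<le> exp (- K * ln (real N))"
      using eventually_ln_ge[of 1] eventually_ln_ge[of "ln (3 ^ CARD('d) * (B + 2))"] eventually_ge_at_top[of 1]
    proof eventually_elim
      case (elim N)
      define l where "l = ln (real N)"
      have l1: "l \<ge> 1" using elim by (simp add: l_def)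
      define X where "X y \<omega> = trunc (A * l powr (1 / \<alpha>)) (\<eta> y \<omega>)" for y \<omega>
      have X: "good_family c B A l X"
        unfolding X_def using good_family_trunc[OF sw] c A by auto
      have X': "good_family c B A l (\<lambda>y \<omega>. - X y \<omega>)" by (rule good_family_uminus[OF X])
      have [measurable]: "X y \<in> borel_measurable M" for y by (rule family_measurable[OF X])
      define g where "g x y = (if y - x \<in> F' then 0 else box_green N x y)" for x y
      have g: "0 \<le> g x y \<and> g x y \<le> gr (y - x)" "y - x \<in> F \<Longrightarrow> g x y = 0" for x y
        using box_green_nonneg[OF dim, of N x y] box_green_le_green[OF dim, of N x y] gr_nonneg[of "y - x"] FF
        by (auto simp: g_def)
      define s where "s = \<kappa> * l powr ((\<alpha> - 1) / \<alpha>)"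
      have s0: "s \<ge> 0" using \<kappa> by (simp add: s_def)
      have sd: "s * (\<delta> * level N) = (p + 1) * l"
        using level_scale[OF l1, of \<kappa> \<delta>] \<delta> by (simp add: s_def level_def l_def \<kappa>_def)
      define S where "S x \<omega> = (\<Sum>y\<in>lattice_box N. g x y * X y \<omega>)" for x \<omega>
      have [measurable]: "S x \<in> borel_measurable M" for x unfolding S_def by measurable
      have one: "prob {\<omega> \<in> space M. S x \<omega> > \<delta> * level N} \<le> exp (- p * l)" for x
      proof -
        have "prob {\<omega> \<in> space M. S x \<omega> > \<delta> * level N} \<le> exp l * exp (- s * (\<delta> * level N))"
          unfolding S_def using g F(2)[OF l1 X, of "lattice_box N" "g x" x]
          by (intro chernoff_bound s0) (auto simp: s_def)
        also have "\<dots> = exp (- p * l)" using sd by (simp add: algebra_simps flip: exp_add)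
        finally show ?thesis .
      qed
      have two: "prob {\<omega> \<in> space M. - S x \<omega> > \<delta> * level N} \<le> exp (- p * l)" for x
      proof -
        have e: "- S x \<omega> = (\<Sum>y\<in>lattice_box N. g x y * - X y \<omega>)" for \<omega> by (simp add: S_def sum_negf)
        have "prob {\<omega> \<in> space M. - S x \<omega> > \<delta> * level N} \<le> exp l * exp (- s * (\<delta> * level N))"
          unfolding e using g F(2)[OF l1 X', of "lattice_box N" "g x" x]
          by (intro chernoff_bound s0) (auto simp: s_def)
        also have "\<dots> = exp (- p * l)" using sd by (simp add: algebra_simps flip: exp_add)
        finally show ?thesis .
      qed
      have sub: "{\<omega> \<in> space M. \<exists>x\<in>lattice_box N. \<bar>far N F' x \<omega>\<bar> > \<delta> * level N} \<subseteq>
        overflow A N \<union> (\<Union>x\<in>lattice_box N. {\<omega> \<in> space M. S x \<omega> > \<delta> * level N} \<union> {\<omega> \<in> space M. - S x \<omega> > \<delta> * level N})"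
      proof
        fix \<omega> assume w: "\<omega> \<in> {\<omega> \<in> space M. \<exists>x\<in>lattice_box N. \<bar>far N F' x \<omega>\<bar> > \<delta> * level N}"
        show "\<omega> \<in> overflow A N \<union> (\<Union>x\<in>lattice_box N. {\<omega> \<in> space M. S x \<omega> > \<delta> * level N} \<union> {\<omega> \<in> space M. - S x \<omega> > \<delta> * level N})"
        proof (cases "\<omega> \<in> overflow A N")
          case False
          then have "X y \<omega> = \<eta> y \<omega>" if "y \<in> lattice_box N" for y
            using that w by (auto simp: overflow_def X_def trunc_def level_def l_def not_less)
          then have "far N F' x \<omega> = S x \<omega>" for x
            unfolding far_def S_def g_def by (intro sum.cong) auto
          then show ?thesis using w by (fastforce simp: abs_if split: if_splits)
        qed simp
      qed
      have "prob {\<omega> \<in> space M. \<exists>x\<in>lattice_box N. \<bar>far N F' x \<omega>\<bar> > \<delta> * level N} \<le>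
        prob (overflow A N \<union> (\<Union>x\<in>lattice_box N. {\<omega> \<in> space M. S x \<omega> > \<delta> * level N} \<union> {\<omega> \<in> space M. - S x \<omega> > \<delta> * level N}))"
        by (rule finite_measure_mono[OF sub]) measurable
      also have "\<dots> \<le> prob (overflow A N) + prob (\<Union>x\<in>lattice_box N. {\<omega> \<in> space M. S x \<omega> > \<delta> * level N} \<union> {\<omega> \<in> space M. - S x \<omega> > \<delta> * level N})"
        by (rule measure_Un_le) measurable
      also have "prob (\<Union>x\<in>lattice_box N. {\<omega> \<in> space M. S x \<omega> > \<delta> * level N} \<union> {\<omega> \<in> space M. - S x \<omega> > \<delta> * level N}) \<le>
         (\<Sum>x\<in>(lattice_box N :: 'd site set). prob ({\<omega> \<in> space M. S x \<omega> > \<delta> * level N} \<union> {\<omega> \<in> space M. - S x \<omega> > \<delta> * level N}))"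
        by (intro measure_UNION_le) auto
      also have "\<dots> \<le> (\<Sum>x\<in>(lattice_box N :: 'd site set). exp (- p * l) + exp (- p * l))"
      proof (rule sum_mono)
        fix x
        have "prob ({\<omega> \<in> space M. S x \<omega> > \<delta> * level N} \<union> {\<omega> \<in> space M. - S x \<omega> > \<delta> * level N}) \<le>
           prob {\<omega> \<in> space M. S x \<omega> > \<delta> * level N} + prob {\<omega> \<in> space M. - S x \<omega> > \<delta> * level N}"
          by (rule measure_Un_le) measurable
        then show "prob ({\<omega> \<in> space M. S x \<omega> > \<delta> * level N} \<union> {\<omega> \<in> space M. - S x \<omega> > \<delta> * level N}) \<le> exp (- p * l) + exp (- p * l)"
          using one[of x] two[of x] by linarith
      qed
      also have "\<dots> = real (card (lattice_box N :: 'd site set)) * (2 * exp (- p * l))" by simp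
      also have "\<dots> \<le> (3 ^ CARD('d) * exp (real CARD('d) * l)) * (2 * exp (- p * l))"
        using card_lattice_box_le[of N, where 'd = 'd] elim by (intro mult_right_mono) (auto simp: l_def)
      also have "\<dots> = 3 ^ CARD('d) * 2 * exp ((real CARD('d) - p) * l)"
        by (simp add: algebra_simps flip: exp_add)
      also have "prob (overflow A N) \<le> 3 ^ CARD('d) * B * exp ((real CARD('d) - p) * l)"
        using prob_overflow_le[OF sw c(1) B A(1), of N] elim A by (simp add: l_def)
      finally have "prob {\<omega> \<in> space M. \<exists>x\<in>lattice_box N. \<bar>far N F' x \<omega>\<bar> > \<delta> * level N} \<le>
         (3 ^ CARD('d) * (B + 2)) * exp ((real CARD('d) - p) * l)"
        by (simp add: algebra_simps)
      also have "3 ^ CARD('d) * (B + 2) \<le> exp l"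
        using elim(2) B by (subst ln_le_cancel_iff[symmetric]) (auto simp: l_def)
      also have "exp l * exp ((real CARD('d) - p) * l) = exp ((real CARD('d) - p + 1) * l)"
        by (simp add: algebra_simps flip: exp_add)
      also have "\<dots> \<le> exp (- K * l)"
      proof -
        have "real CARD('d) - p + 1 \<le> - K" unfolding p_def by linarith
        then have "(real CARD('d) - p + 1) * l \<le> - K * l" using l1 by (intro mult_right_mono) auto
        then show ?thesis by simp
      qed
      finally show ?case by (simp add: l_def)
    qed
  qed
qed

section \<open>The variational constant\<close>

lemma young_const_2: "c > 0 \<Longrightarrow> young_const 2 c = 1 / (4 * c)"
  by (simp add: young_const_def powr_minus_divide)

text \<open>
  The Gaussian part of the exponent.  For \<open>\<alpha> < 2\<close> it is of smaller order than \<open>log N\<close>.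
\<close>

definition gauss_rate :: "real \<Rightarrow> real" where
  "gauss_rate \<kappa> = (if \<alpha> = 2 then \<kappa>\<^sup>2 * Gstar TYPE('d) / 2 else 0)"

text \<open>
  The constant \<open>Mstar\<close> for \<open>\<alpha> = 2\<close> and tail constant \<open>c\<close>; its limit \<open>c \<longlongrightarrow> \<infinity>\<close> is the constant for light
  tails.
\<close>

definition quadratic_Mstar :: "real \<Rightarrow> real" where
  "quadratic_Mstar c = sqrt (2 * real CARD('d) * (Gstar TYPE('d) + Gstar_pow TYPE('d) 2 / (2 * c)))"

lemma quadratic_rate_optimum:
  assumes a: "\<alpha> = 2" and c: "c > 0"
  defines "\<kappa> \<equiv> quadratic_Mstar c / (Gstar TYPE('d) + Gstar_pow TYPE('d) 2 / (2 * c))"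
  shows "\<kappa> > 0" "field_rate c \<kappa> + gauss_rate \<kappa> + real CARD('d) = \<kappa> * quadratic_Mstar c"
proof -
  define S where "S = Gstar_pow TYPE('d) 2"
  define H where "H = Gstar TYPE('d) + S / (2 * c)"
  have S: "S \<ge> 1" unfolding S_def by (rule Gstar_pow_ge_1) auto
  have H: "H > 0" using S Gstar_ge_one c by (simp add: H_def add_pos_nonneg)
  have M: "quadratic_Mstar c > 0" "(quadratic_Mstar c)\<^sup>2 = 2 * real CARD('d) * H"
    using H by (simp_all add: quadratic_Mstar_def S_def[symmetric] H_def[symmetric])
  have \<kappa>: "\<kappa> = quadratic_Mstar c / H" by (simp add: \<kappa>_def H_def S_def)
  show \<kappa>0: "\<kappa> > 0" using \<kappa> H M by simp
  have "field_rate c \<kappa> + gauss_rate \<kappa> = \<kappa>\<^sup>2 * H / 2"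
    using a c \<kappa>0 by (simp add: field_rate_def gauss_rate_def young_const_2 S_def[symmetric] H_def field_simps)
  also have "\<dots> = real CARD('d)" using M H by (simp add: \<kappa> power_divide power2_eq_square[of H])
  finally have "field_rate c \<kappa> + gauss_rate \<kappa> = real CARD('d)" .
  moreover have "\<kappa> * quadratic_Mstar c = 2 * real CARD('d)"
    using M H by (simp add: \<kappa> power2_eq_square field_simps)
  ultimately show "field_rate c \<kappa> + gauss_rate \<kappa> + real CARD('d) = \<kappa> * quadratic_Mstar c" by simp
qed

text \<open>
  The tail constant available for upper bounds is any number below the true one.  By continuity it
  can be chosen so close that the bound stays below \<open>t\<close> and an open condition \<open>Q\<close> is preserved.
\<close>

lemma quadratic_rate_choice:
  assumes a: "\<alpha> = 2" and t: "t > Mstar TYPE('d) T"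
    and P: "T = TailLight \<or> (\<exists>c0. T = TailA 2 c0 \<and> Q c0)"
    and Q: "\<And>c0. Q c0 \<Longrightarrow> c0 > 0 \<Longrightarrow> \<forall>\<^sub>F c in at_left c0. Q c" "\<forall>\<^sub>F c in at_top. Q c"
  obtains c where "c > 0" "tail_rate_above T c" "quadratic_Mstar c < t" "Q c"
proof -
  define S where "S = Gstar_pow TYPE('d) 2"
  from P show thesis
  proof
    assume T: "T = TailLight"
    have "((\<lambda>c. quadratic_Mstar c) \<longlongrightarrow> sqrt (2 * real CARD('d) * (Gstar TYPE('d) + 0))) at_top"
      unfolding quadratic_Mstar_def S_def[symmetric]
      by (intro tendsto_intros tendsto_divide_0[OF tendsto_const]
          filterlim_at_top_imp_at_infinity filterlim_tendsto_pos_mult_at_top[OF tendsto_const _ filterlim_ident]) auto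
    then have "\<forall>\<^sub>F c in at_top. quadratic_Mstar c < t" 
      using t T by (intro order_tendstoD(2)) auto
    then have "\<forall>\<^sub>F c in at_top. quadratic_Mstar c < t \<and> Q c \<and> c > 0"
      using Q(2) eventually_gt_at_top[of 0] by eventually_elim simp
    then obtain c where "quadratic_Mstar c < t \<and> Q c \<and> c > 0"
      using eventually_happens'[OF trivial_limit_at_top_linorder] by blast
    then show thesis using T by (intro that[of c]) auto
  next
    assume "\<exists>c0. T = TailA 2 c0 \<and> Q c0"
    then obtain c0 where T: "T = TailA 2 c0" "Q c0" by blast
    have c0: "c0 > 0" using tail T by simp
    have "((\<lambda>c. quadratic_Mstar c) \<longlongrightarrow> quadratic_Mstar c0) (at_left c0)"
      unfolding quadratic_Mstar_def S_def[symmetric] using c0 by (intro tendsto_intros) auto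
    moreover have "quadratic_Mstar c0 = Mstar TYPE('d) T"
      using c0 by (simp add: quadratic_Mstar_def T field_simps)
    ultimately have "\<forall>\<^sub>F c in at_left c0. quadratic_Mstar c < t"
      using t by (intro order_tendstoD(2)) auto
    moreover have "\<forall>\<^sub>F c in at_left c0. 0 < c \<and> c < c0"
      by (rule eventually_at_leftI[OF _ c0]) simp
    ultimately have "\<forall>\<^sub>F c in at_left c0. quadratic_Mstar c < t \<and> Q c \<and> c > 0 \<and> c < c0"
      using Q(1)[OF T(2) c0] by eventually_elim simp
    then obtain c where "quadratic_Mstar c < t \<and> Q c \<and> c > 0 \<and> c < c0"
      using eventually_happens'[OF trivial_limit_at_left_real] by blast
    then show thesis using T by (intro that[of c]) auto
  qed
qed

text \<open>
  The last inequality makes the annealed probability that a given site exceeds \<open>t * level N\<close> smaller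
  than \<open>N\<^bsup>-d\<^esup>\<close>.  Its left side minus its right side is minimised over \<open>\<kappa>\<close>; it vanishes at the optimum for
  \<open>t\<close> equal to the constant \<open>Mstar\<close> with \<open>c\<close> in place of the true tail constant.  For \<open>\<alpha> \<le> 1\<close> the bound
  on \<open>\<kappa>\<close> imposed by the truncation level \<open>A\<close> takes the place of optimality, and \<open>A\<close> is just above
  the maximum of the disorder over the box.
\<close>

lemma rate_choice:
  assumes t: "t > Mstar TYPE('d) T"
  obtains c A \<kappa> where "c > 0" "tail_rate_above T c" "A > 0" "\<kappa> > 0" "c * A powr \<alpha> > real CARD('d)"
    "\<alpha> \<le> 1 \<Longrightarrow> \<kappa> * Gstar TYPE('d) * A powr (1 - \<alpha>) < c"
    "field_rate c \<kappa> + gauss_rate \<kappa> + real CARD('d) < \<kappa> * t"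
proof -
  have Gpos: "Gstar TYPE('d) > 0" using Gstar_ge_one by simp
  have bigA: "c * ((2 * real CARD('d) / c) powr (1 / \<alpha>)) powr \<alpha> > real CARD('d)" "(2 * real CARD('d) / c) powr (1 / \<alpha>) > 0" if "c > 0" for c
    using that \<alpha> by (simp_all add: powr_powr)
  consider (two) "\<alpha> = 2" | (low) a c0 where "T = TailA a c0" "a \<le> 1" | (mid) a c0 where "T = TailA a c0" "1 < a" "a < 2"
    using \<alpha> tail by (cases T) fastforce+
  then show thesis
  proof cases
    case two
    obtain c where c: "c > 0" "tail_rate_above T c" "quadratic_Mstar c < t"
    proof (rule quadratic_rate_choice[OF two t, of "\<lambda>_. True"])
      show "T = TailLight \<or> (\<exists>c0. T = TailA 2 c0 \<and> True)" using two tail by (cases T) auto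
    qed auto
    define \<kappa> where "\<kappa> = quadratic_Mstar c / (Gstar TYPE('d) + Gstar_pow TYPE('d) 2 / (2 * c))"
    have k: "\<kappa> > 0" "field_rate c \<kappa> + gauss_rate \<kappa> + real CARD('d) = \<kappa> * quadratic_Mstar c"
      unfolding \<kappa>_def by (rule quadratic_rate_optimum[OF two c(1)])+
    have "\<kappa> * quadratic_Mstar c < \<kappa> * t" using k c by simp
    then show thesis using bigA[OF c(1)] c k two
      by (intro that[of c "(2 * real CARD('d) / c) powr (1 / \<alpha>)" \<kappa>]) auto
  next
    case low
    have c0: "c0 > 0" and a: "a > 0" "\<alpha> = a" using tail low by auto
    have M: "Mstar TYPE('d) T = (real CARD('d) / c0) powr (1 / a) * Gstar TYPE('d)" using low by simp
    have "((\<lambda>c. (real CARD('d) / c) powr (1 / a) * Gstar TYPE('d)) \<longlongrightarrow> (real CARD('d) / c0) powr (1 / a) * Gstar TYPE('d)) (at_left c0)"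
      using c0 by (intro tendsto_intros) auto
    then have "\<forall>\<^sub>F c in at_left c0. (real CARD('d) / c) powr (1 / a) * Gstar TYPE('d) < t"
      using t M by (intro order_tendstoD(2)) auto
    moreover have "\<forall>\<^sub>F c in at_left c0. 0 < c \<and> c < c0"
      by (rule eventually_at_leftI[OF _ c0]) simp
    ultimately have "\<forall>\<^sub>F c in at_left c0. (real CARD('d) / c) powr (1 / a) * Gstar TYPE('d) < t \<and> c > 0 \<and> c < c0"
      by eventually_elim simp
    then obtain c where c: "(real CARD('d) / c) powr (1 / a) * Gstar TYPE('d) < t" "c > 0" "c < c0"
      using eventually_happens'[OF trivial_limit_at_left_real] by blast
    then have "(real CARD('d) / c) powr (1 / a) < t / Gstar TYPE('d)" using Gpos by (simp add: field_simps)
    then obtain A where A: "(real CARD('d) / c) powr (1 / a) < A" "A < t / Gstar TYPE('d)" using dense by blast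
    have Apos: "A > 0" using A(1) by (smt (verit) powr_ge_zero)
    have "((real CARD('d) / c) powr (1 / a)) powr a < A powr a" using A a by (intro powr_less_mono2) auto
    then have cA: "c * A powr a > real CARD('d)" using a c by (simp add: powr_powr field_simps)
    \<comment> \<open>With this \<open>\<kappa>\<close> the condition on the truncation level reads \<open>d < c * A\<^bsup>\<alpha>\<^esup>\<close>, and \<open>d < \<kappa> * t\<close> reads \<open>A * G < t\<close>.\<close>
    define \<kappa> where "\<kappa> = real CARD('d) / (A * Gstar TYPE('d))"
    have k: "\<kappa> > 0" using Apos Gpos by (simp add: \<kappa>_def)
    show thesis
    proof (rule that[of c A \<kappa>])
      have "\<kappa> * Gstar TYPE('d) * A powr (1 - a) = real CARD('d) / A powr a"
        using Apos Gpos by (simp add: \<kappa>_def powr_diff)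
      also have "\<dots> < c" using cA Apos by (simp add: field_simps)
      finally show "\<kappa> * Gstar TYPE('d) * A powr (1 - \<alpha>) < c" using a by simp
      have "real CARD('d) * (A * Gstar TYPE('d)) < real CARD('d) * t" using A Gpos by (simp add: field_simps)
      then have "real CARD('d) < \<kappa> * t" using Apos Gpos by (simp add: \<kappa>_def field_simps)
      then show "field_rate c \<kappa> + gauss_rate \<kappa> + real CARD('d) < \<kappa> * t"
        using low(2) a by (simp add: field_rate_def gauss_rate_def)
    next
      show "tail_rate_above T c" using c low(1) by simp
    qed (use c a cA Apos k in auto)
  next
    case mid
    have c0: "c0 > 0" and a: "a > 0" "\<alpha> = a" using tail mid by auto
    define S where "S = Gstar_pow TYPE('d) a"
    have S: "S \<ge> 1" unfolding S_def using mid by (intro Gstar_pow_ge_1) auto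
    have M: "Mstar TYPE('d) T = (real CARD('d) / c0) powr (1 / a) * S powr ((a - 1) / a)" using mid by (simp add: S_def)
    have "((\<lambda>c. (real CARD('d) / c) powr (1 / a) * S powr ((a - 1) / a)) \<longlongrightarrow> (real CARD('d) / c0) powr (1 / a) * S powr ((a - 1) / a)) (at_left c0)"
      using c0 by (intro tendsto_intros) auto
    then have "\<forall>\<^sub>F c in at_left c0. (real CARD('d) / c) powr (1 / a) * S powr ((a - 1) / a) < t"
      using t M by (intro order_tendstoD(2)) auto
    moreover have "\<forall>\<^sub>F c in at_left c0. 0 < c \<and> c < c0"
      by (rule eventually_at_leftI[OF _ c0]) simp
    ultimately have "\<forall>\<^sub>F c in at_left c0. (real CARD('d) / c) powr (1 / a) * S powr ((a - 1) / a) < t \<and> c > 0 \<and> c < c0"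
      by eventually_elim simp
    then obtain c where c: "(real CARD('d) / c) powr (1 / a) * S powr ((a - 1) / a) < t" "c > 0" "c < c0"
      using eventually_happens'[OF trivial_limit_at_left_real] by blast
    define u where "u = (real CARD('d) / (c * S)) powr (1 / a)"
    have u: "u > 0" "c * S * u powr a = real CARD('d)" using c S a by (simp_all add: u_def powr_powr)
    have uS: "u * S = (real CARD('d) / c) powr (1 / a) * S powr ((a - 1) / a)"
    proof -
      have "S powr ((a - 1) / a) = S powr 1 / S powr (1 / a)"
        using a by (subst powr_diff[symmetric]) (simp add: field_simps)
      moreover have "u = (real CARD('d) / c) powr (1 / a) / S powr (1 / a)"
        using c S unfolding u_def by (subst powr_divide[symmetric]) (auto simp: field_simps)
      ultimately show ?thesis using S by simp
    qed
    \<comment> \<open>The cheapest profile is \<open>u\<close> times a power of the Green function, and \<open>\<kappa>\<close> is its Lagrange multiplier.\<close>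
    define \<kappa> where "\<kappa> = c * a * u powr (a - 1)"
    have k: "\<kappa> > 0" using c a u by (simp add: \<kappa>_def)
    have k1: "\<kappa> * (u * S) = a * real CARD('d)"
    proof -
      have "\<kappa> * (u * S) = a * (c * S * (u powr (a - 1) * u powr 1))" using u by (simp add: \<kappa>_def)
      also have "u powr (a - 1) * u powr 1 = u powr a" by (subst powr_add[symmetric]) simp
      finally show ?thesis using u by simp
    qed
    have k2: "field_rate c \<kappa> = (a - 1) * real CARD('d)"
    proof -
      have "\<kappa> powr (a / (a - 1)) = (c * a) powr (a / (a - 1)) * u powr a"
        using c a u mid by (simp add: \<kappa>_def powr_mult powr_powr)
      also have "(c * a) powr (a / (a - 1)) = (c * a) powr 1 * (c * a) powr (1 / (a - 1))"
        using mid by (subst powr_add[symmetric]) (simp add: field_simps)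
      finally have "\<kappa> powr (a / (a - 1)) = (c * a) * (c * a) powr (1 / (a - 1)) * u powr a"
        using c a by simp
      then have "field_rate c \<kappa> = (a - 1) / a * (c * a) powr (- 1 / (a - 1)) * ((c * a) * (c * a) powr (1 / (a - 1)) * u powr a) * S"
        using a mid(2,3) by (simp add: field_rate_def young_const_def S_def)
      also have "\<dots> = (a - 1) / a * ((c * a) powr (- 1 / (a - 1)) * (c * a) powr (1 / (a - 1))) * a * (c * S * u powr a)"
        by (simp add: mult_ac)
      also have "(c * a) powr (- 1 / (a - 1)) * (c * a) powr (1 / (a - 1)) = 1"
        using c a by (simp add: powr_minus field_simps)
      also have "(a - 1) / a * 1 * a * (c * S * u powr a) = (a - 1) * real CARD('d)"
        using a by (simp only: u) simp
      finally show ?thesis .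
    qed
    have "\<kappa> * (u * S) < \<kappa> * t" using c k uS by simp
    then have "field_rate c \<kappa> + gauss_rate \<kappa> + real CARD('d) < \<kappa> * t"
      using k1 k2 a mid(2,3) by (simp add: gauss_rate_def algebra_simps)
    moreover have "tail_rate_above T c" using c mid(1) by simp
    ultimately show thesis using bigA[OF c(2)] c k mid(2,3) a
      by (intro that[of c "(2 * real CARD('d) / c) powr (1 / \<alpha>)" \<kappa>]) auto
  qed
qed

end

lemma (in prob_space) markov_bound:
  assumes [measurable]: "S \<in> borel_measurable M" and S: "\<And>\<omega>. S \<omega> \<ge> (0::real)"
    and e: "(\<integral>\<^sup>+\<omega>. ennreal (S \<omega>) \<partial>M) \<le> ennreal c" "c \<ge> 0" and t: "t > 0"
  shows "prob {\<omega> \<in> space M. S \<omega> > t} \<le> c / t"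
proof -
  have i: "integrable M S" "(\<integral>\<omega>. S \<omega> \<partial>M) \<le> c"
    using nonneg_integral_le[of S M c] S e by auto
  have "prob {\<omega> \<in> space M. S \<omega> > t} \<le> prob {\<omega> \<in> space M. S \<omega> \<ge> t}"
    by (intro finite_measure_mono) auto
  also have "\<dots> \<le> (\<integral>\<omega>. S \<omega> \<partial>M) / t"
    using t S by (intro integral_Markov_inequality_measure[OF i(1), of "{}"]) auto
  also have "\<dots> \<le> c / t" using i t by (intro divide_right_mono) auto
  finally show ?thesis .
qed

text \<open>
  The Borel--Cantelli lemma for probabilities of order \<open>N\<^bsup>-p\<^esup>\<close>, written as exponentials of \<open>log N\<close> like
  all estimates here.
\<close>

lemma (in prob_space) borel_cantelli_ln:
  assumes m: "\<And>N. E N \<in> events"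
    and b: "\<forall>\<^sub>F N in sequentially. prob (E N) \<le> K * exp (- p * ln (real N))" and p: "p > 1"
  shows "AE \<omega> in M. \<forall>\<^sub>F N in sequentially. \<omega> \<notin> E N"
proof -
  have "summable (\<lambda>N. prob (E N))"
  proof (rule summable_comparison_test_ev)
    show "\<forall>\<^sub>F N in sequentially. norm (prob (E N)) \<le> K * real N powr - p"
      using b eventually_gt_at_top[of 0] by eventually_elim (simp add: powr_def)
    show "summable (\<lambda>N. K * real N powr - p)"
      using p by (intro summable_mult) (simp add: summable_real_powr_iff)
  qed
  then have "AE \<omega> in M. \<forall>\<^sub>F N in sequentially. \<omega> \<in> space M - E N"
    using m by (intro borel_cantelli_AE1) (auto simp: emeasure_eq_measure)
  then show ?thesis by eventually_elim (auto elim: eventually_mono)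
qed

context random_field
begin

text \<open>
  The exponential appearing in \<open>gibbs_max_le\<close> at a site, averaged over the disorder, is of smaller order
  than \<open>N\<^bsup>-d\<^esup>\<close>.  The weights \<open>g\<close> stand for \<open>box_green N x\<close> or its restriction to a neighbourhood of \<open>x\<close>.
\<close>

lemma annealed_bound:
  assumes t: "t > Mstar TYPE('d) T"
  obtains c B A \<kappa> \<rho> l0 where "c > 0" "B \<ge> 1" "sub_weibull M \<alpha> c B (\<eta> 0)" "A > 0" "\<kappa> > 0" "\<rho> > 0"
    "c * A powr \<alpha> \<ge> real CARD('d) + \<rho>" "l0 \<ge> 1"
    "\<And>l X Y x g. l \<ge> l0 \<Longrightarrow> good_family c B A l X \<Longrightarrow> finite Y \<Longrightarrow>
     (\<And>y. y \<in> Y \<Longrightarrow> 0 \<le> g y \<and> g y \<le> gr (y - x)) \<Longrightarrow>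
     (\<integral>\<^sup>+\<omega>. ennreal (exp (\<kappa> * l powr ((\<alpha> - 1) / \<alpha>) * ((\<Sum>y\<in>Y. g y * X y \<omega>) - t * l powr (1 / \<alpha>))
         + (\<kappa> * l powr ((\<alpha> - 1) / \<alpha>))\<^sup>2 * Gstar TYPE('d) / 2)) \<partial>M) \<le> ennreal (exp (- (real CARD('d) + \<rho>) * l))"
proof -
  obtain c A \<kappa> where c: "c > 0" "tail_rate_above T c" and A: "A > 0" and \<kappa>: "\<kappa> > 0" and cA: "c * A powr \<alpha> > real CARD('d)"
    and small: "\<alpha> \<le> 1 \<Longrightarrow> \<kappa> * Gstar TYPE('d) * A powr (1 - \<alpha>) < c"
    and gap: "field_rate c \<kappa> + gauss_rate \<kappa> + real CARD('d) < \<kappa> * t"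
    using rate_choice[OF t] by blast
  obtain B where B: "B \<ge> 1" and sw: "sub_weibull M \<alpha> c B (\<eta> 0)"
    using tail_sub_weibull[OF \<eta>_measurable symm tail c] by blast
  \<comment> \<open>The gap is shared among the two error terms and the gain \<open>\<rho>\<close>.\<close>
  define h where "h = (\<kappa> * t - (field_rate c \<kappa> + gauss_rate \<kappa> + real CARD('d))) / 4"
  have h: "h > 0" using gap by (simp add: h_def)
  define \<rho> where "\<rho> = min h (c * A powr \<alpha> - real CARD('d))"
  have \<rho>: "\<rho> > 0" "\<rho> \<le> h" "c * A powr \<alpha> \<ge> real CARD('d) + \<rho>" using h cA by (auto simp: \<rho>_def)
  obtain l1 where l1: "l1 \<ge> 1" "\<And>l X Y x g. l \<ge> l1 \<Longrightarrow> good_family c B A l X \<Longrightarrow> finite Y \<Longrightarrow>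
     (\<And>y. y \<in> Y \<Longrightarrow> 0 \<le> g y \<and> g y \<le> gr (y - x)) \<Longrightarrow>
     (\<integral>\<^sup>+\<omega>. ennreal (exp (\<kappa> * l powr ((\<alpha> - 1) / \<alpha>) * (\<Sum>y\<in>Y. g y * X y \<omega>))) \<partial>M) \<le>
       ennreal (exp ((field_rate c \<kappa> + h) * l))"
    using field_mgf[OF c(1) B \<kappa> A small h] by blast
  have "\<forall>\<^sub>F l in at_top. (\<kappa> * l powr ((\<alpha> - 1) / \<alpha>))\<^sup>2 * Gstar TYPE('d) / 2 \<le> (gauss_rate \<kappa> + h) * l"
  proof (cases "\<alpha> = 2")
    case True
    show ?thesis using eventually_gt_at_top[of 0]
    proof eventually_elim
      case (elim l)
      have "(\<kappa> * l powr ((\<alpha> - 1) / \<alpha>))\<^sup>2 * Gstar TYPE('d) / 2 = \<kappa>\<^sup>2 * Gstar TYPE('d) / 2 * (l powr (1/2))\<^sup>2"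
        using True by (simp add: power_mult_distrib)
      also have "(l powr (1/2))\<^sup>2 = l" using elim by (simp add: powr_half_sqrt)
      also have "\<kappa>\<^sup>2 * Gstar TYPE('d) / 2 * l \<le> (gauss_rate \<kappa> + h) * l"
        using True h elim by (intro mult_right_mono) (auto simp: gauss_rate_def)
      finally show ?case .
    qed
  next
    case False
    define e where "e = 2 * ((\<alpha> - 1) / \<alpha>) - 1"
    have e: "e < 0" using False \<alpha> by (simp add: e_def field_simps)
    have "((\<lambda>l. \<kappa>\<^sup>2 * Gstar TYPE('d) / 2 * l powr e) \<longlongrightarrow> \<kappa>\<^sup>2 * Gstar TYPE('d) / 2 * 0) at_top"
      by (intro tendsto_mult tendsto_const tendsto_neg_powr e filterlim_ident)
    then have "\<forall>\<^sub>F l in at_top. \<kappa>\<^sup>2 * Gstar TYPE('d) / 2 * l powr e < h"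
      by (rule order_tendstoD(2)) (use h in simp)
    then show ?thesis using eventually_gt_at_top[of 0]
    proof eventually_elim
      case (elim l)
      have "(l powr ((\<alpha> - 1) / \<alpha>))\<^sup>2 = l powr e * l powr 1"
        unfolding power2_eq_square powr_add[symmetric] by (simp add: e_def)
      then have "(\<kappa> * l powr ((\<alpha> - 1) / \<alpha>))\<^sup>2 * Gstar TYPE('d) / 2 = \<kappa>\<^sup>2 * Gstar TYPE('d) / 2 * l powr e * l"
        using elim by (simp add: power_mult_distrib)
      also have "\<dots> \<le> h * l" using elim by (intro mult_right_mono) auto
      also have "h * l = (gauss_rate \<kappa> + h) * l" using False by (simp add: gauss_rate_def)
      finally show ?case .
    qed
  qed
  then obtain l2 where l2: "\<And>l. l \<ge> l2 \<Longrightarrow> (\<kappa> * l powr ((\<alpha> - 1) / \<alpha>))\<^sup>2 * Gstar TYPE('d) / 2 \<le> (gauss_rate \<kappa> + h) * l"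
    by (auto simp: eventually_at_top_linorder)
  show thesis
  proof (rule that[of c B A \<kappa> \<rho> "max l1 l2"])
    fix l X Y x g
    assume l: "max l1 l2 \<le> (l::real)" and X: "good_family c B A l X" and Y: "finite Y"
      and g: "\<And>y. y \<in> Y \<Longrightarrow> 0 \<le> g y \<and> g y \<le> gr (y - x)"
    have lge: "l \<ge> l1" "l \<ge> l2" "l \<ge> 1" using l l1(1) by auto
    define s where "s = \<kappa> * l powr ((\<alpha> - 1) / \<alpha>)"
    define w where "w = s\<^sup>2 * Gstar TYPE('d) / 2 - s * (t * l powr (1 / \<alpha>))"
    have [measurable]: "X y \<in> borel_measurable M" for y by (rule family_measurable[OF X])
    have "(\<integral>\<^sup>+\<omega>. ennreal (exp (s * ((\<Sum>y\<in>Y. g y * X y \<omega>) - t * l powr (1 / \<alpha>)) + s\<^sup>2 * Gstar TYPE('d) / 2)) \<partial>M) =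
      (\<integral>\<^sup>+\<omega>. ennreal (exp w) * ennreal (exp (s * (\<Sum>y\<in>Y. g y * X y \<omega>))) \<partial>M)"
      by (simp add: w_def algebra_simps flip: ennreal_mult' exp_add)
    also have "\<dots> = ennreal (exp w) * (\<integral>\<^sup>+\<omega>. ennreal (exp (s * (\<Sum>y\<in>Y. g y * X y \<omega>))) \<partial>M)"
      by (rule nn_integral_cmult) measurable
    also have "\<dots> \<le> ennreal (exp w) * ennreal (exp ((field_rate c \<kappa> + h) * l))"
      unfolding s_def by (intro mult_left_mono l1(2)[OF lge(1) X Y g]) auto
    also have "\<dots> = ennreal (exp (w + (field_rate c \<kappa> + h) * l))"
      by (simp add: exp_add ennreal_mult')
    also have "\<dots> \<le> ennreal (exp (- (real CARD('d) + \<rho>) * l))"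
    proof -
      have "w \<le> (gauss_rate \<kappa> + h) * l - \<kappa> * t * l"
        using l2[OF lge(2)] level_scale[OF lge(3), of \<kappa> t] unfolding w_def s_def by linarith
      then have "w + (field_rate c \<kappa> + h) * l \<le> (gauss_rate \<kappa> + h - \<kappa> * t + field_rate c \<kappa> + h) * l"
        by (simp add: algebra_simps)
      also have "gauss_rate \<kappa> + h - \<kappa> * t + field_rate c \<kappa> + h = - (real CARD('d) + 2 * h)"
        by (simp add: h_def field_simps)
      also have "- (real CARD('d) + 2 * h) * l \<le> - (real CARD('d) + \<rho>) * l"
        using \<rho> h lge by (intro mult_right_mono) auto
      finally show ?thesis by (intro ennreal_leI) simp
    qed
    finally show "(\<integral>\<^sup>+\<omega>. ennreal (exp (\<kappa> * l powr ((\<alpha> - 1) / \<alpha>) * ((\<Sum>y\<in>Y. g y * X y \<omega>) - t * l powr (1 / \<alpha>))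
         + (\<kappa> * l powr ((\<alpha> - 1) / \<alpha>))\<^sup>2 * Gstar TYPE('d) / 2)) \<partial>M) \<le> ennreal (exp (- (real CARD('d) + \<rho>) * l))"
      by (simp only: s_def)
  qed (use c B sw A \<kappa> \<rho> l1 in auto)
qed

section \<open>Upper bound in probability\<close>

lemma scaled_max_le_iff:
  "ln (real N) \<ge> 1 \<Longrightarrow> scaled_max T N \<phi> \<le> u \<longleftrightarrow> (\<forall>x\<in>lattice_box N. \<phi> x \<le> u * level N)"
  by (subst MAX_le_iff[symmetric]) (simp add: scaled_max_def level_def field_simps)

lemma scaled_max_ge_iff:
  "ln (real N) \<ge> 1 \<Longrightarrow> u \<le> scaled_max T N \<phi> \<longleftrightarrow> (\<exists>x\<in>lattice_box N. \<phi> x \<ge> u * level N)"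
  by (subst MAX_ge_iff[symmetric]) (simp add: scaled_max_def level_def field_simps)

text \<open>
  After the shift the disorder enters only through the centre, and the probability is a parameter
  integral over a fixed measure.
\<close>

lemma gibbs_prob_measurable:
  "(\<lambda>\<omega>. measure (gibbs N (\<lambda>x. \<eta> x \<omega>)) {\<phi> \<in> space (field_space N). \<forall>x\<in>lattice_box N. \<phi> x \<le> t}) \<in> borel_measurable M"
proof -
  let ?P = "gibbs N (\<lambda>_ :: 'd site. 0)"
  interpret P: prob_space ?P by (rule prob_space_gibbs[OF dim])
  have [measurable]: "(\<lambda>\<phi>. \<phi> x) \<in> borel_measurable (field_space N)" if "x \<in> lattice_box N" for x :: "'d site"
    using measurable_component_singleton[of x "lattice_box N" "\<lambda>_. lborel"] that by simp
  define f where "f \<omega> \<phi> = (if \<forall>x\<in>lattice_box N. \<phi> x + mean_field N (\<lambda>y. \<eta> y \<omega>) x \<le> t then 1 else 0 :: ennreal)" for \<omega> \<phi>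
  have [measurable]: "case_prod f \<in> borel_measurable (M \<Otimes>\<^sub>M ?P)"
    unfolding f_def by measurable
  have "measure (gibbs N (\<lambda>x. \<eta> x \<omega>)) {\<phi> \<in> space (field_space N). \<forall>x\<in>lattice_box N. \<phi> x \<le> t} =
    enn2real (\<integral>\<^sup>+\<phi>. f \<omega> \<phi> \<partial>?P)" for \<omega>
  proof -
    let ?S = "{\<phi> \<in> space (field_space N). \<forall>x\<in>lattice_box N. shift_field N (mean_field N (\<lambda>y. \<eta> y \<omega>)) \<phi> x \<le> t}"
    have S: "?S \<in> sets ?P" by simp
    have "measure (gibbs N (\<lambda>x. \<eta> x \<omega>)) {\<phi> \<in> space (field_space N). \<forall>x\<in>lattice_box N. \<phi> x \<le> t} = measure ?P ?S"
      by (rule gibbs_measure_shift[OF dim]) measurable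
    also have "\<dots> = enn2real (\<integral>\<^sup>+\<phi>. indicator ?S \<phi> \<partial>?P)"
      using S by (simp add: measure_def)
    also have "(\<integral>\<^sup>+\<phi>. indicator ?S \<phi> \<partial>?P) = (\<integral>\<^sup>+\<phi>. f \<omega> \<phi> \<partial>?P)"
      by (intro nn_integral_cong) (auto simp: f_def indicator_def shift_field_def)
    finally show ?thesis .
  qed
  moreover have "(\<lambda>\<omega>. enn2real (\<integral>\<^sup>+\<phi>. f \<omega> \<phi> \<partial>?P)) \<in> borel_measurable M"
    by measurable
  ultimately show ?thesis by simp
qed

text \<open>
  Unless truncation changes the disorder, the union bound \<open>gibbs_max_le\<close> applies with the centre of the
  truncated disorder.  By \<open>annealed_bound\<close> its right side tends to zero in mean.
\<close>

theorem max_upper_in_probability: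
  assumes \<epsilon>: "\<epsilon> > 0" and \<epsilon>': "\<epsilon>' > 0"
  shows "(\<lambda>N. prob {\<omega> \<in> space M. measure (gibbs N (\<lambda>x. \<eta> x \<omega>))
     {\<phi> \<in> space (gibbs N (\<lambda>x. \<eta> x \<omega>)). scaled_max T N \<phi> \<le> Mstar TYPE('d) T + \<epsilon>} \<ge> 1 - \<epsilon>'}) \<longlonglongrightarrow> 1"
proof -
  define t where "t = Mstar TYPE('d) T + \<epsilon>"
  have t: "t > Mstar TYPE('d) T" using \<epsilon> by (simp add: t_def)
  obtain c B A \<kappa> \<rho> l0 where c: "c > 0" and B: "B \<ge> 1" and sw: "sub_weibull M \<alpha> c B (\<eta> 0)" and A: "A > 0"
    and \<kappa>: "\<kappa> > 0" and \<rho>: "\<rho> > 0" and cA: "c * A powr \<alpha> \<ge> real CARD('d) + \<rho>" and l0: "l0 \<ge> 1"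
    and ann: "\<And>l X Y x g. l \<ge> l0 \<Longrightarrow> good_family c B A l X \<Longrightarrow> finite Y \<Longrightarrow>
     (\<And>y. y \<in> Y \<Longrightarrow> 0 \<le> g y \<and> g y \<le> gr (y - x)) \<Longrightarrow>
     (\<integral>\<^sup>+\<omega>. ennreal (exp (\<kappa> * l powr ((\<alpha> - 1) / \<alpha>) * ((\<Sum>y\<in>Y. g y * X y \<omega>) - t * l powr (1 / \<alpha>))
         + (\<kappa> * l powr ((\<alpha> - 1) / \<alpha>))\<^sup>2 * Gstar TYPE('d) / 2)) \<partial>M) \<le> ennreal (exp (- (real CARD('d) + \<rho>) * l))"
    using annealed_bound[OF t] by blast
  let ?good = "\<lambda>N. {\<omega> \<in> space M. measure (gibbs N (\<lambda>x. \<eta> x \<omega>))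
     {\<phi> \<in> space (gibbs N (\<lambda>x. \<eta> x \<omega>)). scaled_max T N \<phi> \<le> Mstar TYPE('d) T + \<epsilon>} \<ge> 1 - \<epsilon>'}"
  define K where "K = 3 ^ CARD('d) * (B + 1 / \<epsilon>')"
  have lower: "\<forall>\<^sub>F N in sequentially. prob (?good N) \<ge> 1 - K * exp (- \<rho> * ln (real N))"
    using eventually_ln_ge[of l0] eventually_ge_at_top[of 1]
  proof eventually_elim
    case (elim N)
    define l where "l = ln (real N)"
    have l: "l \<ge> l0" "l \<ge> 1" using elim l0 by (auto simp: l_def)
    have lv: "level N = l powr (1 / \<alpha>)" by (simp add: level_def l_def)
    define X where "X y \<omega> = trunc (A * l powr (1 / \<alpha>)) (\<eta> y \<omega>)" for y \<omega>
    have X: "good_family c B A l X"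
      unfolding X_def using good_family_trunc[OF sw] c A by auto
    have [measurable]: "X y \<in> borel_measurable M" for y by (rule family_measurable[OF X])
    define s where "s = \<kappa> * l powr ((\<alpha> - 1) / \<alpha>)"
    have s: "s \<ge> 0" using \<kappa> by (simp add: s_def)
    define Y where "Y x \<omega> = exp (s * ((\<Sum>y\<in>lattice_box N. box_green N x y * X y \<omega>) - t * level N) + s\<^sup>2 * Gstar TYPE('d) / 2)" for x \<omega>
    define S where "S \<omega> = (\<Sum>x\<in>lattice_box N. Y x \<omega>)" for \<omega>
    have [measurable]: "Y x \<in> borel_measurable M" for x unfolding Y_def by measurable
    have [measurable]: "S \<in> borel_measurable M" unfolding S_def by measurable
    have EY: "(\<integral>\<^sup>+\<omega>. ennreal (Y x \<omega>) \<partial>M) \<le> ennreal (exp (- (real CARD('d) + \<rho>) * l))" for x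
      unfolding Y_def s_def lv
      using box_green_nonneg[OF dim] box_green_le_green[OF dim] by (intro ann[OF l(1) X]) auto
    have ES: "(\<integral>\<^sup>+\<omega>. ennreal (S \<omega>) \<partial>M) \<le> ennreal (3 ^ CARD('d) * exp (- \<rho> * l))"
    proof -
      have "(\<integral>\<^sup>+\<omega>. ennreal (S \<omega>) \<partial>M) = (\<integral>\<^sup>+\<omega>. (\<Sum>x\<in>lattice_box N. ennreal (Y x \<omega>)) \<partial>M)"
        unfolding S_def by (subst sum_ennreal) (auto simp: Y_def)
      also have "\<dots> = (\<Sum>x\<in>lattice_box N. \<integral>\<^sup>+\<omega>. ennreal (Y x \<omega>) \<partial>M)"
        by (intro nn_integral_sum) auto
      also have "\<dots> \<le> (\<Sum>x\<in>(lattice_box N :: 'd site set). ennreal (exp (- (real CARD('d) + \<rho>) * l)))"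
        by (intro sum_mono EY)
      also have "\<dots> = ennreal (real (card (lattice_box N :: 'd site set)) * exp (- (real CARD('d) + \<rho>) * l))"
        by (simp add: ennreal_mult' ennreal_of_nat_eq_real_of_nat)
      also have "\<dots> \<le> ennreal ((3 ^ CARD('d) * exp (real CARD('d) * l)) * exp (- (real CARD('d) + \<rho>) * l))"
        using card_lattice_box_le[of N, where 'd = 'd] elim
        by (intro ennreal_leI mult_right_mono) (auto simp: l_def)
      also have "(3 ^ CARD('d) * exp (real CARD('d) * l)) * exp (- (real CARD('d) + \<rho>) * l) = 3 ^ CARD('d) * exp (- \<rho> * l)"
        by (simp add: algebra_simps flip: exp_add)
      finally show ?thesis .
    qed
    have PS: "prob {\<omega> \<in> space M. S \<omega> > \<epsilon>'} \<le> 3 ^ CARD('d) * exp (- \<rho> * l) / \<epsilon>'"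
      using ES \<epsilon>' by (intro markov_bound) (auto simp: S_def Y_def intro!: sum_nonneg)
    have PO: "prob (overflow A N) \<le> 3 ^ CARD('d) * B * exp (- \<rho> * l)"
    proof -
      have "prob (overflow A N) \<le> 3 ^ CARD('d) * B * exp ((real CARD('d) - c * A powr \<alpha>) * l)"
        using prob_overflow_le[OF sw c B A, of N] elim by (simp add: l_def)
      also have "\<dots> \<le> 3 ^ CARD('d) * B * exp (- \<rho> * l)"
      proof -
        have "(real CARD('d) - c * A powr \<alpha>) * l \<le> - \<rho> * l" using cA l by (intro mult_right_mono) auto
        then show ?thesis using B by (intro mult_left_mono) auto
      qed
      finally show ?thesis .
    qed
    have eqset: "?good N = {\<omega> \<in> space M. measure (gibbs N (\<lambda>x. \<eta> x \<omega>))
         {\<phi> \<in> space (field_space N). \<forall>x\<in>lattice_box N. \<phi> x \<le> t * level N} \<ge> 1 - \<epsilon>'}"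
      using l by (simp add: scaled_max_le_iff l_def t_def)
    have goodm: "?good N \<in> events"
      unfolding eqset using gibbs_prob_measurable by measurable
    have sub: "space M - ?good N \<subseteq> overflow A N \<union> {\<omega> \<in> space M. S \<omega> > \<epsilon>'}"
    proof
      fix \<omega> assume w: "\<omega> \<in> space M - ?good N"
      show "\<omega> \<in> overflow A N \<union> {\<omega> \<in> space M. S \<omega> > \<epsilon>'}"
      proof (cases "\<omega> \<in> overflow A N")
        case False
        then have Xe: "X y \<omega> = \<eta> y \<omega>" if "y \<in> lattice_box N" for y
          using that w by (auto simp: overflow_def X_def trunc_def lv not_less)
        have m: "(\<Sum>y\<in>lattice_box N. box_green N x y * X y \<omega>) = mean_field N (\<lambda>y. \<eta> y \<omega>) x" for x
          unfolding mean_field_def by (intro sum.cong) (auto simp: Xe)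
        have "1 - S \<omega> \<le> measure (gibbs N (\<lambda>x. \<eta> x \<omega>)) {\<phi> \<in> space (field_space N). \<forall>x\<in>lattice_box N. \<phi> x \<le> t * level N}"
          unfolding S_def Y_def m using gibbs_max_le[OF dim, of N "\<lambda>_. s" "\<lambda>x. \<eta> x \<omega>" "t * level N"] s by simp
        moreover have "\<not> 1 - \<epsilon>' \<le> measure (gibbs N (\<lambda>x. \<eta> x \<omega>)) {\<phi> \<in> space (field_space N). \<forall>x\<in>lattice_box N. \<phi> x \<le> t * level N}"
          using w unfolding eqset by auto
        ultimately have "S \<omega> > \<epsilon>'" by linarith
        then show ?thesis using w by auto
      qed simp
    qed
    have "prob (space M - ?good N) \<le> prob (overflow A N \<union> {\<omega> \<in> space M. S \<omega> > \<epsilon>'})"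
      by (rule finite_measure_mono[OF sub]) measurable
    also have "\<dots> \<le> prob (overflow A N) + prob {\<omega> \<in> space M. S \<omega> > \<epsilon>'}"
      by (rule measure_Un_le) measurable
    also have "\<dots> \<le> K * exp (- \<rho> * l)" using PS PO by (simp add: K_def algebra_simps)
    finally show ?case using prob_compl[OF goodm] by (simp add: l_def)
  qed
  have lim: "(\<lambda>N. 1 - K * exp (- \<rho> * ln (real N))) \<longlonglongrightarrow> 1"
    using \<rho> by real_asymp
  show ?thesis
    by (rule tendsto_sandwich[OF lower _ lim tendsto_const]) simp
qed

section \<open>Almost sure upper bound\<close>

lemma block_indep:
  assumes "disjoint_family_on K A" and h: "\<And>x. x \<in> A \<Longrightarrow> h x \<in> measurable (\<Pi>\<^sub>M y\<in>K x. borel) N'"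
  shows "indep_vars (\<lambda>_. N') (\<lambda>x \<omega>. h x (restrict (\<lambda>y. \<eta> y \<omega>) (K x))) A"
proof -
  have "indep_vars (\<lambda>x. \<Pi>\<^sub>M y\<in>K x. borel) (\<lambda>x \<omega>. restrict (\<lambda>y. \<eta> y \<omega>) (K x)) A"
    by (rule indep_vars_restrict[OF indep _ assms(1)]) simp
  then show ?thesis by (rule indep_vars_compose2) (rule h)
qed

text \<open>
  If the coordinates of the sites agree modulo \<open>m\<close>, distinct sites are at distance at least \<open>m\<close>.
\<close>

lemma disjoint_translates:
  fixes F :: "'d site set"
  assumes F: "F \<subseteq> lattice_box R" and m: "m > 2 * R"
    and A: "\<And>x y i. x \<in> A \<Longrightarrow> y \<in> A \<Longrightarrow> int m dvd (x $ i - y $ i)"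
  shows "disjoint_family_on (\<lambda>x. (+) x ` F) A"
  unfolding disjoint_family_on_def
proof (intro ballI impI)
  fix x y assume xy: "x \<in> A" "y \<in> A" "x \<noteq> y"
  show "(+) x ` F \<inter> (+) y ` F = {}"
  proof (rule ccontr)
    assume "(+) x ` F \<inter> (+) y ` F \<noteq> {}"
    then obtain z w where zw: "z \<in> F" "w \<in> F" "x + z = y + w" by auto
    have "x $ i = y $ i" for i
    proof (rule ccontr)
      assume ne: "x $ i \<noteq> y $ i"
      have e: "x $ i - y $ i = w $ i - z $ i"
        using arg_cong[OF zw(3), of "\<lambda>v. v $ i"] by simp
      have "\<bar>w $ i\<bar> \<le> int R" "\<bar>z $ i\<bar> \<le> int R" using zw F by (auto simp: lattice_box_def)
      then have "\<bar>x $ i - y $ i\<bar> < int m" using e m by linarith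
      moreover have "int m \<le> \<bar>x $ i - y $ i\<bar>"
        using A[OF xy(1,2), of i] ne dvd_imp_le_int[of "x $ i - y $ i" "int m"] by simp
      ultimately show False by simp
    qed
    then show False using xy by (simp add: vec_eq_iff)
  qed
qed

lemma near_indep:
  assumes "disjoint_family_on (\<lambda>x. (+) x ` F) A"
  shows "indep_vars (\<lambda>_. borel) (near N F) A"
proof -
  define h where "h x q = (\<Sum>y\<in>lattice_box N \<inter> (+) x ` F. box_green N x y * q y)" for x and q :: "'d site \<Rightarrow> real"
  have "indep_vars (\<lambda>_. borel) (\<lambda>x \<omega>. h x (restrict (\<lambda>y. \<eta> y \<omega>) ((+) x ` F))) A"
  proof (rule block_indep[OF assms])
    fix x
    have "(\<lambda>q. q y) \<in> borel_measurable (\<Pi>\<^sub>M y\<in>(+) x ` F. borel)" if "y \<in> (+) x ` F" for y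
      using that by (rule measurable_component_singleton)
    then show "h x \<in> borel_measurable (\<Pi>\<^sub>M y\<in>(+) x ` F. borel)"
      unfolding h_def by (intro borel_measurable_sum borel_measurable_times borel_measurable_const) auto
  qed
  moreover have "h x (restrict (\<lambda>y. \<eta> y \<omega>) ((+) x ` F)) = near N F x \<omega>" for x \<omega>
  proof -
    have "near N F x \<omega> = (\<Sum>y\<in>lattice_box N \<inter> (+) x ` F. box_green N x y * \<eta> y \<omega>)"
      unfolding near_def
      by (rule sum.mono_neutral_cong_right) (auto simp: image_iff split: if_splits, metis add.commute diff_add_cancel)
    then show ?thesis by (simp add: h_def)
  qed
  ultimately show ?thesis by simp
qed

lemma eventually_at_ln:
  "\<forall>\<^sub>F l in at_top. P l \<Longrightarrow> \<forall>\<^sub>F N in sequentially. P (ln (real N))"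
proof -
  have "filterlim (\<lambda>N. ln (real N)) at_top sequentially" by real_asymp
  then show "\<forall>\<^sub>F l in at_top. P l \<Longrightarrow> \<forall>\<^sub>F N in sequentially. P (ln (real N))"
    by (rule eventually_compose_filterlim[rotated])
qed

lemma finite_subset_box:
  assumes "finite (F :: 'd site set)" obtains R where "F \<subseteq> lattice_box R"
proof -
  have "\<exists>R. F \<subseteq> lattice_box R" using assms
  proof (induction F)
    case (insert z F)
    then obtain R where R: "F \<subseteq> lattice_box R" by blast
    define R' where "R' = max R (nat (\<Sum>i\<in>UNIV. \<bar>z $ i\<bar>))"
    have "\<bar>z $ i\<bar> \<le> int R'" for i
    proof -
      have "\<bar>z $ i\<bar> \<le> (\<Sum>i\<in>UNIV. \<bar>z $ i\<bar>)" by (rule member_le_sum) auto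
      then show ?thesis by (simp add: R'_def)
    qed
    then have "z \<in> lattice_box R'" by (simp add: lattice_box_def)
    moreover have "F \<subseteq> lattice_box R'" using R lattice_box_mono[of R R'] by (auto simp: R'_def)
    ultimately show ?case by blast
  qed auto
  then show thesis using that by blast
qed

text \<open>
  The bound on the probability that the field at \<open>x\<close> exceeds \<open>t * level N\<close>, given the near part of the
  centre, where realisations with a near part above \<open>(t - w) * level N\<close> are discarded.  It is the optimum
  over \<open>a x\<close> of the exponential in \<open>gibbs_max_le\<close>.
\<close>

definition near_cost :: "real \<Rightarrow> real \<Rightarrow> nat \<Rightarrow> 'd site set \<Rightarrow> 'd site \<Rightarrow> 'w \<Rightarrow> real" where
  "near_cost t w N F x \<omega> =
     (if near N F x \<omega> \<le> (t - w) * level N then exp (- (t * level N - near N F x \<omega>)\<^sup>2 / (2 * Gstar TYPE('d))) else 0)"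

lemma near_cost_measurable [measurable]: "near_cost t w N F x \<in> borel_measurable M"
  unfolding near_cost_def by measurable

text \<open>
  The terms are at most \<open>N\<^bsup>-q\<^esup>\<close> and their sum has a mean of order \<open>N\<^bsup>-\<rho>\<^esup>\<close>.  Sites that agree modulo \<open>m\<close> have
  independent near parts, so the exponential moment of order \<open>\<theta>\<close> of their partial sum factorises; with
  \<open>\<theta>\<close> a large multiple of \<open>log N\<close> it remains bounded, because \<open>\<theta>\<close> times a single term is at most 1.
\<close>

lemma near_cost_sum_small:
  assumes a: "\<alpha> = 2" and t: "t > Mstar TYPE('d) T" and w: "w > 0" and e0: "\<epsilon>0 > 0" and F: "finite F"
  shows "\<forall>\<^sub>F N in sequentially. prob {\<omega> \<in> space M. (\<Sum>x\<in>lattice_box N. near_cost t w N F x \<omega>) > \<epsilon>0}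
    \<le> exp (- 2 * ln (real N))"
proof -
  have Gpos: "Gstar TYPE('d) > 0" using Gstar_ge_one by simp
  obtain c B A \<kappa> \<rho> l0 where c: "c > 0" and B: "B \<ge> 1" and sw: "sub_weibull M \<alpha> c B (\<eta> 0)" and A: "A > 0"
    and \<kappa>: "\<kappa> > 0" and \<rho>: "\<rho> > 0" and "c * A powr \<alpha> \<ge> real CARD('d) + \<rho>" and l0: "l0 \<ge> 1"
    and ann: "\<And>l X Y x g. l \<ge> l0 \<Longrightarrow> good_family c B A l X \<Longrightarrow> finite Y \<Longrightarrow>
     (\<And>y. y \<in> Y \<Longrightarrow> 0 \<le> g y \<and> g y \<le> gr (y - x)) \<Longrightarrow>
     (\<integral>\<^sup>+\<omega>. ennreal (exp (\<kappa> * l powr ((\<alpha> - 1) / \<alpha>) * ((\<Sum>y\<in>Y. g y * X y \<omega>) - t * l powr (1 / \<alpha>))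
         + (\<kappa> * l powr ((\<alpha> - 1) / \<alpha>))\<^sup>2 * Gstar TYPE('d) / 2)) \<partial>M) \<le> ennreal (exp (- (real CARD('d) + \<rho>) * l))"
    using annealed_bound[OF t] by blast
  obtain R where R: "F \<subseteq> lattice_box R" using finite_subset_box[OF F] by blast
  define m where "m = 2 * R + 1"
  define cls where "cls x = (\<chi> i. x $ i mod int m)" for x :: "'d site"
  have cls: "cls x \<in> lattice_box m" for x
    by (auto simp: cls_def lattice_box_def m_def intro: less_imp_le)
  define n where "n = real (card (lattice_box m :: 'd site set))"
  have n: "n > 0" by (simp add: n_def card_gt_0_iff)
  define q where "q = w\<^sup>2 / (2 * Gstar TYPE('d))"
  have q: "q > 0" using w Gpos by (simp add: q_def)
  define C where "C = 3 ^ CARD('d) * 2 * (3 * n / \<epsilon>0)"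
  have C: "C > 0" using n e0 by (simp add: C_def)
  have small1: "\<forall>\<^sub>F l in at_top. 3 * n / \<epsilon>0 * l * exp (- q * l) \<le> 1"
  proof -
    have "((\<lambda>l. l * exp (- q * l)) \<longlongrightarrow> 0) at_top" using q by real_asymp
    then have "((\<lambda>l. 3 * n / \<epsilon>0 * (l * exp (- q * l))) \<longlongrightarrow> 3 * n / \<epsilon>0 * 0) at_top" by (intro tendsto_intros)
    then have "\<forall>\<^sub>F l in at_top. 3 * n / \<epsilon>0 * (l * exp (- q * l)) < 1" by (rule order_tendstoD(2)) simp
    then show ?thesis by eventually_elim (simp add: mult.assoc)
  qed
  have small2: "\<forall>\<^sub>F l in at_top. C * l * exp (- \<rho> * l) \<le> 1"
  proof -
    have "((\<lambda>l. l * exp (- \<rho> * l)) \<longlongrightarrow> 0) at_top" using \<rho> by real_asymp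
    then have "((\<lambda>l. C * (l * exp (- \<rho> * l))) \<longlongrightarrow> C * 0) at_top" by (intro tendsto_intros)
    then have "\<forall>\<^sub>F l in at_top. C * (l * exp (- \<rho> * l)) < 1" by (rule order_tendstoD(2)) simp
    then show ?thesis by eventually_elim (simp add: mult.assoc)
  qed
  show ?thesis
    using eventually_ln_ge[of l0] eventually_ln_ge[of "ln (n * exp 1)"] eventually_ge_at_top[of 1]
      eventually_at_ln[OF small1] eventually_at_ln[OF small2]
  proof eventually_elim
    case (elim N)
    define l where "l = ln (real N)"
    have l: "l \<ge> l0" "l \<ge> 1" using elim l0 by (auto simp: l_def)
    have lv: "level N = l powr (1 / \<alpha>)" by (simp add: level_def l_def)
    have lv2: "(level N)\<^sup>2 = l" "level N \<ge> 0" using l a by (simp_all add: lv powr_half_sqrt)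
    define Y where "Y = near_cost t w N F"
    have Ynn: "Y x \<omega> \<ge> 0" for x \<omega> by (simp add: Y_def near_cost_def)
    have [measurable]: "Y x \<in> borel_measurable M" for x unfolding Y_def by measurable
    have Yb: "Y x \<omega> \<le> exp (- q * l)" for x \<omega>
    proof (cases "near N F x \<omega> \<le> (t - w) * level N")
      case True
      have "w * level N \<le> t * level N - near N F x \<omega>" using True by (simp add: algebra_simps)
      then have "(w * level N)\<^sup>2 \<le> (t * level N - near N F x \<omega>)\<^sup>2"
        using w lv2 by (intro power_mono) auto
      then have "w\<^sup>2 * l \<le> (t * level N - near N F x \<omega>)\<^sup>2" by (simp add: power_mult_distrib lv2)
      then have "w\<^sup>2 * l / (2 * Gstar TYPE('d)) \<le> (t * level N - near N F x \<omega>)\<^sup>2 / (2 * Gstar TYPE('d))"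
        using Gpos by (intro divide_right_mono) auto
      then show ?thesis using True by (simp add: Y_def near_cost_def q_def)
    qed (simp add: Y_def near_cost_def)
    have X: "good_family c B A l \<eta>" using good_family_\<eta>[OF sw] a by simp
    define s where "s = \<kappa> * l powr ((\<alpha> - 1) / \<alpha>)"
    have EY: "(\<integral>\<^sup>+\<omega>. ennreal (Y x \<omega>) \<partial>M) \<le> ennreal (exp (- (real CARD('d) + \<rho>) * l))" for x
    proof -
      have "(\<integral>\<^sup>+\<omega>. ennreal (Y x \<omega>) \<partial>M) \<le> (\<integral>\<^sup>+\<omega>. ennreal (exp (s * (near N F x \<omega> - t * level N) + s\<^sup>2 * Gstar TYPE('d) / 2)) \<partial>M)"
      proof (intro nn_integral_mono ennreal_leI)
        fix \<omega>
        define u where "u = t * level N - near N F x \<omega>"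
        have "0 \<le> (u - s * Gstar TYPE('d))\<^sup>2 / (2 * Gstar TYPE('d))" using Gpos by simp
        also have "\<dots> = u\<^sup>2 / (2 * Gstar TYPE('d)) - s * u + s\<^sup>2 * Gstar TYPE('d) / 2"
          using Gpos by (simp add: power2_eq_square field_simps)
        finally have "- u\<^sup>2 / (2 * Gstar TYPE('d)) \<le> s * (near N F x \<omega> - t * level N) + s\<^sup>2 * Gstar TYPE('d) / 2"
          by (simp add: u_def algebra_simps)
        then show "Y x \<omega> \<le> exp (s * (near N F x \<omega> - t * level N) + s\<^sup>2 * Gstar TYPE('d) / 2)"
          by (simp add: Y_def near_cost_def u_def)
      qed
      also have "\<dots> \<le> ennreal (exp (- (real CARD('d) + \<rho>) * l))"
        unfolding near_def s_def lv
        using box_green_nonneg[OF dim] box_green_le_green[OF dim] gr_nonneg by (intro ann[OF l(1) X]) auto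
      finally show ?thesis .
    qed
    \<comment> \<open>This makes \<open>exp (- \<theta> * \<epsilon>0 / n)\<close> equal to \<open>N\<^sup>-\<^sup>3\<close>.\<close>
    define \<theta> where "\<theta> = 3 * n / \<epsilon>0 * l"
    have \<theta>: "\<theta> \<ge> 0" using n e0 l by (simp add: \<theta>_def)
    have \<theta>Y: "\<theta> * Y x \<omega> \<le> 1" for x \<omega>
    proof -
      have "\<theta> * Y x \<omega> \<le> \<theta> * exp (- q * l)" using \<theta> Yb by (intro mult_left_mono) auto
      also have "\<dots> \<le> 1" using elim(4) by (simp add: \<theta>_def l_def)
      finally show ?thesis .
    qed
    have mgfY: "(\<integral>\<^sup>+\<omega>. ennreal (exp (\<theta> * Y x \<omega>)) \<partial>M) \<le> ennreal (exp (2 * \<theta> * exp (- (real CARD('d) + \<rho>) * l)))" for x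
    proof -
      have "(\<integral>\<^sup>+\<omega>. ennreal (exp (\<theta> * Y x \<omega>)) \<partial>M) \<le> (\<integral>\<^sup>+\<omega>. 1 + ennreal (2 * \<theta>) * ennreal (Y x \<omega>) \<partial>M)"
      proof (rule nn_integral_mono)
        fix \<omega>
        have y0: "0 \<le> \<theta> * Y x \<omega>" using \<theta> Ynn by simp
        have "exp (\<theta> * Y x \<omega>) \<le> 1 + \<theta> * Y x \<omega> + (\<theta> * Y x \<omega>)\<^sup>2"
          using y0 \<theta>Y by (intro exp_bound)
        also have "(\<theta> * Y x \<omega>)\<^sup>2 \<le> \<theta> * Y x \<omega>"
          using y0 \<theta>Y[of x \<omega>] by (simp add: power2_eq_square mult_left_le)
        finally have "exp (\<theta> * Y x \<omega>) \<le> 1 + (2 * \<theta>) * Y x \<omega>" by simp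
        then have "ennreal (exp (\<theta> * Y x \<omega>)) \<le> ennreal (1 + (2 * \<theta>) * Y x \<omega>)" by (rule ennreal_leI)
        also have "\<dots> = 1 + ennreal (2 * \<theta>) * ennreal (Y x \<omega>)"
          using \<theta> Ynn by (simp add: ennreal_plus ennreal_mult)
        finally show "ennreal (exp (\<theta> * Y x \<omega>)) \<le> 1 + ennreal (2 * \<theta>) * ennreal (Y x \<omega>)" .
      qed
      also have "\<dots> = 1 + ennreal (2 * \<theta>) * (\<integral>\<^sup>+\<omega>. ennreal (Y x \<omega>) \<partial>M)"
        by (subst nn_integral_add) (auto simp: nn_integral_cmult emeasure_space_1)
      also have "\<dots> \<le> 1 + ennreal (2 * \<theta>) * ennreal (exp (- (real CARD('d) + \<rho>) * l))"
        by (intro add_left_mono mult_left_mono EY) auto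
      also have "\<dots> = ennreal (1 + 2 * \<theta> * exp (- (real CARD('d) + \<rho>) * l))"
        using \<theta> by (simp add: ennreal_plus ennreal_mult)
      also have "\<dots> \<le> ennreal (exp (2 * \<theta> * exp (- (real CARD('d) + \<rho>) * l)))"
        by (intro ennreal_leI exp_ge_add_one_self)
      finally show ?thesis .
    qed
    define Cl where "Cl r = {x \<in> lattice_box N. cls x = r}" for r
    have Cl: "finite (Cl r)" for r by (simp add: Cl_def)
    have one: "prob {\<omega> \<in> space M. (\<Sum>x\<in>Cl r. Y x \<omega>) > \<epsilon>0 / n} \<le> exp 1 * exp (- 3 * l)" for r
    proof -
      have "int m dvd x $ i - y $ i" if "x \<in> Cl r" "y \<in> Cl r" for x y i
      proof -
        have "cls x $ i = cls y $ i" using that by (simp add: Cl_def)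
        then show ?thesis by (simp add: cls_def mod_eq_dvd_iff)
      qed
      then have "disjoint_family_on (\<lambda>x. (+) x ` F) (Cl r)"
        by (intro disjoint_translates[OF R, of m]) (auto simp: m_def)
      then have "indep_vars (\<lambda>_. borel) (near N F) (Cl r)" by (rule near_indep)
      then have "indep_vars (\<lambda>_. borel) (\<lambda>x \<omega>. (\<lambda>v. ennreal (exp (\<theta> * (if v \<le> (t - w) * level N then exp (- (t * level N - v)\<^sup>2 / (2 * Gstar TYPE('d))) else 0)))) (near N F x \<omega>)) (Cl r)"
        by (rule indep_vars_compose2) measurable
      then have ind: "indep_vars (\<lambda>_. borel) (\<lambda>x \<omega>. ennreal (exp (\<theta> * Y x \<omega>))) (Cl r)"
        by (simp add: Y_def near_cost_def)
      have "(\<integral>\<^sup>+\<omega>. ennreal (exp (\<theta> * (\<Sum>x\<in>Cl r. Y x \<omega>))) \<partial>M) = (\<integral>\<^sup>+\<omega>. (\<Prod>x\<in>Cl r. ennreal (exp (\<theta> * Y x \<omega>))) \<partial>M)"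
        using Cl by (simp add: prod_ennreal exp_sum sum_distrib_left)
      also have "\<dots> = (\<Prod>x\<in>Cl r. \<integral>\<^sup>+\<omega>. ennreal (exp (\<theta> * Y x \<omega>)) \<partial>M)"
        using Cl ind by (intro indep_vars_nn_integral) auto
      also have "\<dots> \<le> (\<Prod>x\<in>Cl r. ennreal (exp (2 * \<theta> * exp (- (real CARD('d) + \<rho>) * l))))"
        by (rule prod_mono_ennreal) (rule mgfY)
      also have "\<dots> = ennreal (exp (real (card (Cl r)) * (2 * \<theta> * exp (- (real CARD('d) + \<rho>) * l))))"
        by (simp add: ennreal_power exp_of_nat_mult)
      also have "\<dots> \<le> ennreal (exp 1)"
      proof -
        have "real (card (Cl r)) \<le> real (card (lattice_box N :: 'd site set))"
          by (simp add: card_mono Cl_def)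
        also have "\<dots> \<le> 3 ^ CARD('d) * exp (real CARD('d) * l)"
          using card_lattice_box_le[of N, where 'd = 'd] elim by (simp add: l_def)
        finally have "real (card (Cl r)) * (2 * \<theta> * exp (- (real CARD('d) + \<rho>) * l)) \<le> (3 ^ CARD('d) * exp (real CARD('d) * l)) * (2 * \<theta> * exp (- (real CARD('d) + \<rho>) * l))"
          using \<theta> by (intro mult_right_mono) auto
        also have "\<dots> = 3 ^ CARD('d) * 2 * \<theta> * (exp (real CARD('d) * l) * exp (- (real CARD('d) + \<rho>) * l))" by simp
        also have "exp (real CARD('d) * l) * exp (- (real CARD('d) + \<rho>) * l) = exp (- \<rho> * l)"
          by (simp add: algebra_simps flip: exp_add)
        also have "3 ^ CARD('d) * 2 * \<theta> * exp (- \<rho> * l) = C * l * exp (- \<rho> * l)"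
          by (simp add: C_def \<theta>_def)
        also have "\<dots> \<le> 1" using elim(5) by (simp add: l_def)
        finally show ?thesis by (intro ennreal_leI) simp
      qed
      finally have "prob {\<omega> \<in> space M. (\<Sum>x\<in>Cl r. Y x \<omega>) > \<epsilon>0 / n} \<le> exp 1 * exp (- \<theta> * (\<epsilon>0 / n))"
        by (intro chernoff_bound \<theta>) auto
      also have "- \<theta> * (\<epsilon>0 / n) = - 3 * l" using n e0 by (simp add: \<theta>_def)
      finally show ?thesis .
    qed
    have sub: "{\<omega> \<in> space M. (\<Sum>x\<in>lattice_box N. Y x \<omega>) > \<epsilon>0} \<subseteq>
        (\<Union>r\<in>lattice_box m. {\<omega> \<in> space M. (\<Sum>x\<in>Cl r. Y x \<omega>) > \<epsilon>0 / n})"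
    proof (rule subsetI, rule ccontr)
      fix \<omega>
      assume w: "\<omega> \<in> {\<omega> \<in> space M. (\<Sum>x\<in>lattice_box N. Y x \<omega>) > \<epsilon>0}"
        and nw: "\<omega> \<notin> (\<Union>r\<in>lattice_box m. {\<omega> \<in> space M. (\<Sum>x\<in>Cl r. Y x \<omega>) > \<epsilon>0 / n})"
      have small: "(\<Sum>x\<in>Cl r. Y x \<omega>) \<le> \<epsilon>0 / n" if "r \<in> lattice_box m" for r
        using that w nw by (auto simp: not_less)
      have "(\<Sum>x\<in>lattice_box N. Y x \<omega>) = (\<Sum>r\<in>lattice_box m. \<Sum>x\<in>Cl r. Y x \<omega>)"
        unfolding Cl_def using cls by (intro sum.group[symmetric]) auto
      also have "\<dots> \<le> (\<Sum>r\<in>(lattice_box m :: 'd site set). \<epsilon>0 / n)" by (intro sum_mono small)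
      also have "\<dots> = \<epsilon>0" using n by (simp add: n_def)
      finally show False using w by simp
    qed
    have "prob {\<omega> \<in> space M. (\<Sum>x\<in>lattice_box N. Y x \<omega>) > \<epsilon>0} \<le>
       prob (\<Union>r\<in>lattice_box m. {\<omega> \<in> space M. (\<Sum>x\<in>Cl r. Y x \<omega>) > \<epsilon>0 / n})"
      by (rule finite_measure_mono[OF sub]) measurable
    also have "\<dots> \<le> (\<Sum>r\<in>lattice_box m. prob {\<omega> \<in> space M. (\<Sum>x\<in>Cl r. Y x \<omega>) > \<epsilon>0 / n})"
      by (intro measure_UNION_le) auto
    also have "\<dots> \<le> (\<Sum>r\<in>(lattice_box m :: 'd site set). exp 1 * exp (- 3 * l))" by (intro sum_mono one)
    also have "\<dots> = (n * exp 1) * exp (- 3 * l)" by (simp add: n_def)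
    also have "\<dots> \<le> exp l * exp (- 3 * l)"
    proof (rule mult_right_mono)
      have "exp (ln (n * exp 1)) \<le> exp l" using elim(2) unfolding l_def exp_le_cancel_iff .
      moreover have "exp (ln (n * exp 1)) = n * exp 1" using n by (intro exp_ln) simp
      ultimately show "n * exp 1 \<le> exp l" by simp
    qed simp
    also have "\<dots> = exp (- 2 * l)" by (simp flip: exp_add)
    finally show ?case by (simp add: Y_def l_def)
  qed
qed

text \<open>
  At height \<open>quadratic_Mstar c\<close> the disorder alone has the cost \<open>d + 2 d G\<^sup>* c / G\<^sup>*\<^sub>(\<^sub>2\<^sub>)\<close>; the hypothesis on
  \<open>c\<close> makes it larger than \<open>d + 1\<close>.
\<close>

lemma mean_field_max_small:
  assumes a: "\<alpha> = 2" and c: "c > 0" "tail_rate_above T c" and t: "quadratic_Mstar c < t"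
    and Q: "Gstar_pow TYPE('d) 2 / c < 2 * real CARD('d) * Gstar TYPE('d)"
  obtains p where "p > 1" "\<forall>\<^sub>F N in sequentially.
     prob {\<omega> \<in> space M. \<exists>x\<in>lattice_box N. mean_field N (\<lambda>y. \<eta> y \<omega>) x > t * level N} \<le> 3 ^ CARD('d) * exp (- p * ln (real N))"
proof -
  obtain B where B: "B \<ge> 1" and sw: "sub_weibull M \<alpha> c B (\<eta> 0)"
    using tail_sub_weibull[OF \<eta>_measurable symm tail c] by blast
  define S where "S = Gstar_pow TYPE('d) 2"
  have S: "S \<ge> 1" unfolding S_def by (rule Gstar_pow_ge_1) auto
  have Mpos: "quadratic_Mstar c > 0" "(quadratic_Mstar c)\<^sup>2 = 2 * real CARD('d) * (Gstar TYPE('d) + S / (2 * c))"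
    using S c Gstar_ge_one by (simp_all add: quadratic_Mstar_def S_def[symmetric] add_pos_nonneg)
  \<comment> \<open>The optimal parameter for the disorder alone, and the excess of the cost over \<open>d + 1\<close>.\<close>
  define \<kappa> where "\<kappa> = 2 * c * quadratic_Mstar c / S"
  have \<kappa>: "\<kappa> > 0" using c Mpos S by (simp add: \<kappa>_def)
  define h where "h = 2 * real CARD('d) * Gstar TYPE('d) * c / S - 1"
  have h: "h > 0" using Q c S by (simp add: h_def S_def[symmetric] field_simps)
  have fr: "field_rate c \<kappa> - \<kappa> * quadratic_Mstar c = - (real CARD('d) + 1 + h)"
  proof -
    have "field_rate c \<kappa> = \<kappa>\<^sup>2 * S / (4 * c)"
      using a c \<kappa> by (simp add: field_rate_def young_const_2 S_def)
    also have "\<dots> = c * (quadratic_Mstar c)\<^sup>2 / S" using c S by (simp add: \<kappa>_def power2_eq_square field_simps)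
    finally have 1: "field_rate c \<kappa> = c * (quadratic_Mstar c)\<^sup>2 / S" .
    have 2: "\<kappa> * quadratic_Mstar c = 2 * (c * (quadratic_Mstar c)\<^sup>2 / S)" by (simp add: \<kappa>_def power2_eq_square)
    have 3: "c * (quadratic_Mstar c)\<^sup>2 / S = real CARD('d) + 1 + h"
      unfolding Mpos(2) h_def using c S by (simp add: field_simps)
    show ?thesis unfolding 1 2 3 by simp
  qed
  obtain l1 where l1: "l1 \<ge> 1" "\<And>l X Y x g. l \<ge> l1 \<Longrightarrow> good_family c B 1 l X \<Longrightarrow> finite Y \<Longrightarrow>
     (\<And>y. y \<in> Y \<Longrightarrow> 0 \<le> g y \<and> g y \<le> gr (y - x)) \<Longrightarrow>
     (\<integral>\<^sup>+\<omega>. ennreal (exp (\<kappa> * l powr ((\<alpha> - 1) / \<alpha>) * (\<Sum>y\<in>Y. g y * X y \<omega>))) \<partial>M) \<le>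
       ennreal (exp ((field_rate c \<kappa> + h / 2) * l))"
  proof (rule field_mgf[OF c(1) B \<kappa>, of 1 "h / 2"])
  qed (use a h in auto)
  show thesis
  proof (rule that[of "1 + h / 2"])
    show "1 + h / 2 > 1" using h by simp
    show "\<forall>\<^sub>F N in sequentially.
     prob {\<omega> \<in> space M. \<exists>x\<in>lattice_box N. mean_field N (\<lambda>y. \<eta> y \<omega>) x > t * level N} \<le> 3 ^ CARD('d) * exp (- (1 + h / 2) * ln (real N))"
      using eventually_ln_ge[of l1] eventually_ge_at_top[of 1]
    proof eventually_elim
      case (elim N)
      define l where "l = ln (real N)"
      have l: "l \<ge> l1" "l \<ge> 1" using elim l1 by (auto simp: l_def)
      have lv: "level N = l powr (1 / \<alpha>)" by (simp add: level_def l_def)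
      define s where "s = \<kappa> * l powr ((\<alpha> - 1) / \<alpha>)"
      have s: "s \<ge> 0" using \<kappa> by (simp add: s_def)
      have X: "good_family c B 1 l \<eta>" using good_family_\<eta>[OF sw] a by simp
      have one: "prob {\<omega> \<in> space M. mean_field N (\<lambda>y. \<eta> y \<omega>) x > t * level N} \<le> exp (- (real CARD('d) + 1 + h / 2) * l)" for x
      proof -
        have "(\<integral>\<^sup>+\<omega>. ennreal (exp (s * mean_field N (\<lambda>y. \<eta> y \<omega>) x)) \<partial>M) \<le> ennreal (exp ((field_rate c \<kappa> + h / 2) * l))"
          unfolding mean_field_def s_def
          using box_green_nonneg[OF dim] box_green_le_green[OF dim] by (intro l1(2)[OF l(1) X]) auto
        then have "prob {\<omega> \<in> space M. mean_field N (\<lambda>y. \<eta> y \<omega>) x > t * level N} \<le> exp ((field_rate c \<kappa> + h / 2) * l) * exp (- s * (t * level N))"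
          using s by (intro chernoff_bound) auto
        also have "- s * (t * level N) = - (\<kappa> * t * l)"
          using level_scale[OF l(2), of \<kappa> t] by (simp add: s_def lv)
        also have "exp ((field_rate c \<kappa> + h / 2) * l) * exp (- (\<kappa> * t * l)) = exp ((field_rate c \<kappa> + h / 2 - \<kappa> * t) * l)"
          by (simp add: algebra_simps flip: exp_add)
        also have "\<dots> \<le> exp (- (real CARD('d) + 1 + h / 2) * l)"
        proof -
          have "\<kappa> * quadratic_Mstar c \<le> \<kappa> * t" using t \<kappa> by simp
          then have "field_rate c \<kappa> + h / 2 - \<kappa> * t \<le> - (real CARD('d) + 1 + h / 2)" using fr by linarith
          then have "(field_rate c \<kappa> + h / 2 - \<kappa> * t) * l \<le> - (real CARD('d) + 1 + h / 2) * l"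
            using l by (intro mult_right_mono) auto
          then show ?thesis by simp
        qed
        finally show ?thesis .
      qed
      have "{\<omega> \<in> space M. \<exists>x\<in>lattice_box N. mean_field N (\<lambda>y. \<eta> y \<omega>) x > t * level N} =
         (\<Union>x\<in>lattice_box N. {\<omega> \<in> space M. mean_field N (\<lambda>y. \<eta> y \<omega>) x > t * level N})" by auto
      then have "prob {\<omega> \<in> space M. \<exists>x\<in>lattice_box N. mean_field N (\<lambda>y. \<eta> y \<omega>) x > t * level N} \<le>
         (\<Sum>x\<in>lattice_box N. prob {\<omega> \<in> space M. mean_field N (\<lambda>y. \<eta> y \<omega>) x > t * level N})"
        by (simp only:) (intro measure_UNION_le, auto)
      also have "\<dots> \<le> (\<Sum>x\<in>(lattice_box N :: 'd site set). exp (- (real CARD('d) + 1 + h / 2) * l))"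
        by (intro sum_mono one)
      also have "\<dots> = real (card (lattice_box N :: 'd site set)) * exp (- (real CARD('d) + 1 + h / 2) * l)" by simp
      also have "\<dots> \<le> (3 ^ CARD('d) * exp (real CARD('d) * l)) * exp (- (real CARD('d) + 1 + h / 2) * l)"
        using card_lattice_box_le[of N, where 'd = 'd] elim by (intro mult_right_mono) (auto simp: l_def)
      also have "\<dots> = 3 ^ CARD('d) * exp (- (1 + h / 2) * l)"
        by (simp add: algebra_simps flip: exp_add)
      finally show ?case by (simp add: l_def)
    qed
  qed
qed

text \<open>
  Almost surely, for all large \<open>N\<close>, the centre stays below \<open>Mstar + \<epsilon> / 2\<close> and its far part below \<open>\<epsilon> / 8\<close>,
  in units of \<open>level N\<close>.  Then the near part stays below the threshold of \<open>near_cost\<close>, and the union bound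
  with the optimal parameter \<open>b x\<close> at each site is at most the sum of \<open>near_cost\<close>.
\<close>

theorem max_upper_almost_surely:
  assumes a: "\<alpha> = 2" and \<epsilon>: "\<epsilon> > 0"
    and P: "T = TailLight \<or> (\<exists>c0. T = TailA 2 c0 \<and> Gstar_pow TYPE('d) 2 / c0 < 2 * real CARD('d) * Gstar TYPE('d))"
  shows "AE \<omega> in M. (\<lambda>N. measure (gibbs N (\<lambda>x. \<eta> x \<omega>))
     {\<phi> \<in> space (gibbs N (\<lambda>x. \<eta> x \<omega>)). scaled_max T N \<phi> \<le> Mstar TYPE('d) T + \<epsilon>}) \<longlonglongrightarrow> 1"
proof -
  have Gpos: "Gstar TYPE('d) > 0" using Gstar_ge_one by simp
  define m0 where "m0 = Mstar TYPE('d) T"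
  define t where "t = m0 + \<epsilon>"
  define t1 where "t1 = m0 + \<epsilon> / 2"
  define t' where "t' = m0 + 7 * \<epsilon> / 8"
  define w where "w = \<epsilon> / 4"
  obtain c where c: "c > 0" "tail_rate_above T c" "quadratic_Mstar c < t1" "Gstar_pow TYPE('d) 2 / c < 2 * real CARD('d) * Gstar TYPE('d)"
  proof (rule quadratic_rate_choice[OF a _ P, of t1])
    show "t1 > Mstar TYPE('d) T" using \<epsilon> by (simp add: t1_def m0_def)
  next
    fix c0 :: real assume c0: "Gstar_pow TYPE('d) 2 / c0 < 2 * real CARD('d) * Gstar TYPE('d)" "c0 > 0"
    have "((\<lambda>c. Gstar_pow TYPE('d) 2 / c) \<longlongrightarrow> Gstar_pow TYPE('d) 2 / c0) (at_left c0)"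
      using c0 by (intro tendsto_intros) auto
    then show "\<forall>\<^sub>F c in at_left c0. Gstar_pow TYPE('d) 2 / c < 2 * real CARD('d) * Gstar TYPE('d)"
      using c0(1) by (rule order_tendstoD(2))
  next
    have "((\<lambda>c. Gstar_pow TYPE('d) 2 / c) \<longlongrightarrow> 0) at_top"
      by (intro tendsto_divide_0[OF tendsto_const] filterlim_at_top_imp_at_infinity filterlim_ident)
    then show "\<forall>\<^sub>F c in at_top. Gstar_pow TYPE('d) 2 / c < 2 * real CARD('d) * Gstar TYPE('d)"
      using Gpos by (intro order_tendstoD(2)) auto
  qed
  obtain p where p: "p > 1" "\<forall>\<^sub>F N in sequentially.
     prob {\<omega> \<in> space M. \<exists>x\<in>lattice_box N. mean_field N (\<lambda>y. \<eta> y \<omega>) x > t1 * level N} \<le> 3 ^ CARD('d) * exp (- p * ln (real N))"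
    using mean_field_max_small[OF a c] by blast
  have "\<epsilon> / 8 > 0" using \<epsilon> by simp
  then obtain F where F: "finite F" "\<And>F'. F \<subseteq> F' \<Longrightarrow>
    \<forall>\<^sub>F N in sequentially. prob {\<omega> \<in> space M. \<exists>x\<in>lattice_box N. \<bar>far N F' x \<omega>\<bar> > \<epsilon> / 8 * level N} \<le> exp (- 2 * ln (real N))"
    using far_field_small[of "\<epsilon> / 8" 2] by blast
  have t': "t' > Mstar TYPE('d) T" using \<epsilon> by (simp add: t'_def m0_def)
  have w: "w > 0" using \<epsilon> by (simp add: w_def)
  have ev1: "AE \<omega> in M. \<forall>\<^sub>F N in sequentially. \<omega> \<notin> {\<omega> \<in> space M. \<exists>x\<in>lattice_box N. mean_field N (\<lambda>y. \<eta> y \<omega>) x > t1 * level N}"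
    by (rule borel_cantelli_ln[OF _ p(2,1)]) measurable
  have ev2: "AE \<omega> in M. \<forall>\<^sub>F N in sequentially. \<omega> \<notin> {\<omega> \<in> space M. \<exists>x\<in>lattice_box N. \<bar>far N F x \<omega>\<bar> > \<epsilon> / 8 * level N}"
    by (rule borel_cantelli_ln[where p = 2 and K = 1]) (use F(2)[of F] in auto)
  have ev3: "AE \<omega> in M. \<forall>k. \<forall>\<^sub>F N in sequentially. \<omega> \<notin> {\<omega> \<in> space M. (\<Sum>x\<in>lattice_box N. near_cost t' w N F x \<omega>) > 1 / real (Suc k)}"
    unfolding AE_all_countable
    by (intro allI borel_cantelli_ln[where p = 2 and K = 1])
       (use near_cost_sum_small[OF a t' w _ F(1)] in auto)
  show ?thesis
    using ev1 ev2 ev3 AE_space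
  proof eventually_elim
    case (elim \<omega>)
    let ?p = "\<lambda>N. measure (gibbs N (\<lambda>x. \<eta> x \<omega>)) {\<phi> \<in> space (gibbs N (\<lambda>x. \<eta> x \<omega>)). scaled_max T N \<phi> \<le> Mstar TYPE('d) T + \<epsilon>}"
    have ge: "\<forall>\<^sub>F N in sequentially. ?p N \<ge> 1 - 1 / real (Suc k)" for k
      using elim(1,2) elim(3)[rule_format, of k] eventually_ln_ge[of 1]
    proof eventually_elim
      case (elim N)
      have L: "level N \<ge> 0" by (simp add: level_def)
      define m where "m = mean_field N (\<lambda>y. \<eta> y \<omega>)"
      define b where "b x = (t * level N - m x) / Gstar TYPE('d)" for x
      have cost: "0 \<le> b x \<and> exp (b x * (m x - t * level N) + (b x)\<^sup>2 * Gstar TYPE('d) / 2) \<le> near_cost t' w N F x \<omega>"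
        if x: "x \<in> lattice_box N" for x
      proof -
        have m1: "m x \<le> t1 * level N" using elim(1) x \<open>\<omega> \<in> space M\<close> by (auto simp: m_def not_less)
        have f1: "\<bar>far N F x \<omega>\<bar> \<le> \<epsilon> / 8 * level N" using elim(2) x \<open>\<omega> \<in> space M\<close> by (auto simp: not_less)
        have mn: "m x = near N F x \<omega> + far N F x \<omega>" by (simp add: m_def mean_field_near_far)
        have n1: "near N F x \<omega> \<le> (t' - w) * level N"
          using m1 f1 mn by (simp add: t1_def t'_def w_def algebra_simps)
        have u1: "t' * level N - near N F x \<omega> \<le> t * level N - m x"
          using f1 mn by (simp add: t'_def t_def algebra_simps)
        have u0: "0 \<le> t' * level N - near N F x \<omega>"
          using n1 mult_nonneg_nonneg[OF less_imp_le[OF w] L] by (simp add: algebra_simps)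
        have b0: "0 \<le> b x" using u0 u1 Gpos by (simp add: b_def)
        have "b x * (m x - t * level N) + (b x)\<^sup>2 * Gstar TYPE('d) / 2 = - (t * level N - m x)\<^sup>2 / (2 * Gstar TYPE('d))"
          using Gpos by (simp add: b_def power2_eq_square field_simps)
        also have "\<dots> \<le> - (t' * level N - near N F x \<omega>)\<^sup>2 / (2 * Gstar TYPE('d))"
        proof -
          have "(t' * level N - near N F x \<omega>)\<^sup>2 \<le> (t * level N - m x)\<^sup>2" using u0 u1 by (intro power_mono) auto
          then show ?thesis using Gpos by (intro divide_right_mono) auto
        qed
        finally show ?thesis using b0 n1 by (simp add: near_cost_def)
      qed
      have "1 - (\<Sum>x\<in>lattice_box N. exp (b x * (m x - t * level N) + (b x)\<^sup>2 * Gstar TYPE('d) / 2)) \<le>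
        measure (gibbs N (\<lambda>x. \<eta> x \<omega>)) {\<phi> \<in> space (field_space N). \<forall>x\<in>lattice_box N. \<phi> x \<le> t * level N}"
        unfolding m_def using cost by (intro gibbs_max_le[OF dim]) (auto simp: m_def)
      also have "\<dots> = ?p N" using elim(4) by (simp add: scaled_max_le_iff t_def m0_def)
      finally have "1 - (\<Sum>x\<in>lattice_box N. exp (b x * (m x - t * level N) + (b x)\<^sup>2 * Gstar TYPE('d) / 2)) \<le> ?p N" .
      moreover have "(\<Sum>x\<in>lattice_box N. exp (b x * (m x - t * level N) + (b x)\<^sup>2 * Gstar TYPE('d) / 2)) \<le> (\<Sum>x\<in>lattice_box N. near_cost t' w N F x \<omega>)"
        using cost by (intro sum_mono) auto
      moreover have "(\<Sum>x\<in>lattice_box N. near_cost t' w N F x \<omega>) \<le> 1 / real (Suc k)"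
        using elim(3) \<open>\<omega> \<in> space M\<close> by (auto simp: not_less)
      ultimately show ?case by linarith
    qed
    have le: "?p N \<le> 1" for N
      using prob_space.prob_le_1[OF prob_space_gibbs[OF dim, of N "\<lambda>x. \<eta> x \<omega>"]] .
    show "?p \<longlonglongrightarrow> 1"
    proof (rule tendstoI)
      fix e :: real assume e: "e > 0"
      obtain k where k: "1 / real (Suc k) < e" using nat_approx_posE[OF e] by blast
      show "\<forall>\<^sub>F N in sequentially. dist (?p N) 1 < e"
        using ge[of k] by eventually_elim (use k le in \<open>simp add: dist_real_def abs_if\<close>, smt (verit) le)
    qed
  qed
qed

end

text \<open>
  A lower Chernoff bound for independent trials with success probability at least \<open>p\<close>.
\<close>

lemma (in prob_space) count_lower_tail:
  fixes f :: "'i \<Rightarrow> 'a \<Rightarrow> real"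
  assumes A: "finite A" and ind: "indep_vars (\<lambda>_. borel) f A"
    and f: "\<And>x \<omega>. f x \<omega> = 0 \<or> f x \<omega> = 1"
    and p: "\<And>x. x \<in> A \<Longrightarrow> prob {\<omega> \<in> space M. f x \<omega> = 1} \<ge> p" "p \<ge> 0"
  shows "prob {\<omega> \<in> space M. (\<Sum>x\<in>A. f x \<omega>) < real (card A) * p / 4} \<le> exp (- (real (card A) * p / 4))"
proof -
  have [measurable]: "f x \<in> borel_measurable M" if "x \<in> A" for x
    using ind that by (auto simp: indep_vars_def)
  have one: "(\<integral>\<^sup>+\<omega>. ennreal (exp (- f x \<omega>)) \<partial>M) \<le> ennreal (exp (- (p / 2)))" if x: "x \<in> A" for x
  proof -
    have f1: "f x \<omega> \<le> 1" "f x \<omega> \<ge> 0" for \<omega> using f[of x \<omega>] by auto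
    have i: "integrable M (f x)"
      using x f1 by (intro integrable_const_bound[of _ 1]) auto
    have "(\<integral>\<omega>. f x \<omega> \<partial>M) = (\<integral>\<omega>. indicator {\<omega> \<in> space M. f x \<omega> = 1} \<omega> \<partial>M)"
      using f by (intro Bochner_Integration.integral_cong) (auto simp: indicator_def)
    also have "\<dots> = prob {\<omega> \<in> space M. f x \<omega> = 1}" using x by simp
    finally have Ef: "(\<integral>\<omega>. f x \<omega> \<partial>M) \<ge> p" using p(1)[OF x] by simp
    have "exp (- 1 :: real) \<le> 1 / 2"
      using exp_ge_add_one_self[of 1] by (simp add: exp_minus field_simps)
    then have "exp (- f x \<omega>) \<le> 1 - f x \<omega> / 2" for \<omega> using f[of x \<omega>] by auto
    then have "(\<integral>\<^sup>+\<omega>. ennreal (exp (- f x \<omega>)) \<partial>M) \<le> (\<integral>\<^sup>+\<omega>. ennreal (1 - f x \<omega> / 2) \<partial>M)"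
      by (intro nn_integral_mono ennreal_leI)
    also have "\<dots> = ennreal (\<integral>\<omega>. 1 - f x \<omega> / 2 \<partial>M)"
      using i f1 by (intro nn_integral_eq_integral) (auto intro!: AE_I2 order_trans[OF f1(1)])
    also have "(\<integral>\<omega>. 1 - f x \<omega> / 2 \<partial>M) = 1 - (\<integral>\<omega>. f x \<omega> \<partial>M) / 2"
      using i by (simp add: prob_space)
    also have "ennreal \<dots> \<le> ennreal (exp (- (p / 2)))"
      using Ef exp_ge_add_one_self[of "- (p / 2)"] by (intro ennreal_leI) linarith
    finally show ?thesis .
  qed
  have "indep_vars (\<lambda>_. borel) (\<lambda>x \<omega>. ennreal (exp (- f x \<omega>))) A"
    by (rule indep_vars_compose2[OF ind]) simp
  then have "(\<integral>\<^sup>+\<omega>. (\<Prod>x\<in>A. ennreal (exp (- f x \<omega>))) \<partial>M) = (\<Prod>x\<in>A. \<integral>\<^sup>+\<omega>. ennreal (exp (- f x \<omega>)) \<partial>M)"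
    using A by (intro indep_vars_nn_integral) auto
  also have "\<dots> \<le> (\<Prod>x\<in>A. ennreal (exp (- (p / 2))))"
    by (rule prod_mono_ennreal) (rule one)
  also have "\<dots> = ennreal (exp (real (card A) * - (p / 2)))"
    by (simp only: prod_constant exp_of_nat_mult) (simp add: ennreal_power)
  finally have "(\<integral>\<^sup>+\<omega>. ennreal (exp (1 * - (\<Sum>x\<in>A. f x \<omega>))) \<partial>M) \<le> ennreal (exp (real (card A) * - (p / 2)))"
    using A by (simp add: prod_ennreal exp_sum sum_negf[symmetric])
  then have "prob {\<omega> \<in> space M. - (\<Sum>x\<in>A. f x \<omega>) > - (real (card A) * p / 4)} \<le>
      exp (real (card A) * - (p / 2)) * exp (- 1 * - (real (card A) * p / 4))"
    by (intro chernoff_bound) auto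
  then show ?thesis by (simp add: field_simps flip: exp_add)
qed

context random_field
begin

section \<open>Almost sure lower bound\<close>

lemma prob_nonneg_half: "prob {\<omega> \<in> space M. \<eta> 0 \<omega> \<ge> 0} \<ge> 1 / 2"
proof -
  have "1 = prob ({\<omega> \<in> space M. \<eta> 0 \<omega> \<in> {0..}} \<union> {\<omega> \<in> space M. - \<eta> 0 \<omega> \<in> {0..}})"
    by (subst prob_space[symmetric]) (auto intro!: arg_cong[where f = prob])
  also have "\<dots> \<le> prob {\<omega> \<in> space M. \<eta> 0 \<omega> \<in> {0..}} + prob {\<omega> \<in> space M. - \<eta> 0 \<omega> \<in> {0..}}"
    by (rule measure_Un_le) measurable
  also have "prob {\<omega> \<in> space M. - \<eta> 0 \<omega> \<in> {0..}} = prob {\<omega> \<in> space M. \<eta> 0 \<omega> \<in> {0..}}"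
    by (intro symmetric_prob symm) auto
  finally show ?thesis by simp
qed

lemma prob_all_ge:
  assumes "finite Y"
  shows "prob {\<omega> \<in> space M. \<forall>y\<in>Y. \<eta> y \<omega> \<ge> u y} = (\<Prod>y\<in>Y. prob {\<omega> \<in> space M. \<eta> 0 \<omega> \<ge> u y})"
proof -
  have "indep_vars (\<lambda>_. borel) \<eta> Y" using indep by (rule indep_vars_subset) simp
  then have "indep_vars (\<lambda>_. borel) (\<lambda>y \<omega>. (indicator {u y..} (\<eta> y \<omega>) :: ennreal)) Y"
    by (rule indep_vars_compose2) simp
  then have e: "(\<integral>\<^sup>+\<omega>. (\<Prod>y\<in>Y. indicator {u y..} (\<eta> y \<omega>)) \<partial>M) = (\<Prod>y\<in>Y. \<integral>\<^sup>+\<omega>. indicator {u y..} (\<eta> y \<omega>) \<partial>M)"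
    using assms by (intro indep_vars_nn_integral) auto
  have 1: "(\<integral>\<^sup>+\<omega>. indicator {u y..} (\<eta> y \<omega>) \<partial>M) = ennreal (prob {\<omega> \<in> space M. \<eta> 0 \<omega> \<ge> u y})" for y
  proof -
    have "(\<integral>\<^sup>+\<omega>. indicator {u y..} (\<eta> y \<omega>) \<partial>M) = (\<integral>\<^sup>+\<omega>. indicator {\<omega> \<in> space M. \<eta> y \<omega> \<in> {u y..}} \<omega> \<partial>M)"
      by (intro nn_integral_cong) (auto simp: indicator_def)
    also have "\<dots> = ennreal (prob {\<omega> \<in> space M. \<eta> y \<omega> \<in> {u y..}})"
      by (subst nn_integral_indicator) (auto simp: emeasure_eq_measure)
    finally show ?thesis using prob_\<eta>_eq[of "{u y..}" y] by simp
  qed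
  have "(\<Prod>y\<in>Y. indicator {u y..} (\<eta> y \<omega>)) = (indicator {\<omega>. \<forall>y\<in>Y. \<eta> y \<omega> \<ge> u y} \<omega> :: ennreal)" for \<omega>
    using assms by (auto simp: indicator_def intro!: prod.neutral)
  then have "(\<integral>\<^sup>+\<omega>. (\<Prod>y\<in>Y. indicator {u y..} (\<eta> y \<omega>)) \<partial>M) = (\<integral>\<^sup>+\<omega>. indicator {\<omega> \<in> space M. \<forall>y\<in>Y. \<eta> y \<omega> \<ge> u y} \<omega> \<partial>M)"
    by (intro nn_integral_cong) (auto simp: indicator_def)
  also have "\<dots> = ennreal (prob {\<omega> \<in> space M. \<forall>y\<in>Y. \<eta> y \<omega> \<ge> u y})"
    using assms by (subst nn_integral_indicator) (auto simp: emeasure_eq_measure)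
  finally have "ennreal (prob {\<omega> \<in> space M. \<forall>y\<in>Y. \<eta> y \<omega> \<ge> u y}) = ennreal (\<Prod>y\<in>Y. prob {\<omega> \<in> space M. \<eta> 0 \<omega> \<ge> u y})"
    unfolding e 1 by (simp add: prod_ennreal)
  then show ?thesis by (simp add: prod_nonneg)
qed

text \<open>
  Requiring \<open>\<eta> (x + z) \<ge> a z * level N\<close> for all \<open>z\<close> in \<open>F\<close> has cost at most \<open>\<beta>\<close>, uniformly in the finite set
  \<open>F\<close>: sites with \<open>a z = 0\<close> only contribute a factor 1/2, by symmetry.
\<close>

definition profile_cost :: "('d site \<Rightarrow> real) \<Rightarrow> real \<Rightarrow> bool" where
  "profile_cost a \<beta> \<longleftrightarrow> (\<forall>F. finite F \<longrightarrow> (\<forall>\<^sub>F l in at_top.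
     (\<Prod>z\<in>F. prob {\<omega> \<in> space M. \<eta> 0 \<omega> \<ge> a z * l powr (1 / \<alpha>)}) \<ge> (1 / 2) ^ card F * exp (- \<beta> * l)))"

lemma profile_cost_zero: "profile_cost (\<lambda>_. 0) 0"
  unfolding profile_cost_def
proof (intro allI impI always_eventually)
  fix F :: "'d site set" and l :: real assume "finite F"
  have "(\<Prod>z\<in>F. 1 / 2) \<le> (\<Prod>z\<in>F. prob {\<omega> \<in> space M. \<eta> 0 \<omega> \<ge> 0})"
    using prob_nonneg_half by (intro prod_mono) auto
  then show "(1 / 2) ^ card F * exp (- 0 * l) \<le> (\<Prod>z\<in>F. prob {\<omega> \<in> space M. \<eta> 0 \<omega> \<ge> 0 * l powr (1 / \<alpha>)})"
    by simp
qed

lemma profile_costI: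
  assumes T: "T = TailA \<alpha> c" and c: "c < c'" and F0: "finite F0" and a: "\<And>z. a z \<ge> 0" "\<And>z. z \<notin> F0 \<Longrightarrow> a z = 0"
  shows "profile_cost a (c' * (\<Sum>z\<in>F0. a z powr \<alpha>))"
  unfolding profile_cost_def
proof (intro allI impI)
  fix F :: "'d site set" assume F: "finite F"
  have c0: "c' > 0" using tail T c by (metis has_tail.simps(1) less_trans)
  have tl: "\<forall>\<^sub>F r in at_top. prob {\<omega> \<in> space M. \<eta> 0 \<omega> \<ge> r} \<ge> exp (- c' * r powr \<alpha>)"
    using tail T c by (intro tail_lower_bound) auto
  have "\<forall>\<^sub>F l in at_top. prob {\<omega> \<in> space M. \<eta> 0 \<omega> \<ge> a z * l powr (1 / \<alpha>)} \<ge> (1 / 2) * exp (- (c' * a z powr \<alpha>) * l)" for z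
  proof (cases "a z = 0")
    case True
    then show ?thesis using prob_nonneg_half by simp
  next
    case False
    then have az: "a z > 0" using a(1)[of z] by simp
    have "filterlim (\<lambda>l. a z * l powr (1 / \<alpha>)) at_top at_top" using az \<alpha> by real_asymp
    then have "\<forall>\<^sub>F l in at_top. prob {\<omega> \<in> space M. \<eta> 0 \<omega> \<ge> a z * l powr (1 / \<alpha>)} \<ge> exp (- c' * (a z * l powr (1 / \<alpha>)) powr \<alpha>)"
      using tl by (rule eventually_compose_filterlim[rotated])
    then show ?thesis using eventually_gt_at_top[of 0]
    proof eventually_elim
      case (elim l)
      have "(a z * l powr (1 / \<alpha>)) powr \<alpha> = a z powr \<alpha> * l"
        using elim(2) az \<alpha> by (simp add: powr_mult powr_powr)
      then have "exp (- (c' * a z powr \<alpha>) * l) \<le> prob {\<omega> \<in> space M. \<eta> 0 \<omega> \<ge> a z * l powr (1 / \<alpha>)}"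
        using elim(1) by (simp add: mult.assoc)
      then show ?case using exp_gt_zero[of "- (c' * a z powr \<alpha>) * l"] by linarith
    qed
  qed
  then have "\<forall>\<^sub>F l in at_top. \<forall>z\<in>F. prob {\<omega> \<in> space M. \<eta> 0 \<omega> \<ge> a z * l powr (1 / \<alpha>)} \<ge> (1 / 2) * exp (- (c' * a z powr \<alpha>) * l)"
    using F by (simp add: eventually_ball_finite)
  then show "\<forall>\<^sub>F l in at_top. (\<Prod>z\<in>F. prob {\<omega> \<in> space M. \<eta> 0 \<omega> \<ge> a z * l powr (1 / \<alpha>)}) \<ge>
      (1 / 2) ^ card F * exp (- (c' * (\<Sum>z\<in>F0. a z powr \<alpha>)) * l)"
    using eventually_gt_at_top[of 0]
  proof eventually_elim
    case (elim l)
    have "(\<Sum>z\<in>F. a z powr \<alpha>) \<le> (\<Sum>z\<in>F0 \<union> F. a z powr \<alpha>)" using F F0 by (intro sum_mono2) auto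
    also have "\<dots> = (\<Sum>z\<in>F0. a z powr \<alpha>)" using F F0 a(2) by (intro sum.mono_neutral_right) auto
    finally have "c' * (\<Sum>z\<in>F. a z powr \<alpha>) * l \<le> c' * (\<Sum>z\<in>F0. a z powr \<alpha>) * l"
      using c0 elim(2) by (intro mult_right_mono mult_left_mono) auto
    then have "(1 / 2) ^ card F * exp (- (c' * (\<Sum>z\<in>F0. a z powr \<alpha>)) * l) \<le> (1 / 2) ^ card F * exp (- (c' * (\<Sum>z\<in>F. a z powr \<alpha>)) * l)"
      by simp
    also have "\<dots> = (\<Prod>z\<in>F. (1 / 2) * exp (- (c' * a z powr \<alpha>) * l))"
    proof -
      have "- (c' * (\<Sum>z\<in>F. a z powr \<alpha>)) * l = (\<Sum>z\<in>F. - (c' * a z powr \<alpha>) * l)"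
        by (simp add: sum_distrib_left sum_distrib_right sum_negf)
      then show ?thesis using exp_sum[OF F, of "\<lambda>z. - (c' * a z powr \<alpha>) * l"]
        by (simp only: prod.distrib prod_constant)
    qed
    also have "\<dots> \<le> (\<Prod>z\<in>F. prob {\<omega> \<in> space M. \<eta> 0 \<omega> \<ge> a z * l powr (1 / \<alpha>)})"
      using elim(1) by (intro prod_mono) auto
    finally show ?case .
  qed
qed

lemma green_powr_partial:
  assumes a: "1 < a" "a \<le> 2"
  shows "((\<lambda>F. \<Sum>z\<in>F. gr z powr (a / (a - 1))) \<longlongrightarrow> Gstar_pow TYPE('d) a) (finite_subsets_at_top UNIV)"
  using has_sum_infsum[OF green_powr_summable[OF a]] by (simp add: has_sum_def Gstar_pow_def)

lemma tendsto_at_right_choice: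
  assumes "(f \<longlongrightarrow> f c) (at_right c)" "(y::real) < f c"
  obtains c' where "c' > c" "y < f (c' :: real)"
proof -
  have "\<forall>\<^sub>F c' in at_right c. y < f c' \<and> c' > c"
    using order_tendstoD(1)[OF assms] eventually_at_right_less[of c] by eventually_elim simp
  then show thesis using that eventually_happens'[OF trivial_limit_at_right_real] by blast
qed

text \<open>
  The profile \<open>a\<close> and the Gaussian tilt \<open>\<kappa>\<close> have a total cost below \<open>d\<close> and gain more than \<open>Mstar - \<epsilon>\<close>.  The
  optimal profile is a point mass for \<open>\<alpha> \<le> 1\<close> and proportional to a power of the Green function for
  \<open>\<alpha> > 1\<close>; it is cut off to a finite set, the tail constant is slightly increased, and the height is
  slightly decreased to make the inequality for the cost strict.  For \<open>\<alpha> < 2\<close> any positive \<open>\<kappa>\<close>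
  within the remaining cost will do, since the Gaussian gain is of smaller order.
\<close>

lemma profile_choice:
  assumes \<epsilon>: "\<epsilon> > 0"
  obtains F0 a \<beta> \<kappa> where "finite F0" "\<And>z. a z \<ge> 0" "\<And>z. z \<notin> F0 \<Longrightarrow> a z = 0" "\<kappa> > 0"
    "profile_cost a \<beta>" "\<beta> + \<kappa>\<^sup>2 * Gstar TYPE('d) / 2 < real CARD('d)"
    "(\<Sum>z\<in>F0. gr z * a z) + (if \<alpha> = 2 then \<kappa> * Gstar TYPE('d) else 0) > Mstar TYPE('d) T - \<epsilon>"
proof -
  have Gpos: "Gstar TYPE('d) > 0" using Gstar_ge_one by simp
  consider (light) "T = TailLight" | (two) c where "T = TailA 2 c" | (low) a c where "T = TailA a c" "a \<le> 1"
    | (mid) a c where "T = TailA a c" "1 < a" "a < 2"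
    using tail by (cases T) fastforce+
  then show thesis
  proof cases
    case light
    define m where "m = Mstar TYPE('d) T"
    have m: "m > 0" "m\<^sup>2 = 2 * real CARD('d) * Gstar TYPE('d)" using Gpos light by (simp_all add: m_def)
    have "max 0 ((m - \<epsilon>) / Gstar TYPE('d)) < m / Gstar TYPE('d)" using m \<epsilon> Gpos by (simp add: divide_strict_right_mono)
    then obtain \<kappa> where k: "max 0 ((m - \<epsilon>) / Gstar TYPE('d)) < \<kappa>" "\<kappa> < m / Gstar TYPE('d)" using dense by blast
    have k0: "\<kappa> > 0" using k by simp
    have "\<kappa>\<^sup>2 < (m / Gstar TYPE('d))\<^sup>2" using k k0 by (intro power_strict_mono) auto
    then have "\<kappa>\<^sup>2 * Gstar TYPE('d) / 2 < (m / Gstar TYPE('d))\<^sup>2 * Gstar TYPE('d) / 2" using Gpos by simp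
    also have "\<dots> = real CARD('d)" using m Gpos by (simp add: power_divide power2_eq_square[of "Gstar TYPE('d)"])
    finally have k2: "0 + \<kappa>\<^sup>2 * Gstar TYPE('d) / 2 < real CARD('d)" by simp
    have k3: "\<kappa> * Gstar TYPE('d) > m - \<epsilon>" using k Gpos by (simp add: field_simps)
    show thesis
      by (rule that[of "{}" "\<lambda>_. 0" \<kappa> 0]) (use k0 k2 k3 profile_cost_zero light in \<open>auto simp: m_def\<close>)
  next
    case (two c)
    have c: "c > 0" using tail two by simp
    have al: "\<alpha> = 2" using two by simp
    define S where "S = Gstar_pow TYPE('d) 2"
    define m where "m = Mstar TYPE('d) T"
    define f where "f s c = sqrt (2 * real CARD('d) * (Gstar TYPE('d) + s / (2 * c)))" for s c
    have S: "S \<ge> 1" unfolding S_def by (rule Gstar_pow_ge_1) auto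
    have m: "m = f S c" using c two by (simp add: m_def f_def S_def field_simps)
    have "((\<lambda>c. f S c) \<longlongrightarrow> f S c) (at_right c)" unfolding f_def using c by (intro tendsto_intros) auto
    moreover have "m - \<epsilon> < f S c" using \<epsilon> m by simp
    ultimately obtain c' where c': "c' > c" "m - \<epsilon> < f S c'" by (rule tendsto_at_right_choice)
    have p: "((\<lambda>F. \<Sum>z\<in>F. gr z powr 2) \<longlongrightarrow> S) (finite_subsets_at_top UNIV)"
      using green_powr_partial[of 2] by (simp add: S_def)
    have "((\<lambda>F. f (\<Sum>z\<in>F. gr z powr 2) c') \<longlongrightarrow> f S c') (finite_subsets_at_top UNIV)"
      unfolding f_def using c c' by (intro tendsto_intros p) auto
    then have "\<forall>\<^sub>F F in finite_subsets_at_top UNIV. m - \<epsilon> < f (\<Sum>z\<in>F. gr z powr 2) c'"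
      using c'(2) by (rule order_tendstoD(1))
    then obtain F0 where F0: "finite F0" "m - \<epsilon> < f (\<Sum>z\<in>F0. gr z powr 2) c'"
      by (auto simp: eventually_finite_subsets_at_top)
    define s where "s = (\<Sum>z\<in>F0. gr z powr 2)"
    have s: "s \<ge> 0" by (simp add: s_def sum_nonneg)
    \<comment> \<open>With \<open>a\<close> proportional to \<open>\<kappa>\<close> the cost is \<open>\<kappa>\<^sup>2 * H / 2\<close> and the gain is \<open>\<kappa> * H\<close>.\<close>
    define H where "H = Gstar TYPE('d) + s / (2 * c')"
    have H: "H > 0" using s Gpos c c' by (simp add: H_def add_pos_nonneg)
    define h where "h = f s c'"
    have h: "h > 0" "h\<^sup>2 = 2 * real CARD('d) * H" using H by (simp_all add: h_def f_def H_def[symmetric])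
    have "max 0 ((m - \<epsilon>) / H) < h / H" using F0(2) h H by (simp add: divide_strict_right_mono s_def h_def)
    then obtain \<kappa> where k: "max 0 ((m - \<epsilon>) / H) < \<kappa>" "\<kappa> < h / H" using dense by blast
    have k0: "\<kappa> > 0" using k by simp
    have "\<kappa>\<^sup>2 < (h / H)\<^sup>2" using k k0 by (intro power_strict_mono) auto
    then have "\<kappa>\<^sup>2 * H / 2 < (h / H)\<^sup>2 * H / 2" using H by simp
    also have "\<dots> = real CARD('d)" using h H by (simp add: power_divide power2_eq_square[of H])
    finally have k2: "\<kappa>\<^sup>2 * H / 2 < real CARD('d)" .
    have k3: "\<kappa> * H > m - \<epsilon>" using k H by (simp add: field_simps)
    define a where "a z = (if z \<in> F0 then \<kappa> * gr z / (2 * c') else 0)" for z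
    have a: "a z \<ge> 0" "z \<notin> F0 \<Longrightarrow> a z = 0" for z
      using k0 c c' gr_nonneg by (auto simp: a_def)
    have "(\<Sum>z\<in>F0. a z powr \<alpha>) = (\<Sum>z\<in>F0. (\<kappa> / (2 * c'))\<^sup>2 * gr z powr 2)"
      using al k0 c c' gr_nonneg by (intro sum.cong) (auto simp: a_def power_mult_distrib power_divide)
    also have "\<dots> = (\<kappa> / (2 * c'))\<^sup>2 * s" by (simp add: s_def sum_distrib_left)
    finally have cost: "c' * (\<Sum>z\<in>F0. a z powr \<alpha>) = \<kappa>\<^sup>2 * s / (4 * c')"
      using c c' by (simp add: power2_eq_square field_simps)
    have pc: "profile_cost a (c' * (\<Sum>z\<in>F0. a z powr \<alpha>))"
      using two al c' F0 a by (intro profile_costI) auto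
    have "(\<Sum>z\<in>F0. gr z * a z) = (\<Sum>z\<in>F0. \<kappa> / (2 * c') * gr z powr 2)"
      using gr_nonneg by (intro sum.cong) (auto simp: a_def power2_eq_square)
    also have "\<dots> = \<kappa> / (2 * c') * s" by (simp add: s_def sum_distrib_left)
    finally have gain: "(\<Sum>z\<in>F0. gr z * a z) + \<kappa> * Gstar TYPE('d) = \<kappa> * H"
      using c c' by (simp add: H_def field_simps)
    have c3: "\<kappa>\<^sup>2 * s / (4 * c') + \<kappa>\<^sup>2 * Gstar TYPE('d) / 2 < real CARD('d)"
      using k2 c c' by (simp add: H_def field_simps)
    show thesis
      by (rule that[OF F0(1) a(1) a(2) k0 pc]) (use c3 cost gain k3 al in \<open>auto simp: m_def\<close>)
  next
    case (low b c)
    have c: "c > 0" "b > 0" using tail low by auto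
    have al: "\<alpha> = b" using low by simp
    define m where "m = Mstar TYPE('d) T"
    define f where "f c = (real CARD('d) / c) powr (1 / b) * Gstar TYPE('d)" for c
    have m: "m = f c" using low by (simp add: m_def f_def)
    have "(f \<longlongrightarrow> f c) (at_right c)" unfolding f_def using c by (intro tendsto_intros) auto
    moreover have "m - \<epsilon> < f c" using \<epsilon> m by simp
    ultimately obtain c' where c': "c' > c" "m - \<epsilon> < f c'" by (rule tendsto_at_right_choice)
    have "(m - \<epsilon>) / Gstar TYPE('d) < (real CARD('d) / c') powr (1 / b)" using c' Gpos by (simp add: f_def field_simps)
    then have "max 0 ((m - \<epsilon>) / Gstar TYPE('d)) < (real CARD('d) / c') powr (1 / b)" using c c' by simp
    then obtain s where s: "max 0 ((m - \<epsilon>) / Gstar TYPE('d)) < s" "s < (real CARD('d) / c') powr (1 / b)" using dense by blast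
    have s0: "s > 0" using s by simp
    have "s powr b < ((real CARD('d) / c') powr (1 / b)) powr b" using s s0 c by (intro powr_less_mono2) auto
    then have cost: "c' * s powr b < real CARD('d)" using c c' by (simp add: powr_powr field_simps)
    define a where "a z = (if z = (0 :: 'd site) then s else 0)" for z
    have pc: "profile_cost a (c' * (\<Sum>z\<in>{0}. a z powr \<alpha>))"
      using low al c' s0 by (intro profile_costI) (auto simp: a_def)
    define \<kappa> where "\<kappa> = sqrt ((real CARD('d) - c' * s powr b) / Gstar TYPE('d))"
    have k: "\<kappa> > 0" "\<kappa>\<^sup>2 * Gstar TYPE('d) = real CARD('d) - c' * s powr b" using cost Gpos by (simp_all add: \<kappa>_def)
    have "gr 0 * s > m - \<epsilon>" using s Gpos by (simp add: Gstar_def field_simps)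
    moreover have "c' * s powr b + \<kappa>\<^sup>2 * Gstar TYPE('d) / 2 < real CARD('d)" using k(2) cost by linarith
    ultimately show thesis
      using k(1) s0 low(2) al by (intro that[of "{0}" a, OF _ _ _ k(1) pc]) (auto simp: a_def m_def)
  next
    case (mid b c)
    have c: "c > 0" "b > 0" using tail mid by auto
    have al: "\<alpha> = b" using mid by simp
    define q where "q = b / (b - 1)"
    have q: "q > 1" "(q - 1) * b = q" using mid by (simp_all add: q_def field_simps)
    define S where "S = Gstar_pow TYPE('d) b"
    have S: "S \<ge> 1" unfolding S_def using mid by (intro Gstar_pow_ge_1) auto
    define m where "m = Mstar TYPE('d) T"
    define f where "f s c = (real CARD('d) / c) powr (1 / b) * s powr ((b - 1) / b)" for s c
    have m: "m = f S c" using mid by (simp add: m_def f_def S_def)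
    have "((\<lambda>c. f S c) \<longlongrightarrow> f S c) (at_right c)" unfolding f_def using c by (intro tendsto_intros) auto
    moreover have "m - \<epsilon> < f S c" using \<epsilon> m by simp
    ultimately obtain c' where c': "c' > c" "m - \<epsilon> < f S c'" by (rule tendsto_at_right_choice)
    have p: "((\<lambda>F. \<Sum>z\<in>F. gr z powr q) \<longlongrightarrow> S) (finite_subsets_at_top UNIV)"
      using green_powr_partial[of b] mid by (simp add: S_def q_def)
    have "((\<lambda>F. f (\<Sum>z\<in>F. gr z powr q) c') \<longlongrightarrow> f S c') (finite_subsets_at_top UNIV)"
      unfolding f_def using c c' S by (intro tendsto_intros p) auto
    then have "\<forall>\<^sub>F F in finite_subsets_at_top UNIV. m - \<epsilon> < f (\<Sum>z\<in>F. gr z powr q) c'"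
      using c'(2) by (rule order_tendstoD(1))
    moreover have "\<forall>\<^sub>F F in finite_subsets_at_top UNIV. 0 < (\<Sum>z\<in>F. gr z powr q)"
      using p by (rule order_tendstoD(1)) (use S in simp)
    ultimately have "\<forall>\<^sub>F F in finite_subsets_at_top UNIV. m - \<epsilon> < f (\<Sum>z\<in>F. gr z powr q) c' \<and> 0 < (\<Sum>z\<in>F. gr z powr q)"
      by eventually_elim simp
    then obtain F0 where F0: "finite F0" "m - \<epsilon> < f (\<Sum>z\<in>F0. gr z powr q) c'" "0 < (\<Sum>z\<in>F0. gr z powr q)"
      by (auto simp: eventually_finite_subsets_at_top)
    define S0 where "S0 = (\<Sum>z\<in>F0. gr z powr q)"
    have S0: "S0 > 0" using F0 by (simp add: S0_def)
    define u where "u = (real CARD('d) / (c' * S0)) powr (1 / b)"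
    have u: "u > 0" "c' * S0 * u powr b = real CARD('d)" using c c' S0 by (simp_all add: u_def powr_powr)
    have uS: "u * S0 = f S0 c'"
    proof -
      have "S0 powr ((b - 1) / b) = S0 powr 1 / S0 powr (1 / b)"
        using c by (subst powr_diff[symmetric]) (simp add: field_simps)
      moreover have "u = (real CARD('d) / c') powr (1 / b) / S0 powr (1 / b)"
        using c c' S0 unfolding u_def by (subst powr_divide[symmetric]) (auto simp: field_simps)
      ultimately show ?thesis using S0 by (simp add: f_def)
    qed
    have "(m - \<epsilon>) / S0 < u" using F0(2) uS S0 by (simp add: S0_def[symmetric] field_simps)
    then have "max 0 ((m - \<epsilon>) / S0) < u" using u by simp
    then obtain s where s: "max 0 ((m - \<epsilon>) / S0) < s" "s < u" using dense by blast
    have s0: "s > 0" using s by simp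
    have "s powr b < u powr b" using s s0 c by (intro powr_less_mono2) auto
    then have "c' * S0 * s powr b < c' * S0 * u powr b" using c c' S0 by simp
    then have cost: "c' * (s powr b * S0) < real CARD('d)" using u by (simp add: mult_ac)
    define a where "a z = (if z \<in> F0 then s * gr z powr (q - 1) else 0)" for z
    have a: "a z \<ge> 0" "z \<notin> F0 \<Longrightarrow> a z = 0" for z using s0 by (auto simp: a_def)
    have "(\<Sum>z\<in>F0. a z powr \<alpha>) = (\<Sum>z\<in>F0. s powr b * gr z powr q)"
      using al s0 gr_nonneg by (intro sum.cong) (auto simp: a_def powr_mult powr_powr q)
    then have cost': "(\<Sum>z\<in>F0. a z powr \<alpha>) = s powr b * S0" by (simp add: S0_def sum_distrib_left)
    have pc: "profile_cost a (c' * (s powr b * S0))"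
      unfolding cost'[symmetric] using mid al c' F0 a by (intro profile_costI) auto
    have "gr z * gr z powr (q - 1) = gr z powr q" for z
      using gr_nonneg[of z] q(1) powr_add[of "gr z" 1 "q - 1"] by (cases "gr z = 0") auto
    then have "(\<Sum>z\<in>F0. gr z * a z) = (\<Sum>z\<in>F0. s * gr z powr q)"
      by (intro sum.cong) (auto simp: a_def mult.left_commute)
    then have gain: "(\<Sum>z\<in>F0. gr z * a z) = s * S0" by (simp add: S0_def sum_distrib_left)
    have gain': "s * S0 > m - \<epsilon>" using s S0 by (simp add: field_simps)
    define \<kappa> where "\<kappa> = sqrt ((real CARD('d) - c' * (s powr b * S0)) / Gstar TYPE('d))"
    have k: "\<kappa> > 0" "\<kappa>\<^sup>2 * Gstar TYPE('d) = real CARD('d) - c' * (s powr b * S0)" using cost Gpos by (simp_all add: \<kappa>_def)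
    have "c' * (s powr b * S0) + \<kappa>\<^sup>2 * Gstar TYPE('d) / 2 < real CARD('d)" using k(2) cost by linarith
    then show thesis
      by (intro that[OF F0(1) a(1) a(2) k(1) pc]) (use gain gain' mid(2,3) al in \<open>auto simp: m_def\<close>)
  qed
qed

end

definition grid :: "nat \<Rightarrow> nat \<Rightarrow> 'd::finite site set" where
  "grid m k = (\<lambda>w. \<chi> i. int m * w $ i) ` lattice_box k"

lemma finite_grid [simp]: "finite (grid m k)"
  by (simp add: grid_def)

lemma card_grid: "m > 0 \<Longrightarrow> card (grid m k :: 'd::finite site set) = (2 * k + 1) ^ CARD('d)"
  unfolding grid_def by (subst card_image) (auto simp: inj_on_def vec_eq_iff card_lattice_box)

lemma grid_bound: "x \<in> grid m k \<Longrightarrow> \<bar>x $ i\<bar> \<le> int (m * k)"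
  by (auto simp: grid_def lattice_box_def abs_mult intro!: mult_left_mono)

lemma grid_dvd: "x \<in> grid m k \<Longrightarrow> y \<in> grid m k \<Longrightarrow> int m dvd x $ i - y $ i"
  by (auto simp: grid_def)

lemma grid_separated:
  assumes "x \<in> grid m k" "y \<in> grid m k" "x \<noteq> y"
  obtains i where "int m \<le> \<bar>(y - x) $ i\<bar>"
proof -
  obtain i where i: "x $ i \<noteq> y $ i" using assms(3) by (auto simp: vec_eq_iff)
  have "int m dvd y $ i - x $ i" using assms by (intro grid_dvd)
  then have "int m \<le> \<bar>y $ i - x $ i\<bar>" using i dvd_imp_le_int[of "y $ i - x $ i" "int m"] by simp
  then show thesis by (intro that[of i]) simp
qed

context random_field
begin

text \<open>
  Large enough to make the correlation of the field at distinct grid sites, at most of order \<open>1 / (log N)\<^sup>2\<close>, small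
  compared with \<open>1 / log N\<close>, and small enough to lose only a logarithmic factor in the number of sites.
\<close>

definition spacing :: "nat \<Rightarrow> nat" where
  "spacing N = nat \<lceil>(ln (real N))\<^sup>2\<rceil> + 1"

text \<open>
  The grid stays in the inner half of the box, where \<open>box_green\<close> is close to \<open>green\<close>.
\<close>

definition sites :: "nat \<Rightarrow> 'd site set" where
  "sites N = grid (spacing N) (N div (2 * spacing N))"

lemma spacing_bounds: "(ln (real N))\<^sup>2 \<le> real (spacing N)" "real (spacing N) \<le> (ln (real N))\<^sup>2 + 2"
  by (auto simp: spacing_def) linarith+

lemma sites_bound: "x \<in> sites N \<Longrightarrow> \<bar>x $ i\<bar> \<le> int (N div 2)"
proof -
  assume "x \<in> sites N"
  then have "\<bar>x $ i\<bar> \<le> int (spacing N * (N div (2 * spacing N)))"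
    unfolding sites_def by (rule grid_bound)
  also have "N div (2 * spacing N) = N div 2 div spacing N" by (simp add: div_mult2_eq)
  also have "int (spacing N * (N div 2 div spacing N)) \<le> int (N div 2)"
    using times_div_less_eq_dividend[of "spacing N" "N div 2"] by (simp only: of_nat_le_iff)
  finally show ?thesis .
qed

lemma card_sites: "real (card (sites N)) \<ge> (real N / (2 * real (spacing N))) ^ CARD('d)"
proof -
  define m where "m = spacing N"
  have m: "m > 0" by (simp add: m_def spacing_def)
  define k where "k = N div (2 * m)"
  have "N < 2 * m * (k + 1)"
    using dividend_less_times_div[of "2 * m" N] m by (simp add: k_def)
  then have "real N < real (2 * m * (k + 1))" by (simp only: of_nat_less_iff)
  then have "real N < 2 * real m * (real k + 1)" by (simp add: algebra_simps)
  then have "real N / (2 * real m) < real k + 1" using m by (simp add: field_simps)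
  then have "real N / (2 * real m) \<le> real (2 * k + 1)" by simp
  then have "(real N / (2 * real m)) ^ CARD('d) \<le> real (2 * k + 1) ^ CARD('d)" by (intro power_mono) auto
  then show ?thesis using m by (simp add: sites_def card_grid m_def[symmetric] k_def[symmetric])
qed

definition good_sites :: "('d site \<Rightarrow> real) \<Rightarrow> 'd site set \<Rightarrow> nat \<Rightarrow> 'w \<Rightarrow> 'd site set" where
  "good_sites a F N \<omega> = {x \<in> sites N. \<forall>z\<in>F. a z * level N \<le> \<eta> (x + z) \<omega>}"

lemma card_good_sites:
  "real (card (good_sites a F N \<omega>)) = (\<Sum>x\<in>sites N. if \<forall>z\<in>F. a z * level N \<le> \<eta> (x + z) \<omega> then 1 else 0)"
  by (simp add: good_sites_def sites_def sum.If_cases Int_def)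

text \<open>
  The trials at the grid sites are independent because the blocks \<open>x + F\<close> are disjoint for large \<open>N\<close>.  The
  expected number of successes is \<open>N\<^bsup>d-\<beta>\<^esup>\<close> up to logarithmic factors, which exceeds \<open>N\<^bsup>\<rho>\<^esup>\<close>.
\<close>

lemma many_good_sites:
  assumes pc: "profile_cost a \<beta>" and F: "finite F" and \<rho>: "0 < \<rho>" "\<rho> < real CARD('d) - \<beta>"
  shows "\<forall>\<^sub>F N in sequentially. prob {\<omega> \<in> space M. real (card (good_sites a F N \<omega>)) < exp (\<rho> * ln (real N))}
     \<le> exp (- 2 * ln (real N))"
proof -
  obtain R where R: "F \<subseteq> lattice_box R" using finite_subset_box[OF F] by blast
  have dpos: "real CARD('d) > 0" by simp
  \<comment> \<open>Half of the spare exponent \<open>d - \<beta> - \<rho>\<close> is spent on the logarithmic factors from the spacing.\<close>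
  define \<gamma> where "\<gamma> = (real CARD('d) - \<beta> - \<rho>) / (2 * real CARD('d))"
  have \<gamma>: "\<gamma> > 0" using \<rho> dpos by (simp add: \<gamma>_def)
  define c where "c = (1 / 2) ^ card F / (4 :: real)"
  have c: "c > 0" by (simp add: c_def)
  have ev1: "\<forall>\<^sub>F l in at_top. 2 * (l\<^sup>2 + 2) \<le> exp (\<gamma> * l)" using \<gamma> by real_asymp
  have ev2: "\<forall>\<^sub>F l in at_top. c * exp ((real CARD('d) - \<beta> - \<rho>) / 2 * l) \<ge> 1"
  proof -
    have "(real CARD('d) - \<beta> - \<rho>) / 2 > 0" using \<rho> by simp
    then have "filterlim (\<lambda>l. c * exp ((real CARD('d) - \<beta> - \<rho>) / 2 * l)) at_top at_top"
      using c by real_asymp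
    then show ?thesis by (simp add: filterlim_at_top)
  qed
  have ev3: "\<forall>\<^sub>F l in at_top. 2 * l \<le> exp (\<rho> * l)" using \<rho> by real_asymp
  have ev4: "\<forall>\<^sub>F l in at_top. real (2 * R) + 1 \<le> l\<^sup>2" by real_asymp
  have ev5: "\<forall>\<^sub>F l in at_top. (\<Prod>z\<in>F. prob {\<omega> \<in> space M. \<eta> 0 \<omega> \<ge> a z * l powr (1 / \<alpha>)}) \<ge> (1 / 2) ^ card F * exp (- \<beta> * l)"
    using pc F by (simp add: profile_cost_def)
  show ?thesis
    using eventually_at_ln[OF ev1] eventually_at_ln[OF ev2] eventually_at_ln[OF ev3]
      eventually_at_ln[OF ev4] eventually_at_ln[OF ev5] eventually_ge_at_top[of 1]
  proof eventually_elim
    case (elim N)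
    define l where "l = ln (real N)"
    have lv: "level N = l powr (1 / \<alpha>)" by (simp add: level_def l_def)
    have Ne: "real N = exp l" using elim by (simp add: l_def)
    define p where "p = (\<Prod>z\<in>F. prob {\<omega> \<in> space M. \<eta> 0 \<omega> \<ge> a z * level N})"
    have p0: "p \<ge> 0" by (simp add: p_def prod_nonneg)
    define f where "f x \<omega> = (if \<forall>z\<in>F. a z * level N \<le> \<eta> (x + z) \<omega> then 1 else 0 :: real)" for x \<omega>
    have "real (2 * R) < real (spacing N)" using elim(4) spacing_bounds(1)[of N] by linarith
    then have sR: "2 * R < spacing N" by simp
    have disj: "disjoint_family_on (\<lambda>x. (+) x ` F) (sites N)"
      by (rule disjoint_translates[OF R sR]) (auto simp: sites_def grid_dvd)
    have ind: "indep_vars (\<lambda>_. borel) f (sites N)"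
    proof -
      define h where "h x q = (if \<forall>z\<in>F. a z * level N \<le> q (x + z) then 1 else 0 :: real)" for x and q :: "'d site \<Rightarrow> real"
      have "indep_vars (\<lambda>_. borel) (\<lambda>x \<omega>. h x (restrict (\<lambda>y. \<eta> y \<omega>) ((+) x ` F))) (sites N)"
      proof (rule block_indep[OF disj])
        fix x
        have [measurable]: "(\<lambda>q. q (x + z)) \<in> borel_measurable (\<Pi>\<^sub>M y\<in>(+) x ` F. borel :: real measure)" if "z \<in> F" for z
          using that by (intro measurable_component_singleton) auto
        show "h x \<in> borel_measurable (\<Pi>\<^sub>M y\<in>(+) x ` F. borel)"
          unfolding h_def using F by measurable
      qed
      moreover have "h x (restrict (\<lambda>y. \<eta> y \<omega>) ((+) x ` F)) = f x \<omega>" for x \<omega>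
        by (simp add: h_def f_def)
      ultimately show ?thesis by simp
    qed
    have pf: "prob {\<omega> \<in> space M. f x \<omega> = 1} = p" for x
    proof -
      have "{\<omega> \<in> space M. f x \<omega> = 1} = {\<omega> \<in> space M. \<forall>y\<in>(+) x ` F. \<eta> y \<omega> \<ge> a (y - x) * level N}"
        by (auto simp: f_def split: if_splits)
      then have "prob {\<omega> \<in> space M. f x \<omega> = 1} = (\<Prod>y\<in>(+) x ` F. prob {\<omega> \<in> space M. \<eta> 0 \<omega> \<ge> a (y - x) * level N})"
        using prob_all_ge[of "(+) x ` F" "\<lambda>y. a (y - x) * level N"] F by simp
      also have "\<dots> = p" unfolding p_def by (subst prod.reindex) (auto simp: inj_on_def)
      finally show ?thesis .
    qed
    have "prob {\<omega> \<in> space M. (\<Sum>x\<in>sites N. f x \<omega>) < real (card (sites N)) * p / 4} \<le> exp (- (real (card (sites N)) * p / 4))"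
    proof (rule count_lower_tail[OF _ ind _ _ p0])
      show "finite (sites N)" by (simp add: sites_def)
      show "f x \<omega> = 0 \<or> f x \<omega> = 1" for x \<omega> by (simp add: f_def)
    qed (simp only: pf)
    then have main: "prob {\<omega> \<in> space M. real (card (good_sites a F N \<omega>)) < real (card (sites N)) * p / 4} \<le> exp (- (real (card (sites N)) * p / 4))"
      by (simp only: card_good_sites f_def)
    have big: "exp (\<rho> * l) \<le> real (card (sites N)) * p / 4"
    proof -
      have "exp ((1 - \<gamma>) * l) \<le> real N / (2 * real (spacing N))"
      proof -
        have "2 * real (spacing N) \<le> exp (\<gamma> * l)" using spacing_bounds(2)[of N] elim(1) by (simp add: l_def)
        moreover have "spacing N > 0" by (simp add: spacing_def)
        ultimately have "exp l / exp (\<gamma> * l) \<le> exp l / (2 * real (spacing N))" by (intro divide_left_mono) auto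
        then show ?thesis by (simp add: Ne left_diff_distrib exp_diff)
      qed
      then have "exp ((1 - \<gamma>) * l) ^ CARD('d) \<le> (real N / (2 * real (spacing N))) ^ CARD('d)" by (intro power_mono) auto
      also have "\<dots> \<le> real (card (sites N))" by (rule card_sites)
      finally have n: "exp (real CARD('d) * ((1 - \<gamma>) * l)) \<le> real (card (sites N))" by (simp add: exp_of_nat_mult)
      have "real CARD('d) * \<gamma> = (real CARD('d) - \<beta> - \<rho>) / 2" by (simp add: \<gamma>_def)
      then have e: "real CARD('d) * ((1 - \<gamma>) * l) = (real CARD('d) - (real CARD('d) - \<beta> - \<rho>) / 2) * l"
        by (simp only: mult.assoc[symmetric] right_diff_distrib mult_1_right)
      have "exp (\<rho> * l) \<le> exp (\<rho> * l) * (c * exp ((real CARD('d) - \<beta> - \<rho>) / 2 * l))" using elim(2) by (simp add: l_def)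
      also have "\<dots> = exp (\<rho> * l) * exp ((real CARD('d) - \<beta> - \<rho>) / 2 * l) * c" by simp
      also have "exp (\<rho> * l) * exp ((real CARD('d) - \<beta> - \<rho>) / 2 * l) = exp (real CARD('d) * ((1 - \<gamma>) * l)) * exp (- \<beta> * l)"
        unfolding e by (simp add: field_simps flip: exp_add)
      also have "exp (real CARD('d) * ((1 - \<gamma>) * l)) * exp (- \<beta> * l) * c = exp (real CARD('d) * ((1 - \<gamma>) * l)) * ((1 / 2) ^ card F * exp (- \<beta> * l)) / 4"
        by (simp add: c_def)
      also have "\<dots> \<le> real (card (sites N)) * p / 4"
        using n elim(5) by (intro divide_right_mono mult_mono) (auto simp: p_def lv l_def)
      finally show ?thesis .
    qed
    have "prob {\<omega> \<in> space M. real (card (good_sites a F N \<omega>)) < exp (\<rho> * l)} \<le>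
       prob {\<omega> \<in> space M. real (card (good_sites a F N \<omega>)) < real (card (sites N)) * p / 4}"
    proof (rule finite_measure_mono)
      show "{\<omega> \<in> space M. real (card (good_sites a F N \<omega>)) < real (card (sites N)) * p / 4} \<in> events"
        unfolding card_good_sites using F by measurable
    qed (use big in auto)
    also have "\<dots> \<le> exp (- (real (card (sites N)) * p / 4))" by (rule main)
    also have "\<dots> \<le> exp (- 2 * l)" using big elim(3) by (simp add: l_def)
    finally show ?case by (simp add: l_def)
  qed
qed

lemma green_decay:
  obtains C where "C > 0" "\<And>z K i. int K \<le> \<bar>z $ i\<bar> \<Longrightarrow> gr z \<le> C / real (Suc K)"
    "\<And>x z N. N > 0 \<Longrightarrow> (\<And>i. \<bar>x $ i\<bar> \<le> int (N div 2)) \<Longrightarrow> gr z - C / (real N / 2) \<le> box_green N x (x + z)"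
proof -
  obtain C where C: "C > 0" "\<And>K (z :: 'd site). gr z \<le> (\<Sum>n<K. heat n z) + C / real (Suc K)"
    using green_tail_le[OF dim] by blast
  show thesis
  proof (rule that[of C])
    fix z :: "'d site" and K i assume z: "int K \<le> \<bar>z $ i\<bar>"
    have "heat n z = 0" if "n < K" for n
    proof (rule heat_zero_outside)
      show "z \<notin> lattice_box n" using z that by (auto simp: lattice_box_def intro!: exI[of _ i])
    qed
    then show "gr z \<le> C / real (Suc K)" using C(2)[of z K] by simp
  next
    fix x z :: "'d site" and N :: nat assume N: "N > 0" and x: "\<And>i. \<bar>x $ i\<bar> \<le> int (N div 2)"
    define K where "K = N - N div 2"
    have K: "real N / 2 \<le> real (Suc K)" unfolding K_def by linarith
    have "\<bar>x $ i\<bar> + int K \<le> int N" for i using x[of i] by (simp add: K_def of_nat_diff)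
    then have "(\<Sum>n<K. heat n (x + z - x)) \<le> box_green N x (x + z)" by (rule box_green_bulk_ge[OF dim])
    moreover have "C / real (Suc K) \<le> C / (real N / 2)"
      using K C(1) N by (intro divide_left_mono) auto
    moreover have "gr z \<le> (\<Sum>n<K. heat n z) + C / real (Suc K)" by (rule C(2))
    ultimately show "gr z - C / (real N / 2) \<le> box_green N x (x + z)" by simp
  qed (rule C(1))
qed

text \<open>
  At a good grid site the near part of the centre is at least the sum of \<open>green 0 z * a z\<close>, up to a small
  error and in units of \<open>level N\<close>, and the far part is small.  As \<open>\<rho>\<close> exceeds \<open>\<kappa>\<^sup>2 * G\<^sup>* / 2\<close>, the number of
  good sites is large enough for \<open>gibbs_max_ge\<close> to yield a further Gaussian gain of \<open>\<kappa> * G\<^sup>* * sqrt (log N)\<close>.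
\<close>

theorem max_lower_almost_surely:
  assumes \<epsilon>: "\<epsilon> > 0"
  shows "AE \<omega> in M. (\<lambda>N. measure (gibbs N (\<lambda>x. \<eta> x \<omega>))
     {\<phi> \<in> space (gibbs N (\<lambda>x. \<eta> x \<omega>)). scaled_max T N \<phi> \<ge> Mstar TYPE('d) T - \<epsilon>}) \<longlonglongrightarrow> 1"
proof -
  have Gpos: "Gstar TYPE('d) > 0" using Gstar_ge_one by simp
  have "\<epsilon> / 2 > 0" using \<epsilon> by simp
  obtain F0 a \<beta> \<kappa> where F0: "finite F0" and a: "\<And>z. a z \<ge> 0" "\<And>z. z \<notin> F0 \<Longrightarrow> a z = 0" and \<kappa>: "\<kappa> > 0"
    and pc: "profile_cost a \<beta>" and cost: "\<beta> + \<kappa>\<^sup>2 * Gstar TYPE('d) / 2 < real CARD('d)"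
    and gain: "(\<Sum>z\<in>F0. gr z * a z) + (if \<alpha> = 2 then \<kappa> * Gstar TYPE('d) else 0) > Mstar TYPE('d) T - \<epsilon> / 2"
    by (rule profile_choice[OF \<open>\<epsilon> / 2 > 0\<close>]) (rule that; assumption)
  \<comment> \<open>An exponent strictly between the Gaussian cost and the cost left over by the profile.\<close>
  define \<rho> where "\<rho> = (\<kappa>\<^sup>2 * Gstar TYPE('d) / 2 + (real CARD('d) - \<beta>)) / 2"
  have kG: "\<kappa>\<^sup>2 * Gstar TYPE('d) / 2 > 0" using \<kappa> Gpos by simp
  have \<rho>: "\<kappa>\<^sup>2 * Gstar TYPE('d) / 2 < \<rho>" "\<rho> < real CARD('d) - \<beta>" "0 < \<rho>" using cost kG by (auto simp: \<rho>_def)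
  \<comment> \<open>The tolerance: four errors of size \<open>\<delta>\<close> occur, and \<open>\<kappa> * \<delta>\<close> must keep the second moment below \<open>N\<^bsup>\<rho>\<^esup>\<close>.\<close>
  define \<delta> where "\<delta> = min (\<epsilon> / 8) ((\<rho> - \<kappa>\<^sup>2 * Gstar TYPE('d) / 2) / (2 * \<kappa>))"
  have \<delta>: "\<delta> > 0" "\<delta> \<le> \<epsilon> / 8" using \<epsilon> \<rho> \<kappa> by (auto simp: \<delta>_def)
  have \<kappa>\<delta>: "\<kappa> * \<delta> \<le> (\<rho> - \<kappa>\<^sup>2 * Gstar TYPE('d) / 2) / 2"
  proof -
    have "\<kappa> * \<delta> \<le> \<kappa> * ((\<rho> - \<kappa>\<^sup>2 * Gstar TYPE('d) / 2) / (2 * \<kappa>))" using \<kappa> by (intro mult_left_mono) (auto simp: \<delta>_def)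
    then show ?thesis using \<kappa> by simp
  qed
  define e1 where "e1 = \<kappa>\<^sup>2 * Gstar TYPE('d) / 2 + \<kappa> * \<delta> - \<rho>"
  have e1: "e1 < 0" using \<kappa>\<delta> \<rho>(1) by (simp add: e1_def field_simps)
  define sa where "sa = (\<Sum>z\<in>F0. a z)"
  have sa: "sa \<ge> 0" using a by (simp add: sa_def sum_nonneg)
  define \<delta>1 where "\<delta>1 = \<delta> / (\<kappa> + sa + 1)"
  have \<delta>1: "\<delta>1 > 0" "\<kappa> * \<delta>1 \<le> \<delta>" "sa * \<delta>1 \<le> \<delta>"
    using \<delta> \<kappa> sa by (auto simp: \<delta>1_def field_simps)
  obtain F1 where F1: "finite F1" "\<And>F'. F1 \<subseteq> F' \<Longrightarrow>
    \<forall>\<^sub>F N in sequentially. prob {\<omega> \<in> space M. \<exists>x\<in>lattice_box N. \<bar>far N F' x \<omega>\<bar> > \<delta> * level N} \<le> exp (- 2 * ln (real N))"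
    using far_field_small[OF \<delta>(1), of 2] by blast
  define F where "F = F0 \<union> F1"
  have F: "finite F" "F0 \<subseteq> F" "F1 \<subseteq> F" using F0 F1 by (auto simp: F_def)
  obtain R where R: "F \<subseteq> lattice_box R" using finite_subset_box[OF F(1)] by blast
  obtain C where C: "C > 0" "\<And>z K i. int K \<le> \<bar>z $ i\<bar> \<Longrightarrow> gr z \<le> C / real (Suc K)"
    "\<And>x z N. N > 0 \<Longrightarrow> (\<And>i. \<bar>x $ i\<bar> \<le> int (N div 2)) \<Longrightarrow> gr z - C / (real N / 2) \<le> box_green N x (x + z)"
    using green_decay by blast
  have ae1: "AE \<omega> in M. \<forall>\<^sub>F N in sequentially. \<omega> \<notin> {\<omega> \<in> space M. \<exists>x\<in>lattice_box N. \<bar>far N F x \<omega>\<bar> > \<delta> * level N}"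
    by (rule borel_cantelli_ln[where p = 2 and K = 1]) (use F1(2)[OF F(3)] in auto)
  have ae2: "AE \<omega> in M. \<forall>\<^sub>F N in sequentially. \<omega> \<notin> {\<omega> \<in> space M. real (card (good_sites a F N \<omega>)) < exp (\<rho> * ln (real N))}"
  proof (rule borel_cantelli_ln[where p = 2 and K = 1])
    show "{\<omega> \<in> space M. real (card (good_sites a F N \<omega>)) < exp (\<rho> * ln (real N))} \<in> events" for N
      unfolding card_good_sites using F(1) by measurable
  qed (use many_good_sites[OF pc F(1) \<rho>(3,2)] in auto)
  define e3 where "e3 = \<delta>\<^sup>2 / (2 * Gstar TYPE('d))"
  have e3: "e3 > 0" using \<delta> Gpos by (simp add: e3_def)
  define C2 where "C2 = \<kappa>\<^sup>2 * C"
  have C2: "C2 > 0" using \<kappa> C by (simp add: C2_def)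
  define f where "f l = 1 - 4 * (exp (e1 * l) + exp (C2 / l) - 1 + 2 * exp (- e3 * l)) - 2 * exp (- e3 * l)" for l
  have flim: "(\<lambda>N. f (ln (real N))) \<longlonglongrightarrow> 1"
  proof -
    have "((\<lambda>l. exp (e1 * l)) \<longlongrightarrow> 0) at_top" "((\<lambda>l. exp (C2 / l)) \<longlongrightarrow> 1) at_top" "((\<lambda>l. exp (- e3 * l)) \<longlongrightarrow> 0) at_top"
      using e1 e3 by real_asymp+
    then have "(f \<longlongrightarrow> 1 - 4 * (0 + 1 - 1 + 2 * 0) - 2 * 0) at_top"
      unfolding f_def by (intro tendsto_intros)
    then have "(f \<longlongrightarrow> 1) at_top" by simp
    moreover have "filterlim (\<lambda>N. ln (real N)) at_top sequentially" by real_asymp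
    ultimately show ?thesis by (rule filterlim_compose)
  qed
  have evN: "\<forall>\<^sub>F N in sequentially. C / (real N / 2) \<le> \<delta>1 \<and> 2 * R \<le> N"
  proof (rule eventually_conj)
    have "(\<lambda>N. C / (real N / 2)) \<longlonglongrightarrow> 0" by real_asymp
    then have "\<forall>\<^sub>F N in sequentially. C / (real N / 2) < \<delta>1" by (rule order_tendstoD(2)) (rule \<delta>1(1))
    then show "\<forall>\<^sub>F N in sequentially. C / (real N / 2) \<le> \<delta>1" by eventually_elim simp
  qed (rule eventually_ge_at_top)
  show ?thesis
    using ae1 ae2 AE_space
  proof eventually_elim
    case (elim \<omega>)
    let ?p = "\<lambda>N. measure (gibbs N (\<lambda>x. \<eta> x \<omega>)) {\<phi> \<in> space (gibbs N (\<lambda>x. \<eta> x \<omega>)). scaled_max T N \<phi> \<ge> Mstar TYPE('d) T - \<epsilon>}"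
    have lower: "\<forall>\<^sub>F N in sequentially. f (ln (real N)) \<le> ?p N"
      using elim(1,2) evN eventually_ln_ge[of 1]
    proof eventually_elim
      case (elim N)
      define l where "l = ln (real N)"
      have l: "l \<ge> 1" using elim(4) by (simp add: l_def)
      have L: "level N \<ge> 0" "sqrt l \<le> level N" "\<alpha> = 2 \<Longrightarrow> sqrt l = level N"
        using l \<alpha> powr_mono[of "1 / 2" "1 / \<alpha>" l] by (auto simp: level_def l_def powr_half_sqrt field_simps)
      define A where "A = good_sites a F N \<omega>"
      have AS: "A \<subseteq> sites N" by (auto simp: A_def good_sites_def)
      have Ab: "\<bar>x $ i\<bar> \<le> int (N div 2)" if "x \<in> A" for x i using that AS sites_bound by blast
      have inbox: "x + z \<in> lattice_box N" if "x \<in> A" "z \<in> lattice_box R" for x z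
      proof -
        have "\<bar>(x + z) $ i\<bar> \<le> int N" for i
        proof -
          have "\<bar>z $ i\<bar> \<le> int R" using that by (simp add: lattice_box_def)
          moreover have "int (N div 2) + int R \<le> int N" using elim(3) by linarith
          ultimately show ?thesis using Ab[OF that(1), of i] by simp
        qed
        then show ?thesis by (simp add: lattice_box_def)
      qed
      have AB: "A \<subseteq> lattice_box N"
      proof
        fix x assume "x \<in> A"
        then show "x \<in> lattice_box N" using inbox[of x 0] by simp
      qed
      have cA: "exp (\<rho> * l) \<le> real (card A)"
        using elim(2) \<open>\<omega> \<in> space M\<close> by (auto simp: A_def l_def not_less)
      then have "card A > 0" using exp_gt_zero[of "\<rho> * l"] by (metis less_le_trans of_nat_0_less_iff)
      then have Ane: "A \<noteq> {}" by auto
      have gb: "gr z - \<delta>1 \<le> box_green N x (x + z)" if "x \<in> A" for x z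
      proof -
        have "N > 0" using elim(4) by (cases "N = 0") auto
        then have "gr z - C / (real N / 2) \<le> box_green N x (x + z)" using Ab[OF that] by (rule C(3))
        then show ?thesis using elim(3) by linarith
      qed
      have mf: "((\<Sum>z\<in>F0. gr z * a z) - 2 * \<delta>) * level N \<le> mean_field N (\<lambda>y. \<eta> y \<omega>) x" if x: "x \<in> A" for x
      proof -
        have "near N F x \<omega> = (\<Sum>y\<in>(+) x ` F. box_green N x y * \<eta> y \<omega>)"
        proof -
          have "(+) x ` F \<subseteq> lattice_box N" using inbox[OF x] R by auto
          then show ?thesis unfolding near_def
            by (intro sum.mono_neutral_cong_right) (auto simp: image_iff, metis add.commute diff_add_cancel)
        qed
        also have "\<dots> = (\<Sum>z\<in>F. box_green N x (x + z) * \<eta> (x + z) \<omega>)"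
          by (subst sum.reindex) (auto simp: inj_on_def)
        also have "\<dots> \<ge> (\<Sum>z\<in>F. box_green N x (x + z) * (a z * level N))"
          using x box_green_nonneg[OF dim] by (intro sum_mono mult_left_mono) (auto simp: A_def good_sites_def)
        also have "(\<Sum>z\<in>F. box_green N x (x + z) * (a z * level N)) = (\<Sum>z\<in>F0. box_green N x (x + z) * (a z * level N))"
          using F a(2) by (intro sum.mono_neutral_right) auto
        also have "\<dots> \<ge> (\<Sum>z\<in>F0. (gr z - \<delta>1) * (a z * level N))"
          using gb[OF x] a L by (intro sum_mono mult_right_mono) auto
        also have "(\<Sum>z\<in>F0. (gr z - \<delta>1) * (a z * level N)) = ((\<Sum>z\<in>F0. gr z * a z) - sa * \<delta>1) * level N"
        proof -
          have "(\<Sum>z\<in>F0. (gr z - \<delta>1) * (a z * level N)) = (\<Sum>z\<in>F0. gr z * a z * level N - a z * (\<delta>1 * level N))"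
            by (intro sum.cong) (auto simp: algebra_simps)
          also have "\<dots> = (\<Sum>z\<in>F0. gr z * a z) * level N - sa * (\<delta>1 * level N)"
            unfolding sum_subtractf sa_def sum_distrib_right ..
          finally show ?thesis by (simp add: algebra_simps)
        qed
        also have "\<dots> \<ge> ((\<Sum>z\<in>F0. gr z * a z) - \<delta>) * level N"
          using \<delta>1 L by (intro mult_right_mono) auto
        finally have "((\<Sum>z\<in>F0. gr z * a z) - \<delta>) * level N \<le> near N F x \<omega>" .
        moreover have "\<bar>far N F x \<omega>\<bar> \<le> \<delta> * level N"
          using elim(1) \<open>\<omega> \<in> space M\<close> AB x by (auto simp: not_less)
        ultimately show ?thesis
          unfolding mean_field_near_far[where F = F] left_diff_distrib by linarith
      qed
      define lam where "lam = \<kappa> * sqrt l"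
      define D where "D = \<delta> * sqrt l"
      have lam: "lam \<ge> 0" "lam\<^sup>2 = \<kappa>\<^sup>2 * l" using \<kappa> l by (simp_all add: lam_def power_mult_distrib)
      have D: "D > 0" "D\<^sup>2 = \<delta>\<^sup>2 * l" using \<delta> l by (simp_all add: D_def power_mult_distrib)
      have lD: "lam * D = \<kappa> * \<delta> * l" using l by (simp add: lam_def D_def)
      have t: "(Mstar TYPE('d) T - \<epsilon>) * level N \<le> mean_field N (\<lambda>y. \<eta> y \<omega>) x + (lam * box_green N x x - D)"
        if x: "x \<in> A" for x
      proof -
        have g0: "Gstar TYPE('d) - \<delta>1 \<le> box_green N x x" using gb[OF x, of 0] by (simp add: Gstar_def)
        have "((if \<alpha> = 2 then \<kappa> * Gstar TYPE('d) else 0) - 2 * \<delta>) * level N \<le> lam * box_green N x x - D"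
        proof (cases "\<alpha> = 2")
          case True
          have "\<kappa> * Gstar TYPE('d) - \<delta> \<le> \<kappa> * (Gstar TYPE('d) - \<delta>1)" using \<delta>1 by (simp add: algebra_simps)
          also have "\<dots> \<le> \<kappa> * box_green N x x" using g0 \<kappa> by simp
          finally have "(\<kappa> * Gstar TYPE('d) - 2 * \<delta>) * level N \<le> (\<kappa> * box_green N x x - \<delta>) * level N"
            using L by (intro mult_right_mono) auto
          then show ?thesis using True L(3)[OF True] by (simp add: lam_def D_def algebra_simps)
        next
          case False
          have "D \<le> \<delta> * level N" unfolding D_def using L \<delta> by (intro mult_left_mono) auto
          moreover have "0 \<le> lam * box_green N x x" using lam box_green_nonneg[OF dim] by simp
          moreover have "0 \<le> \<delta> * level N" using \<delta> L by simp
          ultimately show ?thesis using False by (simp add: algebra_simps)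
        qed
        moreover have "(Mstar TYPE('d) T - \<epsilon>) * level N \<le> (((\<Sum>z\<in>F0. gr z * a z) - 2 * \<delta>) + ((if \<alpha> = 2 then \<kappa> * Gstar TYPE('d) else 0) - 2 * \<delta>)) * level N"
          using gain \<delta> L by (intro mult_right_mono) auto
        ultimately show ?thesis using mf[OF x] unfolding distrib_right by linarith
      qed
      define b where "b = C / l\<^sup>2"
      have b: "green 0 (y - x) \<le> b" if xy: "x \<in> A" "y \<in> A" "x \<noteq> y" for x y
      proof -
        have "x \<in> grid (spacing N) (N div (2 * spacing N))" "y \<in> grid (spacing N) (N div (2 * spacing N))"
          using xy AS by (auto simp: sites_def)
        then obtain i where "int (spacing N) \<le> \<bar>(y - x) $ i\<bar>" using grid_separated xy(3) by blast
        then have "gr (y - x) \<le> C / real (Suc (spacing N))" by (rule C(2))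
        also have "\<dots> \<le> C / l\<^sup>2"
          using spacing_bounds(1)[of N] C(1) l by (intro divide_left_mono) (auto simp: l_def)
        finally show ?thesis by (simp add: b_def)
      qed
      have lb: "lam\<^sup>2 * b = C2 / l" using l unfolding lam(2) b_def C2_def by (simp add: power2_eq_square)
      have "f l \<le> 1 - 4 * (exp (lam\<^sup>2 * Gstar TYPE('d) / 2 + lam * D) / card A + exp (lam\<^sup>2 * b) - 1 + 2 * exp (- D\<^sup>2 / (2 * Gstar TYPE('d)))) - 2 * exp (- D\<^sup>2 / (2 * Gstar TYPE('d)))"
      proof -
        have "exp (lam\<^sup>2 * Gstar TYPE('d) / 2 + lam * D) / card A \<le> exp (lam\<^sup>2 * Gstar TYPE('d) / 2 + lam * D) / exp (\<rho> * l)"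
          using cA \<open>card A > 0\<close> by (intro divide_left_mono) auto
        also have "\<dots> = exp (e1 * l)"
          unfolding lam(2) lD e1_def by (simp add: algebra_simps flip: exp_diff)
        finally have 1: "exp (lam\<^sup>2 * Gstar TYPE('d) / 2 + lam * D) / card A \<le> exp (e1 * l)" .
        have 2: "- D\<^sup>2 / (2 * Gstar TYPE('d)) = - e3 * l" by (simp add: D(2) e3_def)
        have "1 - 4 * (v + s - 1 + 2 * r) - 2 * r \<le> 1 - 4 * (u + s - 1 + 2 * r) - 2 * r" if "u \<le> v" for u v s r :: real
          using that by simp
        from this[OF 1] show ?thesis unfolding f_def 2 lb .
      qed
      also have "\<dots> \<le> measure (gibbs N (\<lambda>x. \<eta> x \<omega>)) {\<phi> \<in> space (field_space N). \<exists>x\<in>lattice_box N. \<phi> x \<ge> (Mstar TYPE('d) T - \<epsilon>) * level N}"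
        by (rule gibbs_max_ge[OF dim AB Ane lam(1) D(1) b t])
      also have "\<dots> = ?p N" using elim(4) by (simp add: scaled_max_ge_iff)
      finally show ?case by (simp add: l_def)
    qed
    have le: "?p N \<le> 1" for N
      using prob_space.prob_le_1[OF prob_space_gibbs[OF dim, of N "\<lambda>x. \<eta> x \<omega>"]] .
    show "?p \<longlonglongrightarrow> 1"
      by (rule tendsto_sandwich[OF lower _ flim tendsto_const]) (use le in simp)
  qed
qed

end

theorem theorem1p1:
  fixes M :: "'w measure"
    and \<eta> :: "'d::finite site \<Rightarrow> 'w \<Rightarrow> real"
    and T :: tail_type
  assumes dim: "CARD('d) \<ge> 5"
    and prob: "prob_space M"
    and indep: "prob_space.indep_vars M (\<lambda>_. borel) \<eta> UNIV"
    and ident: "\<And>x. distr M borel (\<eta> x) = distr M borel (\<eta> 0)"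
    and symm: "distr M borel (\<lambda>\<omega>. - \<eta> 0 \<omega>) = distr M borel (\<eta> 0)"
    and tail: "has_tail M (\<eta> 0) T"
  shows
    "(\<forall>\<epsilon>>0. AE \<omega> in M.
        (\<lambda>N. measure (gibbs N (\<lambda>x. \<eta> x \<omega>))
              {\<phi> \<in> space (gibbs N (\<lambda>x. \<eta> x \<omega>)).
                scaled_max T N \<phi> \<ge> Mstar TYPE('d) T - \<epsilon>}) \<longlonglongrightarrow> 1)
     \<and> (\<forall>\<epsilon>>0. \<forall>\<epsilon>'>0.
        (\<lambda>N. measure M {\<omega> \<in> space M.
              measure (gibbs N (\<lambda>x. \<eta> x \<omega>))
                {\<phi> \<in> space (gibbs N (\<lambda>x. \<eta> x \<omega>)).
                  scaled_max T N \<phi> \<le> Mstar TYPE('d) T + \<epsilon>} \<ge> 1 - \<epsilon>'}) \<longlonglongrightarrow> 1)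
     \<and> ((\<exists>c. T = TailA 2 c \<and> 2 * real CARD('d) * Gstar TYPE('d) > Gstar_pow TYPE('d) 2 / c)
          \<or> T = TailLight \<longrightarrow>
        (\<forall>\<epsilon>>0. AE \<omega> in M.
          (\<lambda>N. measure (gibbs N (\<lambda>x. \<eta> x \<omega>))
                {\<phi> \<in> space (gibbs N (\<lambda>x. \<eta> x \<omega>)).
                  scaled_max T N \<phi> \<le> Mstar TYPE('d) T + \<epsilon>}) \<longlonglongrightarrow> 1))"
proof -
  interpret random_field M \<eta> T
    using assms by (simp add: random_field_def random_field_axioms_def)
  show ?thesis
  proof (intro conjI allI impI)
    fix \<epsilon> :: real assume e: "\<epsilon> > 0"
      and P: "(\<exists>c. T = TailA 2 c \<and> 2 * real CARD('d) * Gstar TYPE('d) > Gstar_pow TYPE('d) 2 / c) \<or> T = TailLight"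
    have "tail_exponent T = 2" using P by auto
    then show "AE \<omega> in M. (\<lambda>N. measure (gibbs N (\<lambda>x. \<eta> x \<omega>))
       {\<phi> \<in> space (gibbs N (\<lambda>x. \<eta> x \<omega>)). scaled_max T N \<phi> \<le> Mstar TYPE('d) T + \<epsilon>}) \<longlonglongrightarrow> 1"
      using P e by (intro max_upper_almost_surely) auto
  qed (rule max_lower_almost_surely max_upper_in_probability; assumption)+
qed

end
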